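(* Let $\mathscr P$ be a holomorphic Fredholm family over $\mathcal Y\times\Sigma$ satisfying the standing assumptions in the context, let $y_0\in\mathcal Y$, and let $U$ be a connected neighborhood of $y_0$ and $\varepsilon>0$ such that conditions (1)–(5) of the context hold. Let $\phi^s_{j,\ell}$ be the elements $$\phi^s_{j,\ell}=\phi^{K_s}_{j,\ell}-\mathfrak s_{D_{s,\varepsilon}}\big((\mathfrak p^2_{s,2})^{-1}\mathfrak p^2_{s,1}\phi^{K_s}_{j,\ell}\big),\qquad s=1,\dots,S,\ j=1,\dots,J_s,\ \ell=0,\dots,L_{s,j}-1,$$ constructed in the context. Then the $\phi^s_{j,\ell}$ are elements of $\mathscr B^\infty(U;\mathscr K)$ giving a basis of $\mathscr K_y$ for each $y\in U$. Moreover, if $\phi\in\mathscr B^\infty(U;\mathscr K)$, then $$\phi=\sum_{s,j,\ell}f^{j,\ell}_s\,\phi^s_{j,\ell}\qquad\text{for }y\in U$$ with smooth functions $f^{j,\ell}_s:U\to\mathbb C$.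
   Context: **Setting and standing assumptions.** $\mathcal Y$ is a smooth connected manifold; $\mathscr H_1\to\mathcal Y$ and $\mathscr H_2\to\mathcal Y$ are smooth Hilbert space bundles with model spaces $H_1,H_2$ (with smooth unitary local trivializations). $\mathscr D\to\mathcal Y$ is another smooth Hilbert space bundle, with model space $\mathcal D$, continuously embedded in $\mathscr H_1$ with fiberwise dense image and such that the (smooth, unitary) trivializations of $\mathscr H_1$ restrict to smooth trivializations of $\mathscr D$. $\Sigma\subset\mathbb C$ is open and connected. Let $\mathrm{pr}:\mathcal Y\times\Sigma\to\mathcal Y$ be the projection, and let $\mathscr P:\mathrm{pr}^*\mathscr D\subset \mathrm{pr}^*\mathscr H_1\to \mathrm{pr}^*\mathscr H_2$ be a smooth bundle homomorphism covering the identity, consisting of operators $\mathscr P_y(\sigma):\mathscr D_y\subset\mathscr H_{1,y}\to\mathscr H_{2,y}$, each closed (as an unbounded operator with domain $\mathscr D_y$) and Fredholm, depending holomorphically on $\sigma$. For each $y\in\mathcal Y$ there is $\sigma\in\Sigma$ such that $\mathscr P_y(\sigma)$ is invertible (so the index is $0$). Furthermore, the domains of the Hilbert space adjoints $\mathscr P_y(\sigma)^*$ join to give a smooth Hilbert space bundle $\mathscr D^*\to\mathcal Y$ (the domain of $\mathscr P_y(\sigma)^*$ being $\mathscr D^*_y$ for all $\sigma$), continuously embedded in $\mathscr H_2$ and such that the smooth unitary trivializations of $\mathscr H_2$ restrict to trivializations of $\mathscr D^*$; and with $\mathscr P^*_y(\sigma)=\mathscr P_y(\overline\sigma)^*$,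 $\sigma\in\overline\Sigma=\{\overline\sigma:\sigma\in\Sigma\}$, one obtains a smooth homomorphism over $\mathcal Y\times\overline\Sigma$, holomorphic in $\sigma$, with the same Fredholm, analyticity and invertibility properties as $\mathscr P$. Let $\operatorname{sing}_b(\mathscr P_y)=\{\sigma\in\Sigma:\mathscr P_y(\sigma)\text{ is not invertible}\}$ and $\operatorname{sing}_e(\mathscr P)=\{(y,\sigma)\in\mathcal Y\times\Sigma:\sigma\in\operatorname{sing}_b(\mathscr P_y)\}$. It is assumed that $\operatorname{sing}_b(\mathscr P_y)$ is finite for each $y\in\mathcal Y$ and that $\operatorname{sing}_e(\mathscr P)$ is closed in $\mathcal Y\times\mathbb C$. **Singular parts, $\mathscr K_y$ and $\mathscr B^\infty$.** $\mathfrak M(V,K)$ and $\mathfrak H(V,K)$ are the meromorphic, respectively holomorphic, $K$-valued functions on the open set $V\subset\mathbb C$. For $f\in\mathfrak M(V,K)$ with finitely many poles in $V$, $\mathfrak s_V(f)\in\mathfrak M(\mathbb C,K)$ is the sum of the singular (principal) parts of $f$ at its poles in $V$. Define $\mathscr K_y=\{\mathfrak s_\Sigma(\phi):\phi\in\mathfrak M(\Sigma,\mathscr D_y),\ \mathscr P_y\phi\in\mathfrak H(\Sigma,\mathscr H_{2,y})\}$ and $\mathscr K=\bigsqcup_{y\in\mathcal Y}\mathscr K_y$. For $U\subset\mathcal Y$ open, $\mathscr B^\infty(U;\mathscr K)$ is the space of maps $U\ni y\mapsto\phi(y)\in\mathscr K_y$ which, viewed via the trivializations of $\mathscr H_1$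 as $\mathcal D$-valued functions of $(y,\sigma)\in(U\times\mathbb C)\setminus\operatorname{sing}_e(\mathscr P)$, are smooth and holomorphic in $\sigma$. **Local construction near $y_0$.** Work in a neighborhood of $y_0$ over which $\mathscr D,\mathscr H_1,\mathscr H_2$ are trivial, and write $\mathcal P_y(\sigma):\mathcal D\subset H_1\to H_2$ for the family in the trivializations. Let $\sigma_1,\dots,\sigma_S$ be the points of $\operatorname{sing}_b(\mathscr P_{y_0})$; let $K_s\subset\mathcal D$ and $R_s\subset H_2$ be the kernel and image of $\mathcal P_{y_0}(\sigma_s)$; let $K_s^\perp$ be the subspace of $\mathcal D$ orthogonal to $K_s$ in the inner product of $H_1$, and $R_s^\perp$ the orthogonal of $R_s$ in $H_2$. Write $\mathcal P_y(\sigma)$ as $$\begin{bmatrix}\mathfrak p^1_{s,1}&\mathfrak p^1_{s,2}\\ \mathfrak p^2_{s,1}&\mathfrak p^2_{s,2}\end{bmatrix}:\ K_s\oplus K_s^\perp\to R_s^\perp\oplus R_s .$$ Let $D_{s,r}=\{\sigma:|\sigma-\sigma_s|<r\}$. The number $\varepsilon>0$ and the connected neighborhood $U$ of $y_0$ are such that: (1) the discs $D_{s,2\varepsilon}$, $s=1,\dots,S$, are pairwise disjoint and contained in $\Sigma$; (2) for each $s$, $\mathfrak p^2_{s,2}(y_0,\sigma)$ is invertible for $\sigma\in D_{s,2\varepsilon}$; (3) for each $s$, $\mathfrak p^2_{s,2}(y,\sigma)$ is invertible for $(y,\sigma)\in U\times D_{s,\varepsilon}$; (4) for each $s$, with $\mathfrak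 P_s=\mathfrak p^1_{s,1}-\mathfrak p^1_{s,2}(\mathfrak p^2_{s,2})^{-1}\mathfrak p^2_{s,1}:K_s\to R_s^\perp$ on $U\times D_{s,\varepsilon}$ and $q_s=\det\mathfrak P_s$ (computed with respect to some fixed bases of $K_s$ and $R_s^\perp$), $q_s$ is nowhere zero in $U\times\{\sigma:\varepsilon/2\le|\sigma-\sigma_s|<\varepsilon\}$; and $\operatorname{sing}_b(\mathcal P_y)\subset\bigcup_{s}D_{s,\varepsilon/2}$ for every $y\in U$; (5) the elements $\phi^{K_s}_{j,\ell}(y,\cdot)$ defined below form a basis of $\mathfrak K_{s,y}$ for each $y\in U$ and $s=1,\dots,S$, where $$\mathfrak K_{s,y}=\{\mathfrak s_{D_{s,\varepsilon}}(\phi):\phi\in\mathfrak M(D_{s,\varepsilon},K_s),\ \mathfrak P_s(y,\cdot)\phi\in\mathfrak H(D_{s,\varepsilon},R_s^\perp)\}.$$ *The elements $\phi^{K_s}_{j,\ell}$.* For each $s$ choose (this is possible) $\phi^{K_s}_{j,0}(y_0,\cdot)\in\mathfrak K_{s,y_0}$, $j=1,\dots,J_s$, with pole only at $\sigma_s$, of some order $L_{s,j}$, such that (a) the elements $\mathfrak s_{D_{s,\varepsilon}}\big((\sigma-\sigma_s)^\ell\phi^{K_s}_{j,0}(y_0,\sigma)\big)$, $j=1,\dots,J_s$, $\ell=0,\dots,L_{s,j}-1$, form a basis of $\mathfrak K_{s,y_0}$; (b) the values at $\sigma_s$ of $(\sigma-\sigma_s)^{L_{s,j}}\phi^{K_s}_{j,0}(y_0,\sigma)$,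 $j=1,\dots,J_s$, form a basis of $K_s$; (c) the $R_s^\perp$-valued functions $\beta_{s,j}(\sigma)=\mathfrak P_s(y_0,\sigma)\big(\phi^{K_s}_{j,0}(y_0,\sigma)\big)$ are holomorphic in $D_{s,\varepsilon}$ and their values at $\sigma_s$ form a basis of $R_s^\perp$. For $y\in U$ define $$\phi^{K_s}_{j,\ell}(y,\cdot)=\mathfrak s_{D_{s,\varepsilon}}\big((\sigma-\sigma_s)^\ell\,\mathfrak P_s(y,\sigma)^{-1}(\beta_{s,j}(\sigma))\big),\quad j=1,\dots,J_s,\ \ell=0,\dots,L_{s,j}-1 .$$ In the claim, $\phi^s_{j,\ell}$ is regarded, via the trivialization of $\mathscr H_1$ over $U$, as a map assigning to $y\in U$ a meromorphic $\mathscr D_y$-valued function on $\mathbb C$. *)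

theory Defs
  imports
    "HOL-Analysis.Analysis"
    "HOL-Library.Function_Algebras"
    "Jordan_Normal_Form.Determinant"
begin

section \<open>Complex vector spaces and complex Hilbert spaces\<close>

class scaleC =
  fixes scaleC :: "complex \<Rightarrow> 'a \<Rightarrow> 'a"  (infixr "*\<^sub>C" 75)

class complex_vector = ab_group_add + scaleC +
  assumes scaleC_add_right: "a *\<^sub>C (x + y) = a *\<^sub>C x + a *\<^sub>C y"
    and scaleC_add_left: "(a + b) *\<^sub>C x = a *\<^sub>C x + b *\<^sub>C x"
    and scaleC_scaleC: "a *\<^sub>C b *\<^sub>C x = (a * b) *\<^sub>C x"
    and scaleC_one: "1 *\<^sub>C x = x"

global_interpretation complex_vector:
  vector_space "scaleC :: complex \<Rightarrow> 'a \<Rightarrow> 'a::complex_vector"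
  defines csubspace = complex_vector.subspace
    and cspan = complex_vector.span
    and cdependent = complex_vector.dependent
    and crepresentation = complex_vector.representation
  by unfold_locales
    (simp_all add: scaleC_add_right scaleC_add_left scaleC_scaleC scaleC_one)

instantiation "fun" :: (type, complex_vector) complex_vector
begin

definition scaleC_fun :: "complex \<Rightarrow> ('a \<Rightarrow> 'b) \<Rightarrow> 'a \<Rightarrow> 'b"
  where "scaleC_fun c f = (\<lambda>x. c *\<^sub>C f x)"

instance
  by standard
    (simp_all add: scaleC_fun_def plus_fun_def scaleC_add_right scaleC_add_left
      scaleC_scaleC scaleC_one)

end

text \<open>The inner product is linear in its first argument; \<open>inner\<close> and \<open>norm\<close> are those of the
  underlying real Hilbert space.\<close>

class complex_hilbert = complex_vector + real_inner + complete_space +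
  fixes cinner :: "'a \<Rightarrow> 'a \<Rightarrow> complex"
  assumes scaleR_eq_scaleC: "r *\<^sub>R x = of_real r *\<^sub>C x"
    and cinner_commute: "cinner x y = cnj (cinner y x)"
    and cinner_add_left: "cinner (x + y) z = cinner x z + cinner y z"
    and cinner_scaleC_left: "cinner (c *\<^sub>C x) y = c * cinner x y"
    and inner_eq_Re_cinner: "inner x y = Re (cinner x y)"

instantiation complex :: complex_hilbert
begin

definition scaleC_complex :: "complex \<Rightarrow> complex \<Rightarrow> complex"
  where "scaleC_complex c x = c * x"

definition cinner_complex :: "complex \<Rightarrow> complex \<Rightarrow> complex"
  where "cinner_complex x y = x * cnj y"

instance
  by standard
    (simp_all add: scaleC_complex_def cinner_complex_def inner_complex_def algebra_simps
      scaleR_conv_of_real)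

end

definition is_basis :: "'i set \<Rightarrow> ('i \<Rightarrow> 'v::complex_vector) \<Rightarrow> 'v set \<Rightarrow> bool"
  where "is_basis I b V \<longleftrightarrow> inj_on b I \<and> \<not> cdependent (b ` I) \<and> cspan (b ` I) = V"

text \<open>A Hilbert space whose underlying vector space is a subspace of some type: this is used for
  the fibers of bundles (which vary from point to point) and for subspaces of model spaces.\<close>

record 'e hilb =
  car :: "'e set"
  hip :: "'e \<Rightarrow> 'e \<Rightarrow> complex"

definition hnorm :: "'e hilb \<Rightarrow> 'e \<Rightarrow> real"
  where "hnorm F u = sqrt (Re (hip F u u))"

definition sub_hilb :: "'h::complex_hilbert set \<Rightarrow> 'h hilb"
  where "sub_hilb S = \<lparr>car = S, hip = cinner\<rparr>"

definition hlinear :: "'a::complex_vector hilb \<Rightarrow> 'b::complex_vector hilb \<Rightarrow> ('a \<Rightarrow> 'b) \<Rightarrow> bool"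
  where "hlinear F G T \<longleftrightarrow>
    (\<forall>u\<in>car F. T u \<in> car G) \<and>
    (\<forall>u\<in>car F. \<forall>v\<in>car F. T (u + v) = T u + T v) \<and>
    (\<forall>c. \<forall>u\<in>car F. T (c *\<^sub>C u) = c *\<^sub>C T u)"

definition hunitary :: "'a::complex_vector hilb \<Rightarrow> 'b::complex_vector hilb \<Rightarrow> ('a \<Rightarrow> 'b) \<Rightarrow> bool"
  where "hunitary F G T \<longleftrightarrow>
    hlinear F G T \<and> bij_betw T (car F) (car G) \<and>
    (\<forall>u\<in>car F. \<forall>v\<in>car F. hip G (T u) (T v) = hip F u v)"


section \<open>Holomorphic and meromorphic functions, singular parts\<close>

definition hol_on :: "'e::complex_vector hilb \<Rightarrow> complex set \<Rightarrow> (complex \<Rightarrow> 'e) \<Rightarrow> bool"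
  where "hol_on F V f \<longleftrightarrow>
    (\<forall>z\<in>V. f z \<in> car F \<and>
      (\<exists>l\<in>car F. ((\<lambda>w. hnorm F (inverse (w - z) *\<^sub>C (f w - f z) - l)) \<longlongrightarrow> 0) (at z)))"

text \<open>As for the library's \<open>meromorphic_on\<close>, the values of a meromorphic function at isolated
  points (its poles in particular) are irrelevant.  Accordingly, a meromorphic function is an
  element of the space of holomorphic functions on \<open>V\<close> if it is \<open>reg_at\<close> every point of \<open>V\<close>.\<close>

definition reg_at :: "'e::complex_vector hilb \<Rightarrow> complex \<Rightarrow> (complex \<Rightarrow> 'e) \<Rightarrow> bool"
  where "reg_at F p f \<longleftrightarrow>
    (\<exists>r>0. \<exists>g. hol_on F (ball p r) g \<and> (\<forall>z\<in>ball p r - {p}. f z = g z))"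

definition reg_on :: "'e::complex_vector hilb \<Rightarrow> complex set \<Rightarrow> (complex \<Rightarrow> 'e) \<Rightarrow> bool"
  where "reg_on F V f \<longleftrightarrow> (\<forall>p\<in>V. reg_at F p f)"

definition mero_on :: "'e::complex_vector hilb \<Rightarrow> complex set \<Rightarrow> (complex \<Rightarrow> 'e) \<Rightarrow> bool"
  where "mero_on F V f \<longleftrightarrow>
    (\<forall>p\<in>V. \<exists>r>0. \<exists>g n. hol_on F (ball p r) g \<and>
      (\<forall>z\<in>ball p r - {p}. f z = inverse ((z - p) ^ n) *\<^sub>C g z))"

definition poles_in :: "'e::complex_vector hilb \<Rightarrow> complex set \<Rightarrow> (complex \<Rightarrow> 'e) \<Rightarrow> complex set"
  where "poles_in F V f = {p\<in>V. \<not> reg_at F p f}"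

text \<open>Since \<open>inverse 0 = 0\<close>, principal parts, and sums of them, are represented by functions
  normalized at the poles, so that two of them are equal as functions if and only if they are
  equal as meromorphic functions.\<close>

definition principal_part :: "'e::complex_vector hilb \<Rightarrow> complex \<Rightarrow> (complex \<Rightarrow> 'e) \<Rightarrow> complex \<Rightarrow> 'e"
  where "principal_part F p f =
    (THE s. \<exists>n a. (\<forall>k. a k \<in> car F) \<and>
      s = (\<lambda>z. \<Sum>k=1..n. inverse ((z - p) ^ k) *\<^sub>C a k) \<and>
      reg_at F p (\<lambda>z. f z - s z))"

definition sing_part :: "'e::complex_vector hilb \<Rightarrow> complex set \<Rightarrow> (complex \<Rightarrow> 'e) \<Rightarrow> complex \<Rightarrow> 'e"
  where "sing_part F V f = (\<lambda>z. \<Sum>p\<in>poles_in F V f. principal_part F p f z)"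


section \<open>Smooth maps and manifolds\<close>

text \<open>This is only used on open subsets of finite-dimensional spaces, where the
  formulation by directional derivatives is the usual notion of a \<open>C\<^sup>k\<close> map.\<close>

primrec Ck_on ::
  "nat \<Rightarrow> 'a::real_normed_vector set \<Rightarrow> ('a \<Rightarrow> 'b::real_normed_vector) \<Rightarrow> bool"
where
  "Ck_on 0 S f = continuous_on S f"
| "Ck_on (Suc k) S f =
    ((\<forall>x\<in>S. f differentiable (at x)) \<and> (\<forall>v. Ck_on k S (\<lambda>x. frechet_derivative f (at x) v)))"

definition smooth_on :: "'a::real_normed_vector set \<Rightarrow> ('a \<Rightarrow> 'b::real_normed_vector) \<Rightarrow> bool"
  where "smooth_on S f \<longleftrightarrow> (\<forall>k. Ck_on k S f)"

text \<open>The model space \<open>'m\<close> of a manifold is any finite-dimensional normed space rather than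
  a \<open>euclidean_space\<close>, which would exclude dimension zero.\<close>

type_synonym ('y, 'm) atlas = "('y set \<times> ('y \<Rightarrow> 'm)) set"

definition smooth_manifold ::
  "('y::{t2_space, second_countable_topology}, 'm::real_normed_vector) atlas \<Rightarrow> bool"
  where "smooth_manifold A \<longleftrightarrow>
    (\<exists>B::'m set. finite B \<and> span B = UNIV) \<and>
    (\<Union>(V, \<psi>)\<in>A. V) = UNIV \<and>
    (\<forall>(V, \<psi>)\<in>A. open V \<and> open (\<psi> ` V) \<and> homeomorphism V (\<psi> ` V) \<psi> (inv_into V \<psi>)) \<and>
    (\<forall>(V, \<psi>)\<in>A. \<forall>(V', \<psi>')\<in>A. smooth_on (\<psi> ` (V \<inter> V')) (\<psi>' \<circ> inv_into V \<psi>))"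

definition msmooth_on ::
  "('x, 'm::real_normed_vector) atlas \<Rightarrow> 'x set \<Rightarrow> ('x \<Rightarrow> 'b::real_normed_vector) \<Rightarrow> bool"
  where "msmooth_on A W f \<longleftrightarrow> (\<forall>(V, \<psi>)\<in>A. smooth_on (\<psi> ` (W \<inter> V)) (f \<circ> inv_into V \<psi>))"

definition times_complex :: "('y, 'm) atlas \<Rightarrow> ('y \<times> complex, 'm \<times> complex) atlas"
  where "times_complex A = (\<lambda>(V, \<psi>). (V \<times> UNIV, \<lambda>(y, \<sigma>). (\<psi> y, \<sigma>))) ` A"

text \<open>Smoothness of families of bounded operators refers to the operator norm.\<close>

definition op_smooth_on ::
  "('x, 'm::real_normed_vector) atlas \<Rightarrow> 'x set \<Rightarrow>
    ('x \<Rightarrow> 'a::real_normed_vector \<Rightarrow> 'b::real_normed_vector) \<Rightarrow> bool"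
  where "op_smooth_on A W T \<longleftrightarrow>
    (\<forall>x\<in>W. bounded_linear (T x)) \<and> msmooth_on A W (\<lambda>x. Blinfun (T x))"

definition op_holomorphic_on ::
  "complex set \<Rightarrow> (complex \<Rightarrow> 'a::complex_hilbert \<Rightarrow> 'b::complex_hilbert) \<Rightarrow> bool"
  where "op_holomorphic_on V T \<longleftrightarrow>
    (\<forall>z\<in>V. bounded_linear (T z)) \<and>
    (\<forall>z\<in>V. \<exists>T'. bounded_linear T' \<and> (\<forall>c u. T' (c *\<^sub>C u) = c *\<^sub>C T' u) \<and>
      ((\<lambda>w. Blinfun (T w)) has_derivative (\<lambda>h. Blinfun (\<lambda>u. h *\<^sub>C T' u))) (at z))"


section \<open>Hilbert space bundles\<close>

text \<open>The fibers are subspaces of a type \<open>'e\<close> on which only a vector space structure is given;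
  \<open>'h\<close> is the model space.  A local trivialization over \<open>V\<close> is a pair \<open>(V, \<tau>)\<close> with \<open>\<tau> y\<close> a unitary map
  from the fiber over \<open>y\<close> to \<open>'h\<close> for \<open>y \<in> V\<close>.  The topology and smooth
  structure of the bundle are those determined by \<open>trivs\<close>.\<close>

record ('y, 'e, 'h) hbundle =
  fib :: "'y \<Rightarrow> 'e hilb"
  trivs :: "('y set \<times> ('y \<Rightarrow> 'e \<Rightarrow> 'h)) set"

definition triv_inv :: "('y, 'e, 'h) hbundle \<Rightarrow> ('y \<Rightarrow> 'e \<Rightarrow> 'h) \<Rightarrow> 'y \<Rightarrow> 'h \<Rightarrow> 'e"
  where "triv_inv B \<tau> y = inv_into (car (fib B y)) (\<tau> y)"

definition smooth_hilbert_bundle ::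
  "('y::topological_space, 'm::real_normed_vector) atlas \<Rightarrow>
    ('y, 'e::complex_vector, 'h::complex_hilbert) hbundle \<Rightarrow> bool"
  where "smooth_hilbert_bundle A B \<longleftrightarrow>
    (\<forall>y. csubspace (car (fib B y))) \<and>
    (\<Union>(V, \<tau>)\<in>trivs B. V) = UNIV \<and>
    (\<forall>(V, \<tau>)\<in>trivs B. open V \<and> (\<forall>y\<in>V. hunitary (fib B y) (sub_hilb UNIV) (\<tau> y))) \<and>
    (\<forall>(V, \<tau>)\<in>trivs B. \<forall>(V', \<tau>')\<in>trivs B.
      op_smooth_on A (V \<inter> V') (\<lambda>y u. \<tau>' y (triv_inv B \<tau> y u)))"

text \<open>\<open>D\<close> is continuously embedded in \<open>B\<close>, the embedding of the model spaces being \<open>\<iota>\<close>, and the given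
  trivializations \<open>\<tau>\<close> of \<open>B\<close> restrict to smooth trivializations of \<open>D\<close>, namely
  \<open>inv_into UNIV \<iota> \<circ> \<tau> y\<close>; these need not be unitary for the inner products of \<open>D\<close> and
  of its model space \<open>'d\<close>.\<close>

definition embedded_bundle ::
  "('y::topological_space, 'm::real_normed_vector) atlas \<Rightarrow> ('d::complex_hilbert \<Rightarrow> 'h::complex_hilbert) \<Rightarrow>
    ('y, 'e::complex_vector, 'd) hbundle \<Rightarrow> ('y, 'e, 'h) hbundle \<Rightarrow> bool"
  where "embedded_bundle A \<iota> D B \<longleftrightarrow>
    bounded_linear \<iota> \<and> (\<forall>c u. \<iota> (c *\<^sub>C u) = c *\<^sub>C \<iota> u) \<and> inj \<iota> \<and>
    (\<forall>y. car (fib D y) \<subseteq> car (fib B y)) \<and>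
    (\<forall>(V, \<tau>)\<in>trivs B.
      (\<forall>y\<in>V. \<tau> y ` car (fib D y) = range \<iota>) \<and>
      (\<forall>(V', \<delta>)\<in>trivs D.
        op_smooth_on A (V \<inter> V') (\<lambda>y u. inv_into UNIV \<iota> (\<tau> y (triv_inv D \<delta> y u))) \<and>
        op_smooth_on A (V \<inter> V') (\<lambda>y u. \<delta> y (triv_inv B \<tau> y (\<iota> u)))))"

definition hdense :: "'e::complex_vector hilb \<Rightarrow> 'e set \<Rightarrow> bool"
  where "hdense F S \<longleftrightarrow> (\<forall>u\<in>car F. \<forall>e>0. \<exists>v\<in>S. hnorm F (u - v) < e)"


section \<open>Holomorphic Fredholm families\<close>

text \<open>In the following, \<open>T\<close> is an operator from \<open>F\<close> to \<open>G\<close> with domain \<open>E\<close>.\<close>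

definition closed_operator ::
  "'a::complex_vector set \<Rightarrow> 'a hilb \<Rightarrow> 'b::complex_vector hilb \<Rightarrow> ('a \<Rightarrow> 'b) \<Rightarrow> bool"
  where "closed_operator E F G T \<longleftrightarrow>
    (\<forall>x. \<forall>u\<in>car F. \<forall>v\<in>car G.
      (\<forall>n::nat. x n \<in> E) \<and> (\<lambda>n. hnorm F (x n - u)) \<longlonglongrightarrow> 0 \<and>
      (\<lambda>n. hnorm G (T (x n) - v)) \<longlonglongrightarrow> 0 \<longrightarrow> u \<in> E \<and> T u = v)"

definition fredholm_operator ::
  "'a::complex_vector set \<Rightarrow> 'b::complex_vector hilb \<Rightarrow> ('a \<Rightarrow> 'b) \<Rightarrow> bool"
  where "fredholm_operator E G T \<longleftrightarrow>
    (\<exists>B. finite B \<and> {u\<in>E. T u = 0} \<subseteq> cspan B) \<and>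
    (\<forall>x. \<forall>v\<in>car G. (\<forall>n::nat. x n \<in> T ` E) \<and> (\<lambda>n. hnorm G (x n - v)) \<longlonglongrightarrow> 0 \<longrightarrow> v \<in> T ` E) \<and>
    (\<exists>B\<subseteq>car G. finite B \<and> car G = cspan (T ` E \<union> B))"

definition adjoint_dom ::
  "'a set \<Rightarrow> 'a hilb \<Rightarrow> 'b hilb \<Rightarrow> ('a \<Rightarrow> 'b) \<Rightarrow> 'b set"
  where "adjoint_dom E F G T = {v\<in>car G. \<exists>w\<in>car F. \<forall>u\<in>E. hip G (T u) v = hip F u w}"

definition adjoint_op ::
  "'a set \<Rightarrow> 'a hilb \<Rightarrow> 'b hilb \<Rightarrow> ('a \<Rightarrow> 'b) \<Rightarrow> 'b \<Rightarrow> 'a"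
  where "adjoint_op E F G T v = (THE w. w \<in> car F \<and> (\<forall>u\<in>E. hip G (T u) v = hip F u w))"

text \<open>Invertibility is bijectivity onto the target; the inverse is then bounded, the operators
  being closed.\<close>

definition sing_b ::
  "complex set \<Rightarrow> ('y, 'a, 'd) hbundle \<Rightarrow> ('y, 'b, 'h) hbundle \<Rightarrow>
    ('y \<Rightarrow> complex \<Rightarrow> 'a \<Rightarrow> 'b) \<Rightarrow> 'y \<Rightarrow> complex set"
  where "sing_b \<Sigma> D H2 P y = {\<sigma>\<in>\<Sigma>. \<not> bij_betw (P y \<sigma>) (car (fib D y)) (car (fib H2 y))}"

definition sing_e ::
  "complex set \<Rightarrow> ('y, 'a, 'd) hbundle \<Rightarrow> ('y, 'b, 'h) hbundle \<Rightarrow>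
    ('y \<Rightarrow> complex \<Rightarrow> 'a \<Rightarrow> 'b) \<Rightarrow> ('y \<times> complex) set"
  where "sing_e \<Sigma> D H2 P = {(y, \<sigma>). \<sigma> \<in> sing_b \<Sigma> D H2 P y}"

definition holomorphic_fredholm_family ::
  "('y::topological_space, 'm::real_normed_vector) atlas \<Rightarrow> complex set \<Rightarrow>
    ('y, 'a::complex_vector, 'd::complex_hilbert) hbundle \<Rightarrow>
    ('y, 'a, 'h1::complex_hilbert) hbundle \<Rightarrow>
    ('y, 'b::complex_vector, 'h2::complex_hilbert) hbundle \<Rightarrow>
    ('y \<Rightarrow> complex \<Rightarrow> 'a \<Rightarrow> 'b) \<Rightarrow> bool"
  where "holomorphic_fredholm_family A \<Sigma> D H1 H2 P \<longleftrightarrow>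
    (\<forall>y. \<forall>\<sigma>\<in>\<Sigma>. hlinear (fib D y) (fib H2 y) (P y \<sigma>) \<and>
      closed_operator (car (fib D y)) (fib H1 y) (fib H2 y) (P y \<sigma>) \<and>
      fredholm_operator (car (fib D y)) (fib H2 y) (P y \<sigma>)) \<and>
    (\<forall>(V, \<delta>)\<in>trivs D. \<forall>(W, \<tau>)\<in>trivs H2.
      op_smooth_on (times_complex A) ((V \<inter> W) \<times> \<Sigma>)
        (\<lambda>(y, \<sigma>) u. \<tau> y (P y \<sigma> (triv_inv D \<delta> y u))) \<and>
      (\<forall>y\<in>V \<inter> W. op_holomorphic_on \<Sigma> (\<lambda>\<sigma> u. \<tau> y (P y \<sigma> (triv_inv D \<delta> y u))))) \<and>
    (\<forall>y. \<exists>\<sigma>\<in>\<Sigma>. bij_betw (P y \<sigma>) (car (fib D y)) (car (fib H2 y)))"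

text \<open>The spaces \<open>\<K>\<^sub>y\<close> and \<open>\<B>\<^sup>\<infinity>(U; \<K>)\<close>.\<close>

definition sing_space ::
  "complex set \<Rightarrow> ('y, 'a::complex_vector, 'd) hbundle \<Rightarrow> ('y, 'b::complex_vector, 'h) hbundle \<Rightarrow>
    ('y \<Rightarrow> complex \<Rightarrow> 'a \<Rightarrow> 'b) \<Rightarrow> 'y \<Rightarrow> (complex \<Rightarrow> 'a) set"
  where "sing_space \<Sigma> D H2 P y =
    {sing_part (fib D y) \<Sigma> \<phi> | \<phi>.
      mero_on (fib D y) \<Sigma> \<phi> \<and> reg_on (fib H2 y) \<Sigma> (\<lambda>\<sigma>. P y \<sigma> (\<phi> \<sigma>))}"

definition B_infinity ::
  "('y, 'm::real_normed_vector) atlas \<Rightarrow> complex set \<Rightarrow> ('d::complex_hilbert \<Rightarrow> 'h1::complex_hilbert) \<Rightarrow>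
    ('y, 'a::complex_vector, 'd) hbundle \<Rightarrow> ('y, 'a, 'h1) hbundle \<Rightarrow>
    ('y, 'b::complex_vector, 'h2) hbundle \<Rightarrow> ('y \<Rightarrow> complex \<Rightarrow> 'a \<Rightarrow> 'b) \<Rightarrow>
    'y set \<Rightarrow> ('y \<Rightarrow> complex \<Rightarrow> 'a) set"
  where "B_infinity A \<Sigma> \<iota> D H1 H2 P U =
    {\<phi>. (\<forall>y\<in>U. \<phi> y \<in> sing_space \<Sigma> D H2 P y) \<and>
      (\<forall>(V, \<tau>)\<in>trivs H1.
        msmooth_on (times_complex A) (((U \<inter> V) \<times> UNIV) - sing_e \<Sigma> D H2 P)
          (\<lambda>(y, \<sigma>). inv_into UNIV \<iota> (\<tau> y (\<phi> y \<sigma>))) \<and>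
        (\<forall>y\<in>U \<inter> V. hol_on (sub_hilb UNIV) (- sing_b \<Sigma> D H2 P y)
          (\<lambda>\<sigma>. inv_into UNIV \<iota> (\<tau> y (\<phi> y \<sigma>)))))}"


section \<open>The local construction\<close>

definition local_family ::
  "('y, 'a, 'h1) hbundle \<Rightarrow> ('y \<Rightarrow> 'a \<Rightarrow> 'h1) \<Rightarrow> ('y \<Rightarrow> 'b \<Rightarrow> 'h2) \<Rightarrow> ('d \<Rightarrow> 'h1) \<Rightarrow>
    ('y \<Rightarrow> complex \<Rightarrow> 'a \<Rightarrow> 'b) \<Rightarrow> 'y \<Rightarrow> complex \<Rightarrow> 'd \<Rightarrow> 'h2"
  where "local_family H1 \<tau>1 \<tau>2 \<iota> P y \<sigma> u = \<tau>2 y (P y \<sigma> (triv_inv H1 \<tau>1 y (\<iota> u)))"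

text \<open>Below, \<open>T0\<close> stands for \<open>\<P>\<^bsub>y0\<^esub>(\<sigma>\<^sub>s)\<close>, whose kernel and image are \<open>K\<^sub>s\<close> and \<open>R\<^sub>s\<close>, and \<open>T\<close> for
  \<open>\<P>\<^sub>y(\<sigma>)\<close>.  The orthogonal of \<open>K\<^sub>s\<close> is taken in \<open>'d\<close>, with respect to the inner product of \<open>'h\<close>.\<close>

definition ker :: "('d::complex_hilbert \<Rightarrow> 'h2::complex_hilbert) \<Rightarrow> 'd set"
  where "ker T0 = {u. T0 u = 0}"

definition ker_perp ::
  "('d::complex_hilbert \<Rightarrow> 'h::complex_hilbert) \<Rightarrow> ('d \<Rightarrow> 'h2::complex_hilbert) \<Rightarrow> 'd set"
  where "ker_perp \<iota> T0 = {u. \<forall>k\<in>ker T0. cinner (\<iota> u) (\<iota> k) = 0}"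

definition ran_perp :: "('d::complex_hilbert \<Rightarrow> 'h2::complex_hilbert) \<Rightarrow> 'h2 set"
  where "ran_perp T0 = {v. \<forall>r\<in>range T0. cinner v r = 0}"

definition orth_proj :: "'h::complex_hilbert set \<Rightarrow> 'h \<Rightarrow> 'h"
  where "orth_proj S x = (THE p. p \<in> S \<and> (\<forall>s\<in>S. cinner (x - p) s = 0))"

text \<open>The rows of the block matrix of \<open>T\<close>: \<open>top_row\<close> is \<open>\<pp>\<^sup>1\<^sub>1\<close> on \<open>ker T0\<close> and \<open>\<pp>\<^sup>1\<^sub>2\<close> on
  \<open>ker_perp \<iota> T0\<close>, and \<open>bottom_row\<close> is \<open>\<pp>\<^sup>2\<^sub>1\<close> on \<open>ker T0\<close> and \<open>\<pp>\<^sup>2\<^sub>2\<close> on \<open>ker_perp \<iota> T0\<close>.\<close>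

definition top_row ::
  "('d::complex_hilbert \<Rightarrow> 'h2::complex_hilbert) \<Rightarrow> ('d \<Rightarrow> 'h2) \<Rightarrow> 'd \<Rightarrow> 'h2"
  where "top_row T0 T u = orth_proj (ran_perp T0) (T u)"

definition bottom_row ::
  "('d::complex_hilbert \<Rightarrow> 'h2::complex_hilbert) \<Rightarrow> ('d \<Rightarrow> 'h2) \<Rightarrow> 'd \<Rightarrow> 'h2"
  where "bottom_row T0 T u = orth_proj (range T0) (T u)"

definition p22_invertible ::
  "('d::complex_hilbert \<Rightarrow> 'h::complex_hilbert) \<Rightarrow> ('d \<Rightarrow> 'h2::complex_hilbert) \<Rightarrow>
    ('d \<Rightarrow> 'h2) \<Rightarrow> bool"
  where "p22_invertible \<iota> T0 T \<longleftrightarrow> bij_betw (bottom_row T0 T) (ker_perp \<iota> T0) (range T0)"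

definition p22_inv_p21 ::
  "('d::complex_hilbert \<Rightarrow> 'h::complex_hilbert) \<Rightarrow> ('d \<Rightarrow> 'h2::complex_hilbert) \<Rightarrow>
    ('d \<Rightarrow> 'h2) \<Rightarrow> 'd \<Rightarrow> 'd"
  where "p22_inv_p21 \<iota> T0 T u = inv_into (ker_perp \<iota> T0) (bottom_row T0 T) (bottom_row T0 T u)"

text \<open>\<open>\<PP>\<^sub>s\<close>, as a map on \<open>ker T0\<close>.\<close>

definition schur ::
  "('d::complex_hilbert \<Rightarrow> 'h::complex_hilbert) \<Rightarrow> ('d \<Rightarrow> 'h2::complex_hilbert) \<Rightarrow>
    ('d \<Rightarrow> 'h2) \<Rightarrow> 'd \<Rightarrow> 'h2"
  where "schur \<iota> T0 T u = top_row T0 T u - top_row T0 T (p22_inv_p21 \<iota> T0 T u)"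

definition basis_det ::
  "nat \<Rightarrow> (nat \<Rightarrow> 'a::complex_vector) \<Rightarrow> (nat \<Rightarrow> 'b::complex_vector) \<Rightarrow> ('a \<Rightarrow> 'b) \<Rightarrow> complex"
  where "basis_det d a b T =
    Determinant.det (Matrix.mat d d (\<lambda>(i, j). crepresentation (b ` {..<d}) (T (a j)) (b i)))"

text \<open>In the next three definitions \<open>Q\<close> is the family \<open>\<sigma> \<mapsto> \<P>\<^sub>y(\<sigma>)\<close> for a fixed \<open>y\<close>, and \<open>ball c \<epsilon>\<close> with
  \<open>c = \<sigma>\<^sub>s\<close> is the disc \<open>D\<^bsub>s,\<epsilon>\<^esub>\<close>.\<close>

definition local_sing_space ::
  "('d::complex_hilbert \<Rightarrow> 'h::complex_hilbert) \<Rightarrow> ('d \<Rightarrow> 'h2::complex_hilbert) \<Rightarrow>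
    complex \<Rightarrow> real \<Rightarrow> (complex \<Rightarrow> 'd \<Rightarrow> 'h2) \<Rightarrow> (complex \<Rightarrow> 'd) set"
  where "local_sing_space \<iota> T0 c \<epsilon> Q =
    {sing_part (sub_hilb (ker T0)) (ball c \<epsilon>) \<phi> | \<phi>.
      mero_on (sub_hilb (ker T0)) (ball c \<epsilon>) \<phi> \<and>
      reg_on (sub_hilb (ran_perp T0)) (ball c \<epsilon>) (\<lambda>\<sigma>. schur \<iota> T0 (Q \<sigma>) (\<phi> \<sigma>))}"

definition phiK ::
  "('d::complex_hilbert \<Rightarrow> 'h::complex_hilbert) \<Rightarrow> ('d \<Rightarrow> 'h2::complex_hilbert) \<Rightarrow>
    complex \<Rightarrow> real \<Rightarrow> (complex \<Rightarrow> 'd \<Rightarrow> 'h2) \<Rightarrow> (complex \<Rightarrow> 'h2) \<Rightarrow> nat \<Rightarrow> complex \<Rightarrow> 'd"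
  where "phiK \<iota> T0 c \<epsilon> Q \<beta> l =
    sing_part (sub_hilb (ker T0)) (ball c \<epsilon>)
      (\<lambda>\<sigma>. (\<sigma> - c) ^ l *\<^sub>C inv_into (ker T0) (schur \<iota> T0 (Q \<sigma>)) (\<beta> \<sigma>))"

definition phi ::
  "('d::complex_hilbert \<Rightarrow> 'h::complex_hilbert) \<Rightarrow> ('d \<Rightarrow> 'h2::complex_hilbert) \<Rightarrow>
    complex \<Rightarrow> real \<Rightarrow> (complex \<Rightarrow> 'd \<Rightarrow> 'h2) \<Rightarrow> (complex \<Rightarrow> 'h2) \<Rightarrow> nat \<Rightarrow> complex \<Rightarrow> 'd"
  where "phi \<iota> T0 c \<epsilon> Q \<beta> l =
    phiK \<iota> T0 c \<epsilon> Q \<beta> l -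
    sing_part (sub_hilb UNIV) (ball c \<epsilon>) (\<lambda>\<sigma>. p22_inv_p21 \<iota> T0 (Q \<sigma>) (phiK \<iota> T0 c \<epsilon> Q \<beta> l \<sigma>))"

end

theory Submission
  imports Defs "HOL-Complex_Analysis.Complex_Analysis"
begin

text \<open>On a disc around \<open>\<sigma>\<^sub>s\<close>, complete the invertible block \<open>p22\<close> of \<open>Q\<close> by an isomorphism
  \<open>i : K \<cong> R\<^sup>\<bottom>\<close> to an invertible operator \<open>E\<close>. Then \<open>G = E\<^sup>-\<^sup>1 i\<close> is \<open>1 - p22\<^sup>-\<^sup>1 p21\<close> on \<open>K\<close>, and \<open>Q G\<close> is the Schur complement. Hence \<open>\<phi>\<close> is the singular part of
  \<open>(\<sigma> - \<sigma>\<^sub>s)\<^sup>l Q\<^sup>-\<^sup>1 \<beta>\<close>, and \<open>u \<mapsto> \<pi>\<^sub>K u\<close> is an isomorphism from the singular space of \<open>Q\<close> over the disc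
  to that of the Schur complement. Poles of elements of the singular space of \<open>Q\<close> over \<open>\<Sigma>\<close> lie where \<open>Q\<close> is not
  injective, so this space is the direct sum of those over the discs, which gives the bases. Off the
  singular set \<open>\<phi>\<close> is a Cauchy integral of \<open>(\<sigma> - \<sigma>\<^sub>s)\<^sup>l Q\<^sup>-\<^sup>1 \<beta>\<close> over a circle on which \<open>Q\<close> is invertible for
  all parameters, hence smooth. The coefficients of a smooth \<open>\<phi>\<close> solve a linear system obtained from
  finitely many scalar tests (values at \<open>\<sigma>\<close> paired with a vector), and Gaussian elimination shows that
  they are smooth.\<close>

text \<open>The obstacle is that singular points may move, merge and split as the parameter varies,
  so neither pole orders nor single Laurent coefficients need be continuous in it. Hence no pole is
  ever followed: what is smooth is an integral over a fixed circle. The singular points stay within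
  \<open>\<epsilon> / 2\<close> of the centres, which leaves the annulus up to
  \<open>\<epsilon>\<close> free for such circles.

  The passage between \<open>Q\<close> and its Schur complement rests on one fact: \<open>E\<close>
  is invertible also where \<open>Q\<close> is not. So if \<open>Q u\<close> is regular, then so is
  \<open>u - G u'\<close>, where \<open>u'\<close> is the projection of \<open>u\<close> to the
  kernel. Meromorphy of \<open>inv Q\<close> has to be proved; on values orthogonal to the range it
  reduces to a finite matrix, whose determinant has isolated zeros of finite order.

  Uniqueness, independence and the sufficiency of scalar tests all come from the same principle: a
  finite sum of principal parts that is regular at its possible poles is zero. All of this is done
  in fixed Hilbert spaces; the fibers enter through bounded isomorphisms.\<close>

unbundle no vec_syntax

section \<open>Complex vector spaces and Hilbert spaces\<close>

instance complex_hilbert \<subseteq> banach ..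

text \<open>Turns a basis given as a set of vectors into one given by coefficient functions on the
  index set, so that later arguments can compare sums term by term.\<close>

lemma is_basis_iff:
  fixes b :: "'i \<Rightarrow> 'v::complex_vector"
  assumes I: "finite I"
  shows "is_basis I b V \<longleftrightarrow>
    (\<forall>c. (\<Sum>i\<in>I. c i *\<^sub>C b i) = 0 \<longrightarrow> (\<forall>i\<in>I. c i = 0)) \<and>
    V = range (\<lambda>c. \<Sum>i\<in>I. c i *\<^sub>C b i)" (is "_ \<longleftrightarrow> ?ind \<and> _")
proof -
  have reindex: "(\<Sum>v\<in>b ` I. u v *\<^sub>C v) = (\<Sum>i\<in>I. u (b i) *\<^sub>C b i)" if "inj_on b I" for u
    using sum.reindex[OF that] by (simp add: o_def)
  have 1: "inj_on b I \<and> \<not> cdependent (b ` I) \<longleftrightarrow> ?ind"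
  proof (intro iffI conjI)
    assume L: "inj_on b I \<and> \<not> cdependent (b ` I)"
    show ?ind
    proof (intro allI impI ballI)
      fix c i assume 0: "(\<Sum>i\<in>I. c i *\<^sub>C b i) = 0" and i: "i \<in> I"
      have "(\<Sum>v\<in>b ` I. c (inv_into I b v) *\<^sub>C v) = 0"
        using L 0 by (simp add: reindex)
      then have "c (inv_into I b (b i)) = 0"
        using complex_vector.independentD[of "b ` I" "b ` I" "\<lambda>v. c (inv_into I b v)" "b i"] L I i
        by simp
      then show "c i = 0" using L i by simp
    qed
  next
    assume R: ?ind
    show inj: "inj_on b I"
    proof (rule inj_onI, rule ccontr)
      fix i j assume *: "i \<in> I" "j \<in> I" "b i = b j" "i \<noteq> j"
      \<comment> \<open>A repeated vector would satisfy the nontrivial relation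
        \<open>b i - b j = 0\<close>.\<close>
      define c where "c k = (if k = i then 1 else if k = j then -1 else 0 :: complex)" for k
      have "(\<Sum>k\<in>I. c k *\<^sub>C b k) = (\<Sum>k\<in>{i, j}. c k *\<^sub>C b k)"
        using * I by (intro sum.mono_neutral_right) (auto simp: c_def)
      also have "\<dots> = 0" using * by (simp add: c_def)
      finally have "c i = 0" using R * by blast
      then show False by (simp add: c_def)
    qed
    show "\<not> cdependent (b ` I)"
      using R by (auto simp: complex_vector.dependent_finite I reindex[OF inj])
  qed
  have 2: "cspan (b ` I) = range (\<lambda>c. \<Sum>i\<in>I. c i *\<^sub>C b i)" if "inj_on b I"
  proof -
    have "(\<Sum>i\<in>I. c i *\<^sub>C b i) \<in> range (\<lambda>u. \<Sum>v\<in>b ` I. u v *\<^sub>C v)" for c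
      by (rule range_eqI[of _ _ "\<lambda>v. c (inv_into I b v)"]) (simp add: reindex that)
    then show ?thesis
      by (auto simp: complex_vector.span_finite I reindex that)
  qed
  show ?thesis
    unfolding is_basis_def using 1 2 by auto
qed

section \<open>The complex inner product and its norm\<close>

lemma cinner_add_right: "cinner x (y + z :: 'a::complex_hilbert) = cinner x y + cinner x z"
  by (metis cinner_add_left cinner_commute complex_cnj_add)

lemma cinner_scaleC_right: "cinner x (c *\<^sub>C y :: 'a::complex_hilbert) = cnj c * cinner x y"
  by (metis cinner_scaleC_left cinner_commute complex_cnj_mult)

lemma cinner_zero_left [simp]: "cinner 0 (x :: 'a::complex_hilbert) = 0"
  using cinner_add_left[of 0 0 x] by simp

lemma cinner_zero_right [simp]: "cinner (x :: 'a::complex_hilbert) 0 = 0"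
  using cinner_add_right[of x 0 0] by simp

lemma cinner_diff_left: "cinner (x - y :: 'a::complex_hilbert) z = cinner x z - cinner y z"
  by (metis cinner_add_left add_diff_cancel_right' diff_add_cancel)

lemma cinner_sum_left: "cinner (\<Sum>i\<in>I. f i) (x :: 'a::complex_hilbert) = (\<Sum>i\<in>I. cinner (f i) x)"
  by (induction I rule: infinite_finite_induct) (auto simp: cinner_add_left)

lemma cinner_sum_right: "cinner (x :: 'a::complex_hilbert) (\<Sum>i\<in>I. f i) = (\<Sum>i\<in>I. cinner x (f i))"
  by (induction I rule: infinite_finite_induct) (auto simp: cinner_add_right)

lemma Re_cinner_self: "Re (cinner x (x :: 'a::complex_hilbert)) = (norm x)\<^sup>2"
  by (simp add: inner_eq_Re_cinner[symmetric] power2_norm_eq_inner)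

lemma cinner_self: "cinner x (x :: 'a::complex_hilbert) = of_real ((norm x)\<^sup>2)"
proof -
  have "Im (cinner x x) = 0"
    using arg_cong[OF cinner_commute[of x x], of Im] by simp
  then show ?thesis by (simp add: complex_eq_iff Re_cinner_self)
qed

lemma cinner_self_eq_0 [simp]: "cinner x (x :: 'a::complex_hilbert) = 0 \<longleftrightarrow> x = 0"
  by (simp add: cinner_self)

text \<open>Allows an identity between vector-valued integrals to be checked after pairing with each
  \<open>v\<close>, where the scalar theory of contour integrals applies.\<close>

lemma cinner_eqI: "(\<And>v. cinner x v = cinner y v) \<Longrightarrow> x = (y :: 'a::complex_hilbert)"
  by (metis cinner_diff_left cinner_self_eq_0 diff_self right_minus_eq)

lemma norm_scaleC [simp]: "norm (c *\<^sub>C x :: 'a::complex_hilbert) = cmod c * norm x"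
proof -
  have "cnj c * (c * of_real r) = of_real ((cmod c)\<^sup>2 * r)"
    for r by (simp only: of_real_mult complex_norm_square mult.assoc mult.left_commute[of "cnj c"])
  then have "cinner (c *\<^sub>C x) (c *\<^sub>C x) = of_real ((cmod c)\<^sup>2 * (norm x)\<^sup>2)"
    by (simp only: cinner_scaleC_left cinner_scaleC_right cinner_self[of x])
  then have "(norm (c *\<^sub>C x))\<^sup>2 = (cmod c * norm x)\<^sup>2"
    unfolding cinner_self of_real_eq_iff power_mult_distrib .
  then show ?thesis by (simp add: power2_eq_iff_nonneg)
qed

lemma cmod_cinner_le: "cmod (cinner x (y :: 'a::complex_hilbert)) \<le> norm x * norm y"
proof (cases "cinner x y = 0")
  case False
  \<comment> \<open>A factor of modulus one that rotates the inner product onto the positive real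
    axis, where the real Cauchy-Schwarz inequality applies.\<close>
  define c where "c = cnj (cinner x y) / cmod (cinner x y)"
  have c: "cmod c = 1" using False by (simp add: c_def norm_divide)
  have "cinner (c *\<^sub>C x) y = of_real (cmod (cinner x y))"
    using False complex_norm_square[of "cinner x y"]
    by (simp add: cinner_scaleC_left c_def mult.commute[of "cnj _"] power2_eq_square
        nonzero_divide_eq_eq)
  then have "cmod (cinner x y) = inner (c *\<^sub>C x) y"
    by (simp add: inner_eq_Re_cinner)
  also have "\<dots> \<le> norm (c *\<^sub>C x) * norm y" by (rule norm_cauchy_schwarz)
  finally show ?thesis using c by simp
qed simp

lemma bounded_bilinear_scaleC:
  "bounded_bilinear (scaleC :: complex \<Rightarrow> 'a \<Rightarrow> 'a::complex_hilbert)"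
proof
  fix a :: complex and b :: 'a and r :: real
  show "(r *\<^sub>R a) *\<^sub>C b = r *\<^sub>R a *\<^sub>C b"
    by (simp only: scaleR_eq_scaleC[where 'a='a] scaleC_scaleC scaleR_conv_of_real[of r a])
  show "a *\<^sub>C r *\<^sub>R b = r *\<^sub>R a *\<^sub>C b"
    by (simp only: scaleR_eq_scaleC scaleC_scaleC mult.commute)
  show "\<exists>K. \<forall>a b. norm (a *\<^sub>C b :: 'a) \<le> norm a * norm b * K"
    by (rule exI[of _ 1]) simp
qed (rule scaleC_add_left scaleC_add_right)+

text \<open>Conjugate linearity in the second argument is still real linearity, so the real
  continuity and product rules cover \<open>cinner\<close>.\<close>

lemma bounded_bilinear_cinner:
  "bounded_bilinear (cinner :: 'a::complex_hilbert \<Rightarrow> 'a \<Rightarrow> complex)"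
proof
  show "\<exists>K. \<forall>a b. norm (cinner a b :: complex) \<le> norm (a::'a) * norm b * K"
    by (rule exI[of _ 1]) (simp add: cmod_cinner_le)
qed (simp_all add: cinner_add_left cinner_add_right scaleR_eq_scaleC cinner_scaleC_left cinner_scaleC_right scaleC_complex_def)

lemmas bounded_linear_scaleC_right = bounded_bilinear.bounded_linear_right[OF bounded_bilinear_scaleC]
lemmas bounded_linear_scaleC_left = bounded_bilinear.bounded_linear_left[OF bounded_bilinear_scaleC]
lemmas bounded_linear_cinner_left = bounded_bilinear.bounded_linear_left[OF bounded_bilinear_cinner]
lemmas continuous_on_scaleC [continuous_intros] = bounded_bilinear.continuous_on[OF bounded_bilinear_scaleC]
lemmas tendsto_scaleC [tendsto_intros] = bounded_bilinear.tendsto[OF bounded_bilinear_scaleC]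

text \<open>Kept apart from \<open>bounded_linear\<close>, which only expresses real linearity and
  continuity.\<close>

definition clinear_map :: "('a::complex_vector \<Rightarrow> 'b::complex_vector) \<Rightarrow> bool"
  where "clinear_map T \<longleftrightarrow> (\<forall>u v. T (u + v) = T u + T v) \<and> (\<forall>c u. T (c *\<^sub>C u) = c *\<^sub>C T u)"

lemma clinear_mapD:
  assumes "clinear_map T"
  shows "T (u + v) = T u + T v" "T (c *\<^sub>C u) = c *\<^sub>C T u" "T 0 = 0" "T (u - v) = T u - T v"
    "T (\<Sum>i\<in>I. f i) = (\<Sum>i\<in>I. T (f i))"
proof -
  show add: "T (u + v) = T u + T v" for u v using assms by (simp add: clinear_map_def)
  show "T (c *\<^sub>C u) = c *\<^sub>C T u" for c u using assms by (simp add: clinear_map_def)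
  show zero: "T 0 = 0" using add[of 0 0] by simp
  show "T (u - v) = T u - T v" for u v
    using add[of "u - v" v] by simp
  show "T (\<Sum>i\<in>I. f i) = (\<Sum>i\<in>I. T (f i))"
    by (induction I rule: infinite_finite_induct) (auto simp: add zero)
qed

section \<open>Holomorphic functions with values in a Hilbert space\<close>

text \<open>Complex differentiability is written as a Frechet derivative of special form, so that
  all rules for \<open>has_derivative\<close> are available. Over the whole Hilbert space it is
  \<open>hol_on\<close>.\<close>

definition vhol :: "complex set \<Rightarrow> (complex \<Rightarrow> 'h::complex_hilbert) \<Rightarrow> bool"
  where "vhol V f \<longleftrightarrow> (\<forall>z\<in>V. \<exists>l. (f has_derivative (\<lambda>h. h *\<^sub>C l)) (at z))"

text \<open>The bridge to the difference quotients in \<open>hol_on\<close>: dividing the remainder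
  by \<open>norm (w - z)\<close> gives exactly the norm of the difference quotient minus
  \<open>l\<close>.\<close>

lemma has_derivative_scaleC_iff:
  fixes f :: "complex \<Rightarrow> 'h::complex_hilbert"
  shows "(f has_derivative (\<lambda>h. h *\<^sub>C l)) (at z) \<longleftrightarrow>
    ((\<lambda>w. norm (inverse (w - z) *\<^sub>C (f w - f z) - l)) \<longlongrightarrow> 0) (at z)"
proof -
  have "norm (f w - f z - (w - z) *\<^sub>C l) / norm (w - z) = norm (inverse (w - z) *\<^sub>C (f w - f z) - l)"
    if "w \<noteq> z" for w
  proof -
    have "inverse (w - z) *\<^sub>C (f w - f z) - l = inverse (w - z) *\<^sub>C (f w - f z - (w - z) *\<^sub>C l)"
      using that by (simp add: complex_vector.scale_right_diff_distrib scaleC_scaleC scaleC_one)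
    then show ?thesis by (simp add: norm_inverse divide_inverse_commute)
  qed
  then have "((\<lambda>w. norm (f w - f z - (w - z) *\<^sub>C l) / norm (w - z)) \<longlongrightarrow> 0) (at z) \<longleftrightarrow>
    ((\<lambda>w. norm (inverse (w - z) *\<^sub>C (f w - f z) - l)) \<longlongrightarrow> 0) (at z)"
    by (intro tendsto_cong) (auto simp: eventually_at_filter)
  then show ?thesis
    by (simp add: has_derivative_iff_norm bounded_linear_scaleC_left)
qed

section \<open>Closure properties of holomorphic functions\<close>

lemma vhol_subset: "vhol V f \<Longrightarrow> W \<subseteq> V \<Longrightarrow> vhol W f"
  by (auto simp: vhol_def)

lemma vhol_cong:
  assumes "open V" "\<And>z. z \<in> V \<Longrightarrow> f z = g z" "vhol V f" shows "vhol V g"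
  unfolding vhol_def
proof
  fix z assume z: "z \<in> V"
  then obtain l where "(f has_derivative (\<lambda>h. h *\<^sub>C l)) (at z)"
    using assms by (auto simp: vhol_def)
  then have "(g has_derivative (\<lambda>h. h *\<^sub>C l)) (at z)"
    using assms z by (intro has_derivative_transform_within_open[of f _ z UNIV V g]) auto
  then show "\<exists>l. (g has_derivative (\<lambda>h. h *\<^sub>C l)) (at z)" by blast
qed

lemma vhol_continuous_on: "vhol V f \<Longrightarrow> continuous_on V f"
  unfolding vhol_def
  by (intro continuous_at_imp_continuous_on) (auto intro: has_derivative_continuous)

lemma vhol_const [simp]: "vhol V (\<lambda>z. c)"
  unfolding vhol_def by (auto intro!: exI[of _ 0])

lemma vhol_add:
  assumes "vhol V f" "vhol V g" shows "vhol V (\<lambda>z. f z + g z)"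
  unfolding vhol_def
proof
  fix z assume "z \<in> V"
  then obtain l m where "(f has_derivative (\<lambda>h. h *\<^sub>C l)) (at z)" "(g has_derivative (\<lambda>h. h *\<^sub>C m)) (at z)"
    using assms unfolding vhol_def by meson
  from has_derivative_add[OF this]
  show "\<exists>l. ((\<lambda>z. f z + g z) has_derivative (\<lambda>h. h *\<^sub>C l)) (at z)"
    unfolding scaleC_add_right[symmetric] by blast
qed

lemma vhol_holomorphic:
  assumes "open V" shows "vhol V (f :: complex \<Rightarrow> complex) \<longleftrightarrow> f holomorphic_on V"
proof -
  have "(\<lambda>h. h *\<^sub>C l) = (*) l" for l :: complex
    by (auto simp: fun_eq_iff scaleC_complex_def)
  then show ?thesis
    using assms by (simp add: vhol_def holomorphic_on_open has_field_derivative_def)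
qed

lemma vhol_scaleC:
  assumes "open V" "g holomorphic_on V" "vhol V f" shows "vhol V (\<lambda>z. g z *\<^sub>C f z)"
  unfolding vhol_def
proof
  fix z assume z: "z \<in> V"
  obtain l where l: "(f has_derivative (\<lambda>h. h *\<^sub>C l)) (at z)" using assms z by (auto simp: vhol_def)
  obtain m where m: "(g has_derivative (\<lambda>h. h * m)) (at z)"
    using assms z vhol_holomorphic[of V g] by (auto simp: vhol_def scaleC_complex_def)
  have "((\<lambda>z. g z *\<^sub>C f z) has_derivative (\<lambda>h. g z *\<^sub>C h *\<^sub>C l + (h * m) *\<^sub>C f z)) (at z)"
    by (rule bounded_bilinear.FDERIV[OF bounded_bilinear_scaleC m l])
  moreover have "(\<lambda>h. g z *\<^sub>C h *\<^sub>C l + (h * m) *\<^sub>C f z) = (\<lambda>h. h *\<^sub>C (g z *\<^sub>C l + m *\<^sub>C f z))"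
    by (auto simp: scaleC_add_right mult.commute)
  ultimately show "\<exists>l. ((\<lambda>z. g z *\<^sub>C f z) has_derivative (\<lambda>h. h *\<^sub>C l)) (at z)" by auto
qed

lemma vhol_minus: "open V \<Longrightarrow> vhol V f \<Longrightarrow> vhol V (\<lambda>z. - f z)"
  using vhol_scaleC[of V "\<lambda>_. -1" f] by (simp add: scaleC_one)

lemma vhol_diff: "open V \<Longrightarrow> vhol V f \<Longrightarrow> vhol V g \<Longrightarrow> vhol V (\<lambda>z. f z - g z)"
  using vhol_add[of V f "\<lambda>z. - g z"] vhol_minus[of V g] by simp

lemma vhol_sum: "(\<And>i. i \<in> I \<Longrightarrow> vhol V (f i)) \<Longrightarrow> vhol V (\<lambda>z. \<Sum>i\<in>I. f i z)"
  by (induction I rule: infinite_finite_induct) (auto intro: vhol_add)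

lemma vhol_linear:
  assumes "bounded_linear T" "clinear_map T" "vhol V f" shows "vhol V (\<lambda>z. T (f z))"
  unfolding vhol_def
proof
  fix z assume "z \<in> V"
  then obtain l where "(f has_derivative (\<lambda>h. h *\<^sub>C l)) (at z)" using assms by (auto simp: vhol_def)
  from bounded_linear.has_derivative[OF assms(1) this]
  show "\<exists>l. ((\<lambda>z. T (f z)) has_derivative (\<lambda>h. h *\<^sub>C l)) (at z)"
    unfolding clinear_mapD(2)[OF assms(2)] by blast
qed

lemma vhol_cinner:
  assumes "vhol V f" "open V" shows "(\<lambda>z. cinner (f z) v) holomorphic_on V"
proof -
  have "clinear_map (\<lambda>x. cinner x v)"
    by (simp add: clinear_map_def cinner_add_left cinner_scaleC_left scaleC_complex_def)
  from vhol_linear[OF bounded_linear_cinner_left this assms(1)]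
  show ?thesis using vhol_holomorphic[OF assms(2)] by blast
qed

text \<open>The product rule for evaluation of an operator. The increment \<open>h\<close> comes out
  of the first term because \<open>T z\<close> is complex linear, and out of the second by the form
  of the derivative in \<open>op_holomorphic_on\<close>.\<close>

lemma vhol_op:
  assumes T: "op_holomorphic_on V T" and lin: "\<And>z. z \<in> V \<Longrightarrow> clinear_map (T z)"
    and f: "vhol V f" and V: "open V"
  shows "vhol V (\<lambda>z. T z (f z))"
  unfolding vhol_def
proof
  fix z assume z: "z \<in> V"
  obtain l where l: "(f has_derivative (\<lambda>h. h *\<^sub>C l)) (at z)" using f z by (auto simp: vhol_def)
  obtain T' where T': "bounded_linear T'" "\<And>c u. T' (c *\<^sub>C u) = c *\<^sub>C T' u"
     "((\<lambda>w. Blinfun (T w)) has_derivative (\<lambda>h. Blinfun (\<lambda>u. h *\<^sub>C T' u))) (at z)"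
    using T z by (auto simp: op_holomorphic_on_def)
  have T'h: "bounded_linear (\<lambda>u. h *\<^sub>C T' u)" for h
    using bounded_linear_compose[OF bounded_linear_scaleC_right T'(1)] .
  have Tb: "bounded_linear (T w)" if "w \<in> V" for w using T that by (auto simp: op_holomorphic_on_def)
  have "((\<lambda>w. blinfun_apply (Blinfun (T w)) (f w)) has_derivative
      (\<lambda>h. blinfun_apply (Blinfun (T z)) (h *\<^sub>C l) + blinfun_apply (Blinfun (\<lambda>u. h *\<^sub>C T' u)) (f z))) (at z)"
    by (rule bounded_bilinear.FDERIV[OF bounded_bilinear_blinfun_apply T'(3) l])
  moreover have "(\<lambda>h. blinfun_apply (Blinfun (T z)) (h *\<^sub>C l) + blinfun_apply (Blinfun (\<lambda>u. h *\<^sub>C T' u)) (f z))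
     = (\<lambda>h. h *\<^sub>C (T z l + T' (f z)))"
    using clinear_mapD(2)[OF lin[OF z]]
    by (simp add: bounded_linear_Blinfun_apply T'h Tb z scaleC_add_right)
  ultimately have "((\<lambda>w. blinfun_apply (Blinfun (T w)) (f w)) has_derivative (\<lambda>h. h *\<^sub>C (T z l + T' (f z)))) (at z)"
    by simp
  then have "((\<lambda>w. T w (f w)) has_derivative (\<lambda>h. h *\<^sub>C (T z l + T' (f z)))) (at z)"
    by (rule has_derivative_transform_within_open[OF _ V z])
      (simp add: bounded_linear_Blinfun_apply Tb)
  then show "\<exists>l. ((\<lambda>w. T w (f w)) has_derivative (\<lambda>h. h *\<^sub>C l)) (at z)" by blast
qed

definition vderiv :: "(complex \<Rightarrow> 'h::complex_hilbert) \<Rightarrow> complex \<Rightarrow> 'h"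
  where "vderiv f z = frechet_derivative f (at z) 1"

lemma vderivI: "(f has_derivative (\<lambda>h. h *\<^sub>C l)) (at z) \<Longrightarrow> vderiv f z = l"
  unfolding vderiv_def by (metis frechet_derivative_at scaleC_one)

lemma has_derivative_vderiv:
  "vhol V f \<Longrightarrow> z \<in> V \<Longrightarrow> (f has_derivative (\<lambda>h. h *\<^sub>C vderiv f z)) (at z)"
  unfolding vhol_def using vderivI by metis

subsection \<open>Circle integrals\<close>

text \<open>The contour integral over a circle for Hilbert space values, as an integral over the
  parameter interval. Pairing with a vector turns it into \<open>contour_integral\<close>.\<close>

definition circint :: "complex \<Rightarrow> real \<Rightarrow> (complex \<Rightarrow> 'h::complex_hilbert) \<Rightarrow> 'h"
  where "circint c r g = integral {0..1}
    (\<lambda>t. vector_derivative (circlepath c r) (at t) *\<^sub>C g (circlepath c r t))"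

lemma circlepath_in_sphere: "r \<ge> 0 \<Longrightarrow> t \<in> {0..1} \<Longrightarrow> circlepath c r t \<in> sphere c r"
  using path_image_circlepath_nonneg[of r c] unfolding path_image_def by blast

lemma continuous_on_circlepath: "continuous_on {0..1} (circlepath c r)"
  using valid_path_circlepath valid_path_imp_path unfolding path_def by blast

lemma circint_integrable:
  fixes g :: "complex \<Rightarrow> 'h::complex_hilbert"
  assumes "continuous_on (sphere c r) g" "r \<ge> 0"
  shows "continuous_on {0..1} (\<lambda>t. vector_derivative (circlepath c r) (at t) *\<^sub>C g (circlepath c r t))"
    "(\<lambda>t. vector_derivative (circlepath c r) (at t) *\<^sub>C g (circlepath c r t)) integrable_on {0..1}"
proof -
  have "continuous_on {0..1} (\<lambda>t. g (circlepath c r t))"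
    by (rule continuous_on_compose2[OF assms(1) continuous_on_circlepath])
      (use circlepath_in_sphere[OF assms(2)] in blast)
  note [continuous_intros] = this
  show "continuous_on {0..1} (\<lambda>t. vector_derivative (circlepath c r) (at t) *\<^sub>C g (circlepath c r t))"
    unfolding vector_derivative_circlepath by (intro continuous_intros)
  then show "(\<lambda>t. vector_derivative (circlepath c r) (at t) *\<^sub>C g (circlepath c r t)) integrable_on {0..1}"
    by (rule integrable_continuous_real)
qed

lemma cinner_circint:
  assumes "continuous_on (sphere c r) g" "r \<ge> 0"
  shows "cinner (circint c r g) v = contour_integral (circlepath c r) (\<lambda>z. cinner (g z) v)"
  using integral_linear[OF circint_integrable(2)[OF assms] bounded_linear_cinner_left[of v]]
  by (simp add: circint_def contour_integral_integral o_def cinner_scaleC_left mult.commute)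

text \<open>The way in which the scalar Cauchy theorems are lifted to Hilbert space values.\<close>

lemma circint_eqI:
  assumes "continuous_on (sphere c r) g" "r \<ge> 0"
    "\<And>v. ((\<lambda>z. cinner (g z) v) has_contour_integral cinner w v) (circlepath c r)"
  shows "circint c r g = w"
  by (rule cinner_eqI) (use assms in \<open>auto simp: cinner_circint dest: contour_integral_unique\<close>)

lemma circint_diff:
  assumes "continuous_on (sphere c r) f" "continuous_on (sphere c r) g" "r \<ge> 0"
  shows "circint c r (\<lambda>z. f z - g z) = circint c r f - circint c r g"
  using integral_diff[OF circint_integrable(2)[OF assms(1,3)] circint_integrable(2)[OF assms(2,3)]]
  by (simp add: circint_def complex_vector.scale_right_diff_distrib)

lemma circint_add:
  assumes "continuous_on (sphere c r) f" "continuous_on (sphere c r) g" "r \<ge> 0"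
  shows "circint c r (\<lambda>z. f z + g z) = circint c r f + circint c r g"
  using integral_add[OF circint_integrable(2)[OF assms(1,3)] circint_integrable(2)[OF assms(2,3)]]
  by (simp add: circint_def scaleC_add_right)

lemma circint_scaleC:
  assumes "continuous_on (sphere c r) f" "r \<ge> 0"
  shows "circint c r (\<lambda>z. a *\<^sub>C f z) = a *\<^sub>C circint c r f"
  using integral_linear[OF circint_integrable(2)[OF assms] bounded_linear_scaleC_right[of a]]
  by (simp add: circint_def o_def mult.commute[of a])

lemma circint_sum:
  assumes "finite I" "\<And>i. i \<in> I \<Longrightarrow> continuous_on (sphere c r) (f i)" "r \<ge> 0"
  shows "circint c r (\<lambda>z. \<Sum>i\<in>I. f i z) = (\<Sum>i\<in>I. circint c r (f i))"
  using assms(1,2)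
proof (induction I rule: finite_induct)
  case empty
  then show ?case by (simp add: circint_def)
next
  case (insert x F)
  then show ?case
    by (simp add: circint_add[OF _ continuous_on_sum assms(3)])
qed

lemma circint_cong:
  assumes "\<And>z. z \<in> sphere c r \<Longrightarrow> f z = g z" "r \<ge> 0"
  shows "circint c r f = circint c r g"
  unfolding circint_def
  by (rule integral_cong) (simp only: assms(1)[OF circlepath_in_sphere[OF assms(2)]])

lemma two_pi_i_cancel [simp]:
  "inverse (2 * complex_of_real pi * \<i>) *\<^sub>C (2 * complex_of_real pi * \<i>) *\<^sub>C x = (x :: 'a::complex_vector)"
proof -
  have "inverse (2 * complex_of_real pi * \<i>) * (2 * complex_of_real pi * \<i>) = 1"
    by (rule left_inverse) simp
  then show ?thesis by (simp only: scaleC_scaleC scaleC_one)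
qed

lemma inverse_power_derivative:
  assumes "(a :: complex) \<noteq> x"
  shows "((\<lambda>x. inverse ((a - x) ^ n)) has_field_derivative of_nat n * inverse ((a - x) ^ Suc n)) (at x)"
proof (cases n)
  case (Suc m)
  have eq: "- (inverse (b ^ n) * (of_nat n * (-1) * b ^ (n - Suc 0)) * inverse (b ^ n)) = of_nat n * inverse (b ^ Suc n)"
    if "b \<noteq> 0" for b :: complex
    using that Suc by (simp add: field_simps)
  have "((\<lambda>x. inverse ((a - x) ^ n)) has_field_derivative
     - (inverse ((a - x) ^ n) * (of_nat n * (-1) * (a - x) ^ (n - Suc 0)) * inverse ((a - x) ^ n))) (at x)"
    using assms by (auto intro!: derivative_eq_intros)
  then show ?thesis by (rule DERIV_cong) (use assms eq[of "a - x"] in simp)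
qed simp

lemma Cauchy_circint:
  assumes f: "vhol (ball c R) f" and r: "0 < r" "r < R" and w: "w \<in> ball c r"
  shows "circint c r (\<lambda>\<zeta>. inverse (\<zeta> - w) *\<^sub>C f \<zeta>) = (2 * of_real pi * \<i>) *\<^sub>C f w"
proof (rule circint_eqI)
  have sub: "cball c r \<subseteq> ball c R" using r by auto
  have fc: "continuous_on (sphere c r) f"
    using sub by (intro continuous_on_subset[OF vhol_continuous_on[OF f]]) auto
  have "\<zeta> - w \<noteq> 0" if "\<zeta> \<in> sphere c r" for \<zeta> using that w by auto
  then show "continuous_on (sphere c r) (\<lambda>\<zeta>. inverse (\<zeta> - w) *\<^sub>C f \<zeta>)"
    by (intro continuous_intros fc) auto
  fix v
  have h: "(\<lambda>z. cinner (f z) v) holomorphic_on ball c R" using vhol_cinner[OF f] by simp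
  have "((\<lambda>u. cinner (f u) v / (u - w)) has_contour_integral 2 * of_real pi * \<i> * cinner (f w) v) (circlepath c r)"
  proof (rule Cauchy_integral_circlepath)
    show "continuous_on (cball c r) (\<lambda>z. cinner (f z) v)"
      by (rule holomorphic_on_imp_continuous_on[OF holomorphic_on_subset[OF h sub]])
    show "(\<lambda>z. cinner (f z) v) holomorphic_on ball c r"
      using sub by (intro holomorphic_on_subset[OF h]) auto
    show "norm (w - c) < r" using w by (simp add: dist_norm norm_minus_commute)
  qed
  then show "((\<lambda>z. cinner (inverse (z - w) *\<^sub>C f z) v) has_contour_integral
      cinner ((2 * complex_of_real pi * \<i>) *\<^sub>C f w) v) (circlepath c r)"
    by (simp add: cinner_scaleC_left field_simps)
qed (use r in auto)

lemma Cauchy_circint_outside: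
  assumes f: "vhol (ball c R) f" and r: "0 < r" "r < R" and w: "r < dist c w"
  shows "circint c r (\<lambda>\<zeta>. inverse (\<zeta> - w) *\<^sub>C f \<zeta>) = 0"
proof (rule circint_eqI)
  have sub: "cball c r \<subseteq> ball c R" using r by auto
  have fc: "continuous_on (sphere c r) f"
    using sub by (intro continuous_on_subset[OF vhol_continuous_on[OF f]]) auto
  have "\<zeta> - w \<noteq> 0" if "\<zeta> \<in> sphere c r" for \<zeta> using that w by auto
  then show "continuous_on (sphere c r) (\<lambda>\<zeta>. inverse (\<zeta> - w) *\<^sub>C f \<zeta>)"
    by (intro continuous_intros fc) auto
  fix v
  \<comment> \<open>The disc of radius \<open>min R (dist c w)\<close> is convex, contains the
    circle and omits \<open>w\<close>, so the whole integrand is holomorphic on it.\<close>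
  have "(\<lambda>z. cinner (f z) v) holomorphic_on ball c (min R (dist c w))"
    using vhol_cinner[OF f] by (rule holomorphic_on_subset) auto
  then have "(\<lambda>z. cinner (inverse (z - w) *\<^sub>C f z) v) holomorphic_on ball c (min R (dist c w))"
    unfolding cinner_scaleC_left by (intro holomorphic_intros) auto
  moreover have "sphere c r \<subseteq> ball c (min R (dist c w))" using r w by auto
  ultimately show "((\<lambda>z. cinner (inverse (z - w) *\<^sub>C f z) v) has_contour_integral cinner 0 v) (circlepath c r)"
    using Cauchy_theorem_convex_simple[of _ "ball c (min R (dist c w))" "circlepath c r"] r
    by auto
qed (use r in auto)

lemma circint_kernel_derivative:
  fixes g :: "complex \<Rightarrow> 'h::complex_hilbert"
  assumes g: "continuous_on (sphere c r) g" and r: "0 < r" and w: "w \<in> ball c r"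
  shows "((\<lambda>w. circint c r (\<lambda>\<zeta>. inverse ((\<zeta> - w) ^ n) *\<^sub>C g \<zeta>)) has_derivative
    (\<lambda>h. h *\<^sub>C (of_nat n *\<^sub>C circint c r (\<lambda>\<zeta>. inverse ((\<zeta> - w) ^ Suc n) *\<^sub>C g \<zeta>)))) (at w)"
proof -
  define \<gamma> where "\<gamma> = circlepath c r"
  define k where "k t = vector_derivative \<gamma> (at t) *\<^sub>C g (\<gamma> t)" for t
  \<comment> \<open>Leibniz' rule wants the derivative as a \<open>blinfun\<close>. As
    \<open>L\<close> is linear and bounded in \<open>l\<close>, it can be pulled out of the integral
    afterwards.\<close>
  define L where "L = (\<lambda>l::'h. Blinfun (\<lambda>h::complex. h *\<^sub>C l))"
  have Lapp: "blinfun_apply (L l) = (\<lambda>h. h *\<^sub>C l)" for l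
    unfolding L_def by (rule bounded_linear_Blinfun_apply[OF bounded_linear_scaleC_left])
  have L: "bounded_linear L"
  proof (rule bounded_linear_intro[where K=1])
    show "norm (L x) \<le> norm x * 1" for x
      by (rule norm_blinfun_bound) (simp_all add: Lapp mult.commute)
  qed (auto intro!: blinfun_eqI simp: Lapp scaleC_add_right blinfun.add_left blinfun.scaleR_left
      scaleR_eq_scaleC complex_vector.scale_left_commute)
  have kc: "continuous_on {0..1} k"
    unfolding k_def \<gamma>_def using circint_integrable(1)[OF g] r by simp
  have \<gamma>c: "continuous_on {0..1} \<gamma>"
    unfolding \<gamma>_def by (rule continuous_on_circlepath)
  have im: "\<gamma> t \<in> sphere c r" if "t \<in> {0..1}" for t
    unfolding \<gamma>_def using circlepath_in_sphere that r by simp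
  have ne: "\<gamma> t - x \<noteq> 0" if "t \<in> {0..1}" "x \<in> ball c r" for t x
    using im[OF that(1)] that(2) by auto
  define K where "K x t = of_nat n *\<^sub>C (inverse ((\<gamma> t - x) ^ Suc n) *\<^sub>C k t)" for x t
  have Kc: "continuous_on (ball c r \<times> {0..1}) (\<lambda>(x, t). K x t)"
  proof -
    have "continuous_on (ball c r \<times> {0..1}) (\<lambda>p. \<gamma> (snd p))" "continuous_on (ball c r \<times> {0..1}) (\<lambda>p. k (snd p))"
      by (auto intro!: continuous_on_compose2[OF \<gamma>c] continuous_on_compose2[OF kc] continuous_intros)
    then show ?thesis unfolding K_def split_beta
      using ne by (intro continuous_intros) auto
  qed
  have int: "(\<lambda>t. inverse ((\<gamma> t - x) ^ m) *\<^sub>C k t) integrable_on {0..1}" if "x \<in> ball c r" for x m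
    using ne that by (intro integrable_continuous_real continuous_intros \<gamma>c kc) auto
  have "((\<lambda>x. integral (cbox 0 1) (\<lambda>t. inverse ((\<gamma> t - x) ^ n) *\<^sub>C k t)) has_derivative
      integral (cbox 0 1) (\<lambda>t. L (K w t))) (at w within ball c r)"
  proof (rule leibniz_rule)
    fix x t assume x: "x \<in> ball c r" and t: "t \<in> cbox (0::real) 1"
    have "((\<lambda>x. inverse ((\<gamma> t - x) ^ n)) has_field_derivative of_nat n * inverse ((\<gamma> t - x) ^ Suc n)) (at x)"
      using ne[of t x] x t by (intro inverse_power_derivative) auto
    then have "((\<lambda>x. inverse ((\<gamma> t - x) ^ n)) has_derivative (\<lambda>h. h * (of_nat n * inverse ((\<gamma> t - x) ^ Suc n)))) (at x)"
      unfolding has_field_derivative_def by (rule has_derivative_eq_rhs) (auto simp: fun_eq_iff)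
    from bounded_linear.has_derivative[OF bounded_linear_scaleC_left this, of "k t"]
    show "((\<lambda>x. inverse ((\<gamma> t - x) ^ n) *\<^sub>C k t) has_derivative blinfun_apply (L (K x t))) (at x within ball c r)"
      unfolding Lapp K_def scaleC_scaleC by (rule has_derivative_at_withinI)
  next
    show "continuous_on (ball c r \<times> cbox 0 1) (\<lambda>(x, t). L (K x t))"
      using bounded_linear.continuous_on[OF L Kc] by (simp add: split_beta)
  qed (use int w in auto)
  moreover have "integral {0..1} (\<lambda>t. L (K w t)) = L (integral {0..1} (K w))"
    using integral_linear[OF integrable_linear[OF int[OF w, of "Suc n"] bounded_linear_scaleC_right[of "of_nat n"]] L]
    by (simp only: o_def K_def[abs_def])
  moreover have "integral {0..1} (K w) = of_nat n *\<^sub>C circint c r (\<lambda>\<zeta>. inverse ((\<zeta> - w) ^ Suc n) *\<^sub>C g \<zeta>)"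
    using integral_linear[OF int[OF w, of "Suc n"] bounded_linear_scaleC_right[of "of_nat n"]]
    by (simp add: o_def K_def[abs_def] circint_def k_def \<gamma>_def mult_ac)
  moreover have "circint c r (\<lambda>\<zeta>. inverse ((\<zeta> - x) ^ n) *\<^sub>C g \<zeta>) = integral (cbox 0 1) (\<lambda>t. inverse ((\<gamma> t - x) ^ n) *\<^sub>C k t)" for x
    by (simp add: circint_def k_def \<gamma>_def mult_ac)
  ultimately show ?thesis
    using w by (simp add: Lapp at_within_open[OF w])
qed

lemma vhol_circint_kernel:
  assumes "continuous_on (sphere c r) g" "0 < r"
  shows "vhol (ball c r) (\<lambda>w. circint c r (\<lambda>\<zeta>. inverse ((\<zeta> - w) ^ n) *\<^sub>C g \<zeta>))"
  unfolding vhol_def using circint_kernel_derivative[OF assms] by blast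

text \<open>Near each point Cauchy's formula writes \<open>f\<close> as the kernel integral
  \<open>I 1\<close>. Its derivative is \<open>I 2\<close>, which is again holomorphic.\<close>

lemma vhol_vderiv:
  assumes f: "vhol V f" and V: "open V" shows "vhol V (vderiv f)"
  unfolding vhol_def
proof
  fix z assume z: "z \<in> V"
  obtain R where R: "R > 0" "ball z R \<subseteq> V" using V z openE by blast
  define r where "r = R / 2"
  have r: "0 < r" "r < R" using R by (auto simp: r_def)
  have fc: "continuous_on (sphere z r) f"
    using r by (intro continuous_on_subset[OF vhol_continuous_on[OF f]] order_trans[OF _ R(2)]) auto
  have fR: "vhol (ball z R) f" using f R vhol_subset by blast
  define k where "k = inverse (2 * complex_of_real pi * \<i>)"
  define I where "I n w = k *\<^sub>C circint z r (\<lambda>\<zeta>. inverse ((\<zeta> - w) ^ n) *\<^sub>C f \<zeta>)" for n w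
  have I1: "f w = I 1 w" if "w \<in> ball z r" for w
    using Cauchy_circint[OF fR r that] by (simp only: I_def k_def two_pi_i_cancel power_one_right)
  have "(I 1 has_derivative (\<lambda>h. h *\<^sub>C I 2 w)) (at w)" if w: "w \<in> ball z r" for w
    using bounded_linear.has_derivative[OF bounded_linear_scaleC_right circint_kernel_derivative[OF fc r(1) w, of 1],
      of k]
    by (simp add: I_def[abs_def] scaleC_one mult.commute[of k] numeral_2_eq_2)
  then have "(f has_derivative (\<lambda>h. h *\<^sub>C I 2 w)) (at w)" if w: "w \<in> ball z r" for w
    by (rule has_derivative_transform_within_open[OF _ open_ball w]) (use w I1 in auto)
  then have eq: "vderiv f w = I 2 w" if "w \<in> ball z r" for w
    using vderivI that by blast
  have "vhol (ball z r) (I 2)"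
    unfolding I_def[abs_def] by (intro vhol_scaleC vhol_circint_kernel fc r) auto
  then have "vhol (ball z r) (vderiv f)"
    by (rule vhol_cong[rotated 2]) (simp_all add: eq)
  then show "\<exists>l. (vderiv f has_derivative (\<lambda>h. h *\<^sub>C l)) (at z)"
    using r by (auto simp: vhol_def)
qed

text \<open>The singularity of the difference quotient \<open>h\<close> is removable: off
  \<open>p\<close> it equals the Cauchy-type integral \<open>I\<close> of
  \<open>f \<zeta> / (\<zeta> - p)\<close>, which is holomorphic across \<open>p\<close>.\<close>

lemma vhol_factor:
  assumes f: "vhol (ball p R) f"
  obtains h where "vhol (ball p R) h" "\<And>z. z \<in> ball p R \<Longrightarrow> f z = f p + (z - p) *\<^sub>C h z"
proof (cases "R > 0")
  case R: True
  define h where "h z = (if z = p then vderiv f p else inverse (z - p) *\<^sub>C (f z - f p))" for z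
  have eq: "f z = f p + (z - p) *\<^sub>C h z" for z
    by (simp add: h_def scaleC_scaleC scaleC_one)
  have "vhol (ball p R) h"
  proof -
    have V: "open (ball p R - {p})" by auto
    have "vhol (ball p R - {p}) (\<lambda>z. inverse (z - p) *\<^sub>C (f z - f p))"
      using V by (intro vhol_scaleC vhol_diff vhol_subset[OF f] holomorphic_intros) auto
    then have 1: "vhol (ball p R - {p}) h"
      by (rule vhol_cong[OF V, rotated]) (auto simp: h_def)
    define r where "r = R / 2"
    have r: "0 < r" "r < R" using R by (auto simp: r_def)
    define I where "I w = inverse (2 * of_real pi * \<i>) *\<^sub>C
      circint p r (\<lambda>\<zeta>. inverse ((\<zeta> - w) ^ 1) *\<^sub>C (inverse (\<zeta> - p) *\<^sub>C f \<zeta>))" for w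
    have fc: "continuous_on (sphere p r) f"
      using r by (intro continuous_on_subset[OF vhol_continuous_on[OF f]]) auto
    have nz: "\<zeta> - w \<noteq> 0" if "\<zeta> \<in> sphere p r" "w \<in> ball p r" for \<zeta> w using that by auto
    have gc: "continuous_on (sphere p r) (\<lambda>\<zeta>. inverse (\<zeta> - p) *\<^sub>C f \<zeta>)"
      using nz[of _ p] r by (intro continuous_intros fc) auto
    have I: "vhol (ball p r) I"
      unfolding I_def[abs_def] by (intro vhol_scaleC vhol_circint_kernel gc r) auto
    have hI: "h w = I w" if w: "w \<in> ball p r" "w \<noteq> p" for w
    proof -
      have "circint p r (\<lambda>\<zeta>. inverse ((\<zeta> - w) ^ 1) *\<^sub>C (inverse (\<zeta> - p) *\<^sub>C f \<zeta>)) =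
        circint p r (\<lambda>\<zeta>. inverse (w - p) *\<^sub>C (inverse (\<zeta> - w) *\<^sub>C f \<zeta> - inverse (\<zeta> - p) *\<^sub>C f \<zeta>))"
      proof (rule circint_cong)
        fix z assume z: "z \<in> sphere p r"
        \<comment> \<open>Partial fractions reduce the integral to the difference of the Cauchy
          integrals at \<open>w\<close> and at \<open>p\<close>.\<close>
        have "inverse ((z - w) ^ 1) * inverse (z - p) = inverse (w - p) * (inverse (z - w) - inverse (z - p))"
          using nz[OF z w(1)] nz[OF z, of p] r w by (simp add: field_simps)
        then show "inverse ((z - w) ^ 1) *\<^sub>C (inverse (z - p) *\<^sub>C f z) =
          inverse (w - p) *\<^sub>C (inverse (z - w) *\<^sub>C f z - inverse (z - p) *\<^sub>C f z)"
          by (simp only: scaleC_scaleC flip: complex_vector.scale_left_diff_distrib)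
      qed (use r in auto)
      also have "\<dots> = inverse (w - p) *\<^sub>C (circint p r (\<lambda>\<zeta>. inverse (\<zeta> - w) *\<^sub>C f \<zeta>)
          - circint p r (\<lambda>\<zeta>. inverse (\<zeta> - p) *\<^sub>C f \<zeta>))"
      proof -
        have c: "continuous_on (sphere p r) (\<lambda>\<zeta>. inverse (\<zeta> - u) *\<^sub>C f \<zeta>)" if "u \<in> ball p r" for u
          using nz that by (intro continuous_intros fc) auto
        show ?thesis using c[OF w(1)] c[of p] r
          by (subst circint_scaleC) (auto intro!: continuous_intros simp: circint_diff)
      qed
      also have "\<dots> = (2 * of_real pi * \<i>) *\<^sub>C (inverse (w - p) *\<^sub>C (f w - f p))"
        using Cauchy_circint[OF f r w(1)] Cauchy_circint[OF f r, of p] r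
        by (simp add: complex_vector.scale_right_diff_distrib mult.commute)
      finally show ?thesis using w by (simp only: I_def h_def two_pi_i_cancel if_False)
    qed
    \<comment> \<open>\<open>h\<close> and \<open>I\<close> have been compared only off
      \<open>p\<close>. Both are continuous there, so equality at \<open>p\<close> follows from
      uniqueness of limits.\<close>
    have "(h \<longlongrightarrow> vderiv f p) (at p)"
    proof -
      have "(f has_derivative (\<lambda>h. h *\<^sub>C vderiv f p)) (at p)"
        using has_derivative_vderiv[OF f] R by simp
      then have "((\<lambda>w. norm (inverse (w - p) *\<^sub>C (f w - f p) - vderiv f p)) \<longlongrightarrow> 0) (at p)"
        by (simp add: has_derivative_scaleC_iff)
      then have "((\<lambda>w. inverse (w - p) *\<^sub>C (f w - f p)) \<longlongrightarrow> vderiv f p) (at p)"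
        by (rule LIM_zero_cancel[OF tendsto_norm_zero_cancel])
      then show ?thesis
        by (rule Lim_transform_eventually) (auto simp: h_def eventually_at_filter)
    qed
    moreover have "(h \<longlongrightarrow> I p) (at p)"
    proof -
      have "(I \<longlongrightarrow> I p) (at p)"
        using vhol_continuous_on[OF I] r by (simp add: continuous_on_eq_continuous_at isCont_def)
      moreover have "\<forall>\<^sub>F w in at p. I w = h w"
        using hI r unfolding eventually_at by (intro exI[of _ r]) (auto simp: dist_commute)
      ultimately show ?thesis by (rule Lim_transform_eventually)
    qed
    ultimately have "h p = I p" using tendsto_unique[OF trivial_limit_at] by (metis h_def)
    then have "I z = h z" if "z \<in> ball p r" for z
      using hI[OF that] by (cases "z = p") simp_all
    then have "vhol (ball p r) h"
      by (rule vhol_cong[OF open_ball _ I])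
    show ?thesis
      unfolding vhol_def
    proof
      fix z assume z: "z \<in> ball p R"
      show "\<exists>l. (h has_derivative (\<lambda>h. h *\<^sub>C l)) (at z)"
      proof (cases "z = p")
        case True
        then show ?thesis using \<open>vhol (ball p r) h\<close> r by (simp add: vhol_def)
      next
        case False
        then show ?thesis using 1 z by (simp add: vhol_def)
      qed
    qed
  qed
  then show thesis using that eq by blast
qed (use that in \<open>auto simp: vhol_def ball_empty\<close>)

text \<open>Iterates \<open>vhol_factor\<close>. A finite expansion with holomorphic remainder is
  all that a pole of finite order calls for.\<close>

lemma vhol_Taylor:
  assumes f: "vhol (ball p R) f"
  shows "\<exists>a h. vhol (ball p R) h \<and>
    (\<forall>z\<in>ball p R. f z = (\<Sum>k<n. (z - p) ^ k *\<^sub>C a k) + (z - p) ^ n *\<^sub>C h z)"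
proof (induction n)
  case 0
  then show ?case using f by (auto simp: scaleC_one)
next
  case (Suc n)
  then obtain a h where h: "vhol (ball p R) h"
    "\<forall>z\<in>ball p R. f z = (\<Sum>k<n. (z - p) ^ k *\<^sub>C a k) + (z - p) ^ n *\<^sub>C h z" by blast
  obtain h' where h': "vhol (ball p R) h'" "\<And>z. z \<in> ball p R \<Longrightarrow> h z = h p + (z - p) *\<^sub>C h' z"
    using vhol_factor[OF h(1)] by blast
  define a' where "a' = a(n := h p)"
  have "f z = (\<Sum>k<Suc n. (z - p) ^ k *\<^sub>C a' k) + (z - p) ^ Suc n *\<^sub>C h' z" if z: "z \<in> ball p R" for z
  proof -
    have "(\<Sum>k<n. (z - p) ^ k *\<^sub>C a' k) = (\<Sum>k<n. (z - p) ^ k *\<^sub>C a k)"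
      by (intro sum.cong) (auto simp: a'_def)
    then show ?thesis using h(2) h'(2)[OF z] z
      by (simp add: a'_def scaleC_add_right scaleC_scaleC mult.commute add.assoc)
  qed
  then show ?case using h'(1) by blast
qed

section \<open>Regular and meromorphic functions, singular parts\<close>

lemma car_sub_hilb [simp]: "car (sub_hilb X) = X"
  and hnorm_sub_hilb [simp]: "hnorm (sub_hilb X) u = norm u"
  by (simp_all add: sub_hilb_def hnorm_def Re_cinner_self)

abbreviation full :: "'h::complex_hilbert hilb"
  where "full \<equiv> sub_hilb UNIV"

lemma hol_on_full: "hol_on full V f \<longleftrightarrow> vhol V f"
  by (simp add: hol_on_def vhol_def has_derivative_scaleC_iff)

text \<open>The derivative is a limit of difference quotients, which lie in the closed subspace
  \<open>X\<close>; hence it lies there too.\<close>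

lemma hol_on_sub_hilb:
  assumes "csubspace X" "closed X" "open V"
  shows "hol_on (sub_hilb X) V f \<longleftrightarrow> vhol V f \<and> (\<forall>z\<in>V. f z \<in> X)"
proof -
  have "l \<in> X" if z: "z \<in> V" and fX: "\<forall>z\<in>V. f z \<in> X" and
    l: "((\<lambda>w. norm (inverse (w - z) *\<^sub>C (f w - f z) - l)) \<longlongrightarrow> 0) (at z)" for z l
  proof (rule Lim_in_closed_set[OF assms(2)])
    show "((\<lambda>w. inverse (w - z) *\<^sub>C (f w - f z)) \<longlongrightarrow> l) (at z)"
      by (rule LIM_zero_cancel[OF tendsto_norm_zero_cancel[OF l]])
    show "\<forall>\<^sub>F w in at z. inverse (w - z) *\<^sub>C (f w - f z) \<in> X"
      using eventually_at_in_open[OF assms(3) z]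
    proof eventually_elim
      case (elim w)
      then show ?case
        using fX z assms(1) by (intro complex_vector.subspace_scale complex_vector.subspace_diff) auto
    qed
  qed auto
  then show ?thesis
    unfolding hol_on_def vhol_def has_derivative_scaleC_iff car_sub_hilb hnorm_sub_hilb
    by blast
qed

lemma hol_on_subset: "hol_on F V f \<Longrightarrow> W \<subseteq> V \<Longrightarrow> hol_on F W f"
  by (auto simp: hol_on_def)

section \<open>Regularity at a point, a property of the germ on a punctured disc\<close>

lemma reg_at_cong:
  assumes "\<forall>\<^sub>F z in at p. f z = g z" "reg_at F p f" shows "reg_at F p g"
proof -
  obtain r h where r: "r > 0" "hol_on F (ball p r) h" "\<forall>z\<in>ball p r - {p}. f z = h z"
    using assms(2) by (auto simp: reg_at_def)
  obtain d where d: "d > 0" "\<And>z. z \<noteq> p \<Longrightarrow> dist z p < d \<Longrightarrow> f z = g z"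
    using assms(1) by (auto simp: eventually_at)
  show ?thesis
    unfolding reg_at_def
    by (rule exI[of _ "min r d"], intro conjI exI[of _ h] hol_on_subset[OF r(2)])
      (use r d(1) in \<open>auto simp: d(2)[symmetric] dist_commute[of _ p]\<close>)
qed

lemma reg_at_full_iff:
  "reg_at full p f \<longleftrightarrow> (\<exists>g r. r > 0 \<and> vhol (ball p r) g \<and> (\<forall>\<^sub>F z in at p. f z = g z))"
proof
  assume "reg_at full p f"
  then obtain r g where "r > 0" "vhol (ball p r) g" "\<forall>z\<in>ball p r - {p}. f z = g z"
    by (auto simp: reg_at_def hol_on_full)
  then show "\<exists>g r. r > 0 \<and> vhol (ball p r) g \<and> (\<forall>\<^sub>F z in at p. f z = g z)"
    by (intro exI[of _ g] exI[of _ r]) (auto simp: eventually_at dist_commute)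
next
  assume "\<exists>g r. r > 0 \<and> vhol (ball p r) g \<and> (\<forall>\<^sub>F z in at p. f z = g z)"
  then obtain g r where gr: "r > 0" "vhol (ball p r) g" "\<forall>\<^sub>F z in at p. f z = g z" by blast
  have "reg_at full p g"
    unfolding reg_at_def hol_on_full using gr by blast
  moreover have "\<forall>\<^sub>F z in at p. g z = f z"
    using gr(3) by eventually_elim simp
  ultimately show "reg_at full p f" using reg_at_cong by blast
qed

lemma reg_at_vhol:
  assumes "vhol V f" "open V" "p \<in> V" shows "reg_at full p f"
proof -
  obtain r where "r > 0" "ball p r \<subseteq> V" using openE[OF assms(2,3)] by blast
  then show ?thesis
    unfolding reg_at_def hol_on_full using vhol_subset[OF assms(1)] by blast
qed

lemma reg_at_const [simp]: "reg_at full p (\<lambda>z. c)"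
  by (rule reg_at_vhol[of UNIV]) auto

lemma reg_at_comp2:
  assumes f: "reg_at full p f" and g: "reg_at full p g"
    and H: "\<And>r F G. r > 0 \<Longrightarrow> vhol (ball p r) F \<Longrightarrow> vhol (ball p r) G \<Longrightarrow> vhol (ball p r) (\<lambda>z. H (F z) (G z))"
  shows "reg_at full p (\<lambda>z. H (f z) (g z))"
proof -
  obtain F r where F: "r > 0" "vhol (ball p r) F" "\<forall>\<^sub>F z in at p. f z = F z"
    using f by (auto simp: reg_at_full_iff)
  obtain G s where G: "s > 0" "vhol (ball p s) G" "\<forall>\<^sub>F z in at p. g z = G z"
    using g by (auto simp: reg_at_full_iff)
  have "vhol (ball p (min r s)) (\<lambda>z. H (F z) (G z))"
    using F G by (intro H vhol_subset[OF F(2)] vhol_subset[OF G(2)]) auto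
  moreover have "\<forall>\<^sub>F z in at p. H (f z) (g z) = H (F z) (G z)"
    using F(3) G(3) by eventually_elim simp
  moreover have "min r s > 0" using F G by simp
  ultimately show ?thesis unfolding reg_at_full_iff by blast
qed

lemma reg_at_add: "reg_at full p f \<Longrightarrow> reg_at full p g \<Longrightarrow> reg_at full p (\<lambda>z. f z + g z)"
  by (rule reg_at_comp2) (auto intro: vhol_add)

lemma reg_at_diff: "reg_at full p f \<Longrightarrow> reg_at full p g \<Longrightarrow> reg_at full p (\<lambda>z. f z - g z)"
  by (rule reg_at_comp2) (auto intro: vhol_diff)

lemma reg_at_sum: "(\<And>i. i \<in> I \<Longrightarrow> reg_at full p (f i)) \<Longrightarrow> reg_at full p (\<lambda>z. \<Sum>i\<in>I. f i z)"
  by (induction I rule: infinite_finite_induct) (auto intro: reg_at_add)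

lemma reg_at_comp1:
  assumes f: "reg_at full p f" and V: "open V" "p \<in> V"
    and H: "\<And>W F. open W \<Longrightarrow> W \<subseteq> V \<Longrightarrow> vhol W F \<Longrightarrow> vhol W (\<lambda>z. H z (F z))"
  shows "reg_at full p (\<lambda>z. H z (f z))"
proof -
  obtain F r where F: "r > 0" "vhol (ball p r) F" "\<forall>\<^sub>F z in at p. f z = F z"
    using f by (auto simp: reg_at_full_iff)
  have "vhol (ball p r \<inter> V) (\<lambda>z. H z (F z))"
    using V by (intro H vhol_subset[OF F(2)]) auto
  then have "reg_at full p (\<lambda>z. H z (F z))"
    using V F(1) by (intro reg_at_vhol[of "ball p r \<inter> V"]) auto
  moreover have "\<forall>\<^sub>F z in at p. H z (F z) = H z (f z)"
    using F(3) by eventually_elim simp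
  ultimately show ?thesis by (rule reg_at_cong[rotated])
qed

lemma op_holomorphic_on_subset: "op_holomorphic_on V T \<Longrightarrow> W \<subseteq> V \<Longrightarrow> op_holomorphic_on W T"
  by (auto simp: op_holomorphic_on_def)

lemma reg_at_op:
  fixes T :: "complex \<Rightarrow> 'd::complex_hilbert \<Rightarrow> 'h::complex_hilbert"
  assumes "op_holomorphic_on V T" "\<And>z. z \<in> V \<Longrightarrow> clinear_map (T z)" "open V" "p \<in> V" "reg_at full p f"
  shows "reg_at full p (\<lambda>z. T z (f z))"
proof (rule reg_at_comp1[OF assms(5,3,4)])
  fix W and F :: "complex \<Rightarrow> 'd" assume W: "open W" "W \<subseteq> V" and F: "vhol W F"
  show "vhol W (\<lambda>z. T z (F z))"
    by (rule vhol_op[OF op_holomorphic_on_subset[OF assms(1) W(2)] _ F W(1)]) (use assms(2) W in auto)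
qed

lemma reg_at_linear:
  assumes "bounded_linear T" "clinear_map T" "reg_at full p f" shows "reg_at full p (\<lambda>z. T (f z))"
  by (rule reg_at_comp1[OF assms(3) open_UNIV]) (simp_all add: vhol_linear[OF assms(1,2)])

lemma reg_at_tendsto:
  assumes "reg_at full p f" shows "\<exists>l. (f \<longlongrightarrow> l) (at p)"
proof -
  obtain F r where F: "r > 0" "vhol (ball p r) F" "\<forall>\<^sub>F z in at p. f z = F z"
    using assms by (auto simp: reg_at_full_iff)
  have "(F \<longlongrightarrow> F p) (at p)"
    using vhol_continuous_on[OF F(2)] F(1) by (simp add: continuous_on_eq_continuous_at isCont_def)
  moreover have "\<forall>\<^sub>F z in at p. F z = f z" using F(3) by eventually_elim simp
  ultimately show ?thesis using Lim_transform_eventually by blast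
qed

lemma vhol_tendsto: "vhol V f \<Longrightarrow> z \<in> V \<Longrightarrow> (f \<longlongrightarrow> f z) (at z)"
  using has_derivative_vderiv[THEN has_derivative_continuous] by (simp add: isCont_def)

subsection \<open>Uniqueness of principal parts\<close>

text \<open>Multiplication by the highest power of \<open>z - p\<close> makes the sum tend to its
  top coefficient, whereas regularity makes the same product tend to zero. Then the order drops by
  one.\<close>

lemma principal_part_coeff_zero:
  fixes a :: "nat \<Rightarrow> 'h::complex_hilbert"
  assumes "reg_at full p (\<lambda>z. \<Sum>k=1..n. inverse ((z - p) ^ k) *\<^sub>C a k)"
  shows "\<forall>k\<in>{1..n}. a k = 0"
  using assms
proof (induction n)
  case (Suc n)
  have lim: "((\<lambda>z. (z - p) ^ Suc n *\<^sub>C (\<Sum>k=1..Suc n. inverse ((z - p) ^ k) *\<^sub>C a k)) \<longlongrightarrow> 0) (at p)"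
  proof -
    obtain l where l: "((\<lambda>z. \<Sum>k=1..Suc n. inverse ((z - p) ^ k) *\<^sub>C a k) \<longlongrightarrow> l) (at p)"
      using reg_at_tendsto[OF Suc.prems] by blast
    have "((\<lambda>z. (z - p) ^ Suc n) \<longlongrightarrow> (p - p) ^ Suc n) (at p)"
      by (intro tendsto_intros)
    from tendsto_scaleC[OF this l] show ?thesis by simp
  qed
  have "((\<lambda>z. \<Sum>k=1..Suc n. (z - p) ^ (Suc n - k) *\<^sub>C a k) \<longlongrightarrow> (\<Sum>k=1..Suc n. (p - p) ^ (Suc n - k) *\<^sub>C a k)) (at p)"
    by (intro tendsto_intros)
  \<comment> \<open>Since \<open>0 ^ 0 = 1\<close>, exactly the term with \<open>k = Suc n\<close>
    survives at \<open>z = p\<close>.\<close>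
  moreover have "(\<Sum>k=1..Suc n. (p - p) ^ (Suc n - k) *\<^sub>C a k) = a (Suc n)"
    by (simp add: scaleC_one power_0_left if_distrib[of "\<lambda>c. c *\<^sub>C _"] cong: if_cong)
  ultimately have "((\<lambda>z. \<Sum>k=1..Suc n. (z - p) ^ (Suc n - k) *\<^sub>C a k) \<longlongrightarrow> a (Suc n)) (at p)" by simp
  moreover have "\<forall>\<^sub>F z in at p. (\<Sum>k=1..Suc n. (z - p) ^ (Suc n - k) *\<^sub>C a k) =
      (z - p) ^ Suc n *\<^sub>C (\<Sum>k=1..Suc n. inverse ((z - p) ^ k) *\<^sub>C a k)"
  proof -
    have "(z - p) ^ (Suc n - k) = (z - p) ^ Suc n * inverse ((z - p) ^ k)"
      if "z \<noteq> p" "k \<in> {1..Suc n}" for z k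
      using that by (simp only: power_diff divide_inverse right_minus_eq not_False_eq_True atLeastAtMost_iff)
    then show ?thesis
      unfolding complex_vector.scale_sum_right scaleC_scaleC eventually_at_filter
      by (intro always_eventually allI impI sum.cong) auto
  qed
  ultimately have "((\<lambda>z. (z - p) ^ Suc n *\<^sub>C (\<Sum>k=1..Suc n. inverse ((z - p) ^ k) *\<^sub>C a k)) \<longlongrightarrow> a (Suc n)) (at p)"
    by (rule Lim_transform_eventually)
  then have 0: "a (Suc n) = 0"
    using tendsto_unique[OF trivial_limit_at lim] by simp
  then have "reg_at full p (\<lambda>z. \<Sum>k=1..n. inverse ((z - p) ^ k) *\<^sub>C a k)"
    using Suc.prems by simp
  then show ?case using Suc.IH 0 by (auto simp: le_Suc_eq)
qed auto

section \<open>Finite sums of principal parts\<close>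

definition pform :: "nat \<Rightarrow> complex set \<Rightarrow> (complex \<Rightarrow> nat \<Rightarrow> 'h::complex_vector) \<Rightarrow> complex \<Rightarrow> 'h"
  where "pform n A a = (\<lambda>z. \<Sum>p\<in>A. \<Sum>k=1..n. inverse ((z - p) ^ k) *\<^sub>C a p k)"

definition pforms :: "complex set \<Rightarrow> (complex \<Rightarrow> 'h::complex_vector) set"
  where "pforms V = {pform n A a | n A a. finite A \<and> A \<subseteq> V}"

lemma pforms_single:
  assumes "p \<in> V" shows "(\<lambda>z. \<Sum>k=1..n. inverse ((z - p) ^ k) *\<^sub>C c k) \<in> pforms V"
proof -
  have "(\<lambda>z. \<Sum>k=1..n. inverse ((z - p) ^ k) *\<^sub>C c k) = pform n {p} (\<lambda>_. c)" by (simp add: pform_def)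
  then show ?thesis using assms unfolding pforms_def by blast
qed

text \<open>Padding with zero coefficients brings two sums of principal parts to a common order and
  a common pole set, after which they are added coefficientwise.\<close>

lemma pform_extend:
  assumes "n \<le> m" "finite B" "A \<subseteq> B"
  shows "pform n A a = pform m B (\<lambda>p k. if p \<in> A \<and> k \<le> n then a p k else 0)"
proof
  fix z
  have "(\<Sum>k=1..n. inverse ((z - p) ^ k) *\<^sub>C a p k) =
     (\<Sum>k=1..m. inverse ((z - p) ^ k) *\<^sub>C (if p \<in> A \<and> k \<le> n then a p k else 0))" if "p \<in> A" for p
    using assms that by (intro sum.mono_neutral_cong_left) auto
  then show "pform n A a z = pform m B (\<lambda>p k. if p \<in> A \<and> k \<le> n then a p k else 0) z"
    unfolding pform_def using assms by (intro sum.mono_neutral_cong_left) auto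
qed

lemma pform_add: "pform n A a z + pform n A b z = pform n A (\<lambda>p k. a p k + b p k) z"
  by (simp add: pform_def scaleC_add_right sum.distrib)

lemma pform_linear:
  assumes "clinear_map T" shows "T (pform n A a z) = pform n A (\<lambda>p k. T (a p k)) z"
  by (simp add: pform_def clinear_mapD[OF assms])

lemma pforms_add:
  assumes "s \<in> pforms V" "t \<in> pforms V" shows "(\<lambda>z. s z + t z) \<in> pforms V"
proof -
  obtain n A a where s: "s = pform n A a" "finite A" "A \<subseteq> V" using assms(1) by (auto simp: pforms_def)
  obtain m B b where t: "t = pform m B b" "finite B" "B \<subseteq> V" using assms(2) by (auto simp: pforms_def)
  have "\<exists>c. s = pform (max n m) (A \<union> B) c" "\<exists>c. t = pform (max n m) (A \<union> B) c"
    using s t pform_extend[of n "max n m" "A \<union> B" A a] pform_extend[of m "max n m" "A \<union> B" B b] by auto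
  then obtain c d where "s = pform (max n m) (A \<union> B) c" "t = pform (max n m) (A \<union> B) d" by blast
  then have "(\<lambda>z. s z + t z) = pform (max n m) (A \<union> B) (\<lambda>p k. c p k + d p k)"
    by (simp add: pform_add)
  then show ?thesis unfolding pforms_def using s t by blast
qed

lemma pforms_linear:
  assumes "clinear_map T" "s \<in> pforms V" shows "(\<lambda>z. T (s z)) \<in> pforms V"
proof -
  obtain n A a where s: "s = pform n A a" "finite A" "A \<subseteq> V" using assms(2) by (auto simp: pforms_def)
  then have "(\<lambda>z. T (s z)) = pform n A (\<lambda>p k. T (a p k))"
    by (simp add: pform_linear[OF assms(1)])
  then show ?thesis unfolding pforms_def using s by blast
qed

lemma clinear_map_scaleC: "clinear_map (scaleC c :: 'a \<Rightarrow> 'a::complex_vector)"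
  by (auto simp: clinear_map_def scaleC_add_right mult.commute)

lemma pforms_scaleC: "s \<in> pforms V \<Longrightarrow> (\<lambda>z. c *\<^sub>C s z) \<in> pforms V"
  by (rule pforms_linear[OF clinear_map_scaleC])

lemma pforms_diff: "s \<in> pforms V \<Longrightarrow> t \<in> pforms V \<Longrightarrow> (\<lambda>z. s z - t z) \<in> pforms V"
  using pforms_add[of s V "\<lambda>z. (-1) *\<^sub>C t z"] pforms_scaleC[of t V "-1"] by (simp add: scaleC_one)

lemma pforms_zero: "(\<lambda>z. 0) \<in> pforms V"
  unfolding pforms_def by (auto intro!: exI[of _ "{}"] simp: pform_def)

lemma pforms_sum: "(\<And>i. i \<in> I \<Longrightarrow> s i \<in> pforms V) \<Longrightarrow> (\<lambda>z. \<Sum>i\<in>I. s i z) \<in> pforms V"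
  by (induction I rule: infinite_finite_induct) (auto intro: pforms_add pforms_zero)

lemma pforms_mono: "V \<subseteq> W \<Longrightarrow> s \<in> pforms V \<Longrightarrow> s \<in> pforms W"
  unfolding pforms_def by blast

lemma vhol_pform: "finite A \<Longrightarrow> vhol (- A) (pform n A a)"
  unfolding pform_def
  by (intro vhol_sum vhol_scaleC holomorphic_intros) (auto intro: finite_imp_closed)

lemma reg_at_pform: "finite A \<Longrightarrow> p \<notin> A \<Longrightarrow> reg_at full p (pform n A a)"
  by (rule reg_at_vhol[OF vhol_pform]) (auto intro: finite_imp_closed)

lemma pform_split:
  "finite A \<Longrightarrow> p \<in> A \<Longrightarrow> pform n A a z = (\<Sum>k=1..n. inverse ((z - p) ^ k) *\<^sub>C a p k) + pform n (A - {p}) a z"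
  unfolding pform_def by (rule sum.remove)

lemma reg_at_pform_minus:
  assumes "finite A" "p \<in> A"
  shows "reg_at full p (\<lambda>z. pform n A a z - (\<Sum>k=1..n. inverse ((z - p) ^ k) *\<^sub>C a p k))"
  using reg_at_pform[of "A - {p}" p n a] assms by (simp add: pform_split[OF assms])

lemma reg_pform_coeff_zero:
  assumes "finite A" "p \<in> A" "reg_at full p (pform n A a)" "k \<in> {1..n}"
  shows "a p k = 0"
proof -
  have "reg_at full p (\<lambda>z. \<Sum>k=1..n. inverse ((z - p) ^ k) *\<^sub>C a p k)"
    using reg_at_diff[OF assms(3) reg_at_pform_minus[OF assms(1,2)], of n a] by simp
  then show ?thesis using principal_part_coeff_zero assms(4) by blast
qed

text \<open>The uniqueness principle for singular parts. Every coefficient vanishes, so the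
  conclusion is equality of functions, at the former poles as well.\<close>

lemma pforms_reg_zero:
  assumes "s \<in> pforms V" "reg_on full V s" shows "s = (\<lambda>z. 0)"
proof -
  obtain n A a where s: "s = pform n A a" "finite A" "A \<subseteq> V" using assms(1) by (auto simp: pforms_def)
  then have "\<forall>p\<in>A. \<forall>k\<in>{1..n}. a p k = 0"
    using reg_pform_coeff_zero[of A _ n a] assms(2) unfolding reg_on_def by blast
  then show ?thesis unfolding s pform_def by simp
qed

text \<open>A relational form of \<open>sing_part\<close> that can be verified by exhibiting
  \<open>s\<close>, without the definite description. Finiteness of the set of poles is built into
  \<open>pforms\<close>.\<close>

definition has_sing :: "complex set \<Rightarrow> (complex \<Rightarrow> 'h::complex_hilbert) \<Rightarrow> (complex \<Rightarrow> 'h) \<Rightarrow> bool"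
  where "has_sing V f s \<longleftrightarrow> s \<in> pforms V \<and> reg_on full V (\<lambda>z. f z - s z)"

lemma has_sing_unique:
  assumes "has_sing V f s" "has_sing V f t" shows "s = t"
proof -
  have "reg_on full V (\<lambda>z. s z - t z)"
    unfolding reg_on_def
  proof
    fix p assume "p \<in> V"
    then have "reg_at full p (\<lambda>z. f z - t z)" "reg_at full p (\<lambda>z. f z - s z)"
      using assms by (auto simp: has_sing_def reg_on_def)
    then have "reg_at full p (\<lambda>z. (f z - t z) - (f z - s z))"
      by (rule reg_at_diff)
    then show "reg_at full p (\<lambda>z. s z - t z)" by simp
  qed
  then have "(\<lambda>z. s z - t z) = (\<lambda>z. 0)"
    using assms by (intro pforms_reg_zero[of _ V] pforms_diff) (auto simp: has_sing_def)
  then show ?thesis by (simp add: fun_eq_iff)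
qed

lemma has_sing_self: "s \<in> pforms V \<Longrightarrow> has_sing V s s"
  by (simp add: has_sing_def reg_on_def)

lemma principal_part_eq:
  assumes "reg_at full p (\<lambda>z. f z - (\<Sum>k=1..n. inverse ((z - p) ^ k) *\<^sub>C a k))"
  shows "principal_part full p f = (\<lambda>z. \<Sum>k=1..n. inverse ((z - p) ^ k) *\<^sub>C a k)"
  unfolding principal_part_def
proof (rule the_equality)
  show "\<exists>n' a'. (\<forall>k. a' k \<in> car full) \<and>
    (\<lambda>z. \<Sum>k=1..n. inverse ((z - p) ^ k) *\<^sub>C a k) = (\<lambda>z. \<Sum>k=1..n'. inverse ((z - p) ^ k) *\<^sub>C a' k) \<and>
    reg_at full p (\<lambda>z. f z - (\<Sum>k=1..n. inverse ((z - p) ^ k) *\<^sub>C a k))"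
    using assms by auto
next
  fix s assume "\<exists>n a. (\<forall>k. a k \<in> car full) \<and> s = (\<lambda>z. \<Sum>k=1..n. inverse ((z - p) ^ k) *\<^sub>C a k) \<and>
      reg_at full p (\<lambda>z. f z - s z)"
  then obtain m b where s: "s = (\<lambda>z. \<Sum>k=1..m. inverse ((z - p) ^ k) *\<^sub>C b k)" "reg_at full p (\<lambda>z. f z - s z)"
    by blast
  \<comment> \<open>Regularity on the one-point set \<open>{p}\<close> is regularity at
    \<open>p\<close>, so the uniqueness of singular parts specializes to a single principal
    part.\<close>
  have "has_sing {p} f s" "has_sing {p} f (\<lambda>z. \<Sum>k=1..n. inverse ((z - p) ^ k) *\<^sub>C a k)"
    unfolding has_sing_def reg_on_def using s assms by (auto intro!: pforms_single[unfolded One_nat_def])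
  then show "s = (\<lambda>z. \<Sum>k=1..n. inverse ((z - p) ^ k) *\<^sub>C a k)" by (rule has_sing_unique)
qed

lemma has_sing_principal_part:
  assumes "has_sing V f (pform n A a)" "finite A" "p \<in> A" "p \<in> V"
  shows "reg_at full p (\<lambda>z. f z - (\<Sum>k=1..n. inverse ((z - p) ^ k) *\<^sub>C a p k))"
proof -
  have "reg_at full p (\<lambda>z. (f z - pform n A a z) +
      (pform n A a z - (\<Sum>k=1..n. inverse ((z - p) ^ k) *\<^sub>C a p k)))"
    using assms by (intro reg_at_add reg_at_pform_minus) (auto simp: has_sing_def reg_on_def)
  then show ?thesis by simp
qed

lemma has_sing_poles:
  assumes "has_sing V f (pform n A a)" "finite A" shows "poles_in full V f \<subseteq> A"
proof
  fix p assume p: "p \<in> poles_in full V f"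
  show "p \<in> A"
  proof (rule ccontr)
    assume "p \<notin> A"
    then have "reg_at full p (\<lambda>z. (f z - pform n A a z) + pform n A a z)"
      using assms p by (intro reg_at_add reg_at_pform) (auto simp: has_sing_def reg_on_def poles_in_def)
    then show False using p by (simp add: poles_in_def)
  qed
qed

lemma sing_part_eq:
  assumes "has_sing V f s" shows "sing_part full V f = s"
proof -
  obtain n A a where s: "s = pform n A a" "finite A" "A \<subseteq> V"
    using assms by (auto simp: has_sing_def pforms_def)
  have pp: "reg_at full p (\<lambda>z. f z - (\<Sum>k=1..n. inverse ((z - p) ^ k) *\<^sub>C a p k))" if "p \<in> A" for p
    using has_sing_principal_part[of V f n A a p] assms s that by auto
  show ?thesis
  proof
    fix z
    \<comment> \<open>A point of \<open>A\<close> may fail to be a pole of \<open>f\<close>, when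
      its coefficients vanish; its principal part is then zero and may be added to the sum.\<close>
    have "sing_part full V f z = (\<Sum>p\<in>A. principal_part full p f z)"
      unfolding sing_part_def
    proof (rule sum.mono_neutral_left)
      show "poles_in full V f \<subseteq> A" using has_sing_poles assms s by blast
      show "\<forall>p\<in>A - poles_in full V f. principal_part full p f z = 0"
      proof
        fix p assume p: "p \<in> A - poles_in full V f"
        then have "reg_at full p f" using s by (auto simp: poles_in_def)
        then show "principal_part full p f z = 0"
          using principal_part_eq[of p f 0] by simp
      qed
    qed (rule s)
    also have "\<dots> = s z"
      unfolding s(1) pform_def by (intro sum.cong refl fun_cong[OF principal_part_eq[OF pp]])
    finally show "sing_part full V f z = s z" .
  qed
qed

section \<open>Existence of singular parts of meromorphic functions\<close>

lemma mero_on_fullE: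
  assumes "mero_on full V f" "p \<in> V"
  obtains r g n where "r > 0" "vhol (ball p r) g" "\<forall>z\<in>ball p r - {p}. f z = inverse ((z - p) ^ n) *\<^sub>C g z"
proof -
  from assms have "\<exists>r>0. \<exists>g n. vhol (ball p r) g \<and> (\<forall>z\<in>ball p r - {p}. f z = inverse ((z - p) ^ n) *\<^sub>C g z)"
    unfolding mero_on_def hol_on_full by (rule bspec)
  then show thesis by (elim exE conjE) (rule that)
qed

text \<open>Divide the Taylor expansion of the numerator \<open>g\<close> by
  \<open>(z - p) ^ n\<close>: the coefficient of order \<open>-k\<close> is the Taylor coefficient
  of index \<open>n - k\<close>.\<close>

lemma mero_principal_part:
  assumes "r > 0" "vhol (ball p r) g" "\<forall>z\<in>ball p r - {p}. f z = inverse ((z - p) ^ n) *\<^sub>C g z"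
  shows "\<exists>a. reg_at full p (\<lambda>z. f z - (\<Sum>k=1..n. inverse ((z - p) ^ k) *\<^sub>C a k))"
proof -
  obtain b h where h: "vhol (ball p r) h"
    "\<forall>z\<in>ball p r. g z = (\<Sum>k<n. (z - p) ^ k *\<^sub>C b k) + (z - p) ^ n *\<^sub>C h z"
    using vhol_Taylor[OF assms(2), of n] by blast
  have "f z - (\<Sum>k=1..n. inverse ((z - p) ^ k) *\<^sub>C b (n - k)) = h z" if z: "z \<in> ball p r - {p}" for z
  proof -
    have nz: "z - p \<noteq> 0" using z by simp
    have "(\<Sum>k=1..n. inverse ((z - p) ^ k) *\<^sub>C b (n - k)) = (\<Sum>k<n. inverse ((z - p) ^ (n - k)) *\<^sub>C b k)"
      by (rule sum.reindex_bij_witness[of _ "\<lambda>k. n - k" "\<lambda>k. n - k"]) auto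
    also have "\<dots> = (\<Sum>k<n. (inverse ((z - p) ^ n) * (z - p) ^ k) *\<^sub>C b k)"
    proof (rule sum.cong)
      fix k assume "k \<in> {..<n}"
      then have "inverse ((z - p) ^ (n - k)) = inverse ((z - p) ^ n) * (z - p) ^ k"
        using nz by (subst power_diff) (auto simp: field_simps)
      then show "inverse ((z - p) ^ (n - k)) *\<^sub>C b k = (inverse ((z - p) ^ n) * (z - p) ^ k) *\<^sub>C b k"
        by simp
    qed simp
    moreover have "f z = inverse ((z - p) ^ n) *\<^sub>C ((\<Sum>k<n. (z - p) ^ k *\<^sub>C b k) + (z - p) ^ n *\<^sub>C h z)"
      using assms(3) h(2) z by simp
    ultimately show ?thesis
      using nz by (simp add: scaleC_add_right complex_vector.scale_sum_right)
  qed
  then have "\<forall>\<^sub>F z in at p. h z = f z - (\<Sum>k=1..n. inverse ((z - p) ^ k) *\<^sub>C b (n - k))"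
    using assms(1) unfolding eventually_at by (intro exI[of _ r]) (auto simp: dist_commute)
  moreover have "reg_at full p h" using h assms(1) by (intro reg_at_vhol) auto
  ultimately have "reg_at full p (\<lambda>z. f z - (\<Sum>k=1..n. inverse ((z - p) ^ k) *\<^sub>C b (n - k)))"
    by (rule reg_at_cong)
  then show ?thesis by (rule exI[of _ "\<lambda>k. b (n - k)"])
qed

lemma mero_has_sing:
  fixes f :: "complex \<Rightarrow> 'h::complex_hilbert"
  assumes "mero_on full V f" "finite (poles_in full V f)"
  shows "\<exists>s. has_sing V f s"
proof -
  have "\<exists>n a. reg_at full p (\<lambda>z. f z - (\<Sum>k=1..n. inverse ((z - p) ^ k) *\<^sub>C a k))" if "p \<in> V" for p
  proof -
    obtain r g n where "r > 0" "vhol (ball p r) g" "\<forall>z\<in>ball p r - {p}. f z = inverse ((z - p) ^ n) *\<^sub>C g z"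
      by (rule mero_on_fullE[OF assms(1) \<open>p \<in> V\<close>])
    then have "\<exists>a. reg_at full p (\<lambda>z. f z - (\<Sum>k=1..n. inverse ((z - p) ^ k) *\<^sub>C a k))"
      by (rule mero_principal_part)
    then show ?thesis by (rule exI)
  qed
  note ex = this
  define n where "n p = (SOME n. \<exists>a. reg_at full p (\<lambda>z. f z - (\<Sum>k=1..n. inverse ((z - p) ^ k) *\<^sub>C a k)))" for p
  define a where "a p = (SOME a. reg_at full p (\<lambda>z. f z - (\<Sum>k=1..n p. inverse ((z - p) ^ k) *\<^sub>C a k)))" for p
  have na: "reg_at full p (\<lambda>z. f z - (\<Sum>k=1..n p. inverse ((z - p) ^ k) *\<^sub>C a p k))"
    if "p \<in> V" for p
  proof -
    have "\<exists>a. reg_at full p (\<lambda>z. f z - (\<Sum>k=1..n p. inverse ((z - p) ^ k) *\<^sub>C a k))"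
      unfolding n_def by (rule someI_ex[OF ex[OF that]])
    from someI_ex[OF this] show ?thesis unfolding a_def .
  qed
  define B where "B = poles_in full V f"
  have B: "finite B" "B \<subseteq> V" using assms by (auto simp: B_def poles_in_def)
  \<comment> \<open>The order \<open>n p\<close> varies with the pole. Each inner sum is a form with
    one pole, and \<open>pforms_sum\<close> brings them to a common order.\<close>
  define s where "s z = (\<Sum>p\<in>B. \<Sum>k=1..n p. inverse ((z - p) ^ k) *\<^sub>C a p k)" for z
  have single: "(\<lambda>z. \<Sum>k=1..n p. inverse ((z - p) ^ k) *\<^sub>C a p k) = pform (n p) {p} a" for p
    by (simp add: pform_def)
  have "s \<in> pforms V"
    unfolding s_def[abs_def]
  proof (rule pforms_sum)
    fix p assume "p \<in> B"
    then show "(\<lambda>z. \<Sum>k=1..n p. inverse ((z - p) ^ k) *\<^sub>C a p k) \<in> pforms V"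
      unfolding single pforms_def using B by blast
  qed
  moreover have "reg_at full q (\<lambda>z. f z - s z)" if q: "q \<in> V" for q
  proof -
    have others: "reg_at full q (\<lambda>z. \<Sum>p\<in>B - {q}. \<Sum>k=1..n p. inverse ((z - p) ^ k) *\<^sub>C a p k)"
    proof (rule reg_at_sum)
      fix p assume "p \<in> B - {q}"
      then show "reg_at full q (\<lambda>z. \<Sum>k=1..n p. inverse ((z - p) ^ k) *\<^sub>C a p k)"
        unfolding single by (intro reg_at_pform) auto
    qed
    show ?thesis
    proof (cases "q \<in> B")
      case True
      have "s z = (\<Sum>k=1..n q. inverse ((z - q) ^ k) *\<^sub>C a q k) + (\<Sum>p\<in>B - {q}. \<Sum>k=1..n p. inverse ((z - p) ^ k) *\<^sub>C a p k)" for z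
        unfolding s_def using B True by (intro sum.remove)
      then show ?thesis using reg_at_diff[OF na[OF q] others] by (simp add: algebra_simps)
    next
      case False
      then have "reg_at full q f" using q by (auto simp: B_def poles_in_def)
      moreover have "B - {q} = B" using False by auto
      ultimately show ?thesis using others reg_at_diff by (auto simp: s_def)
    qed
  qed
  ultimately show ?thesis unfolding has_sing_def reg_on_def by blast
qed

lemma has_sing_mero:
  fixes f :: "complex \<Rightarrow> 'h::complex_hilbert"
  assumes "has_sing V f s" shows "mero_on full V f"
  unfolding mero_on_def hol_on_full
proof
  fix p assume p: "p \<in> V"
  obtain n0 A0 a0 where s0: "s = pform n0 A0 a0" "finite A0" "A0 \<subseteq> V"
    using assms by (auto simp: has_sing_def pforms_def)
  \<comment> \<open>If \<open>p\<close> is not a pole it is adjoined with zero coefficients, so that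
    one computation serves all points of \<open>V\<close>.\<close>
  obtain n A a where s: "s = pform n A a" "finite A" "p \<in> A"
    using pform_extend[of n0 n0 "insert p A0" A0 a0] s0 by auto
  have "has_sing (insert p V) f (pform n A a)" using assms p s by (simp add: insert_absorb)
  then have "reg_at full p (\<lambda>z. f z - (\<Sum>k=1..n. inverse ((z - p) ^ k) *\<^sub>C a p k))"
    using has_sing_principal_part s by blast
  then obtain r h where h: "r > 0" "vhol (ball p r) h"
    "\<forall>z\<in>ball p r - {p}. f z - (\<Sum>k=1..n. inverse ((z - p) ^ k) *\<^sub>C a p k) = h z"
    by (auto simp: reg_at_def hol_on_full)
  define g where "g z = (\<Sum>k=1..n. (z - p) ^ (n - k) *\<^sub>C a p k) + (z - p) ^ n *\<^sub>C h z" for z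
  have "vhol (ball p r) g"
    unfolding g_def by (intro vhol_add vhol_sum vhol_scaleC h holomorphic_intros) auto
  moreover have "f z = inverse ((z - p) ^ n) *\<^sub>C g z" if z: "z \<in> ball p r - {p}" for z
  proof -
    have nz: "z - p \<noteq> 0" using z by simp
    have "inverse ((z - p) ^ k) *\<^sub>C a p k = inverse ((z - p) ^ n) *\<^sub>C (z - p) ^ (n - k) *\<^sub>C a p k"
      if "k \<in> {1..n}" for k
    proof -
      have "inverse ((z - p) ^ k) = inverse ((z - p) ^ n) * (z - p) ^ (n - k)"
        using that nz by (subst power_diff) (auto simp: field_simps)
      then show ?thesis by simp
    qed
    then have "(\<Sum>k=1..n. inverse ((z - p) ^ k) *\<^sub>C a p k) =
      inverse ((z - p) ^ n) *\<^sub>C (\<Sum>k=1..n. (z - p) ^ (n - k) *\<^sub>C a p k)"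
      unfolding complex_vector.scale_sum_right by (rule sum.cong[OF refl])
    moreover have "h z = inverse ((z - p) ^ n) *\<^sub>C (z - p) ^ n *\<^sub>C h z"
      using nz by (simp add: scaleC_one)
    moreover have "f z = h z + (\<Sum>k=1..n. inverse ((z - p) ^ k) *\<^sub>C a p k)"
      using h(3) z by (metis diff_add_cancel)
    ultimately show ?thesis unfolding g_def scaleC_add_right by (metis add.commute)
  qed
  ultimately show "\<exists>r>0. \<exists>g n. vhol (ball p r) g \<and> (\<forall>z\<in>ball p r - {p}. f z = inverse ((z - p) ^ n) *\<^sub>C g z)"
    using h(1) by blast
qed

text \<open>The leading Laurent coefficient of a pole lies in the kernel of \<open>T p\<close>.\<close>

lemma reg_at_of_injective:
  fixes T :: "complex \<Rightarrow> 'd::complex_hilbert \<Rightarrow> 'h::complex_hilbert"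
  assumes T: "op_holomorphic_on V T" "\<And>z. z \<in> V \<Longrightarrow> clinear_map (T z)" "open V" "p \<in> V"
    and inj: "inj (T p)" and f: "mero_on full V f" and Tf: "reg_at full p (\<lambda>z. T z (f z))"
  shows "reg_at full p f"
proof -
  obtain r g n where "r > 0" "vhol (ball p r) g" "\<forall>z\<in>ball p r - {p}. f z = inverse ((z - p) ^ n) *\<^sub>C g z"
    by (rule mero_on_fullE[OF f T(4)])
  then show ?thesis
  proof (induction n arbitrary: g)
    case 0
    then show ?case by (auto simp: reg_at_def hol_on_full scaleC_one)
  next
    case (Suc n)
    obtain l where l: "((\<lambda>z. T z (f z)) \<longlongrightarrow> l) (at p)" using reg_at_tendsto[OF Tf] by blast
    have "((\<lambda>z. (z - p) ^ Suc n) \<longlongrightarrow> (p - p) ^ Suc n) (at p)" by (intro tendsto_intros)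
    from tendsto_scaleC[OF this l] have lim: "((\<lambda>z. (z - p) ^ Suc n *\<^sub>C T z (f z)) \<longlongrightarrow> 0) (at p)"
      by simp
    have hol: "vhol (ball p r \<inter> V) (\<lambda>z. T z (g z))"
      by (rule vhol_op[OF op_holomorphic_on_subset[OF T(1)] T(2) vhol_subset[OF Suc.prems(2)]])
        (auto simp: T(3) open_Int)
    have "((\<lambda>z. T z (g z)) \<longlongrightarrow> T p (g p)) (at p)"
      using T(4) Suc.prems(1) by (intro vhol_tendsto[OF hol]) auto
    moreover have "\<forall>\<^sub>F z in at p. T z (g z) = (z - p) ^ Suc n *\<^sub>C T z (f z)"
    proof -
      have "\<forall>\<^sub>F z in at p. z \<in> ball p r \<inter> V - {p}"
        using T(3,4) Suc.prems(1) by (intro eventually_at_in_open) auto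
      then show ?thesis
      proof eventually_elim
        case (elim z)
        then have nz: "(z - p) ^ Suc n \<noteq> 0" by simp
        have "T z (f z) = inverse ((z - p) ^ Suc n) *\<^sub>C T z (g z)"
          using elim Suc.prems(3) clinear_mapD(2)[OF T(2)] by auto
        then have "(z - p) ^ Suc n *\<^sub>C T z (f z) = ((z - p) ^ Suc n * inverse ((z - p) ^ Suc n)) *\<^sub>C T z (g z)"
          by (simp only: scaleC_scaleC)
        then show ?case by (simp only: right_inverse[OF nz] scaleC_one)
      qed
    qed
    ultimately have "((\<lambda>z. (z - p) ^ Suc n *\<^sub>C T z (f z)) \<longlongrightarrow> T p (g p)) (at p)"
      by (rule Lim_transform_eventually)
    then have "T p (g p) = 0" using tendsto_unique[OF trivial_limit_at lim] by simp
    then have gp: "g p = 0" using inj clinear_mapD(3)[OF T(2)[OF T(4)]] by (metis injD)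
    \<comment> \<open>As \<open>g p = 0\<close>, one factor \<open>z - p\<close> cancels and the
      induction continues with a pole order smaller by one.\<close>
    obtain h where h: "vhol (ball p r) h" "\<And>z. z \<in> ball p r \<Longrightarrow> g z = g p + (z - p) *\<^sub>C h z"
      using vhol_factor[OF Suc.prems(2)] by blast
    show ?case
    proof (rule Suc.IH[OF Suc.prems(1) h(1)], rule ballI)
      fix z assume z: "z \<in> ball p r - {p}"
      then have "f z = inverse ((z - p) ^ Suc n) *\<^sub>C (z - p) *\<^sub>C h z"
        using Suc.prems(3) h(2) gp by simp
      then show "f z = inverse ((z - p) ^ n) *\<^sub>C h z" using z by simp
    qed
  qed
qed

subsection \<open>Singular spaces\<close>

text \<open>Singular parts represent themselves here: \<open>T\<close> maps the regular function
  \<open>f - s\<close> to a regular one, so \<open>T f\<close> is regular exactly if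
  \<open>T s\<close> is. This makes the space of singular parts accessible without the original
  \<open>f\<close>.\<close>

definition ksing :: "complex set \<Rightarrow> (complex \<Rightarrow> 'd::complex_hilbert \<Rightarrow> 'h::complex_hilbert) \<Rightarrow> (complex \<Rightarrow> 'd) set"
  where "ksing V T = {s \<in> pforms V. reg_on full V (\<lambda>z. T z (s z))}"

lemma sing_part_reg:
  assumes T: "op_holomorphic_on V T" "\<And>z. z \<in> V \<Longrightarrow> clinear_map (T z)" "open V"
    and s: "has_sing V f s"
  shows "reg_on full V (\<lambda>z. T z (f z)) \<longleftrightarrow> reg_on full V (\<lambda>z. T z (s z))"
proof -
  have reg: "reg_at full p (\<lambda>z. T z (f z - s z))" if "p \<in> V" for p
    using s that by (intro reg_at_op[OF T]) (auto simp: has_sing_def reg_on_def)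
  have ev: "\<forall>\<^sub>F z in at p. T z (f z - s z) = T z (f z) - T z (s z)" if "p \<in> V" for p
    using eventually_at_in_open[OF T(3) that]
    by eventually_elim (auto simp: clinear_mapD[OF T(2)])
  have reg': "reg_at full p (\<lambda>z. T z (f z) - T z (s z))" if "p \<in> V" for p
    by (rule reg_at_cong[OF ev[OF that] reg[OF that]])
  show ?thesis
    unfolding reg_on_def
  proof (intro iffI ballI)
    fix p assume p: "p \<in> V" "\<forall>p\<in>V. reg_at full p (\<lambda>z. T z (f z))"
    then have "reg_at full p (\<lambda>z. T z (f z) - (T z (f z) - T z (s z)))"
      by (intro reg_at_diff[OF _ reg']) auto
    then show "reg_at full p (\<lambda>z. T z (s z))" by simp
  next
    fix p assume p: "p \<in> V" "\<forall>p\<in>V. reg_at full p (\<lambda>z. T z (s z))"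
    then have "reg_at full p (\<lambda>z. (T z (f z) - T z (s z)) + T z (s z))"
      by (intro reg_at_add[OF reg']) auto
    then show "reg_at full p (\<lambda>z. T z (f z))" by simp
  qed
qed

lemma ksing_poles:
  assumes T: "op_holomorphic_on V T" "\<And>z. z \<in> V \<Longrightarrow> clinear_map (T z)" "open V"
    and inj: "\<And>z. z \<in> V - B \<Longrightarrow> inj (T z)" 
    and f: "mero_on full V f" "reg_on full V (\<lambda>z. T z (f z))"
  shows "poles_in full V f \<subseteq> B"
  using reg_at_of_injective[OF T _ inj f(1)] f(2) by (auto simp: poles_in_def reg_on_def)

unbundle no m_inv_syntax

section \<open>Orthogonal projections and bounded inverses\<close>

lemma orth_proj_eqI:
  assumes "csubspace S" "p \<in> S" "\<And>s. s \<in> S \<Longrightarrow> cinner (x - p) s = 0"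
  shows "orth_proj S x = p"
  unfolding orth_proj_def
proof (rule the_equality)
  show "p \<in> S \<and> (\<forall>s\<in>S. cinner (x - p) s = 0)" using assms by blast
next
  fix q assume q: "q \<in> S \<and> (\<forall>s\<in>S. cinner (x - q) s = 0)"
  have "q - p \<in> S" using q assms(1,2) complex_vector.subspace_diff by blast
  then have "cinner (x - p) (q - p) = 0" "cinner (x - q) (q - p) = 0"
    using q assms(3) by auto
  then have "cinner (q - p) (q - p) = 0" by (simp add: cinner_diff_left)
  then show "q = p" by simp
qed

text \<open>By the parallelogram identity a minimizing sequence for the distance to \<open>R\<close>
  is Cauchy. Its limit is a nearest point, and minimality along each direction of \<open>R\<close>
  gives orthogonality for the real inner product.\<close>

lemma exists_orth_proj:
  fixes R :: "'h::complex_hilbert set"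
  assumes R: "csubspace R" "closed R"
  shows "\<exists>p\<in>R. \<forall>s\<in>R. cinner (x - p) s = 0"
proof -
  define d where "d = (INF r\<in>R. norm (x - r))"
  have R0: "0 \<in> R" using R(1) by (rule complex_vector.subspace_0)
  have bdd: "bdd_below ((\<lambda>r. norm (x - r)) ` R)" by (auto intro: bdd_belowI[of _ 0])
  have d: "d \<le> norm (x - r)" if "r \<in> R" for r
    unfolding d_def using bdd that by (rule cINF_lower)
  have "\<exists>r\<in>R. norm (x - r) < d + e" if "e > 0" for e
    using cINF_less_iff[OF _ bdd, of "d + e"] R0 that unfolding d_def by auto
  then have "\<forall>n. \<exists>r. r \<in> R \<and> norm (x - r) < d + inverse (real (Suc n))"
    by (metis inverse_positive_iff_positive of_nat_0_less_iff zero_less_Suc)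
  then obtain r where r: "\<And>n. r n \<in> R" "\<And>n. norm (x - r n) < d + inverse (real (Suc n))" by metis
  have d0: "d \<ge> 0" unfolding d_def using R0 by (intro cINF_greatest) auto
  have lim: "(\<lambda>n. (d + inverse (real (Suc n)))\<^sup>2) \<longlonglongrightarrow> (d + 0)\<^sup>2"
    by (intro tendsto_intros LIMSEQ_inverse_real_of_nat)
  have par: "(norm (r m - r n))\<^sup>2 \<le> 2 * (norm (x - r m))\<^sup>2 + 2 * (norm (x - r n))\<^sup>2 - 4 * d\<^sup>2" for m n
  proof -
    have "(1 / 2) *\<^sub>R (r m + r n) \<in> R"
      unfolding scaleR_eq_scaleC using r(1) R(1)
      by (intro complex_vector.subspace_scale complex_vector.subspace_add)
    from d[OF this] have "d\<^sup>2 \<le> (norm (x - (1 / 2) *\<^sub>R (r m + r n)))\<^sup>2"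
      using d0 by (intro power_mono)
    moreover have "(norm (r m - r n))\<^sup>2 + 4 * (norm (x - (1 / 2) *\<^sub>R (r m + r n)))\<^sup>2 =
        2 * (norm (x - r m))\<^sup>2 + 2 * (norm (x - r n))\<^sup>2"
      by (simp add: power2_norm_eq_inner inner_diff_left inner_diff_right inner_add_left inner_add_right inner_commute)
        (simp add: field_simps)
    ultimately show ?thesis by linarith
  qed
  have "Cauchy r"
  proof (rule metric_CauchyI)
    fix e :: real assume e: "e > 0"
    have "\<forall>\<^sub>F n in sequentially. (d + inverse (real (Suc n)))\<^sup>2 < d\<^sup>2 + e\<^sup>2 / 4"
      using order_tendstoD(2)[OF lim, of "d\<^sup>2 + e\<^sup>2 / 4"] e by simp
    then obtain N where N: "\<And>n. n \<ge> N \<Longrightarrow> (d + inverse (real (Suc n)))\<^sup>2 < d\<^sup>2 + e\<^sup>2 / 4"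
      by (auto simp: eventually_sequentially)
    have N': "(norm (x - r n))\<^sup>2 < d\<^sup>2 + e\<^sup>2 / 4" if "n \<ge> N" for n
    proof -
      have "(norm (x - r n))\<^sup>2 \<le> (d + inverse (real (Suc n)))\<^sup>2"
        using r(2)[of n] by (intro power_mono) auto
      then show ?thesis using N[OF that] by linarith
    qed
    have "dist (r m) (r n) < e" if "m \<ge> N" "n \<ge> N" for m n
    proof -
      have "(norm (r m - r n))\<^sup>2 < e\<^sup>2"
        using par[of m n] N'[OF that(1)] N'[OF that(2)] by linarith
      then show ?thesis using e by (simp add: dist_norm power2_less_imp_less)
    qed
    then show "\<exists>N. \<forall>m\<ge>N. \<forall>n\<ge>N. dist (r m) (r n) < e" by blast
  qed
  then obtain p where p: "r \<longlonglongrightarrow> p" using Cauchy_convergent convergent_def by blast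
  have pR: "p \<in> R" using closed_sequentially[OF R(2) _ p] r(1) by blast
  have "(\<lambda>n. norm (x - r n)) \<longlonglongrightarrow> norm (x - p)" by (intro tendsto_intros p)
  moreover have "(\<lambda>n. d + inverse (real (Suc n))) \<longlonglongrightarrow> d + 0"
    by (intro tendsto_intros LIMSEQ_inverse_real_of_nat)
  ultimately have "norm (x - p) \<le> d + 0"
    using r(2) less_imp_le by (intro LIMSEQ_le) blast+
  then have xp: "norm (x - p) \<le> norm (x - s)" if "s \<in> R" for s using d[OF that] by simp
  have Re0: "inner (x - p) s = 0" if s: "s \<in> R" for s
  proof (cases "s = 0")
    case False
    \<comment> \<open>The optimal step from \<open>p\<close> in direction \<open>s\<close>.
      Minimality then gives \<open>2 * a \<le> a\<close> for a nonnegative multiple \<open>a\<close>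
      of the squared inner product, which therefore vanishes.\<close>
    define t where "t = inner (x - p) s / (norm s)\<^sup>2"
    have "p + t *\<^sub>R s \<in> R"
      unfolding scaleR_eq_scaleC using pR s R(1)
      by (intro complex_vector.subspace_scale complex_vector.subspace_add)
    from xp[OF this] have "(norm (x - p))\<^sup>2 \<le> (norm (x - p - t *\<^sub>R s))\<^sup>2"
      by (intro power_mono) (auto simp: algebra_simps)
    also have "\<dots> = (norm (x - p))\<^sup>2 - 2 * t * inner (x - p) s + t\<^sup>2 * (norm s)\<^sup>2"
    proof -
      have "(norm (w - t *\<^sub>R s))\<^sup>2 = (norm w)\<^sup>2 - 2 * t * inner w s + t\<^sup>2 * (norm s)\<^sup>2" for w
        unfolding power2_norm_eq_inner
        by (simp add: inner_diff_left inner_diff_right inner_commute power2_eq_square)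
      then show ?thesis .
    qed
    finally have "2 * t * inner (x - p) s \<le> t\<^sup>2 * (norm s)\<^sup>2" by simp
    then have "2 * (inner (x - p) s)\<^sup>2 / (norm s)\<^sup>2 \<le> (inner (x - p) s)\<^sup>2 / (norm s)\<^sup>2"
      using False by (simp add: t_def power2_eq_square power_divide)
    then show ?thesis using False by (simp add: divide_le_cancel)
  qed simp
  have "cinner (x - p) s = 0" if s: "s \<in> R" for s
  proof -
    have "Re (cinner (x - p) s) = 0" using Re0[OF s] by (simp add: inner_eq_Re_cinner)
    \<comment> \<open>Real orthogonality to \<open>\<i> *\<^sub>C s\<close> accounts for the
      imaginary part of the complex inner product with \<open>s\<close>.\<close>
    moreover have "\<i> *\<^sub>C s \<in> R" using s R(1) complex_vector.subspace_scale by blast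
    then have "Re (cinner (x - p) (\<i> *\<^sub>C s)) = 0" using Re0 by (simp add: inner_eq_Re_cinner)
    ultimately show ?thesis by (simp add: cinner_scaleC_right complex_eq_iff)
  qed
  then show ?thesis using pR by blast
qed

text \<open>Orthogonality is measured after \<open>\<iota>\<close>, since the complement of the
  kernel is formed with the inner product of the larger space, while the vectors themselves stay in
  the domain.\<close>

lemma gram_schmidt:
  fixes \<iota> :: "'d::complex_vector \<Rightarrow> 'h::complex_hilbert" and b :: "nat \<Rightarrow> 'd"
  assumes \<iota>: "clinear_map \<iota>" "inj \<iota>"
    and b: "\<forall>c. (\<Sum>i<n. c i *\<^sub>C b i) = 0 \<longrightarrow> (\<forall>i<n. c i = 0)"
  shows "\<exists>e. (\<forall>i<n. \<forall>j<n. cinner (\<iota> (e i)) (\<iota> (e j)) = (if i = j then 1 else 0)) \<and>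
    cspan (e ` {..<n}) = cspan (b ` {..<n})"
  using b
proof (induction n)
  case 0
  then show ?case by simp
next
  case (Suc n)
  have "\<forall>c. (\<Sum>i<n. c i *\<^sub>C b i) = 0 \<longrightarrow> (\<forall>i<n. c i = 0)"
  proof (intro allI impI)
    fix c i assume "(\<Sum>i<n. c i *\<^sub>C b i) = 0" "i < n"
    then show "c i = 0" using Suc.prems[rule_format, of "\<lambda>i. if i < n then c i else 0" i] by simp
  qed
  then obtain e where e: "\<And>i j. i < n \<Longrightarrow> j < n \<Longrightarrow> cinner (\<iota> (e i)) (\<iota> (e j)) = (if i = j then 1 else 0)"
    "cspan (e ` {..<n}) = cspan (b ` {..<n})" using Suc.IH by blast
  define w where "w = (\<Sum>i<n. cinner (\<iota> (b n)) (\<iota> (e i)) *\<^sub>C e i)"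
  define u where "u = b n - w"
  have w: "w \<in> cspan (e ` {..<n})"
    unfolding w_def by (intro complex_vector.span_sum complex_vector.span_scale complex_vector.span_base) auto
  have "u \<noteq> 0"
  proof
    assume "u = 0"
    then have "b n \<in> cspan (b ` {..<n})" using w e(2) by (simp add: u_def)
    then obtain c where c: "b n = (\<Sum>v\<in>b ` {..<n}. c v *\<^sub>C v)"
      by (auto simp: complex_vector.span_finite)
    have inj: "inj_on b {..<n}"
    proof (rule inj_onI, rule ccontr)
      fix i j assume ij: "i \<in> {..<n}" "j \<in> {..<n}" "b i = b j" "i \<noteq> j"
      have "(\<Sum>k<Suc n. (if k = i then 1 else if k = j then -1 else 0) *\<^sub>C b k) =
        (\<Sum>k\<in>{i, j}. (if k = i then 1 else if k = j then -1 else 0) *\<^sub>C b k)"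
        using ij by (intro sum.mono_neutral_right) auto
      also have "\<dots> = 0" using ij by (simp add: scaleC_one)
      finally show False using Suc.prems[rule_format, of _ i] ij by fastforce
    qed
    have "(\<Sum>k<Suc n. (if k = n then -1 else c (b k)) *\<^sub>C b k) = 0"
      using c by (simp add: sum.reindex[OF inj] scaleC_one)
    then show False using Suc.prems[rule_format, of _ n] by fastforce
  qed
  then have \<iota>u: "\<iota> u \<noteq> 0" using \<iota> clinear_mapD(3)[OF \<iota>(1)] by (metis injD)
  define v where "v = inverse (of_real (norm (\<iota> u))) *\<^sub>C u"
  define e' where "e' = e(n := v)"
  have orth: "cinner (\<iota> u) (\<iota> (e j)) = 0" if "j < n" for j
    using that by (simp add: u_def w_def clinear_mapD[OF \<iota>(1)] cinner_diff_left cinner_sum_left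
        cinner_scaleC_left e(1) if_distrib cong: if_cong)
  have "cinner (\<iota> v) (\<iota> v) = 1"
    using \<iota>u by (simp add: v_def clinear_mapD[OF \<iota>(1)] cinner_scaleC_left cinner_scaleC_right
        cinner_self power2_eq_square norm_inverse)
  moreover have "cinner (\<iota> v) (\<iota> (e j)) = 0" "cinner (\<iota> (e j)) (\<iota> v) = 0" if "j < n" for j
    using orth[OF that] cinner_commute[of "\<iota> (e j)" "\<iota> u"]
    by (simp_all add: v_def clinear_mapD[OF \<iota>(1)] cinner_scaleC_left cinner_scaleC_right)
  ultimately have 1: "\<forall>i<Suc n. \<forall>j<Suc n. cinner (\<iota> (e' i)) (\<iota> (e' j)) = (if i = j then 1 else 0)"
    using e(1) by (auto simp: e'_def less_Suc_eq)
  have e'n: "e' ` {..<n} = e ` {..<n}" by (auto simp: e'_def)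
  have "cspan (e' ` {..<Suc n}) = cspan (b ` {..<Suc n})"
  proof -
    have im: "e' ` {..<Suc n} = insert v (e ` {..<n})" "b ` {..<Suc n} = insert (b n) (b ` {..<n})"
      using e'n by (auto simp: lessThan_Suc e'_def)
    have sub1: "cspan (e ` {..<n}) \<subseteq> cspan (insert v (e ` {..<n}))"
      and sub2: "cspan (b ` {..<n}) \<subseteq> cspan (insert (b n) (b ` {..<n}))"
      by (intro complex_vector.span_mono; blast)+
    have "b n = of_real (norm (\<iota> u)) *\<^sub>C v + w"
      using \<iota>u by (simp add: v_def u_def scaleC_one)
    moreover have "of_real (norm (\<iota> u)) *\<^sub>C v + w \<in> cspan (insert v (e ` {..<n}))"
      using w sub1 by (intro complex_vector.span_add complex_vector.span_scale) (auto intro: complex_vector.span_base)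
    ultimately have "b n \<in> cspan (insert v (e ` {..<n}))" by simp
    moreover have "u \<in> cspan (insert (b n) (b ` {..<n}))"
      unfolding u_def using w e(2) sub2
      by (intro complex_vector.span_diff) (auto intro: complex_vector.span_base)
    then have "v \<in> cspan (insert (b n) (b ` {..<n}))"
      unfolding v_def by (rule complex_vector.span_scale)
    moreover have "e ` {..<n} \<subseteq> cspan (insert (b n) (b ` {..<n}))"
      using order_trans[OF order_trans[OF complex_vector.span_superset equalityD1[OF e(2)]] sub2] .
    moreover have "b ` {..<n} \<subseteq> cspan (insert v (e ` {..<n}))"
      using order_trans[OF order_trans[OF complex_vector.span_superset equalityD2[OF e(2)]] sub1] .
    ultimately show ?thesis unfolding im complex_vector.span_eq insert_subset by simp
  qed
  then show ?case using 1 by blast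
qed

lemma exists_orthonormal_basis:
  fixes \<iota> :: "'d::complex_vector \<Rightarrow> 'h::complex_hilbert" and b :: "nat \<Rightarrow> 'd"
  assumes \<iota>: "clinear_map \<iota>" "inj \<iota>" and b: "is_basis {..<n} b V"
  obtains e where "\<And>i. i < n \<Longrightarrow> e i \<in> V"
    "\<And>i j. i < n \<Longrightarrow> j < n \<Longrightarrow> cinner (\<iota> (e i)) (\<iota> (e j)) = (if i = j then 1 else 0)"
    "\<And>v. v \<in> V \<Longrightarrow> v = (\<Sum>i<n. cinner (\<iota> v) (\<iota> (e i)) *\<^sub>C e i)"
proof -
  obtain e where "\<forall>i<n. \<forall>j<n. cinner (\<iota> (e i)) (\<iota> (e j)) = (if i = j then 1 else 0)"
    and e2: "cspan (e ` {..<n}) = cspan (b ` {..<n})"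
    using gram_schmidt[OF \<iota>, where n = n and b = b] b unfolding is_basis_iff[OF finite_lessThan] by (auto simp: Ball_def)
  then have e: "cinner (\<iota> (e i)) (\<iota> (e j)) = (if i = j then 1 else 0)" if "i < n" "j < n" for i j
    using that by simp
  have V: "V = cspan (e ` {..<n})" using b e2 by (simp add: is_basis_def)
  have "v = (\<Sum>i<n. cinner (\<iota> v) (\<iota> (e i)) *\<^sub>C e i)" if "v \<in> V" for v
    using that unfolding V
  proof (induction rule: complex_vector.span_induct_alt)
    case base
    then show ?case by (simp add: clinear_mapD[OF \<iota>(1)])
  next
    case (step c x y)
    then obtain j where j: "x = e j" "j < n" by auto
    have "(\<Sum>i<n. cinner (\<iota> (e j)) (\<iota> (e i)) *\<^sub>C e i) = (\<Sum>i<n. (if i = j then e j else 0))"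
      using j by (intro sum.cong) (auto simp: e scaleC_one)
    also have "\<dots> = e j" using j by simp
    finally have "(\<Sum>i<n. (c * cinner (\<iota> (e j)) (\<iota> (e i))) *\<^sub>C e i) = c *\<^sub>C e j"
      by (simp only: scaleC_scaleC[symmetric] complex_vector.scale_sum_right[symmetric])
    then show ?case
      using step.IH j by (simp add: clinear_mapD[OF \<iota>(1)] cinner_add_left cinner_scaleC_left scaleC_add_left sum.distrib)
  qed
  moreover have "e i \<in> V" if "i < n" for i
    unfolding V using that by (intro complex_vector.span_base) auto
  ultimately show thesis using that e by blast
qed

subsection \<open>The bounded inverse theorem\<close>

text \<open>The Baire half of the open mapping theorem: the closure of the image of some ball
  contains a ball, and differences and scaling then approximate every \<open>y\<close> with a
  preimage controlled by \<open>norm y\<close>.\<close>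

lemma bounded_inverse_approx:
  fixes T :: "'a::banach \<Rightarrow> 'b::banach"
  assumes T: "bounded_linear T" "surj T"
  shows "\<exists>C>0. \<forall>y. \<forall>\<delta>>0. \<exists>x. norm x \<le> C * norm y \<and> norm (y - T x) < \<delta>"
proof -
  interpret T: bounded_linear T by fact
  define A where "A n = closure (T ` ball 0 (real n))" for n
  have "(\<Union>n. A n) = UNIV"
  proof -
    have "y \<in> (\<Union>n. A n)" for y
    proof -
      obtain x where x: "y = T x" using T(2) by (metis surjD)
      obtain n :: nat where "norm x < real n" using reals_Archimedean2 by blast
      then have "y \<in> A n" unfolding A_def x by (intro closure_subset[THEN subsetD] imageI) simp
      then show ?thesis by blast
    qed
    then show ?thesis by blast
  qed
  have "\<exists>n. interior (A n) \<noteq> {}"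
  proof (rule ccontr)
    assume "\<not> ?thesis"
    then have "euclidean interior_of \<Union>(range A) = ({} :: 'b set)"
      by (intro Baire_category_alt disjI1 completely_metrizable_space_euclidean)
        (auto simp: A_def)
    then show False using \<open>(\<Union>n. A n) = UNIV\<close> by simp
  qed
  then obtain n y0 where "y0 \<in> interior (A n)" by blast
  then obtain e where e: "e > 0" "ball y0 e \<subseteq> A n" using mem_interior by blast
  \<comment> \<open>Below, \<open>y\<close> is scaled to length \<open>e / 2\<close>, and the
    difference of two preimages has norm less than \<open>2 * real n\<close>; undoing the scaling
    gives \<open>4 * real n / e\<close>. The summand \<open>1\<close> makes \<open>C\<close>
    positive whatever \<open>n\<close> is.\<close>
  define C where "C = 4 * real n / e + 1"
  have "\<exists>x. norm x \<le> C * norm y \<and> norm (y - T x) < \<delta>" if \<delta>: "\<delta> > 0" for y \<delta>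
  proof (cases "y = 0")
    case True
    then show ?thesis using \<delta> by (intro exI[of _ 0]) (simp add: T.zero)
  next
    case y: False
    define s where "s = e / (2 * norm y)"
    have s: "s > 0" using e y by (simp add: s_def)
    have "y0 + s *\<^sub>R y \<in> A n" "y0 \<in> A n"
      using e y by (auto intro!: e(2)[THEN subsetD] simp: dist_norm s_def)
    moreover have "s * \<delta> / 2 > 0" using s \<delta> by simp
    ultimately have "\<exists>v\<in>T ` ball 0 (real n). dist v (y0 + s *\<^sub>R y) < s * \<delta> / 2"
      "\<exists>v\<in>T ` ball 0 (real n). dist v y0 < s * \<delta> / 2"
      unfolding A_def closure_approachable by blast+
    then obtain x1 x2 where x: "norm x1 < n" "norm (T x1 - (y0 + s *\<^sub>R y)) < s * \<delta> / 2"
      "norm x2 < n" "norm (T x2 - y0) < s * \<delta> / 2"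
      by (auto simp: dist_norm)
    define x where "x = (1 / s) *\<^sub>R (x1 - x2)"
    have "norm x \<le> (1 / s) * (norm x1 + norm x2)"
      using s by (auto simp: x_def intro!: divide_right_mono norm_triangle_ineq4)
    also have "\<dots> \<le> (1 / s) * (2 * real n)" using x s by (intro mult_left_mono) auto
    also have "\<dots> = 4 * real n / e * norm y" using e y by (simp add: s_def)
    also have "\<dots> \<le> C * norm y" by (simp add: C_def algebra_simps)
    finally have 1: "norm x \<le> C * norm y" .
    have "y - T x = (1 / s) *\<^sub>R ((T x2 - y0) - (T x1 - (y0 + s *\<^sub>R y)))"
      using s by (simp add: x_def T.scaleR T.diff algebra_simps)
    also have "norm \<dots> \<le> (1 / s) * (norm (T x2 - y0) + norm (T x1 - (y0 + s *\<^sub>R y)))"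
      using s norm_triangle_ineq4[of "T x2 - y0" "T x1 - (y0 + s *\<^sub>R y)"]
      by (simp add: divide_right_mono)
    also have "\<dots> < (1 / s) * (s * \<delta>)"
      using x s by (intro mult_strict_left_mono) auto
    finally show ?thesis using 1 s by auto
  qed
  moreover have "C > 0" using e by (simp add: C_def add_nonneg_pos)
  ultimately show ?thesis by blast
qed

text \<open>Successive correction: each approximate preimage halves the error, so the corrections
  sum to an exact preimage, and the geometric series accounts for the factor
  \<open>2\<close>.\<close>

theorem bounded_linear_inv:
  fixes T :: "'a::banach \<Rightarrow> 'b::banach"
  assumes T: "bounded_linear T" "bij T"
  shows "bounded_linear (inv T)"
proof -
  interpret T: bounded_linear T by fact
  obtain C where C: "C > 0" "\<And>y \<delta>. \<delta> > 0 \<Longrightarrow> \<exists>x. norm x \<le> C * norm y \<and> norm (y - T x) < \<delta>"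
    using bounded_inverse_approx[OF T(1)] T(2) bij_is_surj by blast
  have bound: "norm (inv T y) \<le> 2 * C * norm y" for y
  proof (cases "y = 0")
    case True
    then show ?thesis using T by (metis T.zero bij_inv_eq_iff mult_zero_right norm_zero order_refl)
  next
    case y: False
    \<comment> \<open>An approximate preimage that leaves less than half of \<open>z\<close>. For
      \<open>z = 0\<close> the norm bound alone forces \<open>S z = 0\<close>.\<close>
    define S where "S z = (SOME x. norm x \<le> C * norm z \<and> (z \<noteq> 0 \<longrightarrow> norm (z - T x) < norm z / 2))" for z
    have S: "norm (S z) \<le> C * norm z" "z \<noteq> 0 \<Longrightarrow> norm (z - T (S z)) < norm z / 2" for z
    proof -
      have "\<exists>x. norm x \<le> C * norm z \<and> (z \<noteq> 0 \<longrightarrow> norm (z - T x) < norm z / 2)"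
        using C(2)[of "if z = 0 then 1 else norm z / 2" z] by (cases "z = 0") auto
      from someI_ex[OF this] show "norm (S z) \<le> C * norm z" "z \<noteq> 0 \<Longrightarrow> norm (z - T (S z)) < norm z / 2"
        unfolding S_def by auto
    qed
    define ys where "ys k = ((\<lambda>z. z - T (S z)) ^^ k) y" for k
    have ysS: "ys (Suc k) = ys k - T (S (ys k))" for k by (simp add: ys_def)
    have half: "norm (z - T (S z)) \<le> norm z / 2" for z
    proof (cases "z = 0")
      case True
      then have "S z = 0" using S(1)[of z] by simp
      then show ?thesis using True by (simp add: T.zero)
    qed (use S(2) in \<open>auto intro: less_imp_le\<close>)
    have ys: "norm (ys k) \<le> norm y * (1 / 2) ^ k" for k
    proof (induction k)
      case (Suc k)
      then show ?case using half[of "ys k"] by (simp add: ysS)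
    qed (simp add: ys_def)
    have bd: "norm (S (ys k)) \<le> C * norm y * (1 / 2) ^ k" for k
      using order_trans[OF S(1) mult_left_mono[OF ys]] C(1) by (simp add: mult.assoc)
    have geo: "(\<lambda>k. C * norm y * (1 / 2) ^ k) sums (C * norm y * 2)"
      using sums_mult[OF geometric_sums[of "1 / 2 :: real"], of "C * norm y"] by simp
    have sm: "summable (\<lambda>k. norm (S (ys k)))"
      by (rule summable_comparison_test'[OF sums_summable[OF geo], of 0]) (use bd in simp)
    define x where "x = (\<Sum>k. S (ys k))"
    have part: "T (\<Sum>k<n. S (ys k)) = y - ys n" for n
    proof (induction n)
      case (Suc n)
      then show ?case by (simp add: T.add ysS)
    qed (simp add: ys_def T.zero)
    have "(\<lambda>n. \<Sum>k<n. S (ys k)) \<longlonglongrightarrow> x"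
      unfolding x_def using summable_norm_cancel[OF sm] by (rule summable_LIMSEQ)
    from T.tendsto[OF this] have 1: "(\<lambda>n. y - ys n) \<longlonglongrightarrow> T x" by (simp add: part)
    have "(\<lambda>k. norm y * (1 / 2) ^ k) \<longlonglongrightarrow> norm y * 0"
      by (intro tendsto_intros LIMSEQ_power_zero) auto
    then have "ys \<longlonglongrightarrow> 0"
      using Lim_null_comparison[of ys "\<lambda>k. norm y * (1 / 2) ^ k"] ys by simp
    then have "(\<lambda>n. y - ys n) \<longlonglongrightarrow> y - 0" by (intro tendsto_intros)
    then have "T x = y" using LIMSEQ_unique[OF 1] by simp
    then have "inv T y = x" using T(2) by (metis bij_inv_eq_iff)
    moreover have "norm x \<le> (\<Sum>k. norm (S (ys k)))" unfolding x_def by (rule summable_norm[OF sm])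
    moreover have "\<dots> \<le> C * norm y * 2"
      using suminf_le[OF bd sm sums_summable[OF geo]] sums_unique[OF geo] by simp
    ultimately show ?thesis by simp
  qed
  have inv: "T (inv T y) = y" for y using T(2) by (simp add: bij_is_surj surj_f_inv_f)
  have inj: "T u = T v \<Longrightarrow> u = v" for u v using T(2) by (meson bij_is_inj injD)
  show ?thesis
  proof (rule bounded_linear_intro[where K = "2 * C"])
    show "inv T (x + y) = inv T x + inv T y" for x y by (rule inj) (simp add: inv T.add)
    show "inv T (r *\<^sub>R x) = r *\<^sub>R inv T x" for r x by (rule inj) (simp add: inv T.scaleR)
    show "norm (inv T x) \<le> norm x * (2 * C)" for x using bound[of x] by (simp add: mult.commute)
  qed
qed

lemma clinear_map_inv:
  assumes "clinear_map T" "bij T" shows "clinear_map (inv T)"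
proof -
  have inv: "T (inv T y) = y" for y using assms(2) by (simp add: bij_is_surj surj_f_inv_f)
  have inj: "T u = T v \<Longrightarrow> u = v" for u v using assms(2) by (meson bij_is_inj injD)
  show ?thesis
    unfolding clinear_map_def
    by (intro conjI allI; rule inj) (simp_all add: inv clinear_mapD[OF assms(1)])
qed

subsection \<open>Derivative of the inverse of a family of operators\<close>

text \<open>All rests on \<open>B w - B x = - B w (A w - A x) B x\<close>. Used once, with
  \<open>A w\<close> close to \<open>A x\<close>, it gives
  \<open>norm (B w) \<le> 2 * norm (B x)\<close>; used again, it gives convergence.\<close>

lemma continuous_blinfun_inverse:
  fixes A :: "'x::real_normed_vector \<Rightarrow> 'a::real_normed_vector \<Rightarrow>\<^sub>L 'b::real_normed_vector"
  assumes A: "(A \<longlongrightarrow> A x) (at x)"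
    and inv: "\<forall>\<^sub>F w in at x. B w o\<^sub>L A w = id_blinfun" "A x o\<^sub>L B x = id_blinfun"
  shows "(B \<longlongrightarrow> B x) (at x)"
proof -
  have diff: "B w - B x = - (B w o\<^sub>L (A w - A x) o\<^sub>L B x)" if "B w o\<^sub>L A w = id_blinfun" for w
  proof (rule blinfun_eqI)
    fix v
    have "A x (B x v) = v" "B w (A w (B x v)) = B x v"
      using inv(2) that by (metis blinfun_apply_blinfun_compose blinfun_apply_id_blinfun id_apply)+
    then show "blinfun_apply (B w - B x) v = blinfun_apply (- (B w o\<^sub>L (A w - A x) o\<^sub>L B x)) v"
      by (simp add: blinfun.diff_left blinfun.diff_right blinfun.minus_left)
  qed
  have le: "norm (B w - B x) \<le> norm (B w) * norm (A w - A x) * norm (B x)" if "B w o\<^sub>L A w = id_blinfun" for w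
    unfolding diff[OF that] norm_minus_cancel
    by (intro order_trans[OF norm_blinfun_compose] mult_right_mono norm_blinfun_compose) auto
  have "((\<lambda>w. norm (A w - A x) * norm (B x)) \<longlongrightarrow> 0 * norm (B x)) (at x)"
    using A by (intro tendsto_intros tendsto_norm_zero LIM_zero)
  then have "\<forall>\<^sub>F w in at x. norm (A w - A x) * norm (B x) < 1 / 2"
    by (rule order_tendstoD(2)) simp
  with inv(1) have ev: "\<forall>\<^sub>F w in at x. norm (B w - B x) \<le> 2 * norm (B x) * norm (A w - A x) * norm (B x)"
  proof eventually_elim
    case (elim w)
    have "norm (B w) \<le> norm (B x) + norm (B w - B x)" by (metis add.commute diff_add_cancel norm_triangle_ineq)
    also have "norm (B w - B x) \<le> norm (B w) * (norm (A w - A x) * norm (B x))"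
      using le[OF elim(1)] by (simp add: mult.assoc)
    also have "\<dots> \<le> norm (B w) * (1 / 2)" using elim(2) by (intro mult_left_mono) auto
    finally have "norm (B w) \<le> 2 * norm (B x)" by simp
    then show ?case
      using le[OF elim(1)] by (meson mult_right_mono norm_ge_zero order_trans)
  qed
  have "((\<lambda>w. 2 * norm (B x) * norm (A w - A x) * norm (B x)) \<longlongrightarrow> 2 * norm (B x) * 0 * norm (B x)) (at x)"
    using A by (intro tendsto_intros tendsto_norm_zero LIM_zero)
  then have "((\<lambda>w. B w - B x) \<longlongrightarrow> 0) (at x)"
    by (intro Lim_null_comparison[OF ev]) simp
  then show ?thesis by (rule LIM_zero_cancel)
qed

text \<open>A product rule in which the factor \<open>B\<close> is merely continuous: the term with
  the derivative of \<open>B\<close> is absent because \<open>F\<close> vanishes at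
  \<open>x\<close>. It will be applied to an inverse whose differentiability is yet to be
  shown.\<close>

lemma has_derivative_compose_zero:
  fixes F :: "'x::real_normed_vector \<Rightarrow> 'a::real_normed_vector \<Rightarrow>\<^sub>L 'b::real_normed_vector"
    and B :: "'x \<Rightarrow> 'b \<Rightarrow>\<^sub>L 'c::real_normed_vector"
  assumes F: "(F has_derivative F') (at x)" "F x = 0" and B: "(B \<longlongrightarrow> B x) (at x)"
  shows "((\<lambda>w. B w o\<^sub>L F w) has_derivative (\<lambda>h. B x o\<^sub>L F' h)) (at x)"
proof -
  have F': "bounded_linear F'" using F(1) by (rule has_derivative_bounded_linear)
  obtain K where K: "K \<ge> 0" "\<And>h. norm (F' h) \<le> norm h * K"
    using bounded_linear.nonneg_bounded[OF F'] by blast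
  have lim: "((\<lambda>w. norm (B w) * (norm (F w - F' (w - x)) / norm (w - x)) + norm (B w - B x) * K) \<longlongrightarrow>
      norm (B x) * 0 + 0 * K) (at x)"
    using F B by (intro tendsto_intros tendsto_norm_zero LIM_zero) (simp_all add: has_derivative_iff_norm)
  have ev: "norm (norm ((B w o\<^sub>L F w) - (B x o\<^sub>L F x) - (B x o\<^sub>L F' (w - x))) / norm (w - x)) \<le>
      norm (B w) * (norm (F w - F' (w - x)) / norm (w - x)) + norm (B w - B x) * K" if "w \<noteq> x" for w
  proof -
    have "(B w o\<^sub>L F w) - (B x o\<^sub>L F x) - (B x o\<^sub>L F' (w - x)) =
      (B w o\<^sub>L (F w - F' (w - x))) + ((B w - B x) o\<^sub>L F' (w - x))"
      using F(2) by (intro blinfun_eqI) (simp add: blinfun.diff_left blinfun.diff_right blinfun.add_left)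
    also have "norm \<dots> \<le> norm (B w) * norm (F w - F' (w - x)) + norm (B w - B x) * (norm (w - x) * K)"
      by (intro norm_triangle_mono order_trans[OF norm_blinfun_compose] mult_left_mono K order_refl) auto
    finally have "norm ((B w o\<^sub>L F w) - (B x o\<^sub>L F x) - (B x o\<^sub>L F' (w - x))) / norm (w - x) \<le>
       (norm (B w) * norm (F w - F' (w - x)) + norm (B w - B x) * (norm (w - x) * K)) / norm (w - x)"
      by (rule divide_right_mono) simp
    also have "\<dots> = norm (B w) * (norm (F w - F' (w - x)) / norm (w - x)) + norm (B w - B x) * K"
      using that by (simp add: add_divide_distrib)
    finally show ?thesis by simp
  qed
  have "((\<lambda>w. norm ((B w o\<^sub>L F w) - (B x o\<^sub>L F x) - (B x o\<^sub>L F' (w - x))) / norm (w - x)) \<longlongrightarrow> 0) (at x)"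
    by (rule Lim_null_comparison[OF _ lim[simplified]]) (auto simp: eventually_at_filter intro!: always_eventually ev[simplified])
  moreover have "bounded_linear (\<lambda>h. B x o\<^sub>L F' h)"
    by (rule bounded_linear_compose[OF bounded_bilinear.bounded_linear_right[OF bounded_bilinear_blinfun_compose] F'])
  ultimately show ?thesis by (simp add: has_derivative_iff_norm)
qed

text \<open>In \<open>B w = B x - B w (A w - A x) B x\<close> the middle factor vanishes at
  \<open>x\<close>, so continuity of \<open>B\<close> suffices to differentiate the right-hand
  side.\<close>

lemma has_derivative_blinfun_inverse:
  fixes A :: "'x::real_normed_vector \<Rightarrow> 'a::real_normed_vector \<Rightarrow>\<^sub>L 'b::real_normed_vector"
  assumes A: "(A has_derivative A') (at x)" and S: "open S" "x \<in> S"
    and inv: "\<And>w. w \<in> S \<Longrightarrow> B w o\<^sub>L A w = id_blinfun" "\<And>w. w \<in> S \<Longrightarrow> A w o\<^sub>L B w = id_blinfun"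
  shows "(B has_derivative (\<lambda>h. - (B x o\<^sub>L A' h o\<^sub>L B x))) (at x)"
proof -
  have ev: "\<forall>\<^sub>F w in at x. B w o\<^sub>L A w = id_blinfun"
    using eventually_at_in_open[OF S] by eventually_elim (use inv in auto)
  have "(A \<longlongrightarrow> A x) (at x)" using has_derivative_continuous[OF A] by (simp add: isCont_def)
  then have B: "(B \<longlongrightarrow> B x) (at x)" using ev inv(2)[OF S(2)] by (rule continuous_blinfun_inverse)
  have "((\<lambda>w. A w - A x) has_derivative A') (at x)"
    using has_derivative_diff[OF A has_derivative_const[of "A x"]] by simp
  from has_derivative_compose_zero[OF this _ B]
  have "((\<lambda>w. B w o\<^sub>L (A w - A x)) has_derivative (\<lambda>h. B x o\<^sub>L A' h)) (at x)" by simp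
  from bounded_linear.has_derivative[OF bounded_bilinear.bounded_linear_left[OF bounded_bilinear_blinfun_compose, of "B x"] this]
  have "((\<lambda>w. B x - (B w o\<^sub>L (A w - A x) o\<^sub>L B x)) has_derivative (\<lambda>h. 0 - (B x o\<^sub>L A' h o\<^sub>L B x))) (at x)"
    by (intro has_derivative_diff has_derivative_const)
  moreover have "B x - (B w o\<^sub>L (A w - A x) o\<^sub>L B x) = B w" if "w \<in> S" for w
  proof (rule blinfun_eqI)
    fix v
    have "A x (B x v) = v" "B w (A w (B x v)) = B x v"
      using inv(2)[OF S(2)] inv(1)[OF that] by (metis blinfun_apply_blinfun_compose blinfun_apply_id_blinfun id_apply)+
    then show "blinfun_apply (B x - (B w o\<^sub>L (A w - A x) o\<^sub>L B x)) v = blinfun_apply (B w) v"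
      by (simp add: blinfun.diff_left blinfun.diff_right)
  qed
  ultimately show ?thesis
    using has_derivative_transform_within_open[OF _ S, of "\<lambda>w. B x - (B w o\<^sub>L (A w - A x) o\<^sub>L B x)" _ UNIV B] by simp
qed

lemma Blinfun_inv:
  fixes T :: "'a::banach \<Rightarrow> 'b::banach"
  assumes "bounded_linear T" "bij T"
  shows "Blinfun (inv T) o\<^sub>L Blinfun T = id_blinfun" "Blinfun T o\<^sub>L Blinfun (inv T) = id_blinfun"
  using assms bounded_linear_inv[OF assms]
  by (auto intro!: blinfun_eqI simp: bounded_linear_Blinfun_apply bij_is_inj bij_is_surj surj_f_inv_f)

lemma op_holomorphic_on_inv:
  assumes T: "op_holomorphic_on V T" "\<And>z. z \<in> V \<Longrightarrow> clinear_map (T z)" "open V"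
    and bij: "\<And>z. z \<in> V \<Longrightarrow> bij (T z)"
  shows "op_holomorphic_on V (\<lambda>z. inv (T z))"
  unfolding op_holomorphic_on_def
proof (intro conjI ballI)
  fix z assume z: "z \<in> V"
  have bl: "bounded_linear (T w)" if "w \<in> V" for w using T(1) that by (auto simp: op_holomorphic_on_def)
  show bi: "bounded_linear (inv (T z))" by (rule bounded_linear_inv[OF bl[OF z] bij[OF z]])
  obtain T' where T': "bounded_linear T'" "\<And>c u. T' (c *\<^sub>C u) = c *\<^sub>C T' u"
    "((\<lambda>w. Blinfun (T w)) has_derivative (\<lambda>h. Blinfun (\<lambda>u. h *\<^sub>C T' u))) (at z)"
    using T(1) z by (auto simp: op_holomorphic_on_def)
  have lin: "inv (T z) (c *\<^sub>C u) = c *\<^sub>C inv (T z) u" for c u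
    using clinear_mapD(2)[OF clinear_map_inv[OF T(2)[OF z] bij[OF z]]] .
  define D where "D u = - inv (T z) (T' (inv (T z) u))" for u
  have D: "bounded_linear D"
    unfolding D_def by (intro bounded_linear_minus bounded_linear_compose[OF bi] bounded_linear_compose[OF T'(1) bi])
  have "((\<lambda>w. Blinfun (inv (T w))) has_derivative
     (\<lambda>h. - (Blinfun (inv (T z)) o\<^sub>L Blinfun (\<lambda>u. h *\<^sub>C T' u) o\<^sub>L Blinfun (inv (T z))))) (at z)"
    by (rule has_derivative_blinfun_inverse[OF T'(3) T(3) z]) (auto simp: Blinfun_inv bl bij)
  moreover have "- (Blinfun (inv (T z)) o\<^sub>L Blinfun (\<lambda>u. h *\<^sub>C T' u) o\<^sub>L Blinfun (inv (T z))) = Blinfun (\<lambda>u. h *\<^sub>C D u)" for h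
  proof (rule blinfun_eqI)
    fix u
    have 1: "bounded_linear (\<lambda>u. h *\<^sub>C T' u)" "bounded_linear (\<lambda>u. h *\<^sub>C D u)"
      by (rule bounded_linear_compose[OF bounded_linear_scaleC_right] T' D)+
    show "blinfun_apply (- (Blinfun (inv (T z)) o\<^sub>L Blinfun (\<lambda>u. h *\<^sub>C T' u) o\<^sub>L Blinfun (inv (T z)))) u =
      blinfun_apply (Blinfun (\<lambda>u. h *\<^sub>C D u)) u"
      by (simp add: blinfun.minus_left bounded_linear_Blinfun_apply 1 bi lin)
        (simp add: D_def lin)
  qed
  ultimately have "((\<lambda>w. Blinfun (inv (T w))) has_derivative (\<lambda>h. Blinfun (\<lambda>u. h *\<^sub>C D u))) (at z)" by simp
  moreover have "D (c *\<^sub>C u) = c *\<^sub>C D u" for c u by (simp add: D_def lin T'(2))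
  ultimately show "\<exists>T'. bounded_linear T' \<and> (\<forall>c u. T' (c *\<^sub>C u) = c *\<^sub>C T' u) \<and>
    ((\<lambda>w. Blinfun (inv (T w))) has_derivative (\<lambda>h. Blinfun (\<lambda>u. h *\<^sub>C T' u))) (at z)"
    using D by blast
qed

section \<open>Calculus of \<open>C\<^sup>k\<close> maps\<close>

lemma Ck_on_subset: "Ck_on k S f \<Longrightarrow> T \<subseteq> S \<Longrightarrow> Ck_on k T f"
  by (induction k arbitrary: f) (auto intro: continuous_on_subset)

lemma Ck_on_SucD:
  assumes "Ck_on (Suc k) S f"
  shows "x \<in> S \<Longrightarrow> (f has_derivative frechet_derivative f (at x)) (at x)"
    "Ck_on k S (\<lambda>x. frechet_derivative f (at x) v)"
  using assms by (auto simp: frechet_derivative_works[symmetric])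

lemma Ck_on_cong:
  assumes "open S" "\<And>x. x \<in> S \<Longrightarrow> f x = g x" "Ck_on k S f" shows "Ck_on k S g"
  using assms(2,3)
proof (induction k arbitrary: f g)
  case 0
  then show ?case using continuous_on_cong[of S S f g] by simp
next
  case (Suc k)
  have der: "(g has_derivative frechet_derivative f (at x)) (at x)" if "x \<in> S" for x
    by (rule has_derivative_transform_within_open[OF Ck_on_SucD(1)[OF Suc.prems(2) that] assms(1) that])
      (use Suc.prems(1) in auto)
  have eq: "frechet_derivative f (at x) v = frechet_derivative g (at x) v" if "x \<in> S" for x v
    using frechet_derivative_at[OF der[OF that]] by simp
  have "Ck_on k S (\<lambda>x. frechet_derivative g (at x) v)" for v
    using Suc.IH[OF eq Ck_on_SucD(2)[OF Suc.prems(2)]] .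
  moreover have "g differentiable (at x)" if "x \<in> S" for x
    using der[OF that] by (auto simp: differentiable_def)
  ultimately show ?case by simp
qed

lemma Ck_on_SucI:
  assumes "open S" "\<And>x. x \<in> S \<Longrightarrow> (f has_derivative f' x) (at x)" "\<And>v. Ck_on k S (\<lambda>x. f' x v)"
  shows "Ck_on (Suc k) S f"
proof -
  have "Ck_on k S (\<lambda>x. frechet_derivative f (at x) v)" for v
    by (rule Ck_on_cong[OF assms(1) _ assms(3)[of v]]) (simp add: frechet_derivative_at[OF assms(2), symmetric])
  then show ?thesis using assms(2) by (auto simp: differentiable_def)
qed

lemma Ck_on_Suc_imp: "Ck_on (Suc k) S f \<Longrightarrow> Ck_on k S f"
proof (induction k arbitrary: f)
  case 0
  then show ?case
    by (auto intro!: continuous_at_imp_continuous_on differentiable_imp_continuous_within)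
next
  case (Suc k)
  have "Ck_on k S (\<lambda>x. frechet_derivative f (at x) v)" for v
    by (rule Suc.IH[OF Ck_on_SucD(2)[OF Suc.prems]])
  moreover have "\<forall>x\<in>S. f differentiable (at x)" using Suc.prems by simp
  ultimately show ?case by simp
qed

lemma Ck_on_continuous: "Ck_on k S f \<Longrightarrow> continuous_on S f"
proof (induction k)
  case (Suc k)
  then show ?case using Ck_on_Suc_imp by blast
qed simp

lemma Ck_on_local:
  assumes "\<And>x. x \<in> S \<Longrightarrow> \<exists>N. open N \<and> x \<in> N \<and> Ck_on k N f"
  shows "Ck_on k S f"
  using assms
proof (induction k arbitrary: f)
  case 0
  have "continuous (at x within S) f" if "x \<in> S" for x
  proof -
    obtain N where "open N" "x \<in> N" "continuous_on N f" using 0[OF \<open>x \<in> S\<close>] by auto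
    then show ?thesis using continuous_on_eq_continuous_at continuous_at_imp_continuous_at_within by blast
  qed
  then show ?case by (simp add: continuous_on_eq_continuous_within)
next
  case (Suc k)
  have "f differentiable (at x)" if "x \<in> S" for x using Suc.prems[OF that] by auto
  moreover have "Ck_on k S (\<lambda>x. frechet_derivative f (at x) v)" for v
    by (rule Suc.IH) (use Suc.prems in force)
  ultimately show ?case by simp
qed

lemma Ck_on_const [simp]: "Ck_on k S (\<lambda>x. c)"
  by (induction k arbitrary: c) auto

lemma Ck_on_bounded_linear:
  assumes L: "bounded_linear L" and S: "open S" and f: "Ck_on k S f"
  shows "Ck_on k S (\<lambda>x. L (f x))"
  using f
proof (induction k arbitrary: f)
  case 0
  then show ?case using bounded_linear.continuous_on[OF L] by simp
next
  case (Suc k)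
  show ?case
    by (rule Ck_on_SucI[OF S bounded_linear.has_derivative[OF L Ck_on_SucD(1)[OF Suc.prems]]])
      (auto intro!: Suc.IH Ck_on_SucD(2)[OF Suc.prems])
qed

lemma Ck_on_add:
  assumes S: "open S" and f: "Ck_on k S f" "Ck_on k S g"
  shows "Ck_on k S (\<lambda>x. f x + g x)"
  using f
proof (induction k arbitrary: f g)
  case 0
  then show ?case by (simp add: continuous_on_add)
next
  case (Suc k)
  show ?case
    by (rule Ck_on_SucI[OF S has_derivative_add[OF Ck_on_SucD(1)[OF Suc.prems(1)] Ck_on_SucD(1)[OF Suc.prems(2)]]])
      (auto intro!: Suc.IH Ck_on_SucD(2)[OF Suc.prems(1)] Ck_on_SucD(2)[OF Suc.prems(2)])
qed

lemma Ck_on_minus: "open S \<Longrightarrow> Ck_on k S f \<Longrightarrow> Ck_on k S (\<lambda>x. - f x)"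
  by (rule Ck_on_bounded_linear[OF bounded_linear_minus[OF bounded_linear_ident]])

lemma Ck_on_diff: "open S \<Longrightarrow> Ck_on k S f \<Longrightarrow> Ck_on k S g \<Longrightarrow> Ck_on k S (\<lambda>x. f x - g x)"
  using Ck_on_add[of S k f "\<lambda>x. - g x"] Ck_on_minus[of S k g] by simp

lemma Ck_on_sum: "open S \<Longrightarrow> (\<And>i. i \<in> I \<Longrightarrow> Ck_on k S (f i)) \<Longrightarrow> Ck_on k S (\<lambda>x. \<Sum>i\<in>I. f i x)"
  by (induction I rule: infinite_finite_induct) (auto intro: Ck_on_add)

lemma Ck_on_bilinear:
  assumes b: "bounded_bilinear b" and S: "open S" and f: "Ck_on k S f" "Ck_on k S g"
  shows "Ck_on k S (\<lambda>x. b (f x) (g x))"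
  using f
proof (induction k arbitrary: f g)
  case 0
  then show ?case using bounded_bilinear.continuous_on[OF b] by simp
next
  case (Suc k)
  show ?case
    by (rule Ck_on_SucI[OF S bounded_bilinear.FDERIV[OF b Ck_on_SucD(1)[OF Suc.prems(1)] Ck_on_SucD(1)[OF Suc.prems(2)]]])
      (auto intro!: Ck_on_add[OF S] Suc.IH Ck_on_SucD(2)[OF Suc.prems(1)] Ck_on_SucD(2)[OF Suc.prems(2)]
        Ck_on_Suc_imp[OF Suc.prems(1)] Ck_on_Suc_imp[OF Suc.prems(2)])
qed

text \<open>Covers the changes of variables made below: projections, slices and differences of
  variables. The derivative is composed with the same affine map, so the induction closes.\<close>

lemma Ck_on_affine:
  assumes L: "bounded_linear L" and S: "open S" "\<And>x. x \<in> S \<Longrightarrow> L x + a \<in> S'" and f: "Ck_on k S' f"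
  shows "Ck_on k S (\<lambda>x. f (L x + a))"
  using f
proof (induction k arbitrary: f)
  case 0
  then show ?case
    using S(2) by (auto intro!: continuous_on_compose2[of S' f] continuous_intros
        linear_continuous_on[OF L])
next
  case (Suc k)
  have "((\<lambda>x. f (L x + a)) has_derivative (\<lambda>v. frechet_derivative f (at (L x + a)) (L v))) (at x)" if "x \<in> S" for x
  proof (rule has_derivative_compose[where f = "\<lambda>x. L x + a" and g = f, OF _ Ck_on_SucD(1)[OF Suc.prems S(2)[OF that]]])
    show "((\<lambda>x. L x + a) has_derivative L) (at x)"
      using bounded_linear_imp_has_derivative[OF L] by (auto intro!: derivative_eq_intros)
  qed
  then show ?case
    by (rule Ck_on_SucI[OF S(1)]) (auto intro!: Suc.IH Ck_on_SucD(2)[OF Suc.prems])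
qed

text \<open>Bootstrapping: the derivative \<open>- B A' B\<close> contains \<open>B\<close> itself,
  which is already known to be of class \<open>k\<close> by induction.\<close>

lemma Ck_on_blinfun_inverse:
  assumes S: "open S" and A: "Ck_on k S A"
    and inv: "\<And>w. w \<in> S \<Longrightarrow> B w o\<^sub>L A w = id_blinfun" "\<And>w. w \<in> S \<Longrightarrow> A w o\<^sub>L B w = id_blinfun"
  shows "Ck_on k S B"
  using A
proof (induction k)
  case 0
  have "isCont B x" if x: "x \<in> S" for x
    unfolding isCont_def
  proof (rule continuous_blinfun_inverse)
    show "(A \<longlongrightarrow> A x) (at x)" using 0 S x by (simp add: continuous_on_eq_continuous_at isCont_def)
    show "\<forall>\<^sub>F w in at x. B w o\<^sub>L A w = id_blinfun"
      using eventually_at_in_open[OF S x] by eventually_elim (use inv in auto)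
  qed (use inv x in auto)
  then show ?case by (simp add: continuous_at_imp_continuous_on)
next
  case (Suc k)
  note comp = Ck_on_bilinear[OF bounded_bilinear_blinfun_compose S]
  show ?case
    by (rule Ck_on_SucI[OF S has_derivative_blinfun_inverse[OF Ck_on_SucD(1)[OF Suc.prems] S _ inv]])
      (auto intro!: Ck_on_minus[OF S] comp Suc.IH Ck_on_Suc_imp[OF Suc.prems] Ck_on_SucD(2)[OF Suc.prems])
qed

lemma Ck_on_inverse:
  fixes f :: "'a::real_normed_vector \<Rightarrow> 'b::real_normed_field"
  assumes S: "open S" and f: "Ck_on k S f" "\<And>x. x \<in> S \<Longrightarrow> f x \<noteq> 0"
  shows "Ck_on k S (\<lambda>x. inverse (f x))"
  using f(1)
proof (induction k)
  case 0
  then show ?case using f(2) by (auto intro!: continuous_intros)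
next
  case (Suc k)
  note mult = Ck_on_bilinear[OF bounded_bilinear_mult S]
  have "((\<lambda>x. inverse (f x)) has_derivative (\<lambda>v. - (inverse (f x) * frechet_derivative f (at x) v * inverse (f x)))) (at x)"
    if "x \<in> S" for x
    by (rule Deriv.has_derivative_inverse[OF f(2)[OF that] Ck_on_SucD(1)[OF Suc.prems that]])
  then show ?case
    by (rule Ck_on_SucI[OF S])
      (auto intro!: Ck_on_minus[OF S] mult Suc.IH Ck_on_Suc_imp[OF Suc.prems] Ck_on_SucD(2)[OF Suc.prems])
qed

lemma Ck_on_mult:
  fixes f :: "'a::real_normed_vector \<Rightarrow> 'b::real_normed_algebra"
  shows "open S \<Longrightarrow> Ck_on k S f \<Longrightarrow> Ck_on k S g \<Longrightarrow> Ck_on k S (\<lambda>x. f x * g x)"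
  by (rule Ck_on_bilinear[OF bounded_bilinear_mult])

lemma Ck_on_divide:
  fixes f :: "'a::real_normed_vector \<Rightarrow> 'b::real_normed_field"
  shows "open S \<Longrightarrow> Ck_on k S f \<Longrightarrow> Ck_on k S g \<Longrightarrow> (\<And>x. x \<in> S \<Longrightarrow> g x \<noteq> 0) \<Longrightarrow> Ck_on k S (\<lambda>x. f x / g x)"
  unfolding divide_inverse by (intro Ck_on_mult Ck_on_inverse)

lemma Ck_on_scaleC: "open S \<Longrightarrow> Ck_on k S f \<Longrightarrow> Ck_on k S g \<Longrightarrow> Ck_on k S (\<lambda>x. f x *\<^sub>C g x :: 'h::complex_hilbert)"
  by (rule Ck_on_bilinear[OF bounded_bilinear_scaleC])

lemma Ck_on_blinfun_apply:
  "open S \<Longrightarrow> Ck_on k S T \<Longrightarrow> Ck_on k S f \<Longrightarrow> Ck_on k S (\<lambda>x. blinfun_apply (T x) (f x))"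
  by (rule Ck_on_bilinear[OF bounded_bilinear_blinfun_apply])

lemma Ck_on_vhol: "open V \<Longrightarrow> vhol V f \<Longrightarrow> Ck_on k V f"
proof (induction k arbitrary: f)
  case 0
  then show ?case by (simp add: vhol_continuous_on)
next
  case (Suc k)
  show ?case
    by (rule Ck_on_SucI[OF Suc.prems(1) has_derivative_vderiv[OF Suc.prems(2)]])
      (auto intro: Ck_on_scaleC[OF Suc.prems(1) Ck_on_const Suc.IH[OF Suc.prems(1) vhol_vderiv[OF Suc.prems(2,1)]]])
qed

subsection \<open>Integrals depending on a parameter\<close>

text \<open>Continuity of coordinates in a finite-dimensional normed space that carries no Euclidean
  structure, such as the model space of the manifold. A new vector has positive distance
  \<open>\<delta>\<close> from the span of the others, and this bounds its coordinate.\<close>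

lemma finite_independent_coordinates_bounded:
  fixes B :: "'a::real_normed_vector set"
  assumes "finite B" "independent B"
  shows "\<exists>C\<ge>0. \<forall>c. \<forall>b\<in>B. \<bar>c b\<bar> \<le> C * norm (\<Sum>b\<in>B. c b *\<^sub>R b)"
  using assms
proof (induction B rule: finite_induct)
  case empty
  then show ?case by auto
next
  case (insert a B)
  have ind: "independent B" "a \<notin> span B"
    using insert.prems insert.hyps(2) by (auto simp: independent_insert)
  obtain C where C: "C \<ge> 0" "\<And>c b. b \<in> B \<Longrightarrow> \<bar>c b\<bar> \<le> C * norm (\<Sum>b\<in>B. c b *\<^sub>R b)"
    using insert.IH[OF ind(1)] by blast
  \<comment> \<open>By the bound for \<open>B\<close>, the coordinates of a convergent sequence are
    Cauchy, and their limits are coordinates of the limit. Closedness is what makes the distance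
    \<open>\<delta>\<close> positive.\<close>
  have "closed (span B)"
    unfolding closed_sequential_limits
  proof (intro allI impI, elim conjE)
    fix x l assume x: "\<forall>n. x n \<in> span B" and l: "x \<longlonglongrightarrow> l"
    have "\<forall>n. \<exists>c. x n = (\<Sum>b\<in>B. c b *\<^sub>R b)"
      using x by (simp add: span_finite[OF insert.hyps(1)] image_iff)
    then obtain c where c: "\<And>n. x n = (\<Sum>b\<in>B. c n b *\<^sub>R b)" by metis
    have "\<exists>l. (\<lambda>n. c n b) \<longlonglongrightarrow> l" if b: "b \<in> B" for b
    proof -
      have le: "\<bar>c m b - c n b\<bar> \<le> C * norm (x m - x n)" for m n
        using C(2)[OF b, of "\<lambda>b. c m b - c n b"] by (simp add: c scaleR_diff_left sum_subtractf)
      have "Cauchy (\<lambda>n. c n b)"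
      proof (rule metric_CauchyI)
        fix e :: real assume e: "e > 0"
        then have "e / (C + 1) > 0" using C(1) by simp
        from metric_CauchyD[OF LIMSEQ_imp_Cauchy[OF l] this]
        obtain M where M: "\<forall>m\<ge>M. \<forall>n\<ge>M. dist (x m) (x n) < e / (C + 1)" by blast
        have "dist (c m b) (c n b) < e" if "m \<ge> M" "n \<ge> M" for m n
        proof -
          have "\<bar>c m b - c n b\<bar> \<le> (C + 1) * norm (x m - x n)"
            using le[of m n] mult_right_mono[of C "C + 1" "norm (x m - x n)"] by simp
          also have "\<dots> < (C + 1) * (e / (C + 1))"
            using M that C(1) by (intro mult_strict_left_mono) (auto simp: dist_norm)
          finally show ?thesis using C(1) by (simp add: dist_real_def)
        qed
        then show "\<exists>M. \<forall>m\<ge>M. \<forall>n\<ge>M. dist (c m b) (c n b) < e" by blast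
      qed
      then show ?thesis using Cauchy_convergent convergent_def by blast
    qed
    then obtain d where d: "\<And>b. b \<in> B \<Longrightarrow> (\<lambda>n. c n b) \<longlonglongrightarrow> d b" by metis
    have "x \<longlonglongrightarrow> (\<Sum>b\<in>B. d b *\<^sub>R b)"
      unfolding c[abs_def] by (intro tendsto_sum tendsto_scaleR d tendsto_const)
    then have "l = (\<Sum>b\<in>B. d b *\<^sub>R b)" using LIMSEQ_unique l by blast
    then show "l \<in> span B" by (simp add: span_sum span_scale span_base)
  qed
  then obtain \<delta> where \<delta>: "\<delta> > 0" "ball a \<delta> \<subseteq> - span B"
    using ind(2) openE[of "- span B" a] by (auto simp: open_Compl)
  \<comment> \<open>The first entry bounds the coordinate of \<open>a\<close>; the second bounds the
    others after \<open>c a *\<^sub>R a\<close> has been subtracted.\<close>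
  define C' where "C' = max (1 / \<delta>) (C * (1 + norm a / \<delta>))"
  have "\<bar>c b\<bar> \<le> C' * norm (\<Sum>b\<in>insert a B. c b *\<^sub>R b)" if b: "b \<in> insert a B" for c b
  proof -
    define w where "w = (\<Sum>b\<in>B. c b *\<^sub>R b)"
    define v where "v = (\<Sum>b\<in>insert a B. c b *\<^sub>R b)"
    have v: "v = c a *\<^sub>R a + w" using insert.hyps by (simp add: v_def w_def)
    have w: "w \<in> span B" by (simp add: w_def span_sum span_scale span_base)
    have ca: "\<bar>c a\<bar> \<le> norm v / \<delta>"
    proof (cases "c a = 0")
      case False
      have "- (inverse (c a) *\<^sub>R w) \<in> span B" using w by (intro span_neg span_scale)
      then have "\<delta> \<le> dist a (- (inverse (c a) *\<^sub>R w))" using \<delta>(2) by (force simp: not_less[symmetric])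
      also have "\<dots> = norm (inverse (c a) *\<^sub>R v)"
        using False by (simp add: dist_norm v scaleR_add_right)
      also have "\<dots> = norm v / \<bar>c a\<bar>" by (simp add: divide_inverse_commute)
      finally show ?thesis using False \<delta>(1) by (simp add: field_simps)
    qed (use \<delta> in simp)
    show ?thesis
    proof (cases "b = a")
      case True
      have "norm v / \<delta> \<le> C' * norm v"
        unfolding C'_def divide_inverse by (subst mult.commute, intro mult_right_mono) auto
      with ca have "\<bar>c a\<bar> \<le> C' * norm v" by (rule order_trans)
      then show ?thesis using True by (simp add: v_def)
    next
      case False
      then have "\<bar>c b\<bar> \<le> C * norm w" using C(2)[of b c] b by (simp add: w_def)
      also have "norm w \<le> norm v + \<bar>c a\<bar> * norm a"
        using norm_triangle_ineq4[of v "c a *\<^sub>R a"] by (simp add: v)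
      also have "\<dots> \<le> norm v + norm v / \<delta> * norm a" using ca by (intro add_left_mono mult_right_mono) auto
      also have "\<dots> = (1 + norm a / \<delta>) * norm v" by (simp add: algebra_simps)
      finally have "\<bar>c b\<bar> \<le> C * (1 + norm a / \<delta>) * norm v" using C(1) by (simp add: mult_left_mono mult.assoc)
      also have "\<dots> \<le> C' * norm v" by (intro mult_right_mono) (auto simp: C'_def)
      finally show ?thesis unfolding v_def .
    qed
  qed
  moreover have "C' \<ge> 0" using \<delta>(1) by (simp add: C'_def le_max_iff_disj)
  ultimately show ?case by blast
qed

lemma finite_span_coordinates:
  fixes B :: "'a::real_normed_vector set"
  assumes "finite B" "span B = UNIV"
  obtains B' :: "'a set" and C :: real where "finite B'" "C \<ge> 0"
    "\<And>v. \<exists>c. v = (\<Sum>b\<in>B'. c b *\<^sub>R b) \<and> (\<forall>b\<in>B'. \<bar>c b\<bar> \<le> C * norm v)"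
proof -
  obtain B' where B': "B' \<subseteq> B" "independent B'" "B \<subseteq> span B'"
    using maximal_independent_subset[of B] by blast
  have fin: "finite B'" using B' assms finite_subset by blast
  have sp: "span B' = UNIV" using B'(3) assms(2) by (metis span_mono span_span top.extremum_uniqueI)
  obtain C where C: "C \<ge> 0" "\<And>c b. b \<in> B' \<Longrightarrow> \<bar>c b\<bar> \<le> C * norm (\<Sum>b\<in>B'. c b *\<^sub>R b)"
    using finite_independent_coordinates_bounded[OF fin B'(2)] by blast
  have coord: "\<exists>c. v = (\<Sum>b\<in>B'. c b *\<^sub>R b) \<and> (\<forall>b\<in>B'. \<bar>c b\<bar> \<le> C * norm v)" for v
  proof -
    have "v \<in> span B'" using sp by simp
    then obtain c where "v = (\<Sum>b\<in>B'. c b *\<^sub>R b)" by (auto simp: span_finite[OF fin])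
    then show ?thesis using C(2) by blast
  qed
  show thesis by (rule that[OF fin C(1) coord])
qed

lemma linear_bound_on_basis:
  fixes g :: "'a::real_normed_vector \<Rightarrow> 'b::real_normed_vector"
  assumes g: "linear g" and B: "\<And>b. b \<in> B \<Longrightarrow> norm (g b) \<le> e"
    and v: "v = (\<Sum>b\<in>B. c b *\<^sub>R b)" "\<And>b. b \<in> B \<Longrightarrow> \<bar>c b\<bar> \<le> C * norm v"
  shows "norm (g v) \<le> real (card B) * C * e * norm v"
proof -
  have "g v = (\<Sum>b\<in>B. c b *\<^sub>R g b)" by (subst v) (simp add: linear_sum[OF g] linear_scale[OF g])
  also have "norm \<dots> \<le> (\<Sum>b\<in>B. (C * norm v) * e)"
  proof (rule sum_norm_le)
    fix b assume b: "b \<in> B"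
    have "C * norm v \<ge> 0" using v(2)[OF b] by (meson abs_ge_zero order_trans)
    then show "norm (c b *\<^sub>R g b) \<le> (C * norm v) * e"
      using v(2)[OF b] B[OF b] by (auto intro: mult_mono)
  qed
  finally show ?thesis by (simp add: mult_ac)
qed

text \<open>\<open>Ck_on\<close> controls the derivative one direction at a time. Finite dimension
  upgrades continuity in finitely many basis directions to an operator norm estimate, to which the
  mean value inequality applies uniformly in \<open>t\<close>.\<close>

lemma has_derivative_integral_param:
  fixes H :: "'a::real_normed_vector \<Rightarrow> real \<Rightarrow> 'b::banach" and H' :: "'a \<Rightarrow> real \<Rightarrow> 'a \<Rightarrow> 'b"
  assumes B: "finite B" "span B = (UNIV :: 'a set)" and S: "open S" and x: "x \<in> S"
    and der: "\<And>x t. x \<in> S \<Longrightarrow> t \<in> {0..1} \<Longrightarrow> ((\<lambda>x. H x t) has_derivative H' x t) (at x)"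
    and cont: "\<And>x. x \<in> S \<Longrightarrow> continuous_on {0..1} (H x)"
    and cont': "\<And>v. continuous_on (S \<times> {0..1}) (\<lambda>(x, t). H' x t v)"
  shows "((\<lambda>x. integral {0..1} (H x)) has_derivative (\<lambda>v. integral {0..1} (\<lambda>t. H' x t v))) (at x)"
proof -
  obtain B' :: "'a set" and C :: real where B': "finite B'" "C \<ge> 0"
    "\<And>v. \<exists>c. v = (\<Sum>b\<in>B'. c b *\<^sub>R b) \<and> (\<forall>b\<in>B'. \<bar>c b\<bar> \<le> C * norm v)"
    by (rule finite_span_coordinates[OF B]) (rule that)
  have lin: "linear (H' y t)" if "y \<in> S" "t \<in> {0..1}" for y t
    using has_derivative_linear[OF der[OF that]] .
  have cx: "continuous_on {0..1} (\<lambda>t. H' x t v)" for v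
  proof -
    have "continuous_on {0..1} (\<lambda>t. case (x, t) of (x, t) \<Rightarrow> H' x t v)"
      by (rule continuous_on_compose2[OF cont'[of v]], intro continuous_intros) (use x in auto)
    then show ?thesis by simp
  qed
  have ix: "(\<lambda>t. H' x t v) integrable_on {0..1}" for v by (rule integrable_continuous_real[OF cx])
  define G where "G v = integral {0..1} (\<lambda>t. H' x t v)" for v
  have Glin: "linear G"
  proof (rule linearI)
    show "G (u + v) = G u + G v" for u v
      unfolding G_def integral_add[OF ix ix, symmetric]
      by (intro integral_cong) (use linear_add[OF lin[OF x]] in auto)
    show "G (r *\<^sub>R v) = r *\<^sub>R G v" for r v
      unfolding G_def integral_cmul[symmetric]
      by (intro integral_cong) (use linear_scale[OF lin[OF x]] in auto)
  qed
  have "bounded_linear G"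
  proof -
    define M where "M = (\<Sum>b\<in>B'. norm (G b))"
    have M: "norm (G b) \<le> M" if "b \<in> B'" for b
      unfolding M_def by (rule member_le_sum[OF that]) (use B' in auto)
    have "norm (G v) \<le> norm v * (real (card B') * C * M)" for v
      using linear_bound_on_basis[OF Glin M, of B' v _ C] B'(3)[of v] by (auto simp: mult_ac)
    then show ?thesis
      by (intro bounded_linear_intro linear_add[OF Glin] linear_scale[OF Glin])
  qed
  moreover have "\<exists>d>0. \<forall>y. norm (y - x) < d \<longrightarrow>
     norm (integral {0..1} (H y) - integral {0..1} (H x) - G (y - x)) \<le> e * norm (y - x)" if e: "e > 0" for e
  proof -
    \<comment> \<open>A bound \<open>e'\<close> on the basis vectors becomes
      \<open>card B' * C * e'\<close> for the operator norm, hence at most \<open>e\<close>. The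
      summand \<open>1\<close> keeps the denominator positive.\<close>
    define e' where "e' = e / (real (card B') * C + 1)"
    have pos: "real (card B') * C + 1 > 0" using B'(2) by (simp add: add_nonneg_pos)
    then have e': "e' > 0" using e by (simp add: e'_def)
    have "\<forall>b\<in>B'. \<exists>X. x \<in> X \<and> open X \<and> (\<forall>y\<in>X \<inter> S. \<forall>t\<in>{0..1}. norm (H' y t b - H' x t b) \<le> e')"
    proof
      fix b
      obtain X where "x \<in> X" "open X" "\<forall>y\<in>X \<inter> S. \<forall>t\<in>{0..1}.
          dist ((\<lambda>(x, t). H' x t b) (y, t)) ((\<lambda>(x, t). H' x t b) (x, t)) \<le> e'"
        using continuous_on_prod_compactE[OF cont'[of b] compact_Icc x e'] by blast
      then show "\<exists>X. x \<in> X \<and> open X \<and> (\<forall>y\<in>X \<inter> S. \<forall>t\<in>{0..1}. norm (H' y t b - H' x t b) \<le> e')"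
        by (intro exI[of _ X]) (auto simp: dist_norm)
    qed
    then obtain X where X: "\<And>b. b \<in> B' \<Longrightarrow> x \<in> X b" "\<And>b. b \<in> B' \<Longrightarrow> open (X b)"
      "\<And>b y t. b \<in> B' \<Longrightarrow> y \<in> X b \<inter> S \<Longrightarrow> t \<in> {0..1} \<Longrightarrow> norm (H' y t b - H' x t b) \<le> e'" by metis
    have "open (S \<inter> (\<Inter>b\<in>B'. X b))" using S X(2) B'(1) by (intro open_Int open_INT) auto
    moreover have "x \<in> S \<inter> (\<Inter>b\<in>B'. X b)" using x X(1) by auto
    ultimately obtain d where d: "d > 0" "ball x d \<subseteq> S \<inter> (\<Inter>b\<in>B'. X b)" using openE by blast
    have "norm (integral {0..1} (H y) - integral {0..1} (H x) - G (y - x)) \<le> e * norm (y - x)"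
      if y: "norm (y - x) < d" for y
    proof -
      have yS: "y \<in> S" using d(2) y by (auto simp: dist_norm norm_minus_commute)
      have bound: "norm (H y t - H x t - H' x t (y - x)) \<le> norm (y - x) * e" if t: "t \<in> {0..1}" for t
      proof (rule differentiable_bound_linearization[where S = "ball x d" and f' = "\<lambda>z. H' z t"])
        show "x + s *\<^sub>R (y - x) \<in> ball x d" if "s \<in> {0..1}" for s
        proof -
          have "norm (s *\<^sub>R (y - x)) \<le> 1 * norm (y - x)" using that mult_right_mono[of s 1 "norm (y - x)"] by simp
          then show ?thesis using y by (simp add: dist_norm)
        qed
        show "((\<lambda>x. H x t) has_derivative H' z t) (at z within ball x d)" if "z \<in> ball x d" for z
          using der[of z t] d(2) that t by (blast intro: has_derivative_at_withinI)
        show "onorm (H' z t - H' x t) \<le> e" if z: "z \<in> ball x d" for z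
        proof (rule onorm_bound)
          show "0 \<le> e" using e by simp
          fix v
          have zS: "z \<in> S" using z d(2) by blast
          have l: "linear (\<lambda>v. H' z t v - H' x t v)"
            by (intro linear_compose_sub lin zS x t)
          have "norm (H' z t v - H' x t v) \<le> real (card B') * C * e' * norm v"
          proof -
            obtain c where c: "v = (\<Sum>b\<in>B'. c b *\<^sub>R b)" "\<forall>b\<in>B'. \<bar>c b\<bar> \<le> C * norm v"
              using B'(3) by blast
            show ?thesis
              by (rule linear_bound_on_basis[OF l _ c(1)]) (use X(3) z zS d(2) t c(2) in auto)
          qed
          also have "\<dots> \<le> (real (card B') * C + 1) * e' * norm v"
            using e' by (intro mult_right_mono) auto
          also have "\<dots> = e * norm v" using pos by (simp add: e'_def)
          finally show "norm ((H' z t - H' x t) v) \<le> e * norm v" by simp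
        qed
      qed (use d in simp)
      have iy: "H y integrable_on {0..1}" "H x integrable_on {0..1}"
        by (intro integrable_continuous_real cont yS x)+
      have "integral {0..1} (H y) - integral {0..1} (H x) - G (y - x) =
          integral {0..1} (\<lambda>t. H y t - H x t - H' x t (y - x))"
        unfolding G_def by (simp add: integral_diff iy ix integrable_diff)
      also have "norm \<dots> \<le> (norm (y - x) * e) * (1 - 0)"
        by (rule integral_bound) (auto intro!: continuous_intros cont yS x cx bound)
      finally show ?thesis by (simp add: mult.commute)
    qed
    then show ?thesis using d(1) by blast
  qed
  ultimately show ?thesis unfolding G_def[abs_def] by (simp add: has_derivative_at_alt)
qed

lemma Ck_on_integral:
  fixes H :: "'a::real_normed_vector \<times> complex \<Rightarrow> 'b::banach" and \<gamma> :: "real \<Rightarrow> complex"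
  assumes B: "finite B" "span B = (UNIV :: 'a set)" and S: "open S"
    and \<gamma>: "continuous_on {0..1} \<gamma>" "\<And>x t. x \<in> S \<Longrightarrow> t \<in> {0..1} \<Longrightarrow> (x, \<gamma> t) \<in> \<Omega>"
    and H: "Ck_on k \<Omega> H"
  shows "Ck_on k S (\<lambda>x. integral {0..1} (\<lambda>t. H (x, \<gamma> t)))"
proof -
  have comp: "continuous_on (S \<times> {0..1}) (\<lambda>(x, t). F (x, \<gamma> t))"
    if F: "continuous_on \<Omega> F" for F :: "'a \<times> complex \<Rightarrow> 'b"
  proof -
    have [continuous_intros]: "continuous_on (S \<times> {0..1}) (\<lambda>p. \<gamma> (snd p))"
      by (rule continuous_on_compose2[OF \<gamma>(1)]) (auto intro: continuous_on_snd continuous_on_id)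
    show ?thesis
      unfolding split_beta
      by (rule continuous_on_compose2[OF F], intro continuous_intros) (use \<gamma>(2) in auto)
  qed
  have comp1: "continuous_on {0..1} (\<lambda>t. F (x, \<gamma> t))"
    if "continuous_on \<Omega> F" "x \<in> S" for F :: "'a \<times> complex \<Rightarrow> 'b" and x
    by (rule continuous_on_compose2[OF that(1)], intro continuous_intros \<gamma>(1)) (use \<gamma>(2) that(2) in auto)
  show ?thesis
  using H
proof (induction k arbitrary: H)
  case (0 H)
  have "continuous_on (S \<times> cbox 0 1) (\<lambda>(x, t). H (x, \<gamma> t))"
    using comp[of H] 0 by (simp add: cbox_interval)
  from integral_continuous_on_param[OF this] show ?case by simp
next
  case (Suc k H)
  \<comment> \<open>The parameter derivative only moves the first component. It is again the
    integral of a function on \<open>\<Omega>\<close>, of one class less, so the induction applies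
    to it.\<close>
  define H' where "H' x t v = frechet_derivative H (at (x, \<gamma> t)) (v, 0)" for x t v
  have Hc: "continuous_on \<Omega> H" by (rule Ck_on_continuous[OF Suc.prems])
  have Hvc: "continuous_on \<Omega> (\<lambda>p. frechet_derivative H (at p) v)" for v
    by (rule Ck_on_continuous[OF Ck_on_SucD(2)[OF Suc.prems]])
  have "((\<lambda>x. integral {0..1} (\<lambda>t. H (x, \<gamma> t))) has_derivative (\<lambda>v. integral {0..1} (\<lambda>t. H' x t v))) (at x)"
    if "x \<in> S" for x
  proof (rule has_derivative_integral_param[OF B S that])
    fix x t assume x: "x \<in> S" "t \<in> {0..1::real}"
    have "((\<lambda>x. (x, \<gamma> t)) has_derivative (\<lambda>v. (v, 0))) (at x)" by (auto intro!: derivative_eq_intros)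
    from has_derivative_compose[where g = H, OF this Ck_on_SucD(1)[OF Suc.prems \<gamma>(2)[OF x]]]
    show "((\<lambda>x. H (x, \<gamma> t)) has_derivative H' x t) (at x)" by (simp add: H'_def[abs_def])
  next
    fix x assume "x \<in> S"
    then show "continuous_on {0..1} (\<lambda>t. H (x, \<gamma> t))"
      by (rule comp1[OF Hc])
  next
    fix v
    show "continuous_on (S \<times> {0..1}) (\<lambda>(x, t). H' x t v)"
      unfolding H'_def by (rule comp[OF Hvc])
  qed
  then show ?case
  proof (rule Ck_on_SucI[OF S])
    fix v
    show "Ck_on k S (\<lambda>x. integral {0..1} (\<lambda>t. H' x t v))"
      unfolding H'_def by (rule Suc.IH[OF Ck_on_SucD(2)[OF Suc.prems]])
  qed
qed
qed

lemma finite_span_times_complex: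
  assumes "finite B" "span B = (UNIV :: 'm::real_normed_vector set)"
  shows "\<exists>B'. finite B' \<and> span B' = (UNIV :: ('m \<times> complex) set)"
proof -
  define B' where "B' = ((\<lambda>b. (b, 0)) ` B \<union> {(0, 1), (0, \<i>)} :: ('m \<times> complex) set)"
  have 1: "(v, 0) \<in> span B'" for v :: 'm
  proof -
    have "linear (\<lambda>v::'m. (v, 0::complex))" by (auto intro!: linearI)
    from linear_span_image[OF this, of B] have "(\<lambda>v. (v, 0)) ` UNIV = span ((\<lambda>v. (v, 0::complex)) ` B)"
      using assms(2) by simp
    moreover have "span ((\<lambda>v. (v, 0::complex)) ` B) \<subseteq> span B'" by (rule span_mono) (auto simp: B'_def)
    ultimately show ?thesis by blast
  qed
  have 2: "(0, z) \<in> span B'" for z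
  proof -
    have "(0, z) = Re z *\<^sub>R (0 :: 'm, 1) + Im z *\<^sub>R (0, \<i>)" by (simp add: complex_eq_iff)
    also have "\<dots> \<in> span B'"
      by (intro span_add span_scale span_base) (auto simp: B'_def)
    finally show ?thesis .
  qed
  have "p \<in> span B'" for p
    using span_add[OF 1[of "fst p"] 2[of "snd p"]] by simp
  then have "span B' = UNIV" by blast
  moreover have "finite B'" using assms by (simp add: B'_def)
  ultimately show ?thesis by blast
qed

subsection \<open>Smoothness of coefficients\<close>

lemma smooth_on_subset: "smooth_on S f \<Longrightarrow> T \<subseteq> S \<Longrightarrow> smooth_on T f"
  by (auto simp: smooth_on_def intro: Ck_on_subset)

lemma smooth_on_cong: "open S \<Longrightarrow> (\<And>x. x \<in> S \<Longrightarrow> f x = g x) \<Longrightarrow> smooth_on S f \<Longrightarrow> smooth_on S g"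
  unfolding smooth_on_def by (blast intro: Ck_on_cong)

lemma smooth_on_local:
  "(\<And>x. x \<in> S \<Longrightarrow> \<exists>N. open N \<and> x \<in> N \<and> smooth_on N f) \<Longrightarrow> smooth_on S f"
  unfolding smooth_on_def by (meson Ck_on_local)

text \<open>Gaussian elimination: the test \<open>t0\<close> is a pivot.\<close>

lemma smooth_coefficients:
  fixes g :: "'i \<Rightarrow> 'a::real_normed_vector \<Rightarrow> 't \<Rightarrow> complex"
  assumes "finite I" "open S" "x0 \<in> S"
    and "\<And>i t. i \<in> I \<Longrightarrow> t \<in> T \<Longrightarrow> \<exists>N. open N \<and> x0 \<in> N \<and> smooth_on N (\<lambda>x. g i x t)"
    and "\<And>t. t \<in> T \<Longrightarrow> \<exists>N. open N \<and> x0 \<in> N \<and> smooth_on N (\<lambda>x. h x t)"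
    and "\<And>x t. x \<in> S \<Longrightarrow> t \<in> T \<Longrightarrow> h x t = (\<Sum>i\<in>I. f i x * g i x t)"
    and "\<And>c. (\<And>t. t \<in> T \<Longrightarrow> (\<Sum>i\<in>I. c i * g i x0 t) = 0) \<Longrightarrow> (\<forall>i\<in>I. c i = 0)"
  shows "\<exists>N. open N \<and> x0 \<in> N \<and> (\<forall>i\<in>I. smooth_on N (f i))"
  using assms
proof (induction I arbitrary: S g h rule: finite_induct)
  case empty
  then show ?case by auto
next
  case (insert a I)
  \<comment> \<open>Otherwise the coefficient vector that is \<open>1\<close> at \<open>a\<close>
    and \<open>0\<close> elsewhere would pass all tests at \<open>x0\<close>.\<close>
  have "\<exists>t0\<in>T. g a x0 t0 \<noteq> 0"
  proof (rule ccontr)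
    assume "\<not> ?thesis"
    then have "(\<Sum>i\<in>insert a I. (if i = a then 1 else 0) * g i x0 t) = 0" if "t \<in> T" for t
      using that insert.hyps by (intro sum.neutral) auto
    from insert.prems(6)[OF this] show False by simp
  qed
  then obtain t0 where t0: "t0 \<in> T" "g a x0 t0 \<noteq> 0" by blast
  obtain N0 where N0: "open N0" "x0 \<in> N0" "smooth_on N0 (\<lambda>x. g a x t0)"
    using insert.prems(3)[of a t0] t0 by auto
  have "continuous_on N0 (\<lambda>x. g a x t0)"
    using N0(3) Ck_on.simps(1) unfolding smooth_on_def by blast
  then have "open (N0 \<inter> (\<lambda>x. g a x t0) -` (- {0}))"
    using N0(1) by (intro continuous_open_preimage) auto
  then obtain N1 where N1: "open N1" "x0 \<in> N1" "N1 \<subseteq> S" "smooth_on N1 (\<lambda>x. g a x t0)"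
      "\<And>x. x \<in> N1 \<Longrightarrow> g a x t0 \<noteq> 0"
  proof -
    assume *: "\<And>N1. open N1 \<Longrightarrow> x0 \<in> N1 \<Longrightarrow> N1 \<subseteq> S \<Longrightarrow> smooth_on N1 (\<lambda>x. g a x t0) \<Longrightarrow>
      (\<And>x. x \<in> N1 \<Longrightarrow> g a x t0 \<noteq> 0) \<Longrightarrow> thesis"
    show thesis
      by (rule *[of "S \<inter> (N0 \<inter> (\<lambda>x. g a x t0) -` (- {0}))"])
        (use insert.prems(1,2) N0 t0 \<open>open (N0 \<inter> (\<lambda>x. g a x t0) -` (- {0}))\<close> in \<open>auto intro: smooth_on_subset\<close>)
  qed
  \<comment> \<open>Elimination of the unknown \<open>f a\<close>: where the pivot is nonzero,
    \<open>E (g a)\<close> vanishes for every test.\<close>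
  define E where "E k x t = k x t - k x t0 / g a x t0 * g a x t" for k :: "'a \<Rightarrow> 't \<Rightarrow> complex" and x t
  have E: "\<exists>N. open N \<and> x0 \<in> N \<and> smooth_on N (\<lambda>x. E k x t)"
    if k: "\<And>t. t \<in> T \<Longrightarrow> \<exists>N. open N \<and> x0 \<in> N \<and> smooth_on N (\<lambda>x. k x t)" and t: "t \<in> T" for k t
  proof -
    obtain M1 where M1: "open M1" "x0 \<in> M1" "smooth_on M1 (\<lambda>x. k x t)" using k[OF t] by blast
    obtain M2 where M2: "open M2" "x0 \<in> M2" "smooth_on M2 (\<lambda>x. k x t0)" using k[OF t0(1)] by blast
    obtain M3 where M3: "open M3" "x0 \<in> M3" "smooth_on M3 (\<lambda>x. g a x t)" using insert.prems(3)[of a t] t by auto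
    define M where "M = M1 \<inter> M2 \<inter> M3 \<inter> N1"
    have M: "open M" "x0 \<in> M" using M1 M2 M3 N1 by (auto simp: M_def)
    have "Ck_on m M (\<lambda>x. E k x t)" for m
      unfolding E_def using M1(3) M2(3) M3(3) N1(4,5)
      by (intro Ck_on_diff Ck_on_mult Ck_on_divide M) (auto simp: smooth_on_def M_def intro: Ck_on_subset)
    then show ?thesis using M by (auto simp: smooth_on_def)
  qed
  have "\<exists>N. open N \<and> x0 \<in> N \<and> (\<forall>i\<in>I. smooth_on N (f i))"
  proof (rule insert.IH[OF N1(1,2), where g = "\<lambda>i. E (g i)" and h = "E h"])
    fix i t assume "i \<in> I" "t \<in> T"
    then show "\<exists>N. open N \<and> x0 \<in> N \<and> smooth_on N (\<lambda>x. E (g i) x t)"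
      using insert.prems(3) by (intro E) auto
  next
    fix t assume "t \<in> T"
    then show "\<exists>N. open N \<and> x0 \<in> N \<and> smooth_on N (\<lambda>x. E h x t)"
      using insert.prems(4) by (intro E) auto
  next
    fix x t assume x: "x \<in> N1" "t \<in> T"
    have h: "h x t' = f a x * g a x t' + (\<Sum>i\<in>I. f i x * g i x t')" if "t' \<in> T" for t'
      using insert.prems(5)[of x t'] x N1(3) that insert.hyps by auto
    have "E h x t = (\<Sum>i\<in>I. f i x * g i x t) - (\<Sum>i\<in>I. f i x * g i x t0) / g a x t0 * g a x t"
      unfolding E_def h[OF x(2)] h[OF t0(1)] using N1(5)[OF x(1)] by (simp add: field_simps)
    also have "\<dots> = (\<Sum>i\<in>I. f i x * E (g i) x t)"
      by (simp add: E_def sum_subtractf right_diff_distrib sum_divide_distrib sum_distrib_left sum_distrib_right mult_ac)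
    finally show "E h x t = (\<Sum>i\<in>I. f i x * E (g i) x t)" .
  next
    fix c assume c: "\<And>t. t \<in> T \<Longrightarrow> (\<Sum>i\<in>I. c i * E (g i) x0 t) = 0"
    \<comment> \<open>The pivot test determines the coefficient at \<open>a\<close>. With this
      choice a relation among the reduced columns becomes one among the original columns.\<close>
    define d where "d = c(a := - (\<Sum>i\<in>I. c i * g i x0 t0) / g a x0 t0)"
    have "(\<Sum>i\<in>insert a I. d i * g i x0 t) = 0" if t: "t \<in> T" for t
    proof -
      have "(\<Sum>i\<in>insert a I. d i * g i x0 t) = d a * g a x0 t + (\<Sum>i\<in>I. c i * g i x0 t)"
      proof -
        have "(\<Sum>i\<in>I. d i * g i x0 t) = (\<Sum>i\<in>I. c i * g i x0 t)"
          using insert.hyps by (intro sum.cong) (auto simp: d_def)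
        then show ?thesis using insert.hyps by simp
      qed
      also have "\<dots> = (\<Sum>i\<in>I. c i * E (g i) x0 t)"
        by (simp add: d_def E_def sum_subtractf right_diff_distrib sum_divide_distrib sum_distrib_left sum_distrib_right mult_ac
            sum_negf[symmetric])
      finally show ?thesis using c[OF t] by simp
    qed
    from insert.prems(6)[OF this] show "\<forall>i\<in>I. c i = 0"
      using insert.hyps by (auto simp: d_def split: if_splits)
  qed
  then obtain N2 where N2: "open N2" "x0 \<in> N2" "\<And>i. i \<in> I \<Longrightarrow> smooth_on N2 (f i)" by blast
  obtain M where M: "open M" "x0 \<in> M" "smooth_on M (\<lambda>x. h x t0)" using insert.prems(4)[OF t0(1)] by blast
  have "\<exists>N. open N \<and> x0 \<in> N \<and> (\<forall>i\<in>I. smooth_on N (\<lambda>x. g i x t0))"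
  proof -
    have "\<forall>i\<in>I. \<exists>N. open N \<and> x0 \<in> N \<and> smooth_on N (\<lambda>x. g i x t0)"
      using insert.prems(3) t0(1) by blast
    then obtain N where N: "\<And>i. i \<in> I \<Longrightarrow> open (N i) \<and> x0 \<in> N i \<and> smooth_on (N i) (\<lambda>x. g i x t0)" by metis
    have "open (\<Inter>i\<in>I. N i)" "x0 \<in> (\<Inter>i\<in>I. N i)"
      using N insert.hyps(1) by (auto intro!: open_INT)
    moreover have "smooth_on (\<Inter>i\<in>I. N i) (\<lambda>x. g i x t0)" if "i \<in> I" for i
      by (rule smooth_on_subset[of "N i"]) (use N that in auto)
    ultimately show ?thesis by blast
  qed
  then obtain N3 where N3: "open N3" "x0 \<in> N3" "\<And>i. i \<in> I \<Longrightarrow> smooth_on N3 (\<lambda>x. g i x t0)" by blast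
  define N where "N = N1 \<inter> N2 \<inter> N3 \<inter> M"
  have N: "open N" "x0 \<in> N" using N1 N2 N3 M by (auto simp: N_def)
  \<comment> \<open>Back substitution: the pivot test is solved for \<open>f a\<close> in terms of
    coefficients already known to be smooth.\<close>
  have "Ck_on m N (\<lambda>x. (h x t0 - (\<Sum>i\<in>I. f i x * g i x t0)) / g a x t0)" for m
  proof -
    have "Ck_on m N (f i)" "Ck_on m N (\<lambda>x. g i x t0)" if "i \<in> I" for i
      using N2(3)[OF that] N3(3)[OF that] unfolding smooth_on_def N_def by (auto intro: Ck_on_subset)
    moreover have "Ck_on m N (\<lambda>x. h x t0)" "Ck_on m N (\<lambda>x. g a x t0)"
      using N1(4) M(3) unfolding smooth_on_def N_def by (auto intro: Ck_on_subset)
    moreover have "g a x t0 \<noteq> 0" if "x \<in> N" for x using N1(5) that by (simp add: N_def)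
    ultimately show ?thesis by (intro Ck_on_divide Ck_on_diff Ck_on_sum Ck_on_mult N(1)) auto
  qed
  note Ck = this
  have eq: "(h x t0 - (\<Sum>i\<in>I. f i x * g i x t0)) / g a x t0 = f a x" if "x \<in> N" for x
    using insert.prems(5)[of x t0] insert.hyps t0(1) N1(3,5) that by (auto simp: N_def)
  have "smooth_on N (f a)"
    unfolding smooth_on_def by (intro allI Ck_on_cong[OF N(1) eq Ck])
  moreover have "smooth_on N (f i)" if "i \<in> I" for i
    using N2(3)[OF that] by (rule smooth_on_subset) (auto simp: N_def)
  ultimately show ?case using N by blast
qed

section \<open>Transport of singular parts\<close>

text \<open>Covers both a subspace \<open>range \<pi>\<close> of a Hilbert space (\<open>\<theta>\<close> the identity) and a fiber of a bundle
  (\<open>\<pi>\<close> the identity).\<close>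

locale hilb_embedding =
  fixes \<pi> :: "'d::complex_hilbert \<Rightarrow> 'd" and \<theta> :: "'d \<Rightarrow> 'e::complex_vector" and F :: "'e hilb"
  assumes \<pi>: "bounded_linear \<pi>" "clinear_map \<pi>" "\<And>u. \<pi> (\<pi> u) = \<pi> u"
    and \<theta>: "clinear_map \<theta>" "bij_betw \<theta> (range \<pi>) (car F)"
    and bounds: "\<exists>C. \<forall>u\<in>range \<pi>. \<bar>hnorm F (\<theta> u)\<bar> \<le> C * norm u" "\<exists>C. \<forall>u\<in>range \<pi>. norm u \<le> C * hnorm F (\<theta> u)"
begin

definition \<kappa> :: "'e \<Rightarrow> 'd" where "\<kappa> = inv_into (range \<pi>) \<theta>"

lemma range_\<pi>_iff: "u \<in> range \<pi> \<longleftrightarrow> \<pi> u = u"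
  using \<pi>(3) by (metis rangeE rangeI)

lemma subspace_range: "csubspace (range \<pi>)"
  unfolding complex_vector.subspace_def range_\<pi>_iff using clinear_mapD[OF \<pi>(2)] \<pi>(3) by auto

lemma closed_range: "closed (range \<pi>)"
proof -
  have "closed {u. \<pi> u = u}"
    by (intro closed_Collect_eq linear_continuous_on \<pi> continuous_on_id)
  moreover have "range \<pi> = {u. \<pi> u = u}" using range_\<pi>_iff by blast
  ultimately show ?thesis by simp
qed

lemma \<kappa>_\<theta>: "u \<in> range \<pi> \<Longrightarrow> \<kappa> (\<theta> u) = u"
  unfolding \<kappa>_def using \<theta>(2) by (meson bij_betw_inv_into_left)

lemma \<theta>_\<kappa>: "v \<in> car F \<Longrightarrow> \<theta> (\<kappa> v) = v"
  unfolding \<kappa>_def using \<theta>(2) by (meson bij_betw_inv_into_right)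

lemma \<kappa>_range: "v \<in> car F \<Longrightarrow> \<kappa> v \<in> range \<pi>"
  unfolding \<kappa>_def using \<theta>(2) by (metis bij_betw_imp_surj_on inv_into_into)

lemma \<theta>_car: "u \<in> range \<pi> \<Longrightarrow> \<theta> u \<in> car F"
  using \<theta>(2) by (meson bij_betwE)

lemma \<kappa>_diff: "u \<in> car F \<Longrightarrow> v \<in> car F \<Longrightarrow> \<kappa> (u - v) = \<kappa> u - \<kappa> v"
  using \<kappa>_\<theta>[of "\<kappa> u - \<kappa> v"] \<kappa>_range complex_vector.subspace_diff[OF subspace_range]
  by (simp add: clinear_mapD[OF \<theta>(1)] \<theta>_\<kappa>)

lemma \<kappa>_scaleC: "u \<in> car F \<Longrightarrow> \<kappa> (c *\<^sub>C u) = c *\<^sub>C \<kappa> u"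
  using \<kappa>_\<theta>[of "c *\<^sub>C \<kappa> u"] \<kappa>_range complex_vector.subspace_scale[OF subspace_range]
  by (simp add: clinear_mapD[OF \<theta>(1)] \<theta>_\<kappa>)

text \<open>The two norm bounds make a difference quotient converge in \<open>F\<close> exactly if
  its preimage converges. The limit stays in \<open>range \<pi>\<close> because that space is
  closed.\<close>

lemma hol_on_\<theta>:
  assumes V: "open V" and f: "\<And>z. z \<in> V \<Longrightarrow> f z \<in> range \<pi>"
  shows "hol_on F V (\<lambda>z. \<theta> (f z)) \<longleftrightarrow> vhol V f"
proof -
  obtain C where C: "\<And>u. u \<in> range \<pi> \<Longrightarrow> \<bar>hnorm F (\<theta> u)\<bar> \<le> C * norm u" using bounds(1) by blast
  obtain D where D: "\<And>u. u \<in> range \<pi> \<Longrightarrow> norm u \<le> D * hnorm F (\<theta> u)" using bounds(2) by blast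
  have lim: "((\<lambda>w. hnorm F (inverse (w - z) *\<^sub>C (\<theta> (f w) - \<theta> (f z)) - \<theta> m)) \<longlongrightarrow> 0) (at z) \<longleftrightarrow>
    ((\<lambda>w. norm (inverse (w - z) *\<^sub>C (f w - f z) - m)) \<longlongrightarrow> 0) (at z)"
    if z: "z \<in> V" and m: "m \<in> range \<pi>" for z m
  proof -
    define q where "q w = inverse (w - z) *\<^sub>C (f w - f z) - m" for w
    have \<theta>q: "inverse (w - z) *\<^sub>C (\<theta> (f w) - \<theta> (f z)) - \<theta> m = \<theta> (q w)" for w
      by (simp add: q_def clinear_mapD[OF \<theta>(1)])
    have ev: "\<forall>\<^sub>F w in at z. q w \<in> range \<pi>"
      using eventually_at_in_open[OF V z]
    proof eventually_elim
      case (elim w)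
      then show ?case
        unfolding q_def using f z m
        by (intro complex_vector.subspace_diff[OF subspace_range] complex_vector.subspace_scale[OF subspace_range]) auto
    qed
    have "((\<lambda>w. hnorm F (\<theta> (q w))) \<longlongrightarrow> 0) (at z) \<longleftrightarrow> ((\<lambda>w. norm (q w)) \<longlongrightarrow> 0) (at z)"
    proof
      assume l: "((\<lambda>w. hnorm F (\<theta> (q w))) \<longlongrightarrow> 0) (at z)"
      have "((\<lambda>w. D * hnorm F (\<theta> (q w))) \<longlongrightarrow> D * 0) (at z)" by (intro tendsto_intros l)
      then show "((\<lambda>w. norm (q w)) \<longlongrightarrow> 0) (at z)"
        by (intro Lim_null_comparison[of "\<lambda>w. norm (q w)" "\<lambda>w. D * hnorm F (\<theta> (q w))"])
          (use D ev in \<open>auto elim: eventually_mono\<close>)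
    next
      assume l: "((\<lambda>w. norm (q w)) \<longlongrightarrow> 0) (at z)"
      have "((\<lambda>w. C * norm (q w)) \<longlongrightarrow> C * 0) (at z)" by (intro tendsto_intros l)
      then show "((\<lambda>w. hnorm F (\<theta> (q w))) \<longlongrightarrow> 0) (at z)"
        by (intro Lim_null_comparison[of "\<lambda>w. hnorm F (\<theta> (q w))" "\<lambda>w. C * norm (q w)"])
          (use C ev in \<open>auto elim: eventually_mono\<close>)
    qed
    then show ?thesis unfolding \<theta>q by (simp add: q_def)
  qed
  show ?thesis
  proof
    assume h: "hol_on F V (\<lambda>z. \<theta> (f z))"
    show "vhol V f"
      unfolding vhol_def has_derivative_scaleC_iff
    proof
      fix z assume z: "z \<in> V"
      then obtain l where l: "l \<in> car F"
        "((\<lambda>w. hnorm F (inverse (w - z) *\<^sub>C (\<theta> (f w) - \<theta> (f z)) - l)) \<longlongrightarrow> 0) (at z)"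
        using h unfolding hol_on_def by blast
      then show "\<exists>l. ((\<lambda>w. norm (inverse (w - z) *\<^sub>C (f w - f z) - l)) \<longlongrightarrow> 0) (at z)"
        using lim[OF z \<kappa>_range[OF l(1)]] by (auto simp: \<theta>_\<kappa>)
    qed
  next
    assume "vhol V f"
    then have h: "hol_on (sub_hilb (range \<pi>)) V f"
      using hol_on_sub_hilb[OF subspace_range closed_range V] f by simp
    show "hol_on F V (\<lambda>z. \<theta> (f z))"
      unfolding hol_on_def
    proof (intro ballI conjI)
      fix z assume z: "z \<in> V"
      show "\<theta> (f z) \<in> car F" using f[OF z] by (rule \<theta>_car)
      obtain m where m: "m \<in> range \<pi>" "((\<lambda>w. norm (inverse (w - z) *\<^sub>C (f w - f z) - m)) \<longlongrightarrow> 0) (at z)"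
        using h z unfolding hol_on_def car_sub_hilb hnorm_sub_hilb by blast
      show "\<exists>l\<in>car F. ((\<lambda>w. hnorm F (inverse (w - z) *\<^sub>C (\<theta> (f w) - \<theta> (f z)) - l)) \<longlongrightarrow> 0) (at z)"
        using lim[OF z m(1)] m \<theta>_car by blast
    qed
  qed
qed

lemma hol_on_\<kappa>:
  assumes "hol_on F V g" "open V" shows "vhol V (\<lambda>z. \<kappa> (g z))"
proof -
  have car: "g z \<in> car F" if "z \<in> V" for z using assms that by (auto simp: hol_on_def)
  have "hol_on F V (\<lambda>z. \<theta> (\<kappa> (g z)))"
    unfolding hol_on_def
  proof (intro ballI conjI)
    fix z assume z: "z \<in> V"
    show "\<theta> (\<kappa> (g z)) \<in> car F" using car[OF z] by (simp add: \<theta>_\<kappa>)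
    obtain l where l: "l \<in> car F" "((\<lambda>w. hnorm F (inverse (w - z) *\<^sub>C (g w - g z) - l)) \<longlongrightarrow> 0) (at z)"
      using assms z unfolding hol_on_def by blast
    have "\<forall>\<^sub>F w in at z. hnorm F (inverse (w - z) *\<^sub>C (g w - g z) - l) =
      hnorm F (inverse (w - z) *\<^sub>C (\<theta> (\<kappa> (g w)) - \<theta> (\<kappa> (g z))) - l)"
      using eventually_at_in_open[OF assms(2) z]
      by eventually_elim (use car z in \<open>simp add: \<theta>_\<kappa>\<close>)
    then show "\<exists>l\<in>car F. ((\<lambda>w. hnorm F (inverse (w - z) *\<^sub>C (\<theta> (\<kappa> (g w)) - \<theta> (\<kappa> (g z))) - l)) \<longlongrightarrow> 0) (at z)"
      by (intro bexI[of _ l] Lim_transform_eventually[OF l(2)] l(1))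
  qed
  moreover have "hol_on F V (\<lambda>z. \<theta> (\<kappa> (g z))) \<longleftrightarrow> vhol V (\<lambda>z. \<kappa> (g z))"
    by (rule hol_on_\<theta>[OF assms(2)]) (rule \<kappa>_range[OF car])
  ultimately show ?thesis by simp
qed

lemma eventually_car:
  assumes "\<forall>\<^sub>F z in at p. g z \<in> car F"
  obtains d where "d > 0" "\<And>z. z \<in> ball p d - {p} \<Longrightarrow> g z \<in> car F"
proof -
  obtain d where "d > 0" "\<And>z. z \<noteq> p \<Longrightarrow> dist z p < d \<Longrightarrow> g z \<in> car F"
    using assms by (auto simp: eventually_at)
  then show thesis by (intro that[of d]) (auto simp: dist_commute)
qed

lemma hol_on_\<theta>_\<pi>: "vhol V H \<Longrightarrow> open V \<Longrightarrow> hol_on F V (\<lambda>z. \<theta> (\<pi> (H z)))"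
  using hol_on_\<theta>[of V "\<lambda>z. \<pi> (H z)"] vhol_linear[OF \<pi>(1,2)] by blast

text \<open>Membership in \<open>car F\<close> near \<open>p\<close> is part of the criterion
  because \<open>\<kappa>\<close> carries no information about \<open>g\<close> outside
  \<open>car F\<close>.\<close>

lemma reg_at_iff:
  "reg_at F p g \<longleftrightarrow> reg_at full p (\<lambda>z. \<kappa> (g z)) \<and> (\<forall>\<^sub>F z in at p. g z \<in> car F)"
proof
  assume "reg_at F p g"
  then obtain r G where r: "r > 0" "hol_on F (ball p r) G" "\<forall>z\<in>ball p r - {p}. g z = G z"
    by (auto simp: reg_at_def)
  have "vhol (ball p r) (\<lambda>z. \<kappa> (G z))" by (rule hol_on_\<kappa>[OF r(2)]) simp
  then have "reg_at full p (\<lambda>z. \<kappa> (g z))"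
    unfolding reg_at_def hol_on_full
    by (intro exI[of _ r] exI[of _ "\<lambda>z. \<kappa> (G z)"] conjI) (use r in auto)
  moreover have "\<forall>\<^sub>F z in at p. g z \<in> car F"
    using eventually_at_in_open[OF open_ball centre_in_ball[THEN iffD2, OF r(1)]]
    by eventually_elim (use r(2,3) in \<open>auto simp: hol_on_def\<close>)
  ultimately show "reg_at full p (\<lambda>z. \<kappa> (g z)) \<and> (\<forall>\<^sub>F z in at p. g z \<in> car F)" by blast
next
  assume *: "reg_at full p (\<lambda>z. \<kappa> (g z)) \<and> (\<forall>\<^sub>F z in at p. g z \<in> car F)"
  obtain d where d: "d > 0" "\<And>z. z \<in> ball p d - {p} \<Longrightarrow> g z \<in> car F"
    by (rule eventually_car[OF conjunct2[OF *]]) (rule that)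
  obtain r H where r: "r > 0" "vhol (ball p r) H" "\<forall>z\<in>ball p r - {p}. \<kappa> (g z) = H z"
    using * by (auto simp: reg_at_def hol_on_full)
  have H: "vhol (ball p (min r d)) H" by (rule vhol_subset[OF r(2)]) auto
  \<comment> \<open>\<open>H\<close> is known to lie in \<open>range \<pi>\<close> only off
    \<open>p\<close>. Composition with \<open>\<pi>\<close> secures this at \<open>p\<close> and
    changes nothing elsewhere.\<close>
  have "g z = \<theta> (\<pi> (H z))" if z: "z \<in> ball p (min r d) - {p}" for z
  proof -
    have "g z \<in> car F" "H z = \<kappa> (g z)" using d(2) r(3) z by auto
    then show ?thesis using \<kappa>_range[of "g z"] by (simp add: range_\<pi>_iff \<theta>_\<kappa>)
  qed
  then show "reg_at F p g"
    unfolding reg_at_def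
    by (intro exI[of _ "min r d"] exI[of _ "\<lambda>z. \<theta> (\<pi> (H z))"] conjI hol_on_\<theta>_\<pi>[OF H])
      (use r(1) d(1) in auto)
qed

lemma mero_on_iff:
  "mero_on F V g \<longleftrightarrow> mero_on full V (\<lambda>z. \<kappa> (g z)) \<and> (\<forall>p\<in>V. \<forall>\<^sub>F z in at p. g z \<in> car F)"
proof
  assume m: "mero_on F V g"
  have "(\<exists>r>0. \<exists>H n. hol_on full (ball p r) H \<and> (\<forall>z\<in>ball p r - {p}. \<kappa> (g z) = inverse ((z - p) ^ n) *\<^sub>C H z)) \<and>
    (\<forall>\<^sub>F z in at p. g z \<in> car F)" if p: "p \<in> V" for p
  proof -
    obtain r G n where r: "r > 0" "hol_on F (ball p r) G" "\<forall>z\<in>ball p r - {p}. g z = inverse ((z - p) ^ n) *\<^sub>C G z"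
      using bspec[OF m[unfolded mero_on_def] p] by (elim exE conjE) (rule that)
    have G: "G z \<in> car F" if "z \<in> ball p r" for z using r(2) that by (auto simp: hol_on_def)
    have "vhol (ball p r) (\<lambda>z. \<kappa> (G z))" by (rule hol_on_\<kappa>[OF r(2)]) simp
    moreover have eq: "\<kappa> (g z) = inverse ((z - p) ^ n) *\<^sub>C \<kappa> (G z)" "g z \<in> car F" if "z \<in> ball p r - {p}" for z
    proof -
      have Gz: "G z \<in> car F" and gz: "g z = inverse ((z - p) ^ n) *\<^sub>C G z" using that r(3) G by auto
      show "\<kappa> (g z) = inverse ((z - p) ^ n) *\<^sub>C \<kappa> (G z)" unfolding gz by (rule \<kappa>_scaleC[OF Gz])
      have "g z = \<theta> (inverse ((z - p) ^ n) *\<^sub>C \<kappa> (G z))"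
        by (simp add: clinear_mapD[OF \<theta>(1)] \<theta>_\<kappa>[OF Gz] gz)
      then show "g z \<in> car F"
        using \<theta>_car[OF complex_vector.subspace_scale[OF subspace_range \<kappa>_range[OF Gz]]] by simp
    qed
    moreover have "\<forall>\<^sub>F z in at p. g z \<in> car F"
      using eventually_at_in_open[OF open_ball centre_in_ball[THEN iffD2, OF r(1)]]
      by eventually_elim (use eq in auto)
    ultimately show ?thesis unfolding hol_on_full using r(1) by blast
  qed
  then show "mero_on full V (\<lambda>z. \<kappa> (g z)) \<and> (\<forall>p\<in>V. \<forall>\<^sub>F z in at p. g z \<in> car F)"
    unfolding mero_on_def by blast
next
  assume *: "mero_on full V (\<lambda>z. \<kappa> (g z)) \<and> (\<forall>p\<in>V. \<forall>\<^sub>F z in at p. g z \<in> car F)"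
  show "mero_on F V g"
    unfolding mero_on_def
  proof
    fix p assume p: "p \<in> V"
    obtain d where d: "d > 0" "\<And>z. z \<in> ball p d - {p} \<Longrightarrow> g z \<in> car F"
      using * p eventually_car by blast
    obtain r H n where r: "r > 0" "vhol (ball p r) H" "\<forall>z\<in>ball p r - {p}. \<kappa> (g z) = inverse ((z - p) ^ n) *\<^sub>C H z"
      by (rule mero_on_fullE[OF conjunct1[OF *] p])
    have H: "vhol (ball p (min r d)) H" by (rule vhol_subset[OF r(2)]) auto
    have "g z = inverse ((z - p) ^ n) *\<^sub>C \<theta> (\<pi> (H z))" if z: "z \<in> ball p (min r d) - {p}" for z
    proof -
      have c: "g z \<in> car F" "\<kappa> (g z) = inverse ((z - p) ^ n) *\<^sub>C H z" using d(2) r(3) z by auto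
      have "g z = \<theta> (\<pi> (\<kappa> (g z)))" using \<kappa>_range[OF c(1)] c(1) by (simp add: range_\<pi>_iff \<theta>_\<kappa>)
      then show ?thesis by (simp add: c(2) clinear_mapD[OF \<theta>(1)] clinear_mapD[OF \<pi>(2)])
    qed
    then show "\<exists>r>0. \<exists>G n. hol_on F (ball p r) G \<and> (\<forall>z\<in>ball p r - {p}. g z = inverse ((z - p) ^ n) *\<^sub>C G z)"
      by (intro exI[of _ "min r d"] exI[of _ "\<lambda>z. \<theta> (\<pi> (H z))"] exI[of _ n] conjI hol_on_\<theta>_\<pi>[OF H])
        (use r(1) d(1) in auto)
  qed
qed

text \<open>The remainder and its image under \<open>\<pi>\<close> are both regular, and
  \<open>h\<close> cancels in their difference. What is left is the principal part with coefficients
  \<open>a k - \<pi> (a k)\<close>, so these vanish.\<close>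

lemma pp_in_range:
  assumes pp: "reg_at full p (\<lambda>z. h z - (\<Sum>k=1..n. inverse ((z - p) ^ k) *\<^sub>C a k))"
    and ev: "\<forall>\<^sub>F z in at p. h z \<in> range \<pi>" and k: "k \<in> {1..n}"
  shows "\<pi> (a k) = a k"
proof -
  have 1: "reg_at full p (\<lambda>z. \<pi> (h z - (\<Sum>k=1..n. inverse ((z - p) ^ k) *\<^sub>C a k)))"
    by (rule reg_at_linear[OF \<pi>(1,2) pp])
  have "\<forall>\<^sub>F z in at p. \<pi> (h z - (\<Sum>k=1..n. inverse ((z - p) ^ k) *\<^sub>C a k)) =
     h z - (\<Sum>k=1..n. inverse ((z - p) ^ k) *\<^sub>C \<pi> (a k))"
    using ev by eventually_elim (simp add: clinear_mapD[OF \<pi>(2)] range_\<pi>_iff)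
  from reg_at_diff[OF reg_at_cong[OF this 1] pp]
  have "reg_at full p (\<lambda>z. \<Sum>k=1..n. inverse ((z - p) ^ k) *\<^sub>C (a k - \<pi> (a k)))"
    by (simp add: complex_vector.scale_right_diff_distrib sum_subtractf)
  from principal_part_coeff_zero[OF this] k show ?thesis by simp
qed

lemma principal_part_\<theta>:
  assumes pp: "reg_at full p (\<lambda>z. \<kappa> (g z) - (\<Sum>k=1..n. inverse ((z - p) ^ k) *\<^sub>C a k))"
    and ev: "\<forall>\<^sub>F z in at p. g z \<in> car F"
  shows "principal_part F p g = (\<lambda>z. \<theta> (principal_part full p (\<lambda>z. \<kappa> (g z)) z))"
  unfolding principal_part_def[of F]
proof (rule the_equality)
  define t where "t z = (\<Sum>k=1..n. inverse ((z - p) ^ k) *\<^sub>C a k)" for z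
  have t: "principal_part full p (\<lambda>z. \<kappa> (g z)) = t"
    unfolding t_def[abs_def] by (rule principal_part_eq[OF pp])
  have ev': "\<forall>\<^sub>F z in at p. \<kappa> (g z) \<in> range \<pi>" using ev by eventually_elim (rule \<kappa>_range)
  have a: "\<pi> (a k) = a k" if "k \<in> {1..n}" for k by (rule pp_in_range[OF pp ev' that])
  \<comment> \<open>\<open>principal_part\<close> asks that all coefficients lie in
    \<open>car F\<close>, also those with index outside \<open>1..n\<close>. Inserting
    \<open>\<pi>\<close> achieves this without changing the sum.\<close>
  have \<theta>t: "\<theta> (t z) = (\<Sum>k=1..n. inverse ((z - p) ^ k) *\<^sub>C \<theta> (\<pi> (a k)))" for z
    unfolding t_def clinear_mapD[OF \<theta>(1)] by (intro sum.cong) (auto simp: a)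
  have tr: "t z \<in> range \<pi>" for z
    unfolding t_def
    by (intro complex_vector.subspace_sum[OF subspace_range] complex_vector.subspace_scale[OF subspace_range])
      (simp add: range_\<pi>_iff a)
  have sub: "\<theta> u - \<theta> v \<in> car F" if "u \<in> range \<pi>" "v \<in> range \<pi>" for u v
    using \<theta>_car[OF complex_vector.subspace_diff[OF subspace_range that]] by (simp add: clinear_mapD[OF \<theta>(1)])
  have regt: "reg_at F p (\<lambda>z. g z - \<theta> (t z))"
    unfolding reg_at_iff
  proof
    have e: "\<forall>\<^sub>F z in at p. \<kappa> (g z) - t z = \<kappa> (g z - \<theta> (t z))"
      using ev by eventually_elim (simp add: \<kappa>_diff \<theta>_car tr \<kappa>_\<theta>)
    show "reg_at full p (\<lambda>z. \<kappa> (g z - \<theta> (t z)))"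
      by (rule reg_at_cong[OF e]) (use pp in \<open>simp add: t_def\<close>)
    show "\<forall>\<^sub>F z in at p. g z - \<theta> (t z) \<in> car F"
      using ev
    proof eventually_elim
      case (elim z)
      then show ?case using sub[OF \<kappa>_range[OF elim] tr[of z]] by (simp add: \<theta>_\<kappa>)
    qed
  qed
  show "\<exists>n a. (\<forall>k. a k \<in> car F) \<and>
      (\<lambda>z. \<theta> (principal_part full p (\<lambda>z. \<kappa> (g z)) z)) = (\<lambda>z. \<Sum>k=1..n. inverse ((z - p) ^ k) *\<^sub>C a k) \<and>
      reg_at F p (\<lambda>z. g z - \<theta> (principal_part full p (\<lambda>z. \<kappa> (g z)) z))"
    unfolding t
    by (rule exI[of _ n], rule exI[of _ "\<lambda>k. \<theta> (\<pi> (a k))"]) (use regt \<theta>t \<theta>_car in auto)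
  fix s assume "\<exists>n a. (\<forall>k. a k \<in> car F) \<and> s = (\<lambda>z. \<Sum>k=1..n. inverse ((z - p) ^ k) *\<^sub>C a k) \<and>
      reg_at F p (\<lambda>z. g z - s z)"
  then obtain m b where b: "\<And>k. b k \<in> car F" and s: "s = (\<lambda>z. \<Sum>k=1..m. inverse ((z - p) ^ k) *\<^sub>C b k)"
    and reg: "reg_at F p (\<lambda>z. g z - s z)" by blast
  define s' where "s' z = (\<Sum>k=1..m. inverse ((z - p) ^ k) *\<^sub>C \<kappa> (b k))" for z
  have s': "s z = \<theta> (s' z)" for z
    unfolding s s'_def clinear_mapD[OF \<theta>(1)] using b by (simp add: \<theta>_\<kappa>)
  have s'r: "s' z \<in> range \<pi>" for z
    unfolding s'_def
    by (intro complex_vector.subspace_sum[OF subspace_range] complex_vector.subspace_scale[OF subspace_range] \<kappa>_range b)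
  have e: "\<forall>\<^sub>F z in at p. \<kappa> (g z - s z) = \<kappa> (g z) - s' z"
    using ev by eventually_elim (simp add: \<kappa>_diff \<theta>_car s' s'r \<kappa>_\<theta>)
  have "reg_at full p (\<lambda>z. \<kappa> (g z) - s' z)"
    by (rule reg_at_cong[OF e]) (use reg in \<open>simp add: reg_at_iff\<close>)
  then have "principal_part full p (\<lambda>z. \<kappa> (g z)) = s'"
    unfolding s'_def[abs_def] by (rule principal_part_eq)
  then show "s = (\<lambda>z. \<theta> (principal_part full p (\<lambda>z. \<kappa> (g z)) z))" by (simp add: s' fun_eq_iff)
qed

lemma sing_part_\<theta>:
  assumes s: "has_sing V (\<lambda>z. \<kappa> (g z)) s" and ev: "\<And>p. p \<in> V \<Longrightarrow> \<forall>\<^sub>F z in at p. g z \<in> car F"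
  shows "sing_part F V g = (\<lambda>z. \<theta> (s z))"
proof
  fix z
  obtain n A a where A: "s = pform n A a" "finite A" "A \<subseteq> V"
    using s by (auto simp: has_sing_def pforms_def)
  have poles: "poles_in F V g = poles_in full V (\<lambda>z. \<kappa> (g z))"
    using ev by (auto simp: poles_in_def reg_at_iff)
  have sub: "poles_in full V (\<lambda>z. \<kappa> (g z)) \<subseteq> A" using has_sing_poles s A by blast
  have pp: "principal_part F p g z = \<theta> (principal_part full p (\<lambda>z. \<kappa> (g z)) z)"
    if "p \<in> poles_in full V (\<lambda>z. \<kappa> (g z))" for p
  proof -
    have p: "p \<in> A" "p \<in> V" using that sub A(3) by auto
    show ?thesis
      by (rule fun_cong[OF principal_part_\<theta>[OF has_sing_principal_part[OF s[unfolded A(1)] A(2) p] ev[OF p(2)]]])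
  qed
  have "sing_part F V g z = \<theta> (sing_part full V (\<lambda>z. \<kappa> (g z)) z)"
    unfolding sing_part_def poles clinear_mapD[OF \<theta>(1)] using pp by (intro sum.cong) auto
  then show "sing_part F V g z = \<theta> (s z)" by (simp add: sing_part_eq[OF s])
qed

end

section \<open>The local construction over a point\<close>

lemma fun_sum_apply: "(\<Sum>i\<in>I. g i) z = (\<Sum>i\<in>I. g i z)" for g :: "'i \<Rightarrow> 'a \<Rightarrow> 'b::comm_monoid_add"
  by (induction I rule: infinite_finite_induct) auto

lemma mero_on_cong:
  assumes f: "mero_on full V f" and ev: "\<And>p. p \<in> V \<Longrightarrow> \<forall>\<^sub>F z in at p. f z = g z"
  shows "mero_on full V g"
  unfolding mero_on_def hol_on_full
proof
  fix p assume p: "p \<in> V"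
  obtain r h n where r: "r > 0" "vhol (ball p r) h" "\<forall>z\<in>ball p r - {p}. f z = inverse ((z - p) ^ n) *\<^sub>C h z"
    by (rule mero_on_fullE[OF f p])
  obtain d where d: "d > 0" "\<And>z. z \<noteq> p \<Longrightarrow> dist z p < d \<Longrightarrow> f z = g z"
    using ev[OF p] by (auto simp: eventually_at)
  have "g z = inverse ((z - p) ^ n) *\<^sub>C h z" if z: "z \<in> ball p (min r d) - {p}" for z
    using d(2)[of z] r(3) z by (simp add: dist_commute)
  moreover have "vhol (ball p (min r d)) h" by (rule vhol_subset[OF r(2)]) auto
  moreover have "min r d > 0" using r d by simp
  ultimately show "\<exists>r>0. \<exists>h n. vhol (ball p r) h \<and> (\<forall>z\<in>ball p r - {p}. g z = inverse ((z - p) ^ n) *\<^sub>C h z)"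
    by blast
qed

lemma eventually_not_in_finite:
  assumes "finite B" "open V" "p \<in> V" shows "\<forall>\<^sub>F z in at (p :: complex). z \<in> V - B"
proof -
  have "open (V - (B - {p}))" "p \<in> V - (B - {p})"
    using assms by (auto intro!: open_Diff finite_imp_closed)
  from eventually_at_in_open[OF this] show ?thesis by eventually_elim auto
qed

lemma op_holomorphic_on_affine:
  fixes Q :: "complex \<Rightarrow> 'd::complex_hilbert \<Rightarrow> 'h::complex_hilbert" and L :: "'h \<Rightarrow> 'k::complex_hilbert"
  assumes Q: "op_holomorphic_on V Q" and V: "open V" and L: "bounded_linear L" "clinear_map L" and M: "bounded_linear M"
  shows "op_holomorphic_on V (\<lambda>z u. L (Q z u) + M u)"
  unfolding op_holomorphic_on_def
proof (intro conjI ballI)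
  fix z assume z: "z \<in> V"
  have Qb: "bounded_linear (Q w)" if "w \<in> V" for w using Q that by (auto simp: op_holomorphic_on_def)
  show "bounded_linear (\<lambda>u. L (Q z u) + M u)"
    by (intro bounded_linear_add bounded_linear_compose[OF L(1) Qb[OF z]] M)
  obtain T where T: "bounded_linear T" "\<And>c u. T (c *\<^sub>C u) = c *\<^sub>C T u"
    "((\<lambda>w. Blinfun (Q w)) has_derivative (\<lambda>h. Blinfun (\<lambda>u. h *\<^sub>C T u))) (at z)"
    using Q z by (auto simp: op_holomorphic_on_def)
  have bT: "bounded_linear (\<lambda>u. h *\<^sub>C T u)" for h
    by (rule bounded_linear_compose[OF bounded_linear_scaleC_right T(1)])
  have "((\<lambda>w. (Blinfun L o\<^sub>L Blinfun (Q w)) + Blinfun M) has_derivative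
      (\<lambda>h. (Blinfun L o\<^sub>L Blinfun (\<lambda>u. h *\<^sub>C T u)) + 0)) (at z)"
    by (intro has_derivative_add has_derivative_const
        bounded_linear.has_derivative[OF bounded_bilinear.bounded_linear_right[OF bounded_bilinear_blinfun_compose] T(3)])
  moreover have "(Blinfun L o\<^sub>L Blinfun (\<lambda>u. h *\<^sub>C T u)) + 0 = Blinfun (\<lambda>u. h *\<^sub>C L (T u))" for h
    by (rule blinfun_eqI)
      (simp add: bounded_linear_Blinfun_apply L bT clinear_mapD[OF L(2)]
        bounded_linear_compose[OF bounded_linear_scaleC_right bounded_linear_compose[OF L(1) T(1)]])
  ultimately have "((\<lambda>w. (Blinfun L o\<^sub>L Blinfun (Q w)) + Blinfun M) has_derivative
      (\<lambda>h. Blinfun (\<lambda>u. h *\<^sub>C L (T u)))) (at z)" by simp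
  then have "((\<lambda>w. Blinfun (\<lambda>u. L (Q w u) + M u)) has_derivative (\<lambda>h. Blinfun (\<lambda>u. h *\<^sub>C L (T u)))) (at z)"
  proof (rule has_derivative_transform_within_open[OF _ V z])
    fix w assume w: "w \<in> V"
    show "(Blinfun L o\<^sub>L Blinfun (Q w)) + Blinfun M = Blinfun (\<lambda>u. L (Q w u) + M u)"
      by (rule blinfun_eqI)
        (simp add: bounded_linear_Blinfun_apply L(1) Qb[OF w] M blinfun.add_left
          bounded_linear_add[OF bounded_linear_compose[OF L(1) Qb[OF w]] M])
  qed
  moreover have "bounded_linear (\<lambda>u. L (T u))" by (rule bounded_linear_compose[OF L(1) T(1)])
  moreover have "L (T (c *\<^sub>C u)) = c *\<^sub>C L (T u)" for c u by (simp add: T(2) clinear_mapD[OF L(2)])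
  ultimately show "\<exists>T'. bounded_linear T' \<and> (\<forall>c u. T' (c *\<^sub>C u) = c *\<^sub>C T' u) \<and>
      ((\<lambda>w. Blinfun (\<lambda>u. L (Q w u) + M u)) has_derivative (\<lambda>h. Blinfun (\<lambda>u. h *\<^sub>C T' u))) (at z)"
    by (intro exI[of _ "\<lambda>u. L (T u)"]) auto
qed

lemma holomorphic_det:
  assumes "\<And>i j. i < n \<Longrightarrow> j < n \<Longrightarrow> (\<lambda>z. m z i j) holomorphic_on V"
  shows "(\<lambda>z. Determinant.det (Matrix.mat n n (\<lambda>(i, j). m z i j))) holomorphic_on V"
proof -
  have "Determinant.det (Matrix.mat n n (\<lambda>(i, j). m z i j)) =
      (\<Sum>p\<in>{p. p permutes {0..<n}}. signof p * (\<Prod>i=0..<n. m z i (p i)))" for z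
  proof -
    have "(\<Prod>i=0..<n. Matrix.mat n n (\<lambda>(i, j). m z i j) $$ (i, p i)) = (\<Prod>i=0..<n. m z i (p i))"
      if "p permutes {0..<n}" for p
      using permutes_in_image[OF that] by (intro prod.cong) auto
    then show ?thesis by (subst det_def'[of _ n]) auto
  qed
  moreover have "(\<lambda>z. \<Sum>p\<in>{p. p permutes {0..<n}}. signof p * (\<Prod>i=0..<n. m z i (p i))) holomorphic_on V"
  proof (intro holomorphic_intros)
    fix p i assume "p \<in> {p. p permutes {0..<n}}" "i \<in> {0..<n}"
    then show "(\<lambda>z. m z i (p i)) holomorphic_on V"
      using permutes_in_image[of p "{0..<n}" i] by (intro assms) auto
  qed
  ultimately show ?thesis by simp
qed

text \<open>\<open>e\<close> and \<open>f\<close> are orthonormal bases of the kernel, for the inner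
  product after \<open>\<iota>\<close>, and of the complement of the range. Their common length
  \<open>n\<close> expresses index zero and provides the isomorphism
  \<open>e i \<mapsto> f i\<close>.\<close>

locale block_split =
  fixes \<iota> :: "'d::complex_hilbert \<Rightarrow> 'h1::complex_hilbert" and T0 :: "'d \<Rightarrow> 'h2::complex_hilbert"
    and n :: nat and e :: "nat \<Rightarrow> 'd" and f :: "nat \<Rightarrow> 'h2"
  assumes \<iota>: "bounded_linear \<iota>" "clinear_map \<iota>" "inj \<iota>"
    and T0: "clinear_map T0" "closed (range T0)"
    and e: "\<And>i. i < n \<Longrightarrow> e i \<in> ker T0"
      "\<And>i j. i < n \<Longrightarrow> j < n \<Longrightarrow> cinner (\<iota> (e i)) (\<iota> (e j)) = (if i = j then 1 else 0)"
      "\<And>u. u \<in> ker T0 \<Longrightarrow> u = (\<Sum>i<n. cinner (\<iota> u) (\<iota> (e i)) *\<^sub>C e i)"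
    and f: "\<And>i. i < n \<Longrightarrow> f i \<in> ran_perp T0"
      "\<And>i j. i < n \<Longrightarrow> j < n \<Longrightarrow> cinner (f i) (f j) = (if i = j then 1 else 0)"
      "\<And>v. v \<in> ran_perp T0 \<Longrightarrow> v = (\<Sum>i<n. cinner v (f i) *\<^sub>C f i)"
begin

text \<open>Finite-rank formulas for the projection onto the kernel, the isomorphism onto the
  complement of the range preceded by that projection, and the projection onto this complement. They
  are everywhere defined, linear and bounded by inspection.\<close>

definition \<pi>K :: "'d \<Rightarrow> 'd" where "\<pi>K u = (\<Sum>i<n. cinner (\<iota> u) (\<iota> (e i)) *\<^sub>C e i)"
definition iK :: "'d \<Rightarrow> 'h2" where "iK u = (\<Sum>i<n. cinner (\<iota> u) (\<iota> (e i)) *\<^sub>C f i)"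
definition Pf :: "'h2 \<Rightarrow> 'h2" where "Pf v = (\<Sum>i<n. cinner v (f i) *\<^sub>C f i)"

lemma clinear_\<pi>K: "clinear_map \<pi>K" and clinear_iK: "clinear_map iK" and clinear_Pf: "clinear_map Pf"
  by (auto simp: clinear_map_def \<pi>K_def iK_def Pf_def clinear_mapD[OF \<iota>(2)] cinner_add_left cinner_scaleC_left
      scaleC_add_left sum.distrib complex_vector.scale_sum_right)

lemma bounded_coeff: "bounded_linear (\<lambda>u. cinner (\<iota> u) w *\<^sub>C (x :: 'k::complex_hilbert))"
proof -
  have "bounded_linear (\<lambda>u. cinner (\<iota> u) w)"
    by (rule bounded_linear_compose[OF bounded_linear_cinner_left \<iota>(1)])
  then show ?thesis by (rule bounded_linear_compose[OF bounded_linear_scaleC_left])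
qed

lemma bounded_\<pi>K: "bounded_linear \<pi>K" and bounded_iK: "bounded_linear iK" and bounded_Pf: "bounded_linear Pf"
  unfolding \<pi>K_def iK_def Pf_def
  by (intro bounded_linear_sum bounded_coeff
      bounded_linear_compose[OF bounded_linear_scaleC_left bounded_linear_cinner_left])+

lemma \<iota>\<pi>K: "i < n \<Longrightarrow> cinner (\<iota> (\<pi>K u)) (\<iota> (e i)) = cinner (\<iota> u) (\<iota> (e i))"
  by (simp add: \<pi>K_def clinear_mapD[OF \<iota>(2)] cinner_sum_left cinner_scaleC_left e(2) if_distrib cong: if_cong)

lemma iK_coeff: "i < n \<Longrightarrow> cinner (iK u) (f i) = cinner (\<iota> u) (\<iota> (e i))"
  by (simp add: iK_def cinner_sum_left cinner_scaleC_left f(2) if_distrib cong: if_cong)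

lemma subspace_ker: "csubspace (ker T0)"
  by (auto simp: complex_vector.subspace_def ker_def clinear_mapD[OF T0(1)])

lemma subspace_ran_perp: "csubspace (ran_perp T0)"
  by (auto simp: complex_vector.subspace_def ran_perp_def cinner_add_left cinner_scaleC_left)

lemma subspace_range: "csubspace (range T0)"
  unfolding complex_vector.subspace_def
  using clinear_mapD(1-3)[OF T0(1)] by (metis (no_types, lifting) rangeE rangeI)

lemma \<pi>K_in: "\<pi>K u \<in> ker T0"
  unfolding \<pi>K_def by (intro complex_vector.subspace_sum[OF subspace_ker] complex_vector.subspace_scale[OF subspace_ker] e) auto

lemma \<pi>K_id: "u \<in> ker T0 \<Longrightarrow> \<pi>K u = u" using e(3) by (simp add: \<pi>K_def)

lemma range_\<pi>K: "range \<pi>K = ker T0" using \<pi>K_in \<pi>K_id by (auto simp: image_iff) metis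

lemma \<pi>K_idem: "\<pi>K (\<pi>K u) = \<pi>K u" using \<pi>K_in \<pi>K_id by blast

lemma Pf_in: "Pf v \<in> ran_perp T0"
  unfolding Pf_def
  by (intro complex_vector.subspace_sum[OF subspace_ran_perp] complex_vector.subspace_scale[OF subspace_ran_perp] f) auto

lemma Pf_id: "v \<in> ran_perp T0 \<Longrightarrow> Pf v = v" using f(3) by (simp add: Pf_def)

lemma range_Pf: "range Pf = ran_perp T0" using Pf_in Pf_id by (auto simp: image_iff) metis

lemma Pf_idem: "Pf (Pf v) = Pf v" using Pf_in Pf_id by blast

lemma Pf_range: "v \<in> range T0 \<Longrightarrow> Pf v = 0"
proof -
  assume v: "v \<in> range T0"
  have "cinner v (f i) = 0" if "i < n" for i
    using f(1)[OF that] v cinner_commute[of v "f i"] by (auto simp: ran_perp_def)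
  then show ?thesis by (simp add: Pf_def)
qed

text \<open>Uses closedness of the range: in \<open>v = p + (v - p)\<close> with \<open>p\<close>
  the nearest point of the range, \<open>Pf\<close> annihilates the first summand and fixes the
  second.\<close>

lemma minus_Pf_in: "v - Pf v \<in> range T0"
proof -
  obtain p where p: "p \<in> range T0" "\<forall>s\<in>range T0. cinner (v - p) s = 0"
    using exists_orth_proj[OF subspace_range T0(2)] by blast
  then have "v - p \<in> ran_perp T0" by (auto simp: ran_perp_def)
  then have "Pf v - Pf p = v - p" using Pf_id[of "v - p"] by (simp add: clinear_mapD[OF clinear_Pf])
  then have "v - Pf v = p" using Pf_range[OF p(1)] by simp
  then show ?thesis using p by simp
qed

lemma orth_proj_range: "orth_proj (range T0) v = v - Pf v"
  by (rule orth_proj_eqI[OF subspace_range minus_Pf_in])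
    (use Pf_in[of v] in \<open>auto simp: ran_perp_def\<close>)

lemma orth_proj_ran_perp: "orth_proj (ran_perp T0) v = Pf v"
proof (rule orth_proj_eqI[OF subspace_ran_perp Pf_in])
  fix s assume "s \<in> ran_perp T0"
  then have "cinner s (v - Pf v) = 0" using minus_Pf_in[of v] by (auto simp: ran_perp_def)
  then show "cinner (v - Pf v) s = 0" using cinner_commute[of "v - Pf v" s] by simp
qed

lemma Pf_iK [simp]: "Pf (iK u) = iK u"
  by (simp add: Pf_def iK_coeff) (simp add: iK_def)

lemma iK_eq_imp: "iK u = iK v \<Longrightarrow> \<pi>K u = \<pi>K v"
  using iK_coeff by (auto simp: \<pi>K_def intro!: sum.cong) metis

lemma iK_\<pi>K: "iK (\<pi>K u) = iK u" by (simp add: iK_def \<iota>\<pi>K)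

lemma iK_surj: "w \<in> ran_perp T0 \<Longrightarrow> \<exists>k\<in>ker T0. iK k = w"
proof
  assume w: "w \<in> ran_perp T0"
  define k where "k = (\<Sum>i<n. cinner w (f i) *\<^sub>C e i)"
  have "cinner (\<iota> k) (\<iota> (e i)) = cinner w (f i)" if "i < n" for i
    using that by (simp add: k_def clinear_mapD[OF \<iota>(2)] cinner_sum_left cinner_scaleC_left e(2) if_distrib cong: if_cong)
  then show "iK k = w" using f(3)[OF w] by (simp add: iK_def)
  show "k \<in> ker T0"
    unfolding k_def by (intro complex_vector.subspace_sum[OF subspace_ker] complex_vector.subspace_scale[OF subspace_ker] e) auto
qed

lemma ker_perp_iff: "u \<in> ker_perp \<iota> T0 \<longleftrightarrow> \<pi>K u = 0"
proof
  assume "u \<in> ker_perp \<iota> T0"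
  then show "\<pi>K u = 0" using e(1) by (auto simp: ker_perp_def \<pi>K_def intro!: sum.neutral)
next
  assume 0: "\<pi>K u = 0"
  have c: "cinner (\<iota> u) (\<iota> (e i)) = 0" if "i < n" for i
    using \<iota>\<pi>K[OF that, of u] 0 by (simp add: clinear_mapD[OF \<iota>(2)])
  have "cinner (\<iota> u) (\<iota> k) = 0" if "k \<in> ker T0" for k
    by (subst e(3)[OF that]) (simp add: clinear_mapD[OF \<iota>(2)] cinner_sum_right cinner_scaleC_right c)
  then show "u \<in> ker_perp \<iota> T0" by (simp add: ker_perp_def)
qed

lemma bottom_row_eq: "bottom_row T0 T u = T u - Pf (T u)"
  by (simp add: bottom_row_def orth_proj_range)

lemma top_row_eq: "top_row T0 T u = Pf (T u)"
  by (simp add: top_row_def orth_proj_ran_perp)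

text \<open>\<open>EE T\<close> completes the invertible block of \<open>T\<close> to an invertible operator on the whole space,
  and \<open>GG T\<close> is the identity minus \<open>(p22)\<^sup>-\<^sup>1 p21\<close> on the kernel.\<close>

definition EE :: "('d \<Rightarrow> 'h2) \<Rightarrow> 'd \<Rightarrow> 'h2" where "EE T u = (T u - Pf (T u)) + iK u"
definition GG :: "('d \<Rightarrow> 'h2) \<Rightarrow> 'd \<Rightarrow> 'd" where "GG T u = inv (EE T) (iK u)"

lemma clinear_EE: "clinear_map T \<Longrightarrow> clinear_map (EE T)"
  by (auto simp: clinear_map_def[of "EE T"] EE_def clinear_mapD clinear_mapD[OF clinear_Pf] clinear_mapD[OF clinear_iK]
      scaleC_add_right complex_vector.scale_right_diff_distrib)

context
  fixes T :: "'d \<Rightarrow> 'h2"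
  assumes T: "clinear_map T" and p22: "p22_invertible \<iota> T0 T"
begin

lemma Pf_EE: "Pf (EE T u) = iK u"
  by (simp add: EE_def clinear_mapD[OF clinear_Pf] Pf_idem)

text \<open>\<open>EE T\<close> is block triangular: its component orthogonal to the range is
  \<open>iK\<close>, an isomorphism on the kernel and zero on \<open>ker_perp \<iota> T0\<close>,
  and on the latter its remaining component is the invertible block.\<close>

lemma bij_EE: "bij (EE T)"
proof (rule bijI)
  have bij: "bij_betw (bottom_row T0 T) (ker_perp \<iota> T0) (range T0)" using p22 by (simp add: p22_invertible_def)
  have b0: "bottom_row T0 T 0 = 0" by (simp add: bottom_row_eq clinear_mapD[OF T] clinear_mapD[OF clinear_Pf])
  have zp: "0 \<in> ker_perp \<iota> T0" by (simp add: ker_perp_def clinear_mapD[OF \<iota>(2)])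
  have z: "u = 0" if "EE T u = 0" for u
  proof -
    have "iK u = iK 0" using Pf_EE[of u] that by (simp add: clinear_mapD[OF clinear_Pf] clinear_mapD[OF clinear_iK])
    then have "\<pi>K u = \<pi>K 0" by (rule iK_eq_imp)
    then have "u \<in> ker_perp \<iota> T0" by (simp add: ker_perp_iff clinear_mapD[OF clinear_\<pi>K])
    moreover have "bottom_row T0 T u = bottom_row T0 T 0"
      using that \<open>iK u = iK 0\<close> unfolding b0 by (simp add: bottom_row_eq EE_def clinear_mapD[OF clinear_iK])
    ultimately show "u = 0" using bij zp unfolding bij_betw_def inj_on_def by blast
  qed
  show "inj (EE T)"
  proof (rule injI)
    fix u v assume "EE T u = EE T v"
    then have "EE T (u - v) = 0" by (simp add: clinear_mapD[OF clinear_EE[OF T]])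
    then show "u = v" using z by fastforce
  qed
  show "surj (EE T)"
  proof -
    have "\<exists>u. EE T u = v" for v
    proof -
      obtain k where k: "k \<in> ker T0" "iK k = Pf v" using iK_surj[OF Pf_in] by blast
      have "(v - Pf v) - bottom_row T0 T k \<in> range T0"
        unfolding bottom_row_eq by (intro complex_vector.subspace_diff[OF subspace_range] minus_Pf_in)
      then obtain m where m: "m \<in> ker_perp \<iota> T0" "bottom_row T0 T m = (v - Pf v) - bottom_row T0 T k"
        using bij by (metis bij_betw_imp_surj_on imageE)
      have "iK m = iK (\<pi>K m)" by (simp add: iK_\<pi>K)
      also have "\<dots> = 0" using m(1) by (simp add: ker_perp_iff clinear_mapD[OF clinear_iK])
      finally have "EE T (k + m) = bottom_row T0 T k + bottom_row T0 T m + iK k"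
        by (simp add: EE_def bottom_row_eq clinear_mapD[OF T] clinear_mapD[OF clinear_Pf] clinear_mapD[OF clinear_iK])
      then show ?thesis using m(2) k(2) by (intro exI[of _ "k + m"]) simp
    qed
    then show ?thesis by (metis surjI)
  qed
qed

lemma EE_inv: "EE T (inv (EE T) v) = v" using bij_EE by (simp add: bij_is_surj surj_f_inv_f)

lemma inv_EE: "inv (EE T) (EE T u) = u" using bij_EE by (simp add: bij_is_inj)

lemma clinear_inv_EE: "clinear_map (inv (EE T))" by (rule clinear_map_inv[OF clinear_EE[OF T] bij_EE])

lemma clinear_GG: "clinear_map (GG T)"
  using clinear_mapD(1,2)[OF clinear_inv_EE] clinear_mapD(1,2)[OF clinear_iK] by (simp add: clinear_map_def GG_def)

lemma \<pi>K_GG: "\<pi>K (GG T u) = \<pi>K u"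
proof (rule iK_eq_imp)
  have "iK (GG T u) = Pf (EE T (GG T u))" by (simp only: Pf_EE)
  also have "\<dots> = iK u" by (simp add: GG_def EE_inv)
  finally show "iK (GG T u) = iK u" .
qed

text \<open>Splits \<open>u\<close> into a part determined by its kernel component and a remainder
  that depends on \<open>u\<close> only through \<open>T u\<close>. This is the mechanism by which
  regularity of \<open>T u\<close> is exploited.\<close>

lemma decompose: "u = GG T (\<pi>K u) + inv (EE T) (T u - Pf (T u))"
proof -
  have "u = inv (EE T) ((T u - Pf (T u)) + iK u)" using inv_EE[of u] by (simp add: EE_def)
  then show ?thesis by (simp add: clinear_mapD[OF clinear_inv_EE] GG_def iK_\<pi>K add.commute)
qed

lemma bottom_GG: "T (GG T u) - Pf (T (GG T u)) = 0"
proof -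
  have "(T (GG T u) - Pf (T (GG T u))) + iK (GG T u) = iK u"
    using EE_inv[of "iK u"] by (simp add: GG_def EE_def)
  moreover have "iK (GG T u) = iK u"
    using Pf_EE[of "GG T u"] EE_inv[of "iK u"] by (simp add: GG_def)
  ultimately show ?thesis by simp
qed

text \<open>\<open>u - GG T u\<close> lies in \<open>ker_perp \<iota> T0\<close> and has the same
  lower component as \<open>u\<close>; injectivity of the lower right block leaves no other such
  vector.\<close>

lemma p22_inv_p21_eq: "p22_inv_p21 \<iota> T0 T u = u - GG T u" if u: "u \<in> ker T0"
  unfolding p22_inv_p21_def
proof -
  have bij: "bij_betw (bottom_row T0 T) (ker_perp \<iota> T0) (range T0)" using p22 by (simp add: p22_invertible_def)
  have "u - GG T u \<in> ker_perp \<iota> T0" by (simp add: ker_perp_iff clinear_mapD[OF clinear_\<pi>K] \<pi>K_GG)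
  moreover have "bottom_row T0 T (u - GG T u) = bottom_row T0 T u"
    using bottom_GG[of u] by (simp add: bottom_row_eq clinear_mapD[OF T] clinear_mapD[OF clinear_Pf])
  ultimately show "inv_into (ker_perp \<iota> T0) (bottom_row T0 T) (bottom_row T0 T u) = u - GG T u"
    using bij bij_betw_inv_into_left by metis
qed

lemma schur_eq: "schur \<iota> T0 T u = T (GG T u)" if u: "u \<in> ker T0"
proof -
  have "T (GG T u) = Pf (T (GG T u))" using bottom_GG[of u] by simp
  then show ?thesis
    by (simp add: schur_def top_row_eq p22_inv_p21_eq[OF u] clinear_mapD[OF T] clinear_mapD[OF clinear_Pf])
qed

lemma T_GG_in: "T (GG T u) \<in> ran_perp T0"
  using bottom_GG[of u] Pf_in[of "T (GG T u)"] by simp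

lemma schur_inj: "inj_on (schur \<iota> T0 T) (ker T0)" if bij: "bij T"
proof (rule inj_onI)
  fix u v assume uv: "u \<in> ker T0" "v \<in> ker T0" "schur \<iota> T0 T u = schur \<iota> T0 T v"
  then have "GG T u = GG T v" using bij by (simp add: schur_eq bij_is_inj inj_eq)
  then have "\<pi>K (GG T u) = \<pi>K (GG T v)" by (rule arg_cong)
  then show "u = v" unfolding \<pi>K_GG \<pi>K_id[OF uv(1)] \<pi>K_id[OF uv(2)] .
qed

text \<open>For \<open>w\<close> orthogonal to the range, \<open>T (inv T w) = w\<close> has no
  component in the range, so the remainder in \<open>decompose\<close> vanishes.\<close>

lemma GG_inv: "GG T (\<pi>K (inv T w)) = inv T w" if bij: "bij T" and w: "w \<in> ran_perp T0"
proof -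
  have "T (inv T w) = w" using bij by (simp add: bij_is_surj surj_f_inv_f)
  then show ?thesis using decompose[of "inv T w"] Pf_id[OF w] by (simp add: clinear_mapD[OF clinear_inv_EE])
qed

lemma inv_schur: "inv_into (ker T0) (schur \<iota> T0 T) w = \<pi>K (inv T w)" if bij: "bij T" and w: "w \<in> ran_perp T0"
proof (rule inv_into_f_eq[OF schur_inj[OF bij] \<pi>K_in])
  show "schur \<iota> T0 T (\<pi>K (inv T w)) = w"
    using bij by (simp add: schur_eq[OF \<pi>K_in] GG_inv[OF that] bij_is_surj surj_f_inv_f)
qed

end

text \<open>Presents the kernel as the range of a bounded projection, so that singular parts taken
  in it agree with those taken in the whole space.\<close>

sublocale K: hilb_embedding \<pi>K "\<lambda>u. u" "sub_hilb (ker T0)"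
  by (rule hilb_embedding.intro)
    (auto simp: bounded_\<pi>K clinear_\<pi>K \<pi>K_idem range_\<pi>K bij_betw_def clinear_map_def[of "\<lambda>u. u"] intro: exI[of _ 1])

sublocale R: hilb_embedding Pf "\<lambda>v. v" "sub_hilb (ran_perp T0)"
  by (rule hilb_embedding.intro)
    (auto simp: bounded_Pf clinear_Pf Pf_idem range_Pf bij_betw_def clinear_map_def[of "\<lambda>u. u"] intro: exI[of _ 1])

lemma K_\<kappa>: "u \<in> ker T0 \<Longrightarrow> K.\<kappa> u = u" using K.\<kappa>_\<theta> by (simp add: range_\<pi>K)
lemma R_\<kappa>: "v \<in> ran_perp T0 \<Longrightarrow> R.\<kappa> v = v" using R.\<kappa>_\<theta> by (simp add: range_Pf)

end

text \<open>The parameter is frozen and only the spectral variable remains. \<open>B\<close> may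
  extend beyond \<open>V\<close>: it will be the full singular set, whereas \<open>V\<close> is one
  disc.\<close>

locale block_family = block_split \<iota> T0 n e f
  for \<iota> :: "'d::complex_hilbert \<Rightarrow> 'h1::complex_hilbert" and T0 :: "'d \<Rightarrow> 'h2::complex_hilbert"
    and n :: nat and e :: "nat \<Rightarrow> 'd" and f :: "nat \<Rightarrow> 'h2" +
  fixes V :: "complex set" and Q :: "complex \<Rightarrow> 'd \<Rightarrow> 'h2" and B :: "complex set"
  assumes V: "open V"
    and Q: "op_holomorphic_on V Q" and linQ: "\<And>z. z \<in> V \<Longrightarrow> clinear_map (Q z)"
    and p22: "\<And>z. z \<in> V \<Longrightarrow> p22_invertible \<iota> T0 (Q z)"
    and B: "finite B" and bijQ: "\<And>z. z \<in> V - B \<Longrightarrow> bij (Q z)"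
begin

section \<open>The completed operator over a disc and regularity across singular points\<close>

lemma hol_inv_EE: "op_holomorphic_on V (\<lambda>z. inv (EE (Q z)))"
proof (rule op_holomorphic_on_inv)
  have "bounded_linear (\<lambda>v. v - Pf v)" by (intro bounded_linear_sub bounded_linear_ident bounded_Pf)
  moreover have "clinear_map (\<lambda>v. v - Pf v)"
    by (auto simp: clinear_map_def clinear_mapD[OF clinear_Pf] complex_vector.scale_right_diff_distrib)
  ultimately have "op_holomorphic_on V (\<lambda>z u. (Q z u - Pf (Q z u)) + iK u)"
    by (rule op_holomorphic_on_affine[OF Q V _ _ bounded_iK])
  then show "op_holomorphic_on V (\<lambda>z. EE (Q z))" by (simp add: EE_def[abs_def])
qed (use V linQ p22 in \<open>auto intro: clinear_EE bij_EE\<close>)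

lemma reg_inv_EE:
  assumes "p \<in> V" "reg_at full p g" shows "reg_at full p (\<lambda>z. inv (EE (Q z)) (g z))"
  by (rule reg_at_op[OF hol_inv_EE _ V assms]) (auto intro: clinear_inv_EE linQ p22)

lemma reg_Q:
  assumes "p \<in> V" "reg_at full p g" shows "reg_at full p (\<lambda>z. Q z (g z))"
  by (rule reg_at_op[OF Q linQ V assms])

text \<open>By \<open>decompose\<close> the difference is \<open>inv (EE (Q z))\<close> applied to
  the lower component of \<open>Q z (s z)\<close>, and \<open>inv (EE (Q z))\<close> is holomorphic
  on all of \<open>V\<close>, also at singular points of \<open>Q\<close>.\<close>

lemma reg_minus_GG:
  assumes p: "p \<in> V" and s: "reg_at full p (\<lambda>z. Q z (s z))"
  shows "reg_at full p (\<lambda>z. s z - GG (Q z) (\<pi>K (s z)))"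
proof -
  have "reg_at full p (\<lambda>z. inv (EE (Q z)) (Q z (s z) - Pf (Q z (s z))))"
    by (intro reg_inv_EE p reg_at_diff s reg_at_linear[OF bounded_Pf clinear_Pf])
  moreover have "\<forall>\<^sub>F z in at p. inv (EE (Q z)) (Q z (s z) - Pf (Q z (s z))) = s z - GG (Q z) (\<pi>K (s z))"
    using eventually_at_in_open[OF V p]
  proof eventually_elim
    case (elim z)
    then have "s z = GG (Q z) (\<pi>K (s z)) + inv (EE (Q z)) (Q z (s z) - Pf (Q z (s z)))"
      by (intro decompose linQ p22) auto
    then show ?case by (simp add: algebra_simps)
  qed
  ultimately show ?thesis by (rule reg_at_cong[rotated])
qed

lemma hol_inv_Q: "op_holomorphic_on (V - B) (\<lambda>z. inv (Q z))"
  by (rule op_holomorphic_on_inv[OF op_holomorphic_on_subset[OF Q]])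
    (auto intro: linQ bijQ simp: V B finite_imp_closed open_Diff)

lemma vhol_inv_Q:
  assumes "vhol V b" shows "vhol (V - B) (\<lambda>z. inv (Q z) (b z))"
  by (rule vhol_op[OF hol_inv_Q _ vhol_subset[OF assms]])
    (auto intro: clinear_map_inv linQ bijQ simp: V B finite_imp_closed open_Diff)

text \<open>By \<open>GG_inv\<close> the vector \<open>inv (Q z) b\<close> is recovered from its
  finitely many kernel coordinates. They solve the system whose matrix \<open>m\<close> is that of
  the Schur complement in the bases \<open>e\<close> and \<open>f\<close>, and this is injective
  where \<open>Q z\<close> is bijective.\<close>

lemma cramer_inv_Q:
  fixes b :: 'h2
  assumes z: "z \<in> V - B" and b: "b \<in> ran_perp T0" and k: "k < n"
  defines "m \<equiv> \<lambda>i j. cinner (Q z (GG (Q z) (e j))) (f i)"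
  shows "cinner (\<iota> (inv (Q z) b)) (\<iota> (e k)) * Determinant.det (Matrix.mat n n (\<lambda>(i, j). m i j)) =
      Determinant.det (Matrix.mat n n (\<lambda>(i, j). if j = k then cinner b (f i) else m i j))" (is ?cramer)
    and "Determinant.det (Matrix.mat n n (\<lambda>(i, j). m i j)) \<noteq> 0" (is ?nz)
    and "inv (Q z) b = (\<Sum>k<n. cinner (\<iota> (inv (Q z) b)) (\<iota> (e k)) *\<^sub>C GG (Q z) (e k))" (is ?sum)
proof -
  have zV: "z \<in> V" using z by blast
  note lin = linQ[OF zV] and p = p22[OF zV] and bij = bijQ[OF z]
  note linG = clinear_mapD[OF clinear_GG[OF lin p]]
  define x where "x k = cinner (\<iota> (inv (Q z) b)) (\<iota> (e k))" for k
  define A where "A = Matrix.mat n n (\<lambda>(i, j). m i j)"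
  have A: "A \<in> carrier_mat n n" by (simp add: A_def)
  have GGsum: "GG (Q z) (\<Sum>k<n. y k *\<^sub>C e k) = (\<Sum>k<n. y k *\<^sub>C GG (Q z) (e k))" for y by (simp add: linG)
  have sum: "inv (Q z) b = (\<Sum>k<n. x k *\<^sub>C GG (Q z) (e k))"
    using GG_inv[OF lin p bij b] by (simp add: \<pi>K_def GGsum x_def)
  then show ?sum by (simp add: x_def)
  have mult: "A *\<^sub>v Matrix.vec n y = Matrix.vec n (\<lambda>i. cinner (Q z (\<Sum>k<n. y k *\<^sub>C GG (Q z) (e k))) (f i))" for y
    by (rule eq_vecI)
      (auto simp: A_def m_def scalar_prod_def clinear_mapD[OF lin] cinner_sum_left cinner_scaleC_left
        mult.commute atLeast0LessThan intro!: sum.cong)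
  have Qinv: "Q z (inv (Q z) b) = b" using bij by (simp add: bij_is_surj surj_f_inv_f)
  have "Determinant.det (replace_col A (A *\<^sub>v Matrix.vec n x) k) = Matrix.vec n x $ k * Determinant.det A"
    by (rule cramer_lemma_mat[OF A _ k]) simp
  moreover have "replace_col A (A *\<^sub>v Matrix.vec n x) k = Matrix.mat n n (\<lambda>(i, j). if j = k then cinner b (f i) else m i j)"
    unfolding mult sum[symmetric] Qinv by (rule eq_matI) (auto simp: replace_col_def A_def)
  ultimately show ?cramer using k by (simp add: A_def x_def)
  show ?nz
  proof
    assume "Determinant.det (Matrix.mat n n (\<lambda>(i, j). m i j)) = 0"
    then obtain v where v: "v \<in> carrier_vec n" "v \<noteq> 0\<^sub>v n" "A *\<^sub>v v = 0\<^sub>v n"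
      using det_0_iff_vec_prod_zero[OF A] by (auto simp: A_def)
    define y where "y i = v $ i" for i
    have vy: "v = Matrix.vec n y" using v(1) by (auto simp: y_def)
    define u where "u = (\<Sum>k<n. y k *\<^sub>C e k)"
    have u: "u \<in> ker T0"
      unfolding u_def by (intro complex_vector.subspace_sum[OF subspace_ker] complex_vector.subspace_scale[OF subspace_ker] e) auto
    have "cinner (Q z (GG (Q z) u)) (f i) = 0" if "i < n" for i
    proof -
      have "(A *\<^sub>v v) $ i = 0" using v(3) that by simp
      then show ?thesis using that unfolding vy mult u_def GGsum by simp
    qed
    then have "Q z (GG (Q z) u) = 0"
      using f(3)[OF T_GG_in[OF lin p, of u]] by simp
    then have "schur \<iota> T0 (Q z) u = schur \<iota> T0 (Q z) 0"
      using K_\<kappa> complex_vector.subspace_0[OF subspace_ker] u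
      by (simp add: schur_eq[OF lin p] linG clinear_mapD[OF lin])
    then have "u = 0"
      using schur_inj[OF lin p bij] u complex_vector.subspace_0[OF subspace_ker] by (auto dest: inj_onD)
    have "y i = 0" if "i < n" for i
    proof -
      have "cinner (\<iota> u) (\<iota> (e i)) = y i"
        using that by (simp add: u_def clinear_mapD[OF \<iota>(2)] cinner_sum_left cinner_scaleC_left e(2) if_distrib cong: if_cong)
      then show ?thesis using \<open>u = 0\<close> by (simp add: clinear_mapD[OF \<iota>(2)])
    qed
    then have "v = 0\<^sub>v n" unfolding vy by (intro eq_vecI) auto
    then show False using v(2) by contradiction
  qed
qed

text \<open>By Cramer's rule the coefficients of \<open>inv (Q z) (b z)\<close> are quotients of holomorphic functions.\<close>

lemma mero_inv_Q:
  assumes b: "vhol V b" "\<And>z. z \<in> V \<Longrightarrow> b z \<in> ran_perp T0"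
  shows "mero_on full V (\<lambda>z. inv (Q z) (b z))"
\<comment> \<open>For \<open>n = 0\<close> there is no coordinate to which Cramer's rule could be
  applied; then \<open>inv (Q z) (b z)\<close> vanishes off \<open>B\<close>.\<close>
proof (cases "n = 0")
  case True
  have \<pi>0: "\<pi>K u = 0" for u unfolding \<pi>K_def using True by simp
  have "inv (Q z) (b z) = 0" if "z \<in> V - B" for z
  proof -
    have z: "z \<in> V" using that by blast
    show ?thesis
      using GG_inv[OF linQ[OF z] p22[OF z] bijQ[OF that] b(2)[OF z]]
      by (simp add: \<pi>0 clinear_mapD[OF clinear_GG[OF linQ[OF z] p22[OF z]]])
  qed
  then have ev: "\<forall>\<^sub>F z in at p. 0 = inv (Q z) (b z)" if "p \<in> V" for p
    using eventually_not_in_finite[OF B V that] by (auto elim!: eventually_mono)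
  show ?thesis
    by (rule mero_on_cong[OF has_sing_mero[OF has_sing_self[OF pforms_zero]] ev])
next
  case False
  define m where "m z i j = cinner (Q z (GG (Q z) (e j))) (f i)" for z i j
  define N where "N z k = Determinant.det (Matrix.mat n n (\<lambda>(i, j). if j = k then cinner (b z) (f i) else m z i j))" for z k
  define dt where "dt z = Determinant.det (Matrix.mat n n (\<lambda>(i, j). m z i j))" for z
  have GGe: "vhol V (\<lambda>z. GG (Q z) (e k))" for k
    unfolding GG_def by (rule vhol_op[OF hol_inv_EE _ vhol_const V]) (auto intro: clinear_inv_EE linQ p22)
  have mh: "(\<lambda>z. m z i j) holomorphic_on V" for i j
    unfolding m_def by (rule vhol_cinner[OF vhol_op[OF Q linQ GGe V] V])
  have bh: "(\<lambda>z. cinner (b z) (f i)) holomorphic_on V" for i by (rule vhol_cinner[OF b(1) V])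
  have Nh: "(\<lambda>z. N z k) holomorphic_on V" for k
    unfolding N_def
  proof (rule holomorphic_det)
    show "(\<lambda>z. if j = k then cinner (b z) (f i) else m z i j) holomorphic_on V" for i j
      using mh bh by (cases "j = k") auto
  qed
  have dth: "dt holomorphic_on V" unfolding dt_def[abs_def] by (rule holomorphic_det[OF mh])
  have cramer: "cinner (\<iota> (inv (Q z) (b z))) (\<iota> (e k)) * dt z = N z k" if "z \<in> V - B" "k < n" for z k
    unfolding dt_def N_def m_def using that by (intro cramer_inv_Q(1) b(2)) auto
  have nz: "dt z \<noteq> 0" if "z \<in> V - B" for z
    unfolding dt_def m_def using that False by (intro cramer_inv_Q(2)[of z "b z" 0] b(2)) auto
  have expand: "inv (Q z) (b z) = (\<Sum>k<n. cinner (\<iota> (inv (Q z) (b z))) (\<iota> (e k)) *\<^sub>C GG (Q z) (e k))"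
    if "z \<in> V - B" for z
    using that False by (intro cramer_inv_Q(3)[of z "b z" 0] b(2)) auto
  show ?thesis
    unfolding mero_on_def hol_on_full
  proof
    fix p assume p: "p \<in> V"
    have "open (V - (B - {p}))" "p \<in> V - (B - {p})"
      using V B p by (auto intro!: open_Diff finite_imp_closed)
    then obtain d where d: "d > 0" "ball p d \<subseteq> V - (B - {p})" using openE by blast
    have sub: "ball p d \<subseteq> V" "ball p d - {p} \<subseteq> V - B" using d(2) by auto
    have "\<exists>w\<in>ball p d. dt w \<noteq> 0"
    proof -
      have "p + of_real (d / 2) \<in> ball p d - {p}" using d(1) by (auto simp: dist_norm)
      then show ?thesis using nz sub(2) by blast
    qed
    \<comment> \<open>The determinant does not vanish identically near \<open>p\<close>, so it is a
      power of \<open>w - p\<close> times a zero-free function. That power bounds the pole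
      order.\<close>
    then obtain r where r: "r > 0" "cball p r \<subseteq> ball p d" "zor_poly dt p holomorphic_on cball p r"
      "\<forall>w\<in>cball p r. dt w = zor_poly dt p w * (w - p) ^ nat (zorder dt p) \<and> zor_poly dt p w \<noteq> 0"
      using zorder_exist_zero[of dt "ball p d" p] holomorphic_on_subset[OF dth sub(1)] d(1) by auto
    define g where "g = zor_poly dt p"
    define q where "q = nat (zorder dt p)"
    define h where "h z = (\<Sum>k<n. (N z k / g z) *\<^sub>C GG (Q z) (e k))" for z
    have g: "g holomorphic_on ball p r" "\<And>z. z \<in> ball p r \<Longrightarrow> g z \<noteq> 0"
      "\<And>z. z \<in> ball p r \<Longrightarrow> dt z = g z * (z - p) ^ q"
      using r(3,4) by (auto simp: g_def q_def intro: holomorphic_on_subset)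
    have br: "ball p r \<subseteq> V" using r(2) sub(1) by force
    have "vhol (ball p r) h"
      unfolding h_def
      by (intro vhol_sum vhol_scaleC holomorphic_on_divide holomorphic_on_subset[OF Nh br] g vhol_subset[OF GGe br]) auto
    moreover have "inv (Q z) (b z) = inverse ((z - p) ^ q) *\<^sub>C h z" if z: "z \<in> ball p r - {p}" for z
    proof -
      have zV: "z \<in> V - B" using z sub(2) r(2) by force
      have "(z - p) ^ q \<noteq> 0" "g z \<noteq> 0" "dt z = g z * (z - p) ^ q" using z g by auto
      then have "cinner (\<iota> (inv (Q z) (b z))) (\<iota> (e k)) = inverse ((z - p) ^ q) * (N z k / g z)" if "k < n" for k
        using cramer[OF zV that] by (simp add: field_simps)
      then show ?thesis
        by (subst expand[OF zV]) (simp add: h_def complex_vector.scale_sum_right)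
    qed
    ultimately show "\<exists>r>0. \<exists>g n. vhol (ball p r) g \<and> (\<forall>z\<in>ball p r - {p}. inv (Q z) (b z) = inverse ((z - p) ^ n) *\<^sub>C g z)"
      using r(1) by blast
  qed
qed

text \<open>Consequently the singular part of \<open>(p22)\<^sup>-\<^sup>1 p21 \<pi>K t\<close> is \<open>\<pi>K t - t\<close>, if \<open>t\<close> is that of the
  function below, because \<open>t - GG (\<pi>K t)\<close> is regular.\<close>

lemma phi_has_sing:
  assumes Vball: "V = ball c \<epsilon>" and b: "vhol V b" "\<And>z. z \<in> V \<Longrightarrow> b z \<in> ran_perp T0"
  shows "has_sing V (\<lambda>z. (z - c) ^ l *\<^sub>C inv (Q z) (b z)) (phi \<iota> T0 c \<epsilon> Q b l)"
    and "\<pi>K (phi \<iota> T0 c \<epsilon> Q b l z) = phiK \<iota> T0 c \<epsilon> Q b l z"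
    and "phi \<iota> T0 c \<epsilon> Q b l \<in> ksing V Q"
    and "\<exists>n A a. phi \<iota> T0 c \<epsilon> Q b l = pform n A a \<and> finite A \<and> A \<subseteq> B \<inter> V"
proof -
  \<comment> \<open>The factor \<open>(z - c) ^ l\<close> is absorbed into \<open>b\<close>, which
    keeps its values orthogonal to the range; so \<open>l\<close> causes no further case.\<close>
  define b' where "b' z = (z - c) ^ l *\<^sub>C b z" for z
  have b': "vhol V b'" "\<And>z. z \<in> V \<Longrightarrow> b' z \<in> ran_perp T0"
    unfolding b'_def
    by (intro vhol_scaleC V b holomorphic_intros) (auto intro: complex_vector.subspace_scale[OF subspace_ran_perp] b(2))
  define F where "F z = inv (Q z) (b' z)" for z
  have F: "F z = (z - c) ^ l *\<^sub>C inv (Q z) (b z)" if "z \<in> V - B" for z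
    using that unfolding F_def b'_def by (simp add: clinear_mapD[OF clinear_map_inv[OF linQ bijQ]])
  have QF: "Q z (F z) = b' z" if "z \<in> V - B" for z
    using bijQ[OF that] by (simp add: F_def bij_is_surj surj_f_inv_f)
  note evB = eventually_not_in_finite[OF B V]
  have Fm: "mero_on full V F" unfolding F_def by (rule mero_inv_Q[OF b'])
  have poles: "poles_in full V F \<subseteq> B \<inter> V"
  proof
    fix p assume p: "p \<in> poles_in full V F"
    have "vhol (V - B) F" unfolding F_def by (rule vhol_inv_Q[OF b'(1)])
    then have "reg_at full p F" if "p \<in> V - B"
      by (rule reg_at_vhol[OF _ _ that]) (auto simp: V B finite_imp_closed open_Diff)
    then show "p \<in> B \<inter> V" using p by (auto simp: poles_in_def)
  qed
  obtain t where t: "has_sing V F t"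
    using mero_has_sing[OF Fm finite_subset[OF poles]] B by blast
  have "reg_on full V (\<lambda>z. Q z (F z))"
    unfolding reg_on_def
  proof
    fix p assume p: "p \<in> V"
    have "\<forall>\<^sub>F z in at p. b' z = Q z (F z)" using evB[OF p] by eventually_elim (simp add: QF)
    then show "reg_at full p (\<lambda>z. Q z (F z))" by (rule reg_at_cong[OF _ reg_at_vhol[OF b'(1) V p]])
  qed
  then have rt: "reg_on full V (\<lambda>z. Q z (t z))" using sing_part_reg[OF Q linQ V t] by simp
  have phiK: "phiK \<iota> T0 c \<epsilon> Q b l = (\<lambda>z. \<pi>K (t z))"
    unfolding phiK_def Vball[symmetric]
  proof (rule K.sing_part_\<theta>)
    define g where "g z = (z - c) ^ l *\<^sub>C inv_into (ker T0) (schur \<iota> T0 (Q z)) (b z)" for z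
    have g: "g z = \<pi>K (F z)" if "z \<in> V - B" for z
      unfolding g_def F[OF that] using that
      by (subst inv_schur) (auto intro: linQ p22 bijQ b(2) simp: clinear_mapD[OF clinear_\<pi>K])
    show "\<forall>\<^sub>F z in at p. (z - c) ^ l *\<^sub>C inv_into (ker T0) (schur \<iota> T0 (Q z)) (b z) \<in> car (sub_hilb (ker T0))"
      if "p \<in> V" for p
      using evB[OF that] by eventually_elim (simp add: g \<pi>K_in flip: g_def)
    have "has_sing V (\<lambda>z. K.\<kappa> (g z)) (\<lambda>z. \<pi>K (t z))"
      unfolding has_sing_def reg_on_def
    proof (intro conjI ballI)
      show "(\<lambda>z. \<pi>K (t z)) \<in> pforms V" using t by (auto simp: has_sing_def intro: pforms_linear[OF clinear_\<pi>K])
      fix p assume p: "p \<in> V"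
      have "reg_at full p (\<lambda>z. \<pi>K (F z - t z))"
        using t p by (intro reg_at_linear[OF bounded_\<pi>K clinear_\<pi>K]) (auto simp: has_sing_def reg_on_def)
      moreover have "\<forall>\<^sub>F z in at p. \<pi>K (F z - t z) = K.\<kappa> (g z) - \<pi>K (t z)"
        using evB[OF p] by eventually_elim (simp add: g K_\<kappa> \<pi>K_in clinear_mapD[OF clinear_\<pi>K])
      ultimately show "reg_at full p (\<lambda>z. K.\<kappa> (g z) - \<pi>K (t z))" by (rule reg_at_cong[rotated])
    qed
    then show "has_sing V (\<lambda>z. K.\<kappa> ((z - c) ^ l *\<^sub>C inv_into (ker T0) (schur \<iota> T0 (Q z)) (b z))) (\<lambda>z. \<pi>K (t z))"
      by (simp add: g_def)
  qed
  have "has_sing V (\<lambda>z. p22_inv_p21 \<iota> T0 (Q z) (\<pi>K (t z))) (\<lambda>z. \<pi>K (t z) - t z)"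
    unfolding has_sing_def reg_on_def
  proof (intro conjI ballI)
    show "(\<lambda>z. \<pi>K (t z) - t z) \<in> pforms V"
      using t by (auto simp: has_sing_def intro: pforms_diff pforms_linear[OF clinear_\<pi>K])
    fix p assume p: "p \<in> V"
    have "reg_at full p (\<lambda>z. t z - GG (Q z) (\<pi>K (t z)))"
      using rt p by (intro reg_minus_GG) (auto simp: reg_on_def)
    moreover have "\<forall>\<^sub>F z in at p. t z - GG (Q z) (\<pi>K (t z)) = p22_inv_p21 \<iota> T0 (Q z) (\<pi>K (t z)) - (\<pi>K (t z) - t z)"
      using eventually_at_in_open[OF V p]
      by eventually_elim (auto simp: p22_inv_p21_eq[OF linQ p22 \<pi>K_in])
    ultimately show "reg_at full p (\<lambda>z. p22_inv_p21 \<iota> T0 (Q z) (\<pi>K (t z)) - (\<pi>K (t z) - t z))"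
      by (rule reg_at_cong[rotated])
  qed
  from sing_part_eq[OF this] have phi: "phi \<iota> T0 c \<epsilon> Q b l = t"
    unfolding phi_def phiK Vball[symmetric] by (simp add: fun_eq_iff)
  show "has_sing V (\<lambda>z. (z - c) ^ l *\<^sub>C inv (Q z) (b z)) (phi \<iota> T0 c \<epsilon> Q b l)"
    unfolding phi has_sing_def reg_on_def
  proof (intro conjI ballI)
    show "t \<in> pforms V" using t by (simp add: has_sing_def)
    fix p assume p: "p \<in> V"
    have "\<forall>\<^sub>F z in at p. F z - t z = (z - c) ^ l *\<^sub>C inv (Q z) (b z) - t z"
      using evB[OF p] by eventually_elim (simp add: F)
    then show "reg_at full p (\<lambda>z. (z - c) ^ l *\<^sub>C inv (Q z) (b z) - t z)"
      by (rule reg_at_cong) (use t p in \<open>auto simp: has_sing_def reg_on_def\<close>)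
  qed
  show "\<pi>K (phi \<iota> T0 c \<epsilon> Q b l z) = phiK \<iota> T0 c \<epsilon> Q b l z" by (simp add: phi phiK)
  show "phi \<iota> T0 c \<epsilon> Q b l \<in> ksing V Q" using rt t by (simp add: phi ksing_def has_sing_def)
  have "has_sing (B \<inter> V) F t'" if "has_sing V F t'" "t' \<in> pforms (B \<inter> V)" for t'
    using that by (auto simp: has_sing_def reg_on_def)
  obtain n A a where A: "t = pform n A a" "finite A" "A \<subseteq> V" using t by (auto simp: has_sing_def pforms_def)
  \<comment> \<open>Points of \<open>A\<close> off \<open>B\<close> carry zero coefficients since
    \<open>F\<close> is regular there. Having the poles inside \<open>B\<close> confines them to the
    region enclosed by the later integration circles.\<close>
  have "t = pform n (A \<inter> B) a"
  proof -
    have "a p k = 0" if "p \<in> A - B" "k \<in> {1..n}" for p k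
    proof -
      have "p \<in> V" "reg_at full p F" using that A(3) poles by (auto simp: poles_in_def)
      moreover have "reg_at full p (\<lambda>z. F z - t z)" using t \<open>p \<in> V\<close> by (simp add: has_sing_def reg_on_def)
      ultimately have "reg_at full p (\<lambda>z. F z - (F z - t z))" using reg_at_diff[of p F] by blast
      then show ?thesis using reg_pform_coeff_zero[OF A(2), of p n a k] that by (simp add: A(1))
    qed
    then show ?thesis
      unfolding A(1) pform_def using A(2) by (intro ext sum.mono_neutral_right) auto
  qed
  then show "\<exists>n A a. phi \<iota> T0 c \<epsilon> Q b l = pform n A a \<and> finite A \<and> A \<subseteq> B \<inter> V"
    using A unfolding phi by (intro exI[of _ n] exI[of _ "A \<inter> B"] exI[of _ a]) auto
qed

text \<open>The Schur complement of \<open>\<pi>K (s z)\<close> is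
  \<open>Q z (GG (Q z) (\<pi>K (s z)))\<close>. By \<open>reg_minus_GG\<close> it differs from the
  regular \<open>Q z (s z)\<close> by the image of a regular function.\<close>

lemma \<pi>K_local_sing_space:
  assumes Vball: "V = ball c \<epsilon>" and s: "s \<in> ksing V Q"
  shows "(\<lambda>z. \<pi>K (s z)) \<in> local_sing_space \<iota> T0 c \<epsilon> Q"
proof -
  define k where "k z = \<pi>K (s z)" for z
  have kP: "k \<in> pforms V" using s unfolding k_def by (auto simp: ksing_def intro: pforms_linear[OF clinear_\<pi>K])
  have kin: "k z \<in> ker T0" for z by (simp add: k_def \<pi>K_in)
  then have K: "K.\<kappa> (k z) = k z" for z by (rule K_\<kappa>)
  have "mero_on (sub_hilb (ker T0)) V k"
    unfolding K.mero_on_iff K using has_sing_mero[OF has_sing_self[OF kP]] by (simp add: kin)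
  moreover have "sing_part (sub_hilb (ker T0)) V k = k"
    using K.sing_part_\<theta>[of V k k] has_sing_self[OF kP] K by (simp add: kin)
  moreover have "reg_on (sub_hilb (ran_perp T0)) V (\<lambda>z. schur \<iota> T0 (Q z) (k z))"
    unfolding reg_on_def R.reg_at_iff
  proof (intro ballI conjI)
    fix p assume p: "p \<in> V"
    have sc: "schur \<iota> T0 (Q z) (k z) = Q z (GG (Q z) (\<pi>K (s z)))" "schur \<iota> T0 (Q z) (k z) \<in> ran_perp T0"
      if "z \<in> V" for z
      unfolding k_def schur_eq[OF linQ[OF that] p22[OF that] \<pi>K_in] using T_GG_in[OF linQ[OF that] p22[OF that]] by auto
    have rs: "reg_at full p (\<lambda>z. Q z (s z))" using s p by (simp add: ksing_def reg_on_def)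
    have "reg_at full p (\<lambda>z. Q z (s z) - Q z (s z - GG (Q z) (\<pi>K (s z))))"
      by (intro reg_at_diff rs reg_Q[OF p] reg_minus_GG[OF p rs])
    moreover have "\<forall>\<^sub>F z in at p. Q z (s z) - Q z (s z - GG (Q z) (\<pi>K (s z))) = R.\<kappa> (schur \<iota> T0 (Q z) (k z))"
      using eventually_at_in_open[OF V p]
    proof eventually_elim
      case (elim z)
      then have z: "z \<in> V" by simp
      have "R.\<kappa> (schur \<iota> T0 (Q z) (k z)) = Q z (GG (Q z) (\<pi>K (s z)))"
        using R_\<kappa>[OF sc(2)[OF z]] sc(1)[OF z] by (rule trans)
      then show ?case by (simp add: clinear_mapD[OF linQ[OF z]])
    qed
    ultimately show "reg_at full p (\<lambda>z. R.\<kappa> (schur \<iota> T0 (Q z) (k z)))" by (rule reg_at_cong[rotated])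
    show "\<forall>\<^sub>F z in at p. schur \<iota> T0 (Q z) (k z) \<in> car (sub_hilb (ran_perp T0))"
      using eventually_at_in_open[OF V p] by eventually_elim (use sc(2) in auto)
  qed
  ultimately show ?thesis
    unfolding local_sing_space_def Vball[symmetric] mem_Collect_eq k_def[abs_def, symmetric]
    by (intro exI[of _ k]) simp
qed

lemma ksing_sum:
  assumes "\<And>i. i \<in> I \<Longrightarrow> s i \<in> ksing V Q" shows "(\<lambda>z. \<Sum>i\<in>I. c i *\<^sub>C s i z) \<in> ksing V Q"
  unfolding ksing_def reg_on_def
proof (intro CollectI conjI ballI)
  show "(\<lambda>z. \<Sum>i\<in>I. c i *\<^sub>C s i z) \<in> pforms V"
    using assms by (intro pforms_sum pforms_scaleC) (auto simp: ksing_def)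
  fix p assume p: "p \<in> V"
  have "reg_at full p (\<lambda>z. \<Sum>i\<in>I. c i *\<^sub>C Q z (s i z))"
    using assms p by (intro reg_at_sum reg_at_linear[OF bounded_linear_scaleC_right clinear_map_scaleC])
      (auto simp: ksing_def reg_on_def)
  moreover have "\<forall>\<^sub>F z in at p. (\<Sum>i\<in>I. c i *\<^sub>C Q z (s i z)) = Q z (\<Sum>i\<in>I. c i *\<^sub>C s i z)"
    using eventually_at_in_open[OF V p] by eventually_elim (simp add: clinear_mapD[OF linQ])
  ultimately show "reg_at full p (\<lambda>z. Q z (\<Sum>i\<in>I. c i *\<^sub>C s i z))" by (rule reg_at_cong[rotated])
qed

text \<open>\<open>\<pi>K\<close> is injective on \<open>ksing V Q\<close>: if
  \<open>\<pi>K d = 0\<close>, then \<open>reg_minus_GG\<close> makes \<open>d\<close> itself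
  regular, hence zero. So the basis of the space for the Schur complement lifts.\<close>

lemma phi_basis:
  assumes Vball: "V = ball c \<epsilon>" and I: "finite I"
    and b: "\<And>i. i \<in> I \<Longrightarrow> vhol V (b i)" "\<And>i z. i \<in> I \<Longrightarrow> z \<in> V \<Longrightarrow> b i z \<in> ran_perp T0"
    and basis: "is_basis I (\<lambda>i. phiK \<iota> T0 c \<epsilon> Q (b i) (l i)) (local_sing_space \<iota> T0 c \<epsilon> Q)"
  shows "is_basis I (\<lambda>i. phi \<iota> T0 c \<epsilon> Q (b i) (l i)) (ksing V Q)"
proof -
  define ph where "ph i = phi \<iota> T0 c \<epsilon> Q (b i) (l i)" for i
  define pk where "pk i = phiK \<iota> T0 c \<epsilon> Q (b i) (l i)" for i
  have pk: "pk i = (\<lambda>z. \<pi>K (ph i z))" if "i \<in> I" for i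
    unfolding ph_def pk_def using phi_has_sing(2)[OF Vball b(1)[OF that] b(2)[OF that], of "l i"] by auto
  have ph: "ph i \<in> ksing V Q" if "i \<in> I" for i
    unfolding ph_def by (rule phi_has_sing(3)[OF Vball b(1)[OF that] b(2)[OF that]])
  have funsum: "(\<Sum>i\<in>I. c i *\<^sub>C g i) = (\<lambda>z. \<Sum>i\<in>I. c i *\<^sub>C g i z)" for c and g :: "_ \<Rightarrow> complex \<Rightarrow> 'd"
    by (auto simp: fun_eq_iff scaleC_fun_def fun_sum_apply)
  have pksum: "(\<lambda>z. \<Sum>i\<in>I. c i *\<^sub>C pk i z) = (\<lambda>z. \<pi>K (\<Sum>i\<in>I. c i *\<^sub>C ph i z))" for c
    by (rule ext) (simp add: clinear_mapD[OF clinear_\<pi>K] pk)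
  from basis have ind: "\<And>c. (\<lambda>z. \<Sum>i\<in>I. c i *\<^sub>C pk i z) = 0 \<Longrightarrow> \<forall>i\<in>I. c i = 0"
    and span: "local_sing_space \<iota> T0 c \<epsilon> Q = range (\<lambda>c. \<lambda>z. \<Sum>i\<in>I. c i *\<^sub>C pk i z)"
    unfolding is_basis_iff[OF I] pk_def[symmetric] funsum by blast+
  have "\<forall>i\<in>I. c i = 0" if "(\<lambda>z. \<Sum>i\<in>I. c i *\<^sub>C ph i z) = 0" for c
  proof (rule ind)
    show "(\<lambda>z. \<Sum>i\<in>I. c i *\<^sub>C pk i z) = 0"
      unfolding pksum using that by (auto simp: fun_eq_iff clinear_mapD[OF clinear_\<pi>K])
  qed
  moreover have "s \<in> range (\<lambda>c. \<lambda>z. \<Sum>i\<in>I. c i *\<^sub>C ph i z)" if s: "s \<in> ksing V Q" for s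
  proof -
    obtain c where c: "(\<lambda>z. \<pi>K (s z)) = (\<lambda>z. \<Sum>i\<in>I. c i *\<^sub>C pk i z)"
      using \<pi>K_local_sing_space[OF Vball s] unfolding span by blast
    \<comment> \<open>The combination of the \<open>ph i\<close> that has the same kernel component
      as \<open>s\<close>; the difference \<open>d\<close> is shown to vanish.\<close>
    define t where "t z = (\<Sum>i\<in>I. c i *\<^sub>C ph i z)" for z
    define d where "d z = s z - t z" for z
    have t: "t \<in> ksing V Q" unfolding t_def[abs_def] by (rule ksing_sum[OF ph])
    have \<pi>d: "\<pi>K (d z) = 0" for z
      using fun_cong[OF c, of z] fun_cong[OF pksum[of c], of z] by (simp add: d_def t_def clinear_mapD(4)[OF clinear_\<pi>K])
    have "d \<in> pforms V" using s t unfolding d_def[abs_def] by (auto simp: ksing_def intro: pforms_diff)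
    moreover have "reg_at full p d" if p: "p \<in> V" for p
    proof -
      have "reg_at full p (\<lambda>z. Q z (s z) - Q z (t z))"
        using s t p by (intro reg_at_diff) (auto simp: ksing_def reg_on_def)
      moreover have "\<forall>\<^sub>F z in at p. Q z (s z) - Q z (t z) = Q z (d z)"
        using eventually_at_in_open[OF V p] by eventually_elim (simp add: d_def clinear_mapD[OF linQ])
      ultimately have "reg_at full p (\<lambda>z. Q z (d z))" by (rule reg_at_cong[rotated])
      from reg_minus_GG[OF p this]
      have 1: "reg_at full p (\<lambda>z. d z - GG (Q z) 0)" unfolding \<pi>d .
      have "\<forall>\<^sub>F z in at p. d z - GG (Q z) 0 = d z"
        using eventually_at_in_open[OF V p] by eventually_elim (simp add: clinear_mapD[OF clinear_GG[OF linQ p22]])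
      then show ?thesis by (rule reg_at_cong[OF _ 1])
    qed
    ultimately have "d = (\<lambda>z. 0)" by (intro pforms_reg_zero[of _ V]) (auto simp: reg_on_def)
    then have "s = t" by (simp add: d_def fun_eq_iff)
    then show ?thesis unfolding t_def[abs_def] by blast
  qed
  moreover have "(\<lambda>z. \<Sum>i\<in>I. c i *\<^sub>C ph i z) \<in> ksing V Q" for c by (rule ksing_sum[OF ph])
  ultimately show ?thesis
    unfolding is_basis_iff[OF I] ph_def[symmetric] funsum by blast
qed

end

section \<open>Smooth dependence of singular parts on parameters\<close>

text \<open>Corrects the irrelevant values at isolated points: taking limits glues the local
  extensions into one holomorphic function.\<close>

lemma reg_on_extend:
  assumes g: "reg_on full V g"
  obtains h where "vhol V h" "\<And>p. p \<in> V \<Longrightarrow> (g \<longlongrightarrow> h p) (at p)"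
proof -
  define h where "h p = Lim (at p) g" for p
  have loc: "\<exists>r>0. \<exists>G. vhol (ball p r) G \<and> (\<forall>q\<in>ball p r. (g \<longlongrightarrow> G q) (at q))" if p: "p \<in> V" for p
  proof -
    obtain r G where r: "r > 0" "vhol (ball p r) G" "\<forall>z\<in>ball p r - {p}. g z = G z"
      using g p by (auto simp: reg_on_def reg_at_def hol_on_full)
    have "(g \<longlongrightarrow> G q) (at q)" if q: "q \<in> ball p r" for q
    proof -
      have "\<forall>\<^sub>F z in at q. z \<in> ball p r - {p}"
        using eventually_not_in_finite[of "{p}" "ball p r" q] q by simp
      then have "\<forall>\<^sub>F z in at q. G z = g z" by eventually_elim (use r(3) in auto)
      with vhol_tendsto[OF r(2) q] show ?thesis by (rule Lim_transform_eventually)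
    qed
    then show ?thesis using r by blast
  qed
  have lim: "(g \<longlongrightarrow> h p) (at p)" if p: "p \<in> V" for p
  proof -
    obtain r G where "r > 0" "\<forall>q\<in>ball p r. (g \<longlongrightarrow> G q) (at q)" using loc[OF p] by blast
    then have "(g \<longlongrightarrow> G p) (at p)" by simp
    then show ?thesis unfolding h_def using tendsto_Lim[OF trivial_limit_at] by metis
  qed
  have "vhol V h"
    unfolding vhol_def
  proof
    fix p assume p: "p \<in> V"
    obtain r G where r: "r > 0" "vhol (ball p r) G" "\<forall>q\<in>ball p r. (g \<longlongrightarrow> G q) (at q)"
      using loc[OF p] by blast
    have "G q = h q" if "q \<in> ball p r" for q
      unfolding h_def using tendsto_Lim[OF trivial_limit_at bspec[OF r(3) that]] by simp
    then have "vhol (ball p r) h" by (rule vhol_cong[OF open_ball _ r(2)])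
    then show "\<exists>l. (h has_derivative (\<lambda>x. x *\<^sub>C l)) (at p)" using r(1) by (auto simp: vhol_def)
  qed
  then show thesis using that lim by blast
qed

text \<open>Partial fractions raise the exponent at \<open>p\<close> one step at a time. If
  \<open>\<sigma>\<close> is inside the circle, the residues at \<open>\<sigma>\<close> and
  \<open>p\<close> cancel; if it is outside, only the one at \<open>p\<close> counts.\<close>

lemma circlepath_kernel_integral:
  assumes p: "p \<in> ball c r" and \<sigma>: "dist c \<sigma> \<noteq> r" "\<sigma> \<noteq> p"
  shows "((\<lambda>\<zeta>. inverse (\<zeta> - \<sigma>) * inverse ((\<zeta> - p) ^ Suc k)) has_contour_integral
    (if dist c \<sigma> < r then 0 else - (2 * of_real pi * \<i>) * inverse ((\<sigma> - p) ^ Suc k))) (circlepath c r)"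
proof (induction k)
  have r: "r > 0" using p by (metis ball_eq_empty empty_iff not_less)
  have power: "((\<lambda>\<zeta>. inverse ((\<zeta> - p) ^ Suc k)) has_contour_integral (if k = 0 then 2 * of_real pi * \<i> else 0)) (circlepath c r)" for k
  proof -
    have "((\<lambda>u. 1 / (u - p) ^ Suc k) has_contour_integral (2 * of_real pi * \<i>) / fact k * (deriv ^^ k) (\<lambda>_. 1) p) (circlepath c r)"
      using Cauchy_has_contour_integral_higher_derivative_circlepath[of c r "\<lambda>_. 1" p k] p by simp
    moreover have "(deriv ^^ k) (\<lambda>_. 1 :: complex) p = (if k = 0 then 1 else 0)"
      using higher_deriv_const[of k "1 :: complex"] by simp
    ultimately show ?thesis by (cases "k = 0") (auto simp: divide_inverse)
  qed
  have base: "((\<lambda>\<zeta>. inverse (\<zeta> - \<sigma>)) has_contour_integral (if dist c \<sigma> < r then 2 * of_real pi * \<i> else 0)) (circlepath c r)"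
  proof (cases "dist c \<sigma> < r")
    case True
    have "((\<lambda>u. 1 / (u - \<sigma>)) has_contour_integral 2 * of_real pi * \<i> * 1) (circlepath c r)"
      using True by (intro Cauchy_integral_circlepath) (auto simp: dist_norm norm_minus_commute)
    then show ?thesis using True by (simp add: divide_inverse)
  next
    case False
    then have "(\<lambda>\<zeta>. inverse (\<zeta> - \<sigma>)) holomorphic_on ball c (dist c \<sigma>)" by (intro holomorphic_intros) auto
    moreover have "sphere c r \<subseteq> ball c (dist c \<sigma>)" using False \<sigma>(1) by auto
    ultimately show ?thesis
      using Cauchy_theorem_convex_simple[of _ "ball c (dist c \<sigma>)" "circlepath c r"] r False by auto
  qed
  have split: "inverse (\<sigma> - p) * (inverse (\<zeta> - \<sigma>) * inverse ((\<zeta> - p) ^ k) - inverse ((\<zeta> - p) ^ Suc k)) =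
     inverse (\<zeta> - \<sigma>) * inverse ((\<zeta> - p) ^ Suc k)" if "\<zeta> \<in> path_image (circlepath c r)" for \<zeta> k
  proof -
    have "\<zeta> \<in> sphere c r" using that r by simp
    then have "\<zeta> - \<sigma> \<noteq> 0" "\<zeta> - p \<noteq> 0" using \<sigma>(1) p by auto
    then have eq: "inverse (\<zeta> - \<sigma>) - inverse (\<zeta> - p) = (\<sigma> - p) * (inverse (\<zeta> - \<sigma>) * inverse (\<zeta> - p))"
      by (simp add: field_simps)
    have "inverse (\<zeta> - \<sigma>) * inverse ((\<zeta> - p) ^ k) - inverse ((\<zeta> - p) ^ Suc k) =
        (inverse (\<zeta> - \<sigma>) - inverse (\<zeta> - p)) * inverse ((\<zeta> - p) ^ k)"
      unfolding power_Suc inverse_mult_distrib by (simp only: left_diff_distrib)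
    then show ?thesis using \<sigma>(2) by (simp add: eq)
  qed
  have step: "((\<lambda>\<zeta>. inverse (\<zeta> - \<sigma>) * inverse ((\<zeta> - p) ^ Suc k)) has_contour_integral
      inverse (\<sigma> - p) * (J - (if k = 0 then 2 * of_real pi * \<i> else 0))) (circlepath c r)"
    if "((\<lambda>\<zeta>. inverse (\<zeta> - \<sigma>) * inverse ((\<zeta> - p) ^ k)) has_contour_integral J) (circlepath c r)" for k J
    by (rule has_contour_integral_eq[OF has_contour_integral_lmul[OF has_contour_integral_diff[OF that power]] split])
  {
    case 0
    have "((\<lambda>\<zeta>. inverse (\<zeta> - \<sigma>) * inverse ((\<zeta> - p) ^ 0)) has_contour_integral
        (if dist c \<sigma> < r then 2 * of_real pi * \<i> else 0)) (circlepath c r)" using base by simp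
    from step[OF this] show ?case by (cases "dist c \<sigma> < r") (auto simp: mult.commute)
  next
    case (Suc k)
    from step[OF Suc] show ?case by (cases "dist c \<sigma> < r") (auto simp: mult_ac)
  }
qed

lemma circint_pform:
  assumes A: "finite A" "A \<subseteq> ball c r" and \<sigma>: "dist c \<sigma> \<noteq> r" "\<sigma> \<notin> A" and r: "r > 0"
  shows "circint c r (\<lambda>\<zeta>. inverse (\<zeta> - \<sigma>) *\<^sub>C pform n A a \<zeta>) =
    (if dist c \<sigma> < r then 0 else - (2 * of_real pi * \<i>) *\<^sub>C pform n A a \<sigma>)"
proof -
  have nz: "\<zeta> - \<sigma> \<noteq> 0" "p \<in> A \<Longrightarrow> \<zeta> - p \<noteq> 0" if "\<zeta> \<in> sphere c r" for \<zeta> p using that \<sigma>(1) A(2) by auto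
  have cont: "continuous_on (sphere c r) (\<lambda>\<zeta>. (inverse (\<zeta> - \<sigma>) * inverse ((\<zeta> - p) ^ k)) *\<^sub>C v)" if "p \<in> A" for p k and v :: 'a
    using nz that by (intro continuous_intros) auto
  define J where "J p k = (if dist c \<sigma> < r then 0 else - (2 * of_real pi * \<i>) * inverse ((\<sigma> - p) ^ k))" for p k
  have single: "circint c r (\<lambda>\<zeta>. (inverse (\<zeta> - \<sigma>) * inverse ((\<zeta> - p) ^ k)) *\<^sub>C v) = J p k *\<^sub>C v"
    if pA: "p \<in> A" and k: "k \<ge> 1" for p k and v :: 'a
  proof (rule circint_eqI[OF cont[OF pA]])
    obtain m where m: "k = Suc m" using k by (cases k) auto
    have "((\<lambda>\<zeta>. inverse (\<zeta> - \<sigma>) * inverse ((\<zeta> - p) ^ k)) has_contour_integral J p k) (circlepath c r)"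
      unfolding J_def m using pA A(2) \<sigma> by (intro circlepath_kernel_integral) auto
    from has_contour_integral_rmul[OF this]
    show "((\<lambda>z. cinner ((inverse (z - \<sigma>) * inverse ((z - p) ^ k)) *\<^sub>C v) w) has_contour_integral cinner (J p k *\<^sub>C v) w) (circlepath c r)" for w
      by (simp add: cinner_scaleC_left)
  qed (use r in simp)
  have "circint c r (\<lambda>\<zeta>. inverse (\<zeta> - \<sigma>) *\<^sub>C pform n A a \<zeta>) =
     (\<Sum>p\<in>A. \<Sum>k=1..n. circint c r (\<lambda>\<zeta>. (inverse (\<zeta> - \<sigma>) * inverse ((\<zeta> - p) ^ k)) *\<^sub>C a p k))"
    unfolding pform_def complex_vector.scale_sum_right scaleC_scaleC using r A(1)
    by (simp add: circint_sum continuous_on_sum cont)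
  also have "\<dots> = (\<Sum>p\<in>A. \<Sum>k=1..n. J p k *\<^sub>C a p k)" by (intro sum.cong refl single) auto
  also have "\<dots> = (if dist c \<sigma> < r then 0 else - (2 * of_real pi * \<i>) *\<^sub>C pform n A a \<sigma>)"
    by (simp add: J_def pform_def complex_vector.scale_sum_right sum_negf)
  finally show ?thesis .
qed

text \<open>Write \<open>F\<close> as singular part plus holomorphic \<open>h\<close>. For
  \<open>\<sigma>\<close> inside the circle the integral yields \<open>h \<sigma>\<close>, to be
  subtracted from \<open>F \<sigma>\<close>; outside it yields minus the singular part. Either way
  no single pole is mentioned.\<close>

lemma sing_part_circint:
  assumes F: "vhol (ball c \<epsilon> - B) F" and B: "finite B" "B \<subseteq> ball c r" and r: "0 < r" "r < \<epsilon>"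
    and s: "has_sing (ball c \<epsilon>) F (pform n A a)" "finite A" "A \<subseteq> B"
    and \<sigma>: "dist c \<sigma> \<noteq> r" "\<sigma> \<notin> B"
  shows "pform n A a \<sigma> = (if dist c \<sigma> < r then F \<sigma> else 0) -
    inverse (2 * of_real pi * \<i>) *\<^sub>C circint c r (\<lambda>\<zeta>. inverse (\<zeta> - \<sigma>) *\<^sub>C F \<zeta>)"
proof -
  have reg: "reg_on full (ball c \<epsilon>) (\<lambda>z. F z - pform n A a z)" using s(1) by (simp add: has_sing_def)
  obtain h where h: "vhol (ball c \<epsilon>) h" "\<And>p. p \<in> ball c \<epsilon> \<Longrightarrow> ((\<lambda>z. F z - pform n A a z) \<longlongrightarrow> h p) (at p)"
    by (rule reg_on_extend[OF reg]) (rule that)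
  have Fh: "F p = pform n A a p + h p" if p: "p \<in> ball c \<epsilon> - B" for p
  proof -
    have "(F \<longlongrightarrow> F p) (at p)" by (rule vhol_tendsto[OF F p])
    moreover have "(pform n A a \<longlongrightarrow> pform n A a p) (at p)"
      using p s(3) by (intro vhol_tendsto[OF vhol_pform[OF s(2)]]) auto
    ultimately have "((\<lambda>z. F z - pform n A a z) \<longlongrightarrow> F p - pform n A a p) (at p)" by (rule tendsto_diff)
    then have "F p - pform n A a p = h p" by (rule tendsto_unique[OF trivial_limit_at]) (use h(2) p in blast)
    then show ?thesis by (metis add.commute diff_add_cancel)
  qed
  have sph: "\<zeta> \<in> ball c \<epsilon> - B" "\<zeta> - \<sigma> \<noteq> 0" "\<zeta> \<notin> A" if "\<zeta> \<in> sphere c r" for \<zeta>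
    using that r B s(3) \<sigma>(1) by auto
  have cs: "continuous_on (sphere c r) (pform n A a)"
    using sph by (intro continuous_on_subset[OF vhol_continuous_on[OF vhol_pform[OF s(2)]]]) auto
  have ch: "continuous_on (sphere c r) h"
    using sph by (intro continuous_on_subset[OF vhol_continuous_on[OF h(1)]]) auto
  have "circint c r (\<lambda>\<zeta>. inverse (\<zeta> - \<sigma>) *\<^sub>C F \<zeta>) =
     circint c r (\<lambda>\<zeta>. inverse (\<zeta> - \<sigma>) *\<^sub>C pform n A a \<zeta> + inverse (\<zeta> - \<sigma>) *\<^sub>C h \<zeta>)"
    using r sph by (intro circint_cong) (auto simp: Fh scaleC_add_right)
  also have "\<dots> = circint c r (\<lambda>\<zeta>. inverse (\<zeta> - \<sigma>) *\<^sub>C pform n A a \<zeta>) + circint c r (\<lambda>\<zeta>. inverse (\<zeta> - \<sigma>) *\<^sub>C h \<zeta>)"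
    using r sph by (intro circint_add continuous_intros cs ch) auto
  finally have sum: "circint c r (\<lambda>\<zeta>. inverse (\<zeta> - \<sigma>) *\<^sub>C F \<zeta>) = \<dots>" .
  have A: "A \<subseteq> ball c r" "\<sigma> \<notin> A" using s(3) B \<sigma>(2) by auto
  note I = circint_pform[OF s(2) A(1) \<sigma>(1) A(2) r(1), of n a]
  show ?thesis
  proof (cases "dist c \<sigma> < r")
    case True
    have "circint c r (\<lambda>\<zeta>. inverse (\<zeta> - \<sigma>) *\<^sub>C F \<zeta>) = (2 * of_real pi * \<i>) *\<^sub>C h \<sigma>"
      unfolding sum I using True Cauchy_circint[OF h(1) r] by simp
    then have "inverse (2 * of_real pi * \<i>) *\<^sub>C circint c r (\<lambda>\<zeta>. inverse (\<zeta> - \<sigma>) *\<^sub>C F \<zeta>) = h \<sigma>"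
      by (simp only: two_pi_i_cancel)
    moreover have "F \<sigma> = pform n A a \<sigma> + h \<sigma>" using True r \<sigma>(2) by (intro Fh) auto
    ultimately show ?thesis using True by simp
  next
    case False
    then have "circint c r (\<lambda>\<zeta>. inverse (\<zeta> - \<sigma>) *\<^sub>C F \<zeta>) = (2 * of_real pi * \<i>) *\<^sub>C (- pform n A a \<sigma>)"
      unfolding sum I using False \<sigma>(1) Cauchy_circint_outside[OF h(1) r] by simp
    then have "inverse (2 * of_real pi * \<i>) *\<^sub>C circint c r (\<lambda>\<zeta>. inverse (\<zeta> - \<sigma>) *\<^sub>C F \<zeta>) = - pform n A a \<sigma>"
      by (simp only: two_pi_i_cancel)
    then show ?thesis using False by simp
  qed
qed

lemma smooth_on_circint:
  fixes F :: "'m::real_normed_vector \<times> complex \<Rightarrow> 'h::complex_hilbert" and D :: "'m set"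
  assumes D: "finite D" "span D = UNIV" and \<Omega>: "open \<Omega>" "smooth_on \<Omega> F" and N: "open N"
    and r: "r > 0" and in\<Omega>: "\<And>x \<sigma> \<zeta>. (x, \<sigma>) \<in> N \<Longrightarrow> \<zeta> \<in> sphere c r \<Longrightarrow> (x, \<zeta>) \<in> \<Omega> \<and> \<zeta> \<noteq> \<sigma>"
  shows "smooth_on N (\<lambda>(x, \<sigma>). circint c r (\<lambda>\<zeta>. inverse (\<zeta> - \<sigma>) *\<^sub>C F (x, \<zeta>)))"
  unfolding smooth_on_def
proof
  fix k
  define \<Omega>' where "\<Omega>' = {p :: ('m \<times> complex) \<times> complex. (fst (fst p), snd p) \<in> \<Omega> \<and> snd p - snd (fst p) \<noteq> 0}"
  have op: "open \<Omega>'"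
  proof -
    have "open ((\<lambda>p :: ('m \<times> complex) \<times> complex. (fst (fst p), snd p)) -` \<Omega> \<inter> (\<lambda>p. snd p - snd (fst p)) -` (- {0}))"
      by (intro open_Int open_vimage \<Omega>(1) continuous_intros)
    then show ?thesis by (simp add: \<Omega>'_def vimage_def Int_def)
  qed
  \<comment> \<open>The factor \<open>2 * of_real pi * \<i> * (snd p - c)\<close> is the velocity of
    the circle, expressed through the point on it, so that the integrand becomes a smooth function
    of that point.\<close>
  define H where "H p = (2 * of_real pi * \<i> * (snd p - c)) *\<^sub>C inverse (snd p - snd (fst p)) *\<^sub>C F (fst (fst p), snd p)"
    for p :: "('m \<times> complex) \<times> complex"
  have lin: "Ck_on k \<Omega>' (\<lambda>p. snd p - c)" "Ck_on k \<Omega>' (\<lambda>p. snd p - snd (fst p))"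
  proof -
    have id: "Ck_on k UNIV (\<lambda>z :: complex. z)" by (rule Ck_on_vhol) (auto simp: vhol_holomorphic)
    have "bounded_linear (\<lambda>p :: ('m \<times> complex) \<times> complex. snd p)"
      "bounded_linear (\<lambda>p :: ('m \<times> complex) \<times> complex. snd p - snd (fst p))"
      by (intro bounded_linear_snd bounded_linear_sub bounded_linear_compose[OF bounded_linear_snd bounded_linear_fst])+
    from Ck_on_affine[OF this(1) op _ id, of "- c"] Ck_on_affine[OF this(2) op _ id, of 0]
    show "Ck_on k \<Omega>' (\<lambda>p. snd p - c)" "Ck_on k \<Omega>' (\<lambda>p. snd p - snd (fst p))" by auto
  qed
  have "bounded_linear (\<lambda>p :: ('m \<times> complex) \<times> complex. (fst (fst p), snd p))"
    by (intro bounded_linear_Pair bounded_linear_compose[OF bounded_linear_fst bounded_linear_fst] bounded_linear_snd)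
  from Ck_on_affine[OF this op, of "0" \<Omega> k F]
  have "Ck_on k \<Omega>' (\<lambda>p. F (fst (fst p), snd p))"
    using \<Omega>(2) by (auto simp: \<Omega>'_def smooth_on_def)
  then have H: "Ck_on k \<Omega>' H"
    unfolding H_def
    by (intro Ck_on_scaleC Ck_on_mult Ck_on_inverse Ck_on_const lin op) (auto simp: \<Omega>'_def)
  obtain D' where D': "finite D'" "span D' = (UNIV :: ('m \<times> complex) set)" using finite_span_times_complex[OF D] by blast
  have "Ck_on k N (\<lambda>q. integral {0..1} (\<lambda>t. H (q, circlepath c r t)))"
  proof (rule Ck_on_integral[OF D' N continuous_on_circlepath _ H])
    fix q :: "'m \<times> complex" and t :: real assume "q \<in> N" "t \<in> {0..1}"
    then show "(q, circlepath c r t) \<in> \<Omega>'"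
      using in\<Omega>[of "fst q" "snd q" "circlepath c r t"] circlepath_in_sphere[of r t c] r by (simp add: \<Omega>'_def)
  qed
  moreover have "(\<lambda>q. integral {0..1} (\<lambda>t. H (q, circlepath c r t))) =
      (\<lambda>(x, \<sigma>). circint c r (\<lambda>\<zeta>. inverse (\<zeta> - \<sigma>) *\<^sub>C F (x, \<zeta>)))"
  proof -
    have "vector_derivative (circlepath c r) (at t) = 2 * of_real pi * \<i> * (circlepath c r t - c)" for t
      unfolding vector_derivative_circlepath by (simp add: circlepath)
    then show ?thesis by (auto simp: fun_eq_iff H_def circint_def)
  qed
  ultimately show "Ck_on k N (\<lambda>(x, \<sigma>). circint c r (\<lambda>\<zeta>. inverse (\<zeta> - \<sigma>) *\<^sub>C F (x, \<zeta>)))" by simp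
qed

text \<open>The poles may move freely in the disc of radius \<open>r0\<close> as \<open>x\<close>
  varies. The circles used have radius between \<open>r0\<close> and \<open>\<epsilon>\<close>, so
  \<open>F\<close> is smooth along them for all \<open>x\<close>.\<close>

lemma smooth_on_sing_part:
  fixes F :: "'m::real_normed_vector \<times> complex \<Rightarrow> 'h::complex_hilbert" and D :: "'m set"
  assumes D: "finite D" "span D = UNIV" and W: "open W"
    and X: "open X" "X = {(x, \<sigma>). x \<in> W \<and> \<sigma> \<notin> B x}"
    and B: "\<And>x. x \<in> W \<Longrightarrow> finite (B x)" "\<And>x. x \<in> W \<Longrightarrow> B x \<inter> ball c \<epsilon> \<subseteq> ball c r0" and r0: "0 < r0" "r0 < \<epsilon>"
    and F: "smooth_on (X \<inter> UNIV \<times> ball c \<epsilon>) F" "\<And>x. x \<in> W \<Longrightarrow> vhol (ball c \<epsilon> - B x) (\<lambda>\<sigma>. F (x, \<sigma>))"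
    and s: "\<And>x. x \<in> W \<Longrightarrow> has_sing (ball c \<epsilon>) (\<lambda>\<sigma>. F (x, \<sigma>)) (s x)"
      "\<And>x. x \<in> W \<Longrightarrow> \<exists>n A a. s x = pform n A a \<and> finite A \<and> A \<subseteq> B x \<inter> ball c \<epsilon>"
  shows "smooth_on X (\<lambda>(x, \<sigma>). s x \<sigma>)"
proof (rule smooth_on_local)
  fix q assume q: "q \<in> X"
  obtain x1 \<sigma>1 where q1: "q = (x1, \<sigma>1)" by (cases q)
  define \<Omega> where "\<Omega> = X \<inter> UNIV \<times> ball c \<epsilon>"
  have \<Omega>: "open \<Omega>" "smooth_on \<Omega> F" using X(1) F(1) by (auto simp: \<Omega>_def intro!: open_Int open_Times)
  define k where "k = inverse (2 * complex_of_real pi * \<i>)"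
  have eq: "s x \<sigma> = (if dist c \<sigma> < r then F (x, \<sigma>) else 0) - k *\<^sub>C circint c r (\<lambda>\<zeta>. inverse (\<zeta> - \<sigma>) *\<^sub>C F (x, \<zeta>))"
    if x: "(x, \<sigma>) \<in> X" and r: "r0 < r" "r < \<epsilon>" "dist c \<sigma> \<noteq> r" for x \<sigma> r
  proof -
    have xW: "x \<in> W" "\<sigma> \<notin> B x" using x X(2) by auto
    obtain n A a where A: "s x = pform n A a" "finite A" "A \<subseteq> B x \<inter> ball c \<epsilon>" using s(2)[OF xW(1)] by blast
    have "ball c \<epsilon> - B x = ball c \<epsilon> - (B x \<inter> ball c \<epsilon>)" by blast
    then have v: "vhol (ball c \<epsilon> - (B x \<inter> ball c \<epsilon>)) (\<lambda>\<sigma>. F (x, \<sigma>))" using F(2)[OF xW(1)] by simp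
    have "B x \<inter> ball c \<epsilon> \<subseteq> ball c r" using B(2)[OF xW(1)] r(1) subset_ball[of r0 r c] by (meson less_imp_le order_trans)
    then show ?thesis
      using s(1)[OF xW(1)] A B(1)[OF xW(1)] r0 r xW unfolding A(1) k_def
      by (intro sing_part_circint[OF v]) auto
  qed
  have out: "(x, \<zeta>) \<in> \<Omega>" if "x \<in> W" "\<zeta> \<in> sphere c r" "r0 < r" "r < \<epsilon>" for x \<zeta> r
    using that B(2)[OF that(1)] unfolding \<Omega>_def X(2) by force
  show "\<exists>N. open N \<and> q \<in> N \<and> smooth_on N (\<lambda>(x, \<sigma>). s x \<sigma>)"
  \<comment> \<open>The radius is chosen according to the point: a circle that leaves
    \<open>\<sigma>1\<close> outside if it is farther than \<open>r0\<close> from \<open>c\<close>,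
    and one that encloses it otherwise.\<close>
  proof (cases "dist c \<sigma>1 > r0")
    case True
    obtain r where r: "r0 < r" "r < min \<epsilon> (dist c \<sigma>1)" using dense[of r0 "min \<epsilon> (dist c \<sigma>1)"] True r0 by auto
    define N where "N = X \<inter> UNIV \<times> {\<sigma>. dist c \<sigma> > r}"
    have N: "open N" "q \<in> N"
      using X(1) q r by (auto simp: N_def q1 intro!: open_Int open_Times open_Collect_less continuous_intros)
    have sm: "smooth_on N (\<lambda>(x, \<sigma>). circint c r (\<lambda>\<zeta>. inverse (\<zeta> - \<sigma>) *\<^sub>C F (x, \<zeta>)))"
    proof (rule smooth_on_circint[OF D \<Omega> N(1)])
      show "r > 0" using r r0 by simp
      show "(x, \<zeta>) \<in> \<Omega> \<and> \<zeta> \<noteq> \<sigma>" if "(x, \<sigma>) \<in> N" "\<zeta> \<in> sphere c r" for x \<sigma> \<zeta>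
        using that out[of x \<zeta> r] r X(2) by (auto simp: N_def)
    qed
    have "smooth_on N (\<lambda>q. - (k *\<^sub>C (\<lambda>(x, \<sigma>). circint c r (\<lambda>\<zeta>. inverse (\<zeta> - \<sigma>) *\<^sub>C F (x, \<zeta>))) q))"
      using sm unfolding smooth_on_def
      by (intro allI Ck_on_minus[OF N(1)] Ck_on_bounded_linear[OF bounded_linear_scaleC_right N(1)]) blast
    then have "smooth_on N (\<lambda>(x, \<sigma>). s x \<sigma>)"
      by (rule smooth_on_cong[OF N(1), rotated]) (use eq[of _ _ r] r in \<open>auto simp: N_def\<close>)
    then show ?thesis using N by blast
  next
    case False
    obtain r where r: "r0 < r" "r < \<epsilon>" using dense[OF r0(2)] by blast
    define N where "N = X \<inter> UNIV \<times> ball c r"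
    have N: "open N" "q \<in> N" using X(1) q False r by (auto simp: N_def q1 intro!: open_Int open_Times)
    have sm: "smooth_on N (\<lambda>(x, \<sigma>). circint c r (\<lambda>\<zeta>. inverse (\<zeta> - \<sigma>) *\<^sub>C F (x, \<zeta>)))"
    proof (rule smooth_on_circint[OF D \<Omega> N(1)])
      show "r > 0" using r r0 by simp
      show "(x, \<zeta>) \<in> \<Omega> \<and> \<zeta> \<noteq> \<sigma>" if "(x, \<sigma>) \<in> N" "\<zeta> \<in> sphere c r" for x \<sigma> \<zeta>
        using that out[of x \<zeta> r] r X(2) by (auto simp: N_def)
    qed
    have F': "smooth_on N F" using F(1) by (rule smooth_on_subset) (use r in \<open>auto simp: N_def\<close>)
    have "smooth_on N (\<lambda>q. F q - k *\<^sub>C (\<lambda>(x, \<sigma>). circint c r (\<lambda>\<zeta>. inverse (\<zeta> - \<sigma>) *\<^sub>C F (x, \<zeta>))) q)"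
      using sm F' unfolding smooth_on_def
      by (intro allI Ck_on_diff[OF N(1)] Ck_on_bounded_linear[OF bounded_linear_scaleC_right N(1)]) blast+
    then have "smooth_on N (\<lambda>(x, \<sigma>). s x \<sigma>)"
      by (rule smooth_on_cong[OF N(1), rotated]) (use eq[of _ _ r] r in \<open>auto simp: N_def\<close>)
    then show ?thesis using N by blast
  qed
qed

section \<open>Smoothness in charts\<close>

text \<open>The image of \<open>X\<close> under the product chart of \<open>times_complex\<close>,
  described by the inverse of the chart of the base so that membership unfolds directly.\<close>

definition chart_set :: "'y set \<Rightarrow> ('y \<Rightarrow> 'm) \<Rightarrow> ('y \<times> complex) set \<Rightarrow> ('m \<times> complex) set"
  where "chart_set V \<psi> X = {(x, \<sigma>). x \<in> \<psi> ` V \<and> (inv_into V \<psi> x, \<sigma>) \<in> X}"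

lemma smooth_manifoldD:
  assumes "smooth_manifold A" "(V, \<psi>) \<in> A"
  shows "open V" "open (\<psi> ` V)" "inj_on \<psi> V" "continuous_on (\<psi> ` V) (inv_into V \<psi>)"
proof -
  have h: "open V \<and> open (\<psi> ` V) \<and> homeomorphism V (\<psi> ` V) \<psi> (inv_into V \<psi>)"
    using assms unfolding smooth_manifold_def by blast
  then show "open V" "open (\<psi> ` V)" "continuous_on (\<psi> ` V) (inv_into V \<psi>)"
    by (auto simp: homeomorphism_def)
  show "inj_on \<psi> V" using h by (metis homeomorphism_def inj_on_inverseI)
qed

lemma open_chart_image:
  assumes A: "smooth_manifold A" "(V, \<psi>) \<in> A" and W: "open W"
  shows "open (\<psi> ` (W \<inter> V))" "\<psi> ` (W \<inter> V) = {x \<in> \<psi> ` V. inv_into V \<psi> x \<in> W}"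
proof -
  note M = smooth_manifoldD[OF A]
  show eq: "\<psi> ` (W \<inter> V) = {x \<in> \<psi> ` V. inv_into V \<psi> x \<in> W}"
    using M(3) by (auto simp: inv_into_f_f)
  have "open (\<psi> ` V \<inter> inv_into V \<psi> -` W)" by (rule continuous_open_preimage[OF M(4,2) W])
  then show "open (\<psi> ` (W \<inter> V))" unfolding eq by (simp add: Int_def vimage_def)
qed

lemma open_chart_set:
  assumes A: "smooth_manifold A" "(V, \<psi>) \<in> A" and X: "open X"
  shows "open (chart_set V \<psi> X)"
proof -
  note M = smooth_manifoldD[OF A]
  have c: "continuous_on (\<psi> ` V \<times> UNIV) (\<lambda>p. (inv_into V \<psi> (fst p), snd p))"
    by (intro continuous_intros continuous_on_compose2[OF M(4)]) auto
  have "open ((\<psi> ` V \<times> UNIV) \<inter> (\<lambda>p. (inv_into V \<psi> (fst p), snd p)) -` X)"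
    by (rule continuous_open_preimage[OF c _ X]) (intro open_Times M(2) open_UNIV)
  moreover have "chart_set V \<psi> X = (\<psi> ` V \<times> UNIV) \<inter> (\<lambda>p. (inv_into V \<psi> (fst p), snd p)) -` X"
    by (auto simp: chart_set_def)
  ultimately show ?thesis by simp
qed

lemma msmooth_on_times_complex:
  assumes A: "smooth_manifold A" and X: "open X"
  shows "msmooth_on (times_complex A) X f \<longleftrightarrow>
    (\<forall>(V, \<psi>)\<in>A. smooth_on (chart_set V \<psi> X) (\<lambda>(x, \<sigma>). f (inv_into V \<psi> x, \<sigma>)))"
proof -
  have "smooth_on ((\<lambda>(y, \<sigma>). (\<psi> y, \<sigma>)) ` (X \<inter> V \<times> UNIV)) (f \<circ> inv_into (V \<times> UNIV) (\<lambda>(y, \<sigma>). (\<psi> y, \<sigma>))) \<longleftrightarrow>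
      smooth_on (chart_set V \<psi> X) (\<lambda>(x, \<sigma>). f (inv_into V \<psi> x, \<sigma>))" if V: "(V, \<psi>) \<in> A" for V \<psi>
  proof -
    note M = smooth_manifoldD[OF A V]
    let ?\<Psi> = "\<lambda>(y, \<sigma> :: complex). (\<psi> y, \<sigma>)"
    have inj: "inj_on ?\<Psi> (V \<times> UNIV)" using M(3) by (auto simp: inj_on_def)
    have im: "?\<Psi> ` (X \<inter> V \<times> UNIV) = chart_set V \<psi> X"
      using M(3) by (force simp: chart_set_def inv_into_f_f image_iff)
    have eq: "(f \<circ> inv_into (V \<times> UNIV) ?\<Psi>) q = (\<lambda>(x, \<sigma>). f (inv_into V \<psi> x, \<sigma>)) q" if qX: "q \<in> chart_set V \<psi> X" for q
    proof -
      obtain x \<sigma> where q: "q = (x, \<sigma>)" by (cases q)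
      then obtain y where y: "y \<in> V" "x = \<psi> y" using qX by (auto simp: chart_set_def)
      then have "inv_into (V \<times> UNIV) ?\<Psi> q = (y, \<sigma>)"
        using inv_into_f_f[OF inj, of "(y, \<sigma>)"] by (simp add: q)
      then show ?thesis using y M(3) by (simp add: q inv_into_f_f)
    qed
    note op = open_chart_set[OF A V X]
    show ?thesis
      unfolding im
    proof
      assume "smooth_on (chart_set V \<psi> X) (f \<circ> inv_into (V \<times> UNIV) ?\<Psi>)"
      then show "smooth_on (chart_set V \<psi> X) (\<lambda>(x, \<sigma>). f (inv_into V \<psi> x, \<sigma>))"
        by (rule smooth_on_cong[OF op, rotated]) (rule eq)
    next
      assume "smooth_on (chart_set V \<psi> X) (\<lambda>(x, \<sigma>). f (inv_into V \<psi> x, \<sigma>))"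
      then show "smooth_on (chart_set V \<psi> X) (f \<circ> inv_into (V \<times> UNIV) ?\<Psi>)"
        by (rule smooth_on_cong[OF op, rotated]) (rule eq[symmetric])
    qed
  qed
  then show ?thesis
    unfolding msmooth_on_def times_complex_def by (force simp: split_beta)
qed

section \<open>Trivialized bundles\<close>

lemma smooth_hilbert_bundleD:
  assumes B: "smooth_hilbert_bundle A B"
  shows "csubspace (car (fib B y))"
    and "(V, \<tau>) \<in> trivs B \<Longrightarrow> open V"
    and "(V, \<tau>) \<in> trivs B \<Longrightarrow> y \<in> V \<Longrightarrow> hunitary (fib B y) full (\<tau> y)"
    and "\<exists>V \<tau>. (V, \<tau>) \<in> trivs B \<and> y \<in> V"
proof -
  have "y \<in> (\<Union>(V, \<tau>)\<in>trivs B. V)" using B unfolding smooth_hilbert_bundle_def by auto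
  then show "\<exists>V \<tau>. (V, \<tau>) \<in> trivs B \<and> y \<in> V" by auto
qed (use B in \<open>auto simp: smooth_hilbert_bundle_def\<close>)

lemma hunitary_fullD:
  assumes T: "hunitary F full T" and F: "csubspace (car F)"
  shows "bij_betw T (car F) UNIV"
    and "u \<in> car F \<Longrightarrow> hnorm F u = norm (T u)"
    and "clinear_map (inv_into (car F) T)"
    and "T (inv_into (car F) T v) = v"
    and "inv_into (car F) T v \<in> car F"
    and "u \<in> car F \<Longrightarrow> inv_into (car F) T (T u) = u"
proof -
  show bij: "bij_betw T (car F) UNIV" using T by (simp add: hunitary_def)
  show TI: "T (inv_into (car F) T v) = v" for v using bij bij_betw_inv_into_right by fastforce
  show car: "inv_into (car F) T v \<in> car F" for v using bij by (metis UNIV_I bij_betw_imp_surj_on inv_into_into)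
  show IT: "u \<in> car F \<Longrightarrow> inv_into (car F) T (T u) = u" for u using bij bij_betw_inv_into_left by fastforce
  show "hnorm F u = norm (T u)" if "u \<in> car F"
  proof -
    have "hip F u u = cinner (T u) (T u)" using T that by (simp add: hunitary_def sub_hilb_def)
    then show ?thesis by (simp add: hnorm_def Re_cinner_self)
  qed
  have add: "T (u + v) = T u + T v" and scale: "T (c *\<^sub>C u) = c *\<^sub>C T u" if "u \<in> car F" "v \<in> car F" for c u v
    using T that by (auto simp: hunitary_def hlinear_def)
  show "clinear_map (inv_into (car F) T)"
    unfolding clinear_map_def
  proof (intro conjI allI)
    show "inv_into (car F) T (u + v) = inv_into (car F) T u + inv_into (car F) T v" for u v
      using IT[OF complex_vector.subspace_add[OF F car[of u] car[of v]]] by (simp add: add car TI)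
    show "inv_into (car F) T (c *\<^sub>C u) = c *\<^sub>C inv_into (car F) T u" for c u
      using IT[OF complex_vector.subspace_scale[OF F car[of u], of c]] by (simp add: scale[OF car car] TI)
  qed
qed

lemma op_holomorphic_on_comp:
  fixes Q :: "complex \<Rightarrow> 'a::complex_hilbert \<Rightarrow> 'b::complex_hilbert" and L :: "'c::complex_hilbert \<Rightarrow> 'a"
  assumes Q: "op_holomorphic_on V Q" and V: "open V" and L: "bounded_linear L" "clinear_map L"
  shows "op_holomorphic_on V (\<lambda>z u. Q z (L u))"
  unfolding op_holomorphic_on_def
proof (intro conjI ballI)
  fix z assume z: "z \<in> V"
  have Qb: "bounded_linear (Q w)" if "w \<in> V" for w using Q that by (auto simp: op_holomorphic_on_def)
  show "bounded_linear (\<lambda>u. Q z (L u))" by (rule bounded_linear_compose[OF Qb[OF z] L(1)])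
  obtain T where T: "bounded_linear T" "\<And>c u. T (c *\<^sub>C u) = c *\<^sub>C T u"
    "((\<lambda>w. Blinfun (Q w)) has_derivative (\<lambda>h. Blinfun (\<lambda>u. h *\<^sub>C T u))) (at z)"
    using Q z by (auto simp: op_holomorphic_on_def)
  have bT: "bounded_linear (\<lambda>u. h *\<^sub>C T u)" for h
    by (rule bounded_linear_compose[OF bounded_linear_scaleC_right T(1)])
  have "((\<lambda>w. Blinfun (Q w) o\<^sub>L Blinfun L) has_derivative (\<lambda>h. Blinfun (\<lambda>u. h *\<^sub>C T u) o\<^sub>L Blinfun L)) (at z)"
    by (rule bounded_linear.has_derivative[OF bounded_bilinear.bounded_linear_left[OF bounded_bilinear_blinfun_compose] T(3)])
  moreover have "Blinfun (\<lambda>u. h *\<^sub>C T u) o\<^sub>L Blinfun L = Blinfun (\<lambda>u. h *\<^sub>C T (L u))" for h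
    by (rule blinfun_eqI)
      (simp add: bounded_linear_Blinfun_apply L bT bounded_linear_compose[OF bT L(1)])
  ultimately have "((\<lambda>w. Blinfun (Q w) o\<^sub>L Blinfun L) has_derivative (\<lambda>h. Blinfun (\<lambda>u. h *\<^sub>C T (L u)))) (at z)" by simp
  then have "((\<lambda>w. Blinfun (\<lambda>u. Q w (L u))) has_derivative (\<lambda>h. Blinfun (\<lambda>u. h *\<^sub>C T (L u)))) (at z)"
  proof (rule has_derivative_transform_within_open[OF _ V z])
    fix w assume w: "w \<in> V"
    show "Blinfun (Q w) o\<^sub>L Blinfun L = Blinfun (\<lambda>u. Q w (L u))"
      by (rule blinfun_eqI)
        (simp add: bounded_linear_Blinfun_apply L Qb[OF w] bounded_linear_compose[OF Qb[OF w] L(1)])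
  qed
  moreover have "bounded_linear (\<lambda>u. T (L u))" by (rule bounded_linear_compose[OF T(1) L(1)])
  moreover have "T (L (c *\<^sub>C u)) = c *\<^sub>C T (L u)" for c u by (simp add: T(2) clinear_mapD[OF L(2)])
  ultimately show "\<exists>T'. bounded_linear T' \<and> (\<forall>c u. T' (c *\<^sub>C u) = c *\<^sub>C T' u) \<and>
      ((\<lambda>w. Blinfun (\<lambda>u. Q w (L u))) has_derivative (\<lambda>h. Blinfun (\<lambda>u. h *\<^sub>C T' u))) (at z)"
    by (intro exI[of _ "\<lambda>u. T (L u)"]) auto
qed

lemma smooth_on_op_comp:
  assumes S: "open S" and T: "\<And>x. x \<in> S \<Longrightarrow> bounded_linear (T x)" "smooth_on S (\<lambda>x. Blinfun (T x))"
    and R: "\<And>x. x \<in> S \<Longrightarrow> bounded_linear (R x)" "smooth_on S (\<lambda>x. Blinfun (R x))"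
  shows "smooth_on S (\<lambda>x. Blinfun (\<lambda>u. T x (R x u)))"
proof (rule smooth_on_cong[OF S])
  show "smooth_on S (\<lambda>x. Blinfun (T x) o\<^sub>L Blinfun (R x))"
    using T(2) R(2) unfolding smooth_on_def
    by (intro allI Ck_on_bilinear[OF bounded_bilinear_blinfun_compose S]) auto
  show "Blinfun (T x) o\<^sub>L Blinfun (R x) = Blinfun (\<lambda>u. T x (R x u))" if "x \<in> S" for x
    by (rule blinfun_eqI)
      (simp add: bounded_linear_Blinfun_apply T(1)[OF that] R(1)[OF that] bounded_linear_compose[OF T(1)[OF that] R(1)[OF that]])
qed

lemma smooth_on_op_apply:
  assumes S: "open S" and T: "\<And>x. x \<in> S \<Longrightarrow> bounded_linear (T x)" "smooth_on S (\<lambda>x. Blinfun (T x))"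
    and f: "smooth_on S f"
  shows "smooth_on S (\<lambda>x. T x (f x))"
proof (rule smooth_on_cong[OF S])
  show "smooth_on S (\<lambda>x. blinfun_apply (Blinfun (T x)) (f x))"
    using T(2) f unfolding smooth_on_def by (intro allI Ck_on_blinfun_apply S) auto
qed (simp add: bounded_linear_Blinfun_apply T(1))

lemma smooth_on_fst:
  fixes f :: "'m::real_normed_vector \<Rightarrow> 'b::real_normed_vector"
  assumes "smooth_on W f" "open N" "\<And>q. q \<in> N \<Longrightarrow> fst q \<in> W"
  shows "smooth_on N (\<lambda>q :: 'm \<times> complex. f (fst q))"
  unfolding smooth_on_def
proof
  fix k
  show "Ck_on k N (\<lambda>q :: 'm \<times> complex. f (fst q))"
    using Ck_on_affine[OF bounded_linear_fst assms(2), of 0 W k f] assms(1,3) by (simp add: smooth_on_def)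
qed

lemma smooth_on_snd:
  assumes "vhol W f" "open W" "open N" "\<And>q. q \<in> N \<Longrightarrow> snd q \<in> W"
  shows "smooth_on N (\<lambda>q :: 'm::real_normed_vector \<times> complex. f (snd q))"
  unfolding smooth_on_def
proof
  fix k
  show "Ck_on k N (\<lambda>q :: 'm \<times> complex. f (snd q))"
    using Ck_on_affine[OF bounded_linear_snd assms(3), of 0 W k f] assms(4) Ck_on_vhol[OF assms(2,1)] by simp
qed

lemma smooth_on_slice:
  fixes f :: "'m::real_normed_vector \<times> complex \<Rightarrow> 'b::real_normed_vector"
  assumes f: "smooth_on X f" and W: "open W" "\<And>x. x \<in> W \<Longrightarrow> (x, \<sigma>) \<in> X"
  shows "smooth_on W (\<lambda>x. f (x, \<sigma>))"
  unfolding smooth_on_def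
proof
  fix k
  have "bounded_linear (\<lambda>x :: 'm. (x, 0 :: complex))"
    by (intro bounded_linear_Pair bounded_linear_ident bounded_linear_zero)
  from Ck_on_affine[OF this W(1), of "(0, \<sigma>)" X k f]
  show "Ck_on k W (\<lambda>x. f (x, \<sigma>))" using f W(2) by (simp add: smooth_on_def)
qed

text \<open>One trivialization of \<open>H1\<close> and one of \<open>H2\<close> are fixed over all
  of \<open>U\<close>. Those of \<open>D\<close> are chosen pointwise, since \<open>U\<close> need
  not lie in the domain of a single one.\<close>

locale trivialized =
  fixes A :: "('y::{t2_space, second_countable_topology}, 'm::real_normed_vector) atlas"
    and H1 :: "('y, 'e1::complex_vector, 'h1::complex_hilbert) hbundle"
    and H2 :: "('y, 'e2::complex_vector, 'h2::complex_hilbert) hbundle"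
    and D :: "('y, 'e1, 'd::complex_hilbert) hbundle"
    and \<iota> :: "'d \<Rightarrow> 'h1" and \<Sigma> :: "complex set" and P :: "'y \<Rightarrow> complex \<Rightarrow> 'e1 \<Rightarrow> 'e2"
    and U V1 V2 :: "'y set" and \<tau>1 :: "'y \<Rightarrow> 'e1 \<Rightarrow> 'h1" and \<tau>2 :: "'y \<Rightarrow> 'e2 \<Rightarrow> 'h2"
    and Q :: "'y \<Rightarrow> complex \<Rightarrow> 'd \<Rightarrow> 'h2"
  assumes manifold: "smooth_manifold A"
    and bundles: "smooth_hilbert_bundle A H1" "smooth_hilbert_bundle A H2" "smooth_hilbert_bundle A D"
    and embedded: "embedded_bundle A \<iota> D H1"
    and \<Sigma>: "open \<Sigma>"
    and family: "holomorphic_fredholm_family A \<Sigma> D H1 H2 P"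
    and finite_sing_b: "\<And>y. finite (sing_b \<Sigma> D H2 P y)"
    and closed_sing_e: "closed (sing_e \<Sigma> D H2 P)"
    and U: "open U"
    and \<tau>1: "(V1, \<tau>1) \<in> trivs H1" "U \<subseteq> V1"
    and \<tau>2: "(V2, \<tau>2) \<in> trivs H2" "U \<subseteq> V2"
    and Q: "Q = local_family H1 \<tau>1 \<tau>2 \<iota> P"
begin

text \<open>\<open>\<theta>1 y\<close> identifies the model space with the fiber of \<open>D\<close>
  by means of \<open>\<tau>1\<close>. It need not be unitary for \<open>D\<close>, unlike
  \<open>\<theta>2 y\<close> for \<open>H2\<close>.\<close>

definition \<theta>1 :: "'y \<Rightarrow> 'd \<Rightarrow> 'e1" where "\<theta>1 y u = triv_inv H1 \<tau>1 y (\<iota> u)"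
definition \<theta>2 :: "'y \<Rightarrow> 'h2 \<Rightarrow> 'e2" where "\<theta>2 y = inv_into (car (fib H2 y)) (\<tau>2 y)"

lemma \<iota>: "bounded_linear \<iota>" "clinear_map \<iota>" "inj \<iota>"
  using embedded by (auto simp: embedded_bundle_def clinear_map_def bounded_linear.linear linear_add)

lemma inv_\<iota> [simp]: "inv_into UNIV \<iota> (\<iota> u) = u" using \<iota>(3) by simp

lemma car_sub: "car (fib D y) \<subseteq> car (fib H1 y)" using embedded by (auto simp: embedded_bundle_def)

lemma image_\<tau>: "(V, \<tau>) \<in> trivs H1 \<Longrightarrow> y \<in> V \<Longrightarrow> \<tau> y ` car (fib D y) = range \<iota>"
  using embedded unfolding embedded_bundle_def by blast

lemma \<theta>1_props:
  assumes y: "y \<in> U"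
  shows "\<theta>1 y u \<in> car (fib D y)" "\<tau>1 y (\<theta>1 y u) = \<iota> u" "clinear_map (\<theta>1 y)" "bij_betw (\<theta>1 y) UNIV (car (fib D y))"
proof -
  have yV: "y \<in> V1" using y \<tau>1 by blast
  note h = hunitary_fullD[OF smooth_hilbert_bundleD(3)[OF bundles(1) \<tau>1(1) yV] smooth_hilbert_bundleD(1)[OF bundles(1)]]
  have eq: "\<theta>1 y u = inv_into (car (fib H1 y)) (\<tau>1 y) (\<iota> u)" for u by (simp add: \<theta>1_def triv_inv_def)
  show t: "\<tau>1 y (\<theta>1 y u) = \<iota> u" for u by (simp add: eq h(4))
  show car: "\<theta>1 y u \<in> car (fib D y)" for u
  proof -
    obtain w where w: "w \<in> car (fib D y)" "\<tau>1 y w = \<iota> u" using image_\<tau>[OF \<tau>1(1) yV] by (metis imageE rangeI)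
    then have "\<theta>1 y u = w" using h(6)[of w] car_sub by (auto simp: eq)
    then show ?thesis using w by simp
  qed
  show "clinear_map (\<theta>1 y)"
    using clinear_mapD(1,2)[OF h(3)] clinear_mapD(1,2)[OF \<iota>(2)] by (simp add: clinear_map_def eq)
  show "bij_betw (\<theta>1 y) UNIV (car (fib D y))"
    unfolding bij_betw_def
  proof
    show "inj (\<theta>1 y)" using t \<iota>(3) by (metis injD injI)
    have "w \<in> range (\<theta>1 y)" if w: "w \<in> car (fib D y)" for w
    proof -
      have "\<tau>1 y w \<in> range \<iota>" using image_\<tau>[OF \<tau>1(1) yV] w by blast
      then obtain u where "\<tau>1 y w = \<iota> u" by blast
      then have "\<theta>1 y u = w" using h(6)[of w] car_sub w by (auto simp: eq)
      then show ?thesis by blast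
    qed
    then show "range (\<theta>1 y) = car (fib D y)" using car by blast
  qed
qed

lemma \<theta>2_props:
  assumes y: "y \<in> U"
  shows "\<theta>2 y v \<in> car (fib H2 y)" "\<tau>2 y (\<theta>2 y v) = v" "clinear_map (\<theta>2 y)" "bij_betw (\<theta>2 y) UNIV (car (fib H2 y))"
    "hnorm (fib H2 y) (\<theta>2 y v) = norm v" "w \<in> car (fib H2 y) \<Longrightarrow> \<theta>2 y (\<tau>2 y w) = w"
proof -
  have yV: "y \<in> V2" using y \<tau>2 by blast
  note h = hunitary_fullD[OF smooth_hilbert_bundleD(3)[OF bundles(2) \<tau>2(1) yV] smooth_hilbert_bundleD(1)[OF bundles(2)]]
  show "\<theta>2 y v \<in> car (fib H2 y)" "\<tau>2 y (\<theta>2 y v) = v" "clinear_map (\<theta>2 y)"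
    "w \<in> car (fib H2 y) \<Longrightarrow> \<theta>2 y (\<tau>2 y w) = w"
    using h(3,4,5,6) by (auto simp: \<theta>2_def)
  show "bij_betw (\<theta>2 y) UNIV (car (fib H2 y))" unfolding \<theta>2_def by (rule bij_betw_inv_into[OF h(1)])
  show "hnorm (fib H2 y) (\<theta>2 y v) = norm v" using h(2)[OF h(5)] h(4) by (simp add: \<theta>2_def)
qed

lemma embedded_op_smooth:
  assumes "(V, \<tau>) \<in> trivs H1" "(V', \<delta>) \<in> trivs D"
  shows "op_smooth_on A (V \<inter> V') (\<lambda>y u. inv_into UNIV \<iota> (\<tau> y (triv_inv D \<delta> y u)))"
    "op_smooth_on A (V \<inter> V') (\<lambda>y u. \<delta> y (triv_inv H1 \<tau> y (\<iota> u)))"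
  using embedded assms unfolding embedded_bundle_def by fast+

text \<open>The norm of the fiber is read off in a unitary trivialization \<open>\<delta>\<close> of
  \<open>D\<close>; the bounds are those of the two transition maps between \<open>\<delta>\<close>
  and \<open>\<tau>1\<close>.\<close>

lemma embedding_D:
  assumes y: "y \<in> U" shows "hilb_embedding (\<lambda>u. u) (\<theta>1 y) (fib D y)"
proof -
  obtain V' \<delta> where \<delta>: "(V', \<delta>) \<in> trivs D" "y \<in> V'" using smooth_hilbert_bundleD(4)[OF bundles(3)] by blast
  have yV: "y \<in> V1" using y \<tau>1 by blast
  note h = hunitary_fullD[OF smooth_hilbert_bundleD(3)[OF bundles(3) \<delta>] smooth_hilbert_bundleD(1)[OF bundles(3)]]
  have b1: "bounded_linear (\<lambda>u. \<delta> y (\<theta>1 y u))"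
    using embedded_op_smooth(2)[OF \<tau>1(1) \<delta>(1)] yV \<delta>(2) by (auto simp: op_smooth_on_def \<theta>1_def)
  have b2: "bounded_linear (\<lambda>u. inv_into UNIV \<iota> (\<tau>1 y (triv_inv D \<delta> y u)))"
    using embedded_op_smooth(1)[OF \<tau>1(1) \<delta>(1)] yV \<delta>(2) by (auto simp: op_smooth_on_def)
  have nrm: "hnorm (fib D y) (\<theta>1 y u) = norm (\<delta> y (\<theta>1 y u))" for u by (rule h(2)[OF \<theta>1_props(1)[OF y]])
  have inv: "inv_into UNIV \<iota> (\<tau>1 y (triv_inv D \<delta> y (\<delta> y (\<theta>1 y u)))) = u" for u
    using h(6)[OF \<theta>1_props(1)[OF y, of u]] \<theta>1_props(2)[OF y, of u] by (simp add: triv_inv_def)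
  show ?thesis
  proof (rule hilb_embedding.intro)
    show "\<exists>C. \<forall>u\<in>range (\<lambda>u. u). \<bar>hnorm (fib D y) (\<theta>1 y u)\<bar> \<le> C * norm u"
      using bounded_linear.bounded[OF b1] by (auto simp: nrm mult.commute)
    obtain K where K: "\<And>v. norm (inv_into UNIV \<iota> (\<tau>1 y (triv_inv D \<delta> y v))) \<le> norm v * K"
      using bounded_linear.bounded[OF b2] by blast
    have "norm u \<le> K * hnorm (fib D y) (\<theta>1 y u)" for u
      using K[of "\<delta> y (\<theta>1 y u)"] by (simp add: inv nrm mult.commute)
    then show "\<exists>C. \<forall>u\<in>range (\<lambda>u. u). norm u \<le> C * hnorm (fib D y) (\<theta>1 y u)" by blast
  qed (use \<theta>1_props(3,4)[OF y] in \<open>auto simp: clinear_map_def[of "\<lambda>u. u"]\<close>)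
qed

lemma embedding_H2:
  assumes y: "y \<in> U" shows "hilb_embedding (\<lambda>v. v) (\<theta>2 y) (fib H2 y)"
  by (rule hilb_embedding.intro)
    (use \<theta>2_props(3-5)[OF y] in \<open>auto simp: clinear_map_def[of "\<lambda>u. u"] intro!: exI[of _ 1]\<close>)

lemma P_linear: "\<sigma> \<in> \<Sigma> \<Longrightarrow> hlinear (fib D y) (fib H2 y) (P y \<sigma>)"
  using family by (simp add: holomorphic_fredholm_family_def)

lemma Q_eq: "Q y \<sigma> u = \<tau>2 y (P y \<sigma> (\<theta>1 y u))" by (simp add: Q local_family_def \<theta>1_def)

lemma P_\<theta>1: "y \<in> U \<Longrightarrow> \<sigma> \<in> \<Sigma> \<Longrightarrow> P y \<sigma> (\<theta>1 y u) \<in> car (fib H2 y)"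
  using P_linear \<theta>1_props(1) by (auto simp: hlinear_def)

lemma \<theta>2_Q: "y \<in> U \<Longrightarrow> \<sigma> \<in> \<Sigma> \<Longrightarrow> \<theta>2 y (Q y \<sigma> u) = P y \<sigma> (\<theta>1 y u)"
  by (simp add: Q_eq \<theta>2_props(6) P_\<theta>1)

lemma inj_\<theta>2: "y \<in> U \<Longrightarrow> \<theta>2 y v = \<theta>2 y w \<Longrightarrow> v = w" using \<theta>2_props(2) by metis

lemma clinear_Q:
  assumes y: "y \<in> U" and \<sigma>: "\<sigma> \<in> \<Sigma>" shows "clinear_map (Q y \<sigma>)"
  unfolding clinear_map_def
  by (intro conjI allI; rule inj_\<theta>2[OF y])
    (use P_linear[OF \<sigma>] \<theta>1_props(1)[OF y] in
      \<open>auto simp: \<theta>2_Q[OF y \<sigma>] clinear_mapD[OF \<theta>2_props(3)[OF y]] clinear_mapD[OF \<theta>1_props(3)[OF y]] hlinear_def\<close>)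

lemma bij_Q:
  assumes y: "y \<in> U" and \<sigma>: "\<sigma> \<in> \<Sigma> - sing_b \<Sigma> D H2 P y" shows "bij (Q y \<sigma>)"
proof -
  have bijP: "bij_betw (P y \<sigma>) (car (fib D y)) (car (fib H2 y))" using \<sigma> by (auto simp: sing_b_def)
  have "bij_betw (\<tau>2 y \<circ> (P y \<sigma> \<circ> \<theta>1 y)) UNIV UNIV"
  proof (intro bij_betw_trans[OF _ bij_betw_trans] bij_betw_trans[OF bij_betw_trans])
    show "bij_betw (\<theta>1 y) UNIV (car (fib D y))" by (rule \<theta>1_props(4)[OF y])
  qed (use bijP y \<tau>2 in \<open>auto intro: hunitary_fullD(1) smooth_hilbert_bundleD[OF bundles(2)]\<close>)
  moreover have "\<tau>2 y \<circ> (P y \<sigma> \<circ> \<theta>1 y) = Q y \<sigma>" by (simp add: fun_eq_iff Q_eq)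
  ultimately show ?thesis by simp
qed

lemma family_op:
  assumes "(V', \<delta>) \<in> trivs D"
  shows "op_smooth_on (times_complex A) ((V' \<inter> V2) \<times> \<Sigma>) (\<lambda>(y, \<sigma>) u. \<tau>2 y (P y \<sigma> (triv_inv D \<delta> y u)))"
    "y \<in> V' \<inter> V2 \<Longrightarrow> op_holomorphic_on \<Sigma> (\<lambda>\<sigma> u. \<tau>2 y (P y \<sigma> (triv_inv D \<delta> y u)))"
  using family assms \<tau>2(1) unfolding holomorphic_fredholm_family_def by fast+

text \<open>The assumptions on \<open>P\<close> refer to trivializations of \<open>D\<close>,
  whereas \<open>Q\<close> is formed with that of \<open>H1\<close>. The factorization separates the
  given family from a bounded transition map independent of \<open>\<sigma>\<close>.\<close>

lemma Q_factor:
  assumes \<delta>: "(V', \<delta>) \<in> trivs D" and y: "y \<in> U \<inter> V'"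
  shows "Q y \<sigma> u = \<tau>2 y (P y \<sigma> (triv_inv D \<delta> y (\<delta> y (\<theta>1 y u))))"
    and "bounded_linear (\<lambda>u. \<delta> y (\<theta>1 y u))" "clinear_map (\<lambda>u. \<delta> y (\<theta>1 y u))"
proof -
  have y': "y \<in> V'" "y \<in> U" "y \<in> V1" using y \<tau>1 by auto
  note hu = smooth_hilbert_bundleD(3)[OF bundles(3) \<delta> y'(1)]
  note h = hunitary_fullD[OF hu smooth_hilbert_bundleD(1)[OF bundles(3)]]
  show "Q y \<sigma> u = \<tau>2 y (P y \<sigma> (triv_inv D \<delta> y (\<delta> y (\<theta>1 y u))))"
    using h(6)[OF \<theta>1_props(1)[OF y'(2), of u]] by (simp add: Q_eq triv_inv_def)
  show "bounded_linear (\<lambda>u. \<delta> y (\<theta>1 y u))"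
    using embedded_op_smooth(2)[OF \<tau>1(1) \<delta>] y' by (auto simp: op_smooth_on_def \<theta>1_def)
  show "clinear_map (\<lambda>u. \<delta> y (\<theta>1 y u))"
    using hu \<theta>1_props(1)[OF y'(2)] by (auto simp: clinear_map_def clinear_mapD[OF \<theta>1_props(3)[OF y'(2)]] hunitary_def hlinear_def)
qed

lemma hol_Q:
  assumes y: "y \<in> U" shows "op_holomorphic_on \<Sigma> (Q y)"
proof -
  obtain V' \<delta> where \<delta>: "(V', \<delta>) \<in> trivs D" "y \<in> V'" using smooth_hilbert_bundleD(4)[OF bundles(3)] by blast
  have y': "y \<in> U \<inter> V'" "y \<in> V' \<inter> V2" using y \<delta>(2) \<tau>2 by auto
  have "Q y = (\<lambda>\<sigma> u. \<tau>2 y (P y \<sigma> (triv_inv D \<delta> y (\<delta> y (\<theta>1 y u)))))"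
    by (intro ext Q_factor(1)[OF \<delta>(1) y'(1)])
  then show ?thesis
    using op_holomorphic_on_comp[OF family_op(2)[OF \<delta>(1) y'(2)] \<Sigma> Q_factor(2,3)[OF \<delta>(1) y'(1)]] by simp
qed

lemma bounded_Q: "y \<in> U \<Longrightarrow> \<sigma> \<in> \<Sigma> \<Longrightarrow> bounded_linear (Q y \<sigma>)"
  using hol_Q by (auto simp: op_holomorphic_on_def)

text \<open>Near each point this is the composition of the two smooth operator families of
  \<open>Q_factor\<close>.\<close>

lemma smooth_Q:
  assumes V: "(V, \<psi>) \<in> A"
  shows "smooth_on (chart_set V \<psi> (U \<times> \<Sigma>)) (\<lambda>(x, \<sigma>). Blinfun (Q (inv_into V \<psi> x) \<sigma>))"
proof (rule smooth_on_local)
  fix q assume "q \<in> chart_set V \<psi> (U \<times> \<Sigma>)"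
  then obtain x1 \<sigma>1 where q: "q = (x1, \<sigma>1)" "x1 \<in> \<psi> ` V" "inv_into V \<psi> x1 \<in> U" "\<sigma>1 \<in> \<Sigma>"
    by (cases q) (auto simp: chart_set_def)
  obtain V' \<delta> where \<delta>: "(V', \<delta>) \<in> trivs D" "inv_into V \<psi> x1 \<in> V'" using smooth_hilbert_bundleD(4)[OF bundles(3)] by blast
  have V'o: "open V'" and V2o: "open V2" and V1o: "open V1"
    using smooth_hilbert_bundleD(2)[OF bundles(3) \<delta>(1)] smooth_hilbert_bundleD(2)[OF bundles(2) \<tau>2(1)]
      smooth_hilbert_bundleD(2)[OF bundles(1) \<tau>1(1)] .
  define N where "N = chart_set V \<psi> ((U \<inter> V') \<times> \<Sigma>)"
  have N: "open N" "q \<in> N"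
    using open_chart_set[OF manifold V, of "(U \<inter> V') \<times> \<Sigma>"] U V'o \<Sigma> q \<delta>(2)
    by (auto simp: N_def chart_set_def open_Times open_Int)
  have 1: "smooth_on N (\<lambda>q. Blinfun (\<lambda>u. \<tau>2 (inv_into V \<psi> (fst q)) (P (inv_into V \<psi> (fst q)) (snd q) (triv_inv D \<delta> (inv_into V \<psi> (fst q)) u))))"
  proof -
    have "smooth_on (chart_set V \<psi> ((V' \<inter> V2) \<times> \<Sigma>)) (\<lambda>(x, \<sigma>). Blinfun (\<lambda>u. \<tau>2 (inv_into V \<psi> x) (P (inv_into V \<psi> x) \<sigma> (triv_inv D \<delta> (inv_into V \<psi> x) u))))"
    proof -
      have op: "open ((V' \<inter> V2) \<times> \<Sigma>)" using V'o V2o \<Sigma> by (simp add: open_Times open_Int)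
      have "msmooth_on (times_complex A) ((V' \<inter> V2) \<times> \<Sigma>)
          (\<lambda>q. Blinfun (case q of (y, \<sigma>) \<Rightarrow> \<lambda>u. \<tau>2 y (P y \<sigma> (triv_inv D \<delta> y u))))"
        using family_op(1)[OF \<delta>(1)] by (simp add: op_smooth_on_def)
      from bspec[OF this[unfolded msmooth_on_times_complex[OF manifold op]] V] show ?thesis by simp
    qed
    then show ?thesis
      unfolding split_beta by (rule smooth_on_subset) (use \<tau>2(2) in \<open>auto simp: N_def chart_set_def\<close>)
  qed
  have 2: "smooth_on N (\<lambda>q. Blinfun (\<lambda>u. \<delta> (inv_into V \<psi> (fst q)) (\<theta>1 (inv_into V \<psi> (fst q)) u)))"
  proof -
    have "smooth_on (\<psi> ` (V1 \<inter> V' \<inter> V)) ((\<lambda>y. Blinfun (\<lambda>u. \<delta> y (\<theta>1 y u))) \<circ> inv_into V \<psi>)"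
      using embedded_op_smooth(2)[OF \<tau>1(1) \<delta>(1)] V unfolding op_smooth_on_def msmooth_on_def \<theta>1_def by blast
    from smooth_on_fst[OF this N(1)] show ?thesis
      using \<tau>1(2) unfolding open_chart_image(2)[OF manifold V open_Int[OF V1o V'o]]
      by (force simp: N_def chart_set_def)
  qed
  have y: "inv_into V \<psi> (fst q) \<in> U \<inter> V'" "inv_into V \<psi> (fst q) \<in> V' \<inter> V2" "snd q \<in> \<Sigma>" if "q \<in> N" for q
    using that \<tau>2(2) by (auto simp: N_def chart_set_def)
  have b1: "bounded_linear (\<lambda>u. \<tau>2 (inv_into V \<psi> (fst q)) (P (inv_into V \<psi> (fst q)) (snd q) (triv_inv D \<delta> (inv_into V \<psi> (fst q)) u)))"
    if "q \<in> N" for q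
    using family_op(2)[OF \<delta>(1) y(2)[OF that]] y(3)[OF that] by (auto simp: op_holomorphic_on_def)
  from smooth_on_op_comp[OF N(1) b1 1 Q_factor(2)[OF \<delta>(1) y(1)] 2]
  have "smooth_on N (\<lambda>q. Blinfun (\<lambda>u. \<tau>2 (inv_into V \<psi> (fst q)) (P (inv_into V \<psi> (fst q)) (snd q)
      (triv_inv D \<delta> (inv_into V \<psi> (fst q)) (\<delta> (inv_into V \<psi> (fst q)) (\<theta>1 (inv_into V \<psi> (fst q)) u))))))" .
  then have "smooth_on N (\<lambda>(x, \<sigma>). Blinfun (Q (inv_into V \<psi> x) \<sigma>))"
  proof (rule smooth_on_cong[OF N(1), rotated])
    fix q assume "q \<in> N"
    from Q_factor(1)[OF \<delta>(1) y(1)[OF this]]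
    show "Blinfun (\<lambda>u. \<tau>2 (inv_into V \<psi> (fst q)) (P (inv_into V \<psi> (fst q)) (snd q)
      (triv_inv D \<delta> (inv_into V \<psi> (fst q)) (\<delta> (inv_into V \<psi> (fst q)) (\<theta>1 (inv_into V \<psi> (fst q)) u))))) =
      (\<lambda>(x, \<sigma>). Blinfun (Q (inv_into V \<psi> x) \<sigma>)) q"
      by (simp add: split_beta flip: fun_eq_iff) (metis ext)
  qed
  then show "\<exists>N. open N \<and> q \<in> N \<and> smooth_on N (\<lambda>(x, \<sigma>). Blinfun (Q (inv_into V \<psi> x) \<sigma>))"
    using N by blast
qed

lemma closed_range_Q:
  assumes y: "y \<in> U" and \<sigma>: "\<sigma> \<in> \<Sigma>" shows "closed (range (Q y \<sigma>))"
  unfolding closed_sequential_limits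
proof (intro allI impI, elim conjE)
  fix x l assume x: "\<forall>n. x n \<in> range (Q y \<sigma>)" and l: "x \<longlonglongrightarrow> l"
  have "fredholm_operator (car (fib D y)) (fib H2 y) (P y \<sigma>)"
    using family \<sigma> by (simp add: holomorphic_fredholm_family_def)
  then have cl: "v \<in> P y \<sigma> ` car (fib D y)"
    if "\<And>n :: nat. z n \<in> P y \<sigma> ` car (fib D y)" "v \<in> car (fib H2 y)" "(\<lambda>n. hnorm (fib H2 y) (z n - v)) \<longlonglongrightarrow> 0" for z v
    using that unfolding fredholm_operator_def by blast
  have "\<theta>2 y l \<in> P y \<sigma> ` car (fib D y)"
  proof (rule cl[of "\<lambda>n. \<theta>2 y (x n)"])
    fix n
    obtain u where "x n = Q y \<sigma> u" using x by blast
    then show "\<theta>2 y (x n) \<in> P y \<sigma> ` car (fib D y)" using \<theta>2_Q[OF y \<sigma>] \<theta>1_props(1)[OF y] by auto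
  next
    have "hnorm (fib H2 y) (\<theta>2 y (x n) - \<theta>2 y l) = norm (x n - l)" for n
      using \<theta>2_props(5)[OF y, of "x n - l"] by (simp add: clinear_mapD[OF \<theta>2_props(3)[OF y]])
    then show "(\<lambda>n. hnorm (fib H2 y) (\<theta>2 y (x n) - \<theta>2 y l)) \<longlonglongrightarrow> 0"
      using l by (simp add: tendsto_norm_zero LIM_zero)
  qed (rule \<theta>2_props(1)[OF y])
  then obtain w where w: "w \<in> car (fib D y)" "\<theta>2 y l = P y \<sigma> w" by blast
  then obtain u where "w = \<theta>1 y u" using \<theta>1_props(4)[OF y] by (metis bij_betw_imp_surj_on imageE)
  then have "l = Q y \<sigma> u" using w(2) \<theta>2_Q[OF y \<sigma>] inj_\<theta>2[OF y] by simp
  then show "l \<in> range (Q y \<sigma>)" by blast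
qed

text \<open>Moves the problem from the fibers, which vary with \<open>y\<close>, to the model space.
  Regularity is transported by \<open>\<theta>2 y\<close> in the target and singular parts by
  \<open>\<theta>1 y\<close> in the source.\<close>

lemma sing_space_eq:
  assumes y: "y \<in> U"
  shows "sing_space \<Sigma> D H2 P y = (\<lambda>s z. \<theta>1 y (s z)) ` ksing \<Sigma> (Q y)"
proof -
  interpret E: hilb_embedding "\<lambda>u. u" "\<theta>1 y" "fib D y" by (rule embedding_D[OF y])
  interpret G: hilb_embedding "\<lambda>v. v" "\<theta>2 y" "fib H2 y" by (rule embedding_H2[OF y])
  have E\<kappa>: "E.\<kappa> (\<theta>1 y u) = u" for u using E.\<kappa>_\<theta> by simp
  have G\<kappa>: "G.\<kappa> (\<theta>2 y u) = u" for u using G.\<kappa>_\<theta> by simp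
  have G\<kappa>P: "G.\<kappa> (P y \<sigma> (\<theta>1 y u)) = Q y \<sigma> u" if "\<sigma> \<in> \<Sigma>" for \<sigma> u
    using G\<kappa>[of "Q y \<sigma> u"] by (simp add: \<theta>2_Q[OF y that])
  show ?thesis
  proof (intro equalityI subsetI)
    fix s assume "s \<in> sing_space \<Sigma> D H2 P y"
    then obtain \<phi> where \<phi>: "s = sing_part (fib D y) \<Sigma> \<phi>" "mero_on (fib D y) \<Sigma> \<phi>"
      "reg_on (fib H2 y) \<Sigma> (\<lambda>\<sigma>. P y \<sigma> (\<phi> \<sigma>))" by (auto simp: sing_space_def)
    define f where "f \<sigma> = E.\<kappa> (\<phi> \<sigma>)" for \<sigma>
    have f: "mero_on full \<Sigma> f" and ev: "\<And>p. p \<in> \<Sigma> \<Longrightarrow> \<forall>\<^sub>F z in at p. \<phi> z \<in> car (fib D y)"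
      using \<phi>(2) unfolding E.mero_on_iff f_def by auto
    have Qf: "reg_on full \<Sigma> (\<lambda>\<sigma>. Q y \<sigma> (f \<sigma>))"
      unfolding reg_on_def
    proof
      fix p assume p: "p \<in> \<Sigma>"
      have "reg_at full p (\<lambda>\<sigma>. G.\<kappa> (P y \<sigma> (\<phi> \<sigma>)))" using \<phi>(3) p by (simp add: reg_on_def G.reg_at_iff)
      moreover have "\<forall>\<^sub>F z in at p. G.\<kappa> (P y z (\<phi> z)) = Q y z (f z)"
        using ev[OF p] eventually_at_in_open[OF \<Sigma> p]
      proof eventually_elim
        case (elim z)
        then have "\<phi> z = \<theta>1 y (f z)" unfolding f_def by (simp add: E.\<theta>_\<kappa>)
        then show ?case using elim by (simp add: G\<kappa>P)
      qed
      ultimately show "reg_at full p (\<lambda>\<sigma>. Q y \<sigma> (f \<sigma>))" by (rule reg_at_cong[rotated])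
    qed
    \<comment> \<open>\<open>sing_space\<close> does not speak of finiteness of the poles; it
      follows because poles occur only where \<open>Q y\<close> fails to be injective.\<close>
    have "poles_in full \<Sigma> f \<subseteq> sing_b \<Sigma> D H2 P y"
      by (rule ksing_poles[OF hol_Q[OF y] clinear_Q[OF y] \<Sigma> bij_is_inj[OF bij_Q[OF y]] f Qf])
    then have "finite (poles_in full \<Sigma> f)" using finite_sing_b finite_subset by blast
    then obtain t where t: "has_sing \<Sigma> f t" using mero_has_sing[OF f] by blast
    have "s = (\<lambda>z. \<theta>1 y (t z))"
      unfolding \<phi>(1) by (rule E.sing_part_\<theta>[OF t[unfolded f_def[abs_def]] ev])
    moreover have "t \<in> ksing \<Sigma> (Q y)"
      using sing_part_reg[OF hol_Q[OF y] clinear_Q[OF y] \<Sigma> t] Qf t by (simp add: ksing_def has_sing_def)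
    ultimately show "s \<in> (\<lambda>s z. \<theta>1 y (s z)) ` ksing \<Sigma> (Q y)" by blast
  next
    fix s assume "s \<in> (\<lambda>s z. \<theta>1 y (s z)) ` ksing \<Sigma> (Q y)"
    then obtain t where t: "s = (\<lambda>z. \<theta>1 y (t z))" "t \<in> ksing \<Sigma> (Q y)" by blast
    then have ht: "has_sing \<Sigma> t t" by (auto simp: ksing_def intro: has_sing_self)
    have "sing_part (fib D y) \<Sigma> s = s"
      unfolding t(1) by (rule E.sing_part_\<theta>) (use ht \<theta>1_props(1)[OF y] in \<open>auto simp: E\<kappa>\<close>)
    moreover have "mero_on (fib D y) \<Sigma> s"
      unfolding E.mero_on_iff t(1) using has_sing_mero[OF ht] \<theta>1_props(1)[OF y] by (simp add: E\<kappa>)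
    moreover have "reg_on (fib H2 y) \<Sigma> (\<lambda>\<sigma>. P y \<sigma> (s \<sigma>))"
      unfolding reg_on_def G.reg_at_iff
    proof (intro ballI conjI)
      fix p assume p: "p \<in> \<Sigma>"
      have "reg_at full p (\<lambda>\<sigma>. Q y \<sigma> (t \<sigma>))" using t(2) p by (simp add: ksing_def reg_on_def)
      moreover have "\<forall>\<^sub>F z in at p. Q y z (t z) = G.\<kappa> (P y z (s z))"
        using eventually_at_in_open[OF \<Sigma> p] by eventually_elim (simp add: t(1) G\<kappa>P)
      ultimately show "reg_at full p (\<lambda>\<sigma>. G.\<kappa> (P y \<sigma> (s \<sigma>)))" by (rule reg_at_cong[rotated])
      show "\<forall>\<^sub>F z in at p. P y z (s z) \<in> car (fib H2 y)"
        using eventually_at_in_open[OF \<Sigma> p] by eventually_elim (simp add: t(1) P_\<theta>1[OF y])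
    qed
    ultimately show "s \<in> sing_space \<Sigma> D H2 P y" unfolding sing_space_def by (metis (mono_tags, lifting) mem_Collect_eq)
  qed
qed

text \<open>The transition from \<open>\<tau>1\<close> to another trivialization of
  \<open>H1\<close>, read in the model space of \<open>D\<close>. \<open>B_infinity\<close> tests
  smoothness in every trivialization.\<close>

definition trans :: "('y \<Rightarrow> 'e1 \<Rightarrow> 'h1) \<Rightarrow> 'y \<Rightarrow> 'd \<Rightarrow> 'd"
  where "trans \<tau> y u = inv_into UNIV \<iota> (\<tau> y (\<theta>1 y u))"

lemma trans_factor:
  assumes \<tau>: "(V, \<tau>) \<in> trivs H1" "y \<in> V" and y: "y \<in> U" and \<delta>: "(V', \<delta>) \<in> trivs D" "y \<in> V'"
  shows "trans \<tau> y u = inv_into UNIV \<iota> (\<tau> y (triv_inv D \<delta> y (\<delta> y (\<theta>1 y u))))"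
    and "bounded_linear (\<lambda>u. inv_into UNIV \<iota> (\<tau> y (triv_inv D \<delta> y u)))"
proof -
  note h = hunitary_fullD[OF smooth_hilbert_bundleD(3)[OF bundles(3) \<delta>] smooth_hilbert_bundleD(1)[OF bundles(3)]]
  show "trans \<tau> y u = inv_into UNIV \<iota> (\<tau> y (triv_inv D \<delta> y (\<delta> y (\<theta>1 y u))))"
    using h(6)[OF \<theta>1_props(1)[OF y, of u]] by (simp add: trans_def triv_inv_def)
  show "bounded_linear (\<lambda>u. inv_into UNIV \<iota> (\<tau> y (triv_inv D \<delta> y u)))"
    using embedded_op_smooth(1)[OF \<tau>(1) \<delta>(1)] \<tau>(2) \<delta>(2) by (auto simp: op_smooth_on_def)
qed

lemma trans_linear:
  assumes \<tau>: "(V, \<tau>) \<in> trivs H1" "y \<in> V" and y: "y \<in> U"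
  shows "bounded_linear (trans \<tau> y)" "clinear_map (trans \<tau> y)"
proof -
  obtain V' \<delta> where \<delta>: "(V', \<delta>) \<in> trivs D" "y \<in> V'" using smooth_hilbert_bundleD(4)[OF bundles(3)] by blast
  have eq: "trans \<tau> y = (\<lambda>u. inv_into UNIV \<iota> (\<tau> y (triv_inv D \<delta> y (\<delta> y (\<theta>1 y u)))))"
    by (intro ext trans_factor(1)[OF \<tau> y \<delta>])
  have "y \<in> U \<inter> V'" using y \<delta> by simp
  from bounded_linear_compose[OF trans_factor(2)[OF \<tau> y \<delta>] Q_factor(2)[OF \<delta>(1) this]]
  show "bounded_linear (trans \<tau> y)" unfolding eq .
  \<comment> \<open>Linearity of \<open>trans \<tau> y\<close> is verified after applying the
    injective \<open>\<iota>\<close>, which removes the \<open>inv_into\<close>.\<close>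
  have \<iota>i: "\<iota> (trans \<tau> y u) = \<tau> y (\<theta>1 y u)" for u
  proof -
    have "\<tau> y (\<theta>1 y u) \<in> range \<iota>" using image_\<tau>[OF \<tau>] \<theta>1_props(1)[OF y] by blast
    then show ?thesis by (simp add: trans_def f_inv_into_f)
  qed
  have hl: "hlinear (fib H1 y) full (\<tau> y)" using smooth_hilbert_bundleD(3)[OF bundles(1) \<tau>] by (simp add: hunitary_def)
  have car: "\<theta>1 y u \<in> car (fib H1 y)" for u using \<theta>1_props(1)[OF y] car_sub by blast
  have inj: "\<iota> u = \<iota> v \<Longrightarrow> u = v" for u v using \<iota>(3) by (rule injD)
  show "clinear_map (trans \<tau> y)"
    unfolding clinear_map_def
    by (intro conjI allI; rule inj)
      (use hl car in \<open>auto simp: \<iota>i clinear_mapD[OF \<iota>(2)] clinear_mapD[OF \<theta>1_props(3)[OF y]] hlinear_def\<close>)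
qed

lemma smooth_trans:
  assumes \<tau>: "(V\<tau>, \<tau>) \<in> trivs H1" and V: "(V, \<psi>) \<in> A"
  shows "smooth_on (\<psi> ` (U \<inter> V\<tau> \<inter> V)) (\<lambda>x. Blinfun (trans \<tau> (inv_into V \<psi> x)))"
proof (rule smooth_on_local)
  have V\<tau>o: "open V\<tau>" by (rule smooth_hilbert_bundleD(2)[OF bundles(1) \<tau>])
  fix x1 assume x1: "x1 \<in> \<psi> ` (U \<inter> V\<tau> \<inter> V)"
  obtain V' \<delta> where \<delta>: "(V', \<delta>) \<in> trivs D" "inv_into V \<psi> x1 \<in> V'" using smooth_hilbert_bundleD(4)[OF bundles(3)] by blast
  have V'o: "open V'" by (rule smooth_hilbert_bundleD(2)[OF bundles(3) \<delta>(1)])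
  note im = open_chart_image[OF manifold V]
  define N where "N = \<psi> ` (U \<inter> V\<tau> \<inter> V' \<inter> V)"
  have N: "open N" "x1 \<in> N"
    using im(1)[of "U \<inter> V\<tau> \<inter> V'"] im(2)[of "U \<inter> V\<tau> \<inter> V'"] im(2)[of "U \<inter> V\<tau>"] U V\<tau>o V'o x1 \<delta>(2)
    by (auto simp: N_def open_Int)
  have y: "inv_into V \<psi> x \<in> U" "inv_into V \<psi> x \<in> V\<tau>" "inv_into V \<psi> x \<in> V'" if "x \<in> N" for x
    using that im(2)[of "U \<inter> V\<tau> \<inter> V'"] U V\<tau>o V'o by (auto simp: N_def open_Int)
  have 1: "smooth_on N (\<lambda>x. Blinfun (\<lambda>u. inv_into UNIV \<iota> (\<tau> (inv_into V \<psi> x) (triv_inv D \<delta> (inv_into V \<psi> x) u))))"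
  proof -
    have "smooth_on (\<psi> ` (V\<tau> \<inter> V' \<inter> V)) ((\<lambda>y. Blinfun (\<lambda>u. inv_into UNIV \<iota> (\<tau> y (triv_inv D \<delta> y u)))) \<circ> inv_into V \<psi>)"
      using embedded_op_smooth(1)[OF \<tau> \<delta>(1)] V unfolding op_smooth_on_def msmooth_on_def by blast
    then show ?thesis unfolding o_def by (rule smooth_on_subset) (auto simp: N_def)
  qed
  have 2: "smooth_on N (\<lambda>x. Blinfun (\<lambda>u. \<delta> (inv_into V \<psi> x) (\<theta>1 (inv_into V \<psi> x) u)))"
  proof -
    have "smooth_on (\<psi> ` (V1 \<inter> V' \<inter> V)) ((\<lambda>y. Blinfun (\<lambda>u. \<delta> y (\<theta>1 y u))) \<circ> inv_into V \<psi>)"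
      using embedded_op_smooth(2)[OF \<tau>1(1) \<delta>(1)] V unfolding op_smooth_on_def msmooth_on_def \<theta>1_def by blast
    then show ?thesis unfolding o_def by (rule smooth_on_subset) (use \<tau>1(2) in \<open>auto simp: N_def\<close>)
  qed
  have b1: "bounded_linear (\<lambda>u. inv_into UNIV \<iota> (\<tau> (inv_into V \<psi> x) (triv_inv D \<delta> (inv_into V \<psi> x) u)))" if "x \<in> N" for x
    by (rule trans_factor(2)[OF \<tau> y(2)[OF that] y(1)[OF that] \<delta>(1) y(3)[OF that]])
  have b2: "bounded_linear (\<lambda>u. \<delta> (inv_into V \<psi> x) (\<theta>1 (inv_into V \<psi> x) u))" if "x \<in> N" for x
    by (rule Q_factor(2)[OF \<delta>(1)]) (use y[OF that] in simp)
  have "smooth_on N (\<lambda>x. Blinfun (trans \<tau> (inv_into V \<psi> x)))"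
  proof (rule smooth_on_cong[OF N(1) _ smooth_on_op_comp[OF N(1) b1 1 b2 2]])
    fix x assume x: "x \<in> N"
    have "trans \<tau> (inv_into V \<psi> x) = (\<lambda>u. inv_into UNIV \<iota> (\<tau> (inv_into V \<psi> x) (triv_inv D \<delta> (inv_into V \<psi> x)
        (\<delta> (inv_into V \<psi> x) (\<theta>1 (inv_into V \<psi> x) u)))))"
      by (intro ext trans_factor(1)[OF \<tau> y(2)[OF x] y(1)[OF x] \<delta>(1) y(3)[OF x]])
    then show "Blinfun (\<lambda>u. inv_into UNIV \<iota> (\<tau> (inv_into V \<psi> x) (triv_inv D \<delta> (inv_into V \<psi> x)
        (\<delta> (inv_into V \<psi> x) (\<theta>1 (inv_into V \<psi> x) u))))) = Blinfun (trans \<tau> (inv_into V \<psi> x))" by simp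
  qed
  then show "\<exists>N. open N \<and> x1 \<in> N \<and> smooth_on N (\<lambda>x. Blinfun (trans \<tau> (inv_into V \<psi> x)))" using N by blast
qed

end

section \<open>Bases of the singular spaces\<close>

lemma is_basis_direct_sum:
  fixes b :: "'s \<Rightarrow> 'k \<Rightarrow> 'v::complex_vector"
  assumes fin: "finite I" "\<And>s. s \<in> I \<Longrightarrow> finite (K s)"
    and basis: "\<And>s. s \<in> I \<Longrightarrow> is_basis (K s) (b s) (Z s)"
    and indep: "\<And>t. (\<And>s. s \<in> I \<Longrightarrow> t s \<in> Z s) \<Longrightarrow> (\<Sum>s\<in>I. t s) = 0 \<Longrightarrow> (\<forall>s\<in>I. t s = 0)"
    and span: "X = {\<Sum>s\<in>I. t s | t. \<forall>s\<in>I. t s \<in> Z s}"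
  shows "is_basis (SIGMA s:I. K s) (\<lambda>(s, k). b s k) X"
proof -
  have finS: "finite (SIGMA s:I. K s)" using fin by auto
  have sum: "(\<Sum>i\<in>(SIGMA s:I. K s). c i *\<^sub>C (case i of (s, k) \<Rightarrow> b s k)) = (\<Sum>s\<in>I. \<Sum>k\<in>K s. c (s, k) *\<^sub>C b s k)" for c
    using sum.Sigma[of I K "\<lambda>s k. c (s, k) *\<^sub>C b s k"] fin by (simp add: split_beta)
  have B1: "\<And>s c. s \<in> I \<Longrightarrow> (\<Sum>k\<in>K s. c k *\<^sub>C b s k) = 0 \<Longrightarrow> \<forall>k\<in>K s. c k = 0"
    and B2: "\<And>s. s \<in> I \<Longrightarrow> Z s = range (\<lambda>c. \<Sum>k\<in>K s. c k *\<^sub>C b s k)"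
    using basis is_basis_iff[OF fin(2)] by blast+
  have "\<forall>i\<in>(SIGMA s:I. K s). c i = 0"
    if "(\<Sum>i\<in>(SIGMA s:I. K s). c i *\<^sub>C (case i of (s, k) \<Rightarrow> b s k)) = 0" for c
  proof -
    have "\<forall>s\<in>I. (\<Sum>k\<in>K s. c (s, k) *\<^sub>C b s k) = 0"
      by (rule indep) (use that in \<open>auto simp: sum B2\<close>)
    then show ?thesis using B1 by fastforce
  qed
  moreover have "X = range (\<lambda>c. \<Sum>i\<in>(SIGMA s:I. K s). c i *\<^sub>C (case i of (s, k) \<Rightarrow> b s k))"
    unfolding sum
  proof (intro equalityI subsetI)
    fix x assume "x \<in> X"
    then obtain t where t: "x = (\<Sum>s\<in>I. t s)" "\<forall>s\<in>I. t s \<in> Z s" using span by blast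
    then have "\<forall>s\<in>I. \<exists>c. t s = (\<Sum>k\<in>K s. c k *\<^sub>C b s k)" using B2 by blast
    then obtain c where c: "\<And>s. s \<in> I \<Longrightarrow> t s = (\<Sum>k\<in>K s. c s k *\<^sub>C b s k)" by metis
    show "x \<in> range (\<lambda>c. \<Sum>s\<in>I. \<Sum>k\<in>K s. c (s, k) *\<^sub>C b s k)"
      by (rule range_eqI[of _ _ "\<lambda>(s, k). c s k"]) (simp add: t(1) c)
  next
    fix x assume "x \<in> range (\<lambda>c. \<Sum>s\<in>I. \<Sum>k\<in>K s. c (s, k) *\<^sub>C b s k)"
    then obtain c where "x = (\<Sum>s\<in>I. \<Sum>k\<in>K s. c (s, k) *\<^sub>C b s k)" by blast
    then show "x \<in> X"
      unfolding span by (intro CollectI exI[of _ "\<lambda>s. \<Sum>k\<in>K s. c (s, k) *\<^sub>C b s k"]) (auto simp: B2)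
  qed
  ultimately show ?thesis using is_basis_iff[OF finS] by blast
qed

lemma is_basis_image:
  assumes I: "finite I" and T: "clinear_map T" "inj T" and b: "is_basis I b X"
  shows "is_basis I (\<lambda>i. T (b i)) (T ` X)"
proof -
  have eq: "(\<Sum>i\<in>I. c i *\<^sub>C T (b i)) = T (\<Sum>i\<in>I. c i *\<^sub>C b i)" for c by (simp add: clinear_mapD[OF T(1)])
  have z: "T u = 0 \<longleftrightarrow> u = 0" for u using T(2) clinear_mapD(3)[OF T(1)] by (metis injD)
  show ?thesis
    using b unfolding is_basis_iff[OF I] eq z by auto
qed

locale local_construction = trivialized A H1 H2 D \<iota> \<Sigma> P U V1 V2 \<tau>1 \<tau>2 Q
  for A :: "('y::{t2_space, second_countable_topology}, 'm::real_normed_vector) atlas"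
    and H1 :: "('y, 'e1::complex_vector, 'h1::complex_hilbert) hbundle"
    and H2 :: "('y, 'e2::complex_vector, 'h2::complex_hilbert) hbundle"
    and D :: "('y, 'e1, 'd::complex_hilbert) hbundle"
    and \<iota> :: "'d \<Rightarrow> 'h1" and \<Sigma> :: "complex set" and P :: "'y \<Rightarrow> complex \<Rightarrow> 'e1 \<Rightarrow> 'e2"
    and U V1 V2 :: "'y set" and \<tau>1 :: "'y \<Rightarrow> 'e1 \<Rightarrow> 'h1" and \<tau>2 :: "'y \<Rightarrow> 'e2 \<Rightarrow> 'h2"
    and Q :: "'y \<Rightarrow> complex \<Rightarrow> 'd \<Rightarrow> 'h2" +
  fixes y0 :: 'y and \<epsilon> :: real and S :: nat and sg :: "nat \<Rightarrow> complex" and T0 :: "nat \<Rightarrow> 'd \<Rightarrow> 'h2"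
    and dm :: "nat \<Rightarrow> nat" and kb :: "nat \<Rightarrow> nat \<Rightarrow> 'd" and rb :: "nat \<Rightarrow> nat \<Rightarrow> 'h2"
    and J :: "nat \<Rightarrow> nat" and L :: "nat \<Rightarrow> nat \<Rightarrow> nat" and \<beta> :: "nat \<Rightarrow> nat \<Rightarrow> complex \<Rightarrow> 'h2"
  assumes y0: "y0 \<in> U" and T0: "\<And>s. T0 s = Q y0 (sg s)" and \<epsilon>: "\<epsilon> > 0"
    and disjoint: "disjoint_family_on (\<lambda>s. ball (sg s) (2 * \<epsilon>)) {1..S}"
    and sub\<Sigma>: "\<And>s. s \<in> {1..S} \<Longrightarrow> ball (sg s) (2 * \<epsilon>) \<subseteq> \<Sigma>"
    and p22: "\<And>s y \<sigma>. s \<in> {1..S} \<Longrightarrow> y \<in> U \<Longrightarrow> \<sigma> \<in> ball (sg s) \<epsilon> \<Longrightarrow> p22_invertible \<iota> (T0 s) (Q y \<sigma>)"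
    and bases: "\<And>s. s \<in> {1..S} \<Longrightarrow> is_basis {..<dm s} (kb s) (ker (T0 s))"
      "\<And>s. s \<in> {1..S} \<Longrightarrow> is_basis {..<dm s} (rb s) (ran_perp (T0 s))"
    and sing: "\<And>y. y \<in> U \<Longrightarrow> sing_b \<Sigma> D H2 P y \<subseteq> (\<Union>s\<in>{1..S}. ball (sg s) (\<epsilon> / 2))"
    and \<beta>: "\<And>s j. s \<in> {1..S} \<Longrightarrow> j \<in> {1..J s} \<Longrightarrow> hol_on (sub_hilb (ran_perp (T0 s))) (ball (sg s) \<epsilon>) (\<beta> s j)"
    and basis_K: "\<And>s y. s \<in> {1..S} \<Longrightarrow> y \<in> U \<Longrightarrow>
      is_basis (SIGMA j:{1..J s}. {..<L s j})
        (\<lambda>(j, l). phiK \<iota> (T0 s) (sg s) \<epsilon> (Q y) (\<beta> s j) l)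
        (local_sing_space \<iota> (T0 s) (sg s) \<epsilon> (Q y))"
begin

section \<open>The discs and the splitting of singular parts among them\<close>

abbreviation "sb \<equiv> sing_b \<Sigma> D H2 P"
abbreviation "disc s \<equiv> ball (sg s) \<epsilon>"
abbreviation "Idx \<equiv> SIGMA s:{1..S}. SIGMA j:{1..J s}. {..<L s j}"

definition Ph :: "nat \<Rightarrow> nat \<Rightarrow> nat \<Rightarrow> 'y \<Rightarrow> complex \<Rightarrow> 'd"
  where "Ph s j l y = phi \<iota> (T0 s) (sg s) \<epsilon> (Q y) (\<beta> s j) l"

lemma finite_Idx: "finite Idx" by auto

lemma disc_sub: "s \<in> {1..S} \<Longrightarrow> disc s \<subseteq> \<Sigma>"
  using sub\<Sigma> \<epsilon> subset_ball[of \<epsilon> "2 * \<epsilon>" "sg s"] by fastforce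

lemma disc_disjoint: "s \<in> {1..S} \<Longrightarrow> s' \<in> {1..S} \<Longrightarrow> s \<noteq> s' \<Longrightarrow> disc s \<inter> disc s' = {}"
proof -
  assume s: "s \<in> {1..S}" "s' \<in> {1..S}" "s \<noteq> s'"
  have "ball (sg s) (2 * \<epsilon>) \<inter> ball (sg s') (2 * \<epsilon>) = {}" by (rule disjoint_family_onD[OF disjoint s])
  moreover have "disc s \<subseteq> ball (sg s) (2 * \<epsilon>)" "disc s' \<subseteq> ball (sg s') (2 * \<epsilon>)"
    using \<epsilon> by (auto intro!: subset_ball)
  ultimately show ?thesis by blast
qed

text \<open>Disjointness of the discs excludes that a singular point of this disc is close to
  another centre. Thus the outer half of each disc is free of singular points for every
  \<open>y\<close>.\<close>

lemma sing_disc: "y \<in> U \<Longrightarrow> s \<in> {1..S} \<Longrightarrow> sb y \<inter> disc s \<subseteq> ball (sg s) (\<epsilon> / 2)"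
proof
  fix p assume y: "y \<in> U" and s: "s \<in> {1..S}" and p: "p \<in> sb y \<inter> disc s"
  then obtain s' where s': "s' \<in> {1..S}" "p \<in> ball (sg s') (\<epsilon> / 2)" using sing[OF y] by blast
  then have "p \<in> disc s'" using \<epsilon> by auto
  then have "s' = s" using disc_disjoint[OF s s'(1)] p by blast
  then show "p \<in> ball (sg s) (\<epsilon> / 2)" using s' by simp
qed

lemma sing_in_discs: "y \<in> U \<Longrightarrow> sb y \<subseteq> (\<Union>s\<in>{1..S}. disc s)"
proof
  fix p assume "y \<in> U" "p \<in> sb y"
  then obtain s where "s \<in> {1..S}" "p \<in> ball (sg s) (\<epsilon> / 2)" using sing by blast
  then show "p \<in> (\<Union>s\<in>{1..S}. disc s)" using \<epsilon> by (intro UN_I[of s]) auto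
qed

text \<open>The two given bases have the same length \<open>dm s\<close>. Each is orthonormalized,
  that of the kernel through \<open>\<iota>\<close>, that of the complement of the range through the
  identity.\<close>

lemma exists_block_family:
  assumes s: "s \<in> {1..S}" and y: "y \<in> U"
  shows "\<exists>e f. block_family \<iota> (T0 s) (dm s) e f (disc s) (Q y) (sb y)"
proof -
  have id: "clinear_map (\<lambda>v :: 'h2. v)" "inj (\<lambda>v :: 'h2. v)" by (auto simp: clinear_map_def)
  obtain e where e: "\<And>i. i < dm s \<Longrightarrow> e i \<in> ker (T0 s)"
    "\<And>i j. i < dm s \<Longrightarrow> j < dm s \<Longrightarrow> cinner (\<iota> (e i)) (\<iota> (e j)) = (if i = j then 1 else 0)"
    "\<And>v. v \<in> ker (T0 s) \<Longrightarrow> v = (\<Sum>i<dm s. cinner (\<iota> v) (\<iota> (e i)) *\<^sub>C e i)"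
    by (rule exists_orthonormal_basis[OF \<iota>(2,3) bases(1)[OF s]]) (rule that)
  obtain f where f: "\<And>i. i < dm s \<Longrightarrow> f i \<in> ran_perp (T0 s)"
    "\<And>i j. i < dm s \<Longrightarrow> j < dm s \<Longrightarrow> cinner (f i) (f j) = (if i = j then 1 else 0)"
    "\<And>v. v \<in> ran_perp (T0 s) \<Longrightarrow> v = (\<Sum>i<dm s. cinner v (f i) *\<^sub>C f i)"
    by (rule exists_orthonormal_basis[OF id bases(2)[OF s]]) (rule that)
  have sgs: "sg s \<in> \<Sigma>" using sub\<Sigma>[OF s] \<epsilon> by (meson centre_in_ball mult_pos_pos subsetD zero_less_numeral)
  have "block_split \<iota> (T0 s) (dm s) e f"
    by (rule block_split.intro[OF \<iota> _ _ e f])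
      (auto simp: T0 intro: clinear_Q[OF y0 sgs] closed_range_Q[OF y0 sgs])
  moreover have "block_family_axioms \<iota> (T0 s) (disc s) (Q y) (sb y)"
  proof
    show "op_holomorphic_on (disc s) (Q y)"
      by (rule op_holomorphic_on_subset[OF hol_Q[OF y] disc_sub[OF s]])
    show "clinear_map (Q y z)" if "z \<in> disc s" for z using clinear_Q[OF y] disc_sub[OF s] that by blast
    show "bij (Q y z)" if "z \<in> disc s - sb y" for z using bij_Q[OF y] disc_sub[OF s] that by blast
  qed (use p22[OF s y] finite_sing_b in auto)
  ultimately show ?thesis using block_family.intro by blast
qed

lemma \<beta>_props:
  assumes "s \<in> {1..S}" "j \<in> {1..J s}"
  shows "vhol (disc s) (\<beta> s j)" "z \<in> disc s \<Longrightarrow> \<beta> s j z \<in> ran_perp (T0 s)"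
  using \<beta>[OF assms] unfolding hol_on_def vhol_def has_derivative_scaleC_iff by auto

lemma Ph_props:
  assumes s: "s \<in> {1..S}" and j: "j \<in> {1..J s}" and y: "y \<in> U"
  shows "has_sing (disc s) (\<lambda>z. (z - sg s) ^ l *\<^sub>C inv (Q y z) (\<beta> s j z)) (Ph s j l y)"
    and "Ph s j l y \<in> ksing (disc s) (Q y)"
    and "\<exists>n A a. Ph s j l y = pform n A a \<and> finite A \<and> A \<subseteq> sb y \<inter> disc s"
proof -
  obtain e f where "block_family \<iota> (T0 s) (dm s) e f (disc s) (Q y) (sb y)" using exists_block_family[OF s y] by blast
  then interpret block_family \<iota> "T0 s" "dm s" e f "disc s" "Q y" "sb y" .
  show "has_sing (disc s) (\<lambda>z. (z - sg s) ^ l *\<^sub>C inv (Q y z) (\<beta> s j z)) (Ph s j l y)"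
    "Ph s j l y \<in> ksing (disc s) (Q y)"
    "\<exists>n A a. Ph s j l y = pform n A a \<and> finite A \<and> A \<subseteq> sb y \<inter> disc s"
    unfolding Ph_def by (rule phi_has_sing(1,3,4)[OF refl \<beta>_props[OF s j]]; assumption)+
qed

lemma Ph_basis_disc:
  assumes s: "s \<in> {1..S}" and y: "y \<in> U"
  shows "is_basis (SIGMA j:{1..J s}. {..<L s j}) (\<lambda>(j, l). Ph s j l y) (ksing (disc s) (Q y))"
proof -
  obtain e f where "block_family \<iota> (T0 s) (dm s) e f (disc s) (Q y) (sb y)" using exists_block_family[OF s y] by blast
  then interpret block_family \<iota> "T0 s" "dm s" e f "disc s" "Q y" "sb y" .
  show ?thesis
    unfolding Ph_def case_prod_unfold
    by (rule phi_basis[OF refl])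
      (use basis_K[OF s y, unfolded case_prod_unfold] \<beta>_props[OF s] in auto)
qed

text \<open>Group the poles by discs. Over one disc the summands belonging to the others are
  regular, so the condition on \<open>Q\<close> and the vanishing of a sum can both be checked disc
  by disc.\<close>

lemma ksing_direct_sum:
  assumes y: "y \<in> U"
  shows "ksing \<Sigma> (Q y) = {\<Sum>s\<in>{1..S}. t s | t. \<forall>s\<in>{1..S}. t s \<in> ksing (disc s) (Q y)}"
    and "(\<And>s. s \<in> {1..S} \<Longrightarrow> t s \<in> ksing (disc s) (Q y)) \<Longrightarrow> (\<Sum>s\<in>{1..S}. t s) = 0 \<Longrightarrow> \<forall>s\<in>{1..S}. t s = 0"
proof -
  have reg_other: "reg_at full p u" if u: "u \<in> pforms (disc s)" and p: "p \<notin> disc s" for u :: "complex \<Rightarrow> 'd" and s p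
  proof -
    obtain n A a where "u = pform n A a" "finite A" "A \<subseteq> disc s" using u by (auto simp: pforms_def)
    then show ?thesis using reg_at_pform[of A p n a] p by blast
  qed
  show "\<forall>s\<in>{1..S}. t s = 0"
    if t: "\<And>s. s \<in> {1..S} \<Longrightarrow> t s \<in> ksing (disc s) (Q y)" and 0: "(\<Sum>s\<in>{1..S}. t s) = 0" for t
  proof
    fix s assume s: "s \<in> {1..S}"
    have tp: "t s' \<in> pforms (disc s')" if "s' \<in> {1..S}" for s' using t[OF that] by (simp add: ksing_def)
    \<comment> \<open>On its own disc, where alone it can have poles, \<open>t s\<close> is minus a
      sum of functions that are regular there.\<close>
    have eq: "t s z = - (\<Sum>s'\<in>{1..S} - {s}. t s' z)" for z
    proof -
      have "(\<Sum>s'\<in>{1..S}. t s' z) = 0" using fun_cong[OF 0, of z] by (simp add: fun_sum_apply)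
      then show ?thesis using sum.remove[of "{1..S}" s "\<lambda>s'. t s' z"] s by (simp add: add_eq_0_iff)
    qed
    have "t s = (\<lambda>z. 0)"
    proof (rule pforms_reg_zero[OF tp[OF s]])
      show "reg_on full (disc s) (t s)"
        unfolding reg_on_def
      proof
        fix p assume p: "p \<in> disc s"
        have "reg_at full p (\<lambda>z. 0 - (\<Sum>s'\<in>{1..S} - {s}. t s' z))"
        proof (intro reg_at_diff reg_at_const reg_at_sum)
          fix s' assume s': "s' \<in> {1..S} - {s}"
          then have "p \<notin> disc s'" using disc_disjoint[OF s, of s'] p by blast
          then show "reg_at full p (t s')" using reg_other[OF tp] s' by blast
        qed
        moreover have "(\<lambda>z. 0 - (\<Sum>s'\<in>{1..S} - {s}. t s' z)) = t s" unfolding fun_eq_iff eq by simp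
        ultimately show "reg_at full p (t s)" by simp
      qed
    qed
    then show "t s = 0" by (simp add: fun_eq_iff)
  qed
  show "ksing \<Sigma> (Q y) = {\<Sum>s\<in>{1..S}. t s | t. \<forall>s\<in>{1..S}. t s \<in> ksing (disc s) (Q y)}"
  proof (intro equalityI subsetI)
    fix u assume u: "u \<in> ksing \<Sigma> (Q y)"
    then obtain n A a where A: "u = pform n A a" "finite A" "A \<subseteq> \<Sigma>" by (auto simp: ksing_def pforms_def)
    have um: "mero_on full \<Sigma> u" using u by (auto simp: ksing_def intro: has_sing_mero has_sing_self)
    have reg: "reg_at full p u" if "p \<in> \<Sigma> - sb y" for p
      using ksing_poles[OF hol_Q[OF y] clinear_Q[OF y] \<Sigma> bij_is_inj[OF bij_Q[OF y]] um] u that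
      by (auto simp: ksing_def poles_in_def)
    \<comment> \<open>The discs are disjoint and poles outside all of them have zero coefficients,
      so restricting the pole set to each disc loses and repeats nothing.\<close>
    define t where "t s = pform n (A \<inter> disc s) a" for s
    have "u = pform n (A \<inter> (\<Union>s\<in>{1..S}. disc s)) a"
    proof -
      have "a p k = 0" if "p \<in> A - (\<Union>s\<in>{1..S}. disc s)" "k \<in> {1..n}" for p k
      proof -
        have "reg_at full p u" using that A(3) sing_in_discs[OF y] by (intro reg) blast
        then show ?thesis using reg_pform_coeff_zero[OF A(2), of p n a k] that by (simp add: A(1))
      qed
      then show ?thesis
        unfolding A(1) pform_def using A(2) by (intro ext sum.mono_neutral_right) auto
    qed
    also have "\<dots> = (\<lambda>z. \<Sum>s\<in>{1..S}. t s z)"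
    proof
      fix z
      have "A \<inter> (\<Union>s\<in>{1..S}. disc s) = (\<Union>s\<in>{1..S}. A \<inter> disc s)" by blast
      then show "pform n (A \<inter> (\<Union>s\<in>{1..S}. disc s)) a z = (\<Sum>s\<in>{1..S}. t s z)"
        unfolding t_def pform_def using A(2) disc_disjoint
        by (simp only:) (rule sum.UNION_disjoint, simp, simp, blast)
    qed
    finally have ut: "u = (\<Sum>s\<in>{1..S}. t s)" by (simp add: fun_eq_iff fun_sum_apply)
    have tp: "t s \<in> pforms (disc s)" for s unfolding t_def pforms_def using A(2) by blast
    have "t s \<in> ksing (disc s) (Q y)" if s: "s \<in> {1..S}" for s
      unfolding ksing_def reg_on_def
    proof (intro CollectI conjI ballI tp)
      fix p assume p: "p \<in> disc s"
      then have p\<Sigma>: "p \<in> \<Sigma>" using disc_sub[OF s] by blast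
      have "reg_at full p (\<lambda>z. \<Sum>s'\<in>{1..S} - {s}. t s' z)"
      proof (rule reg_at_sum)
        fix s' assume s': "s' \<in> {1..S} - {s}"
        then have "p \<notin> disc s'" using disc_disjoint[OF s, of s'] p by blast
        then show "reg_at full p (t s')" by (rule reg_other[OF tp])
      qed
      from reg_at_op[OF hol_Q[OF y] clinear_Q[OF y] \<Sigma> p\<Sigma> this]
      have "reg_at full p (\<lambda>z. Q y z (\<Sum>s'\<in>{1..S} - {s}. t s' z))" .
      moreover have "reg_at full p (\<lambda>z. Q y z (u z))" using u p\<Sigma> by (simp add: ksing_def reg_on_def)
      ultimately have "reg_at full p (\<lambda>z. Q y z (u z) - Q y z (\<Sum>s'\<in>{1..S} - {s}. t s' z))" by (intro reg_at_diff)
      moreover have "\<forall>\<^sub>F z in at p. Q y z (u z) - Q y z (\<Sum>s'\<in>{1..S} - {s}. t s' z) = Q y z (t s z)"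
        using eventually_at_in_open[OF \<Sigma> p\<Sigma>]
      proof eventually_elim
        case (elim z)
        have "u z = t s z + (\<Sum>s'\<in>{1..S} - {s}. t s' z)"
          unfolding ut fun_sum_apply using s by (intro sum.remove) auto
        then show ?case using clinear_mapD(1)[OF clinear_Q[OF y, of z]] elim by simp
      qed
      ultimately show "reg_at full p (\<lambda>z. Q y z (t s z))" by (rule reg_at_cong[rotated])
    qed
    then show "u \<in> {\<Sum>s\<in>{1..S}. t s | t. \<forall>s\<in>{1..S}. t s \<in> ksing (disc s) (Q y)}" using ut by blast
  next
    fix u assume "u \<in> {\<Sum>s\<in>{1..S}. t s | t. \<forall>s\<in>{1..S}. t s \<in> ksing (disc s) (Q y)}"
    then obtain t where t: "u = (\<Sum>s\<in>{1..S}. t s)" "\<And>s. s \<in> {1..S} \<Longrightarrow> t s \<in> ksing (disc s) (Q y)" by blast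
    have tp: "t s \<in> pforms (disc s)" if "s \<in> {1..S}" for s using t(2)[OF that] by (simp add: ksing_def)
    have u: "u = (\<lambda>z. \<Sum>s\<in>{1..S}. t s z)" by (simp add: t(1) fun_eq_iff fun_sum_apply)
    have "u \<in> pforms \<Sigma>" unfolding u using tp pforms_mono[OF disc_sub] by (intro pforms_sum) blast
    moreover have "reg_at full p (\<lambda>z. Q y z (u z))" if p: "p \<in> \<Sigma>" for p
    proof -
      have "reg_at full p (\<lambda>z. \<Sum>s\<in>{1..S}. Q y z (t s z))"
      proof (rule reg_at_sum)
        fix s assume s: "s \<in> {1..S}"
        show "reg_at full p (\<lambda>z. Q y z (t s z))"
        proof (cases "p \<in> disc s")
          case True
          then show ?thesis using t(2)[OF s] by (simp add: ksing_def reg_on_def)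
        next
          case False
          then show ?thesis by (intro reg_at_op[OF hol_Q[OF y] clinear_Q[OF y] \<Sigma> p] reg_other[OF tp[OF s]])
        qed
      qed
      moreover have "\<forall>\<^sub>F z in at p. (\<Sum>s\<in>{1..S}. Q y z (t s z)) = Q y z (u z)"
        using eventually_at_in_open[OF \<Sigma> p]
        by eventually_elim (simp add: u clinear_mapD(5)[OF clinear_Q[OF y]])
      ultimately show ?thesis by (rule reg_at_cong[rotated])
    qed
    ultimately show "u \<in> ksing \<Sigma> (Q y)" by (simp add: ksing_def reg_on_def)
  qed
qed

lemma Ph_basis:
  assumes y: "y \<in> U" shows "is_basis Idx (\<lambda>(s, j, l). Ph s j l y) (ksing \<Sigma> (Q y))"
proof -
  have "is_basis Idx (\<lambda>(s, k). (\<lambda>(j, l). Ph s j l y) k) (ksing \<Sigma> (Q y))"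
    by (rule is_basis_direct_sum[OF _ _ Ph_basis_disc[OF _ y] ksing_direct_sum(2)[OF y] ksing_direct_sum(1)[OF y]]) auto
  then show ?thesis by (simp add: case_prod_unfold)
qed

lemma sing_space_basis:
  assumes y: "y \<in> U"
  shows "is_basis Idx (\<lambda>(s, j, l) \<sigma>. \<theta>1 y (Ph s j l y \<sigma>)) (sing_space \<Sigma> D H2 P y)"
proof -
  let ?T = "\<lambda>s (z :: complex). \<theta>1 y (s z)"
  have "clinear_map ?T"
    by (auto simp: clinear_map_def fun_eq_iff scaleC_fun_def clinear_mapD[OF \<theta>1_props(3)[OF y]])
  moreover have "inj ?T"
    using \<theta>1_props(4)[OF y] by (auto simp: inj_def fun_eq_iff bij_betw_def)
  ultimately have "is_basis Idx (\<lambda>i. ?T ((\<lambda>(s, j, l). Ph s j l y) i)) (?T ` ksing \<Sigma> (Q y))"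
    by (rule is_basis_image[OF finite_Idx _ _ Ph_basis[OF y]])
  then show ?thesis by (simp add: sing_space_eq[OF y] case_prod_unfold)
qed

section \<open>Smoothness of the basis and of the coefficients\<close>

abbreviation "regset \<equiv> U \<times> UNIV - sing_e \<Sigma> D H2 P"

lemma open_regset: "open regset"
  using U closed_sing_e by (auto intro!: open_Diff open_Times)

lemma chart_regset:
  "chart_set V \<psi> regset = {(x, \<sigma>). x \<in> \<psi> ` V \<and> inv_into V \<psi> x \<in> U \<and> \<sigma> \<notin> sb (inv_into V \<psi> x)}"
  by (auto simp: chart_set_def sing_e_def)

text \<open>Off the singular set the function \<open>F\<close> is smooth, as inversion preserves
  smoothness of operator families. Its singular parts inherit this by the integral formula, although
  their poles move.\<close>

lemma smooth_Ph:
  assumes s: "s \<in> {1..S}" and j: "j \<in> {1..J s}" and V: "(V, \<psi>) \<in> A"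
  shows "smooth_on (chart_set V \<psi> regset) (\<lambda>(x, \<sigma>). Ph s j l (inv_into V \<psi> x) \<sigma>)"
proof -
  obtain B where B: "finite B" "span B = (UNIV :: 'm set)" using manifold by (auto simp: smooth_manifold_def)
  define W where "W = \<psi> ` (U \<inter> V)"
  have W: "open W" "W = {x \<in> \<psi> ` V. inv_into V \<psi> x \<in> U}" unfolding W_def by (rule open_chart_image[OF manifold V U])+
  define F where "F q = (snd q - sg s) ^ l *\<^sub>C inv (Q (inv_into V \<psi> (fst q)) (snd q)) (\<beta> s j (snd q))" for q
  define N where "N = chart_set V \<psi> regset \<inter> UNIV \<times> disc s"
  have N: "open N" unfolding N_def by (intro open_Int open_Times open_chart_set[OF manifold V open_regset] open_UNIV open_ball)
  have q: "inv_into V \<psi> (fst q) \<in> U" "snd q \<in> disc s" "snd q \<in> \<Sigma> - sb (inv_into V \<psi> (fst q))" "q \<in> chart_set V \<psi> (U \<times> \<Sigma>)" if "q \<in> N" for q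
    using that disc_sub[OF s] unfolding N_def chart_set_def sing_e_def sing_b_def by auto
  have bl: "bounded_linear (Q (inv_into V \<psi> (fst q)) (snd q))" "bij (Q (inv_into V \<psi> (fst q)) (snd q))"
    "clinear_map (Q (inv_into V \<psi> (fst q)) (snd q))" if "q \<in> N" for q
    using q[OF that] by (auto intro: bounded_Q bij_Q clinear_Q)
  have smQ: "smooth_on N (\<lambda>q. Blinfun (Q (inv_into V \<psi> (fst q)) (snd q)))"
    using smooth_on_subset[OF smooth_Q[OF V], of N] q(4) unfolding case_prod_unfold by blast
  have smI: "smooth_on N (\<lambda>q. Blinfun (inv (Q (inv_into V \<psi> (fst q)) (snd q))))"
    unfolding smooth_on_def
  proof
    fix k
    show "Ck_on k N (\<lambda>q. Blinfun (inv (Q (inv_into V \<psi> (fst q)) (snd q))))"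
      by (rule Ck_on_blinfun_inverse[OF N smQ[unfolded smooth_on_def, rule_format]]) (intro Blinfun_inv bl; assumption)+
  qed
  have "vhol (disc s) (\<lambda>\<sigma>. (\<sigma> - sg s) ^ l *\<^sub>C \<beta> s j \<sigma>)"
    by (intro vhol_scaleC holomorphic_intros \<beta>_props(1)[OF s j]) auto
  then have sm\<beta>: "smooth_on N (\<lambda>q. (snd q - sg s) ^ l *\<^sub>C \<beta> s j (snd q))"
    by (rule smooth_on_snd[OF _ open_ball N]) (rule q(2))
  have "smooth_on N (\<lambda>q. inv (Q (inv_into V \<psi> (fst q)) (snd q)) ((snd q - sg s) ^ l *\<^sub>C \<beta> s j (snd q)))"
    by (rule smooth_on_op_apply[OF N bounded_linear_inv[OF bl(1,2)] smI sm\<beta>])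
  then have smF: "smooth_on N F"
    by (rule smooth_on_cong[OF N, rotated])
      (simp add: F_def clinear_mapD(2)[OF clinear_map_inv[OF bl(3,2)]])
  show ?thesis
  \<comment> \<open>Applied with \<open>r0 = \<epsilon> / 2\<close>, the radius to which
    \<open>sing_disc\<close> confines the singular points.\<close>
  proof (rule smooth_on_sing_part[OF B W(1) open_chart_set[OF manifold V open_regset], where F = F])
    show "chart_set V \<psi> regset = {(x, \<sigma>). x \<in> W \<and> \<sigma> \<notin> sb (inv_into V \<psi> x)}"
      unfolding chart_regset W(2) by auto
    show "0 < \<epsilon> / 2" "\<epsilon> / 2 < \<epsilon>" using \<epsilon> by auto
    show "smooth_on (chart_set V \<psi> regset \<inter> UNIV \<times> disc s) F" using smF by (simp add: N_def)
    fix x assume x: "x \<in> W"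
    then have y: "inv_into V \<psi> x \<in> U" using W(2) by blast
    show "finite (sb (inv_into V \<psi> x))" by (rule finite_sing_b)
    show "sb (inv_into V \<psi> x) \<inter> disc s \<subseteq> ball (sg s) (\<epsilon> / 2)" by (rule sing_disc[OF y s])
    show "has_sing (disc s) (\<lambda>\<sigma>. F (x, \<sigma>)) (Ph s j l (inv_into V \<psi> x))"
      unfolding F_def using Ph_props(1)[OF s j y] by simp
    show "\<exists>n A a. Ph s j l (inv_into V \<psi> x) = pform n A a \<and> finite A \<and> A \<subseteq> sb (inv_into V \<psi> x) \<inter> disc s"
      by (rule Ph_props(3)[OF s j y])
    show "vhol (disc s - sb (inv_into V \<psi> x)) (\<lambda>\<sigma>. F (x, \<sigma>))"
    proof -
      obtain e f where "block_family \<iota> (T0 s) (dm s) e f (disc s) (Q (inv_into V \<psi> x)) (sb (inv_into V \<psi> x))"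
        using exists_block_family[OF s y] by blast
      from block_family.vhol_inv_Q[OF this \<beta>_props(1)[OF s j]]
      have "vhol (disc s - sb (inv_into V \<psi> x)) (\<lambda>z. inv (Q (inv_into V \<psi> x) z) (\<beta> s j z))" .
      then have "vhol (disc s - sb (inv_into V \<psi> x)) (\<lambda>\<sigma>. (\<sigma> - sg s) ^ l *\<^sub>C inv (Q (inv_into V \<psi> x) \<sigma>) (\<beta> s j \<sigma>))"
        using finite_sing_b by (intro vhol_scaleC holomorphic_intros open_Diff finite_imp_closed) auto
      then show ?thesis by (simp add: F_def)
    qed
  qed
qed

text \<open>In any other trivialization the function is changed by \<open>trans\<close>, a smooth
  family of bounded complex linear maps, so smoothness and holomorphy in the model space
  suffice.\<close>

lemma Ph_B_infinity:
  assumes s: "s \<in> {1..S}" and j: "j \<in> {1..J s}" and l: "l < L s j"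
  shows "(\<lambda>y \<sigma>. \<theta>1 y (Ph s j l y \<sigma>)) \<in> B_infinity A \<Sigma> \<iota> D H1 H2 P U"
proof -
  have "(\<lambda>\<sigma>. \<theta>1 y (Ph s j l y \<sigma>)) \<in> sing_space \<Sigma> D H2 P y" if y: "y \<in> U" for y
  proof -
    have i: "(s, j, l) \<in> Idx" using s j l by simp
    have "(\<lambda>(s, j, l) \<sigma>. \<theta>1 y (Ph s j l y \<sigma>)) (s, j, l) \<in> cspan ((\<lambda>(s, j, l) \<sigma>. \<theta>1 y (Ph s j l y \<sigma>)) ` Idx)"
      by (rule complex_vector.span_base[OF imageI[OF i]])
    then show ?thesis using sing_space_basis[OF y] by (simp add: is_basis_def)
  qed
  moreover have "msmooth_on (times_complex A) (((U \<inter> V\<tau>) \<times> UNIV) - sing_e \<Sigma> D H2 P)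
      (\<lambda>(y, \<sigma>). inv_into UNIV \<iota> (\<tau> y (\<theta>1 y (Ph s j l y \<sigma>))))" if \<tau>: "(V\<tau>, \<tau>) \<in> trivs H1" for V\<tau> \<tau>
  proof -
    have V\<tau>o: "open V\<tau>" by (rule smooth_hilbert_bundleD(2)[OF bundles(1) \<tau>])
    define X where "X = ((U \<inter> V\<tau>) \<times> UNIV) - sing_e \<Sigma> D H2 P"
    have X: "open X" unfolding X_def using U V\<tau>o closed_sing_e by (intro open_Diff open_Times open_Int) auto
    have "smooth_on (chart_set V \<psi> X) (\<lambda>(x, \<sigma>). (\<lambda>(y, \<sigma>). inv_into UNIV \<iota> (\<tau> y (\<theta>1 y (Ph s j l y \<sigma>)))) (inv_into V \<psi> x, \<sigma>))"
      if V: "(V, \<psi>) \<in> A" for V \<psi>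
    proof -
      note op = open_chart_set[OF manifold V X]
      have 1: "smooth_on (chart_set V \<psi> X) (\<lambda>q. Ph s j l (inv_into V \<psi> (fst q)) (snd q))"
        using smooth_on_subset[OF smooth_Ph[OF s j V, of l], of "chart_set V \<psi> X"]
        unfolding case_prod_unfold by (auto simp: X_def chart_set_def)
      have 2: "smooth_on (chart_set V \<psi> X) (\<lambda>q. Blinfun (trans \<tau> (inv_into V \<psi> (fst q))))"
      proof (rule smooth_on_fst[OF smooth_trans[OF \<tau> V] op])
        fix q assume "q \<in> chart_set V \<psi> X"
        then show "fst q \<in> \<psi> ` (U \<inter> V\<tau> \<inter> V)"
          unfolding open_chart_image(2)[OF manifold V open_Int[OF U V\<tau>o]] by (auto simp: chart_set_def X_def)
      qed
      have 3: "bounded_linear (trans \<tau> (inv_into V \<psi> (fst q)))" if "q \<in> chart_set V \<psi> X" for q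
        using that by (intro trans_linear(1)[OF \<tau>]) (auto simp: chart_set_def X_def)
      from smooth_on_op_apply[OF op 3 2 1] show ?thesis by (simp add: trans_def case_prod_unfold)
    qed
    then show ?thesis
      unfolding X_def[symmetric] msmooth_on_times_complex[OF manifold X] by blast
  qed
  moreover have "hol_on full (- sb y) (\<lambda>\<sigma>. inv_into UNIV \<iota> (\<tau> y (\<theta>1 y (Ph s j l y \<sigma>))))"
    if \<tau>: "(V\<tau>, \<tau>) \<in> trivs H1" and y: "y \<in> U \<inter> V\<tau>" for V\<tau> \<tau> y
  proof -
    have yU: "y \<in> U" "y \<in> V\<tau>" using y by auto
    obtain n A' a where a: "Ph s j l y = pform n A' a" "finite A'" "A' \<subseteq> sb y \<inter> disc s"
      using Ph_props(3)[OF s j yU(1)] by blast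
    have "vhol (- sb y) (Ph s j l y)" unfolding a(1) by (rule vhol_subset[OF vhol_pform[OF a(2)]]) (use a(3) in auto)
    from vhol_linear[OF trans_linear[OF \<tau> yU(2,1)] this] show ?thesis unfolding hol_on_full trans_def .
  qed
  ultimately show ?thesis unfolding B_infinity_def by blast
qed

text \<open>The basis determines the coefficients separately for each \<open>y\<close>. Near a
  point, scalar tests away from its singular set turn them into the solution of a linear system with
  smooth data.\<close>

lemma smooth_coefficients_Ph:
  assumes \<phi>: "\<phi> \<in> B_infinity A \<Sigma> \<iota> D H1 H2 P U"
  shows "\<exists>f :: nat \<Rightarrow> nat \<Rightarrow> nat \<Rightarrow> 'y \<Rightarrow> complex.
     (\<forall>s\<in>{1..S}. \<forall>j\<in>{1..J s}. \<forall>l<L s j. msmooth_on A U (f s j l)) \<and>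
     (\<forall>y\<in>U. \<forall>\<sigma>. \<phi> y \<sigma> = (\<Sum>s=1..S. \<Sum>j=1..J s. \<Sum>l<L s j. f s j l y *\<^sub>C \<theta>1 y (Ph s j l y \<sigma>)))"
proof -
  define t where "t y \<sigma> = inv_into UNIV \<iota> (\<tau>1 y (\<phi> y \<sigma>))" for y \<sigma>
  define b where "b i y = (case i of (s, j, l) \<Rightarrow> Ph s j l y)" for i y
  have t\<theta>: "\<phi> y = (\<lambda>z. \<theta>1 y (t y z))" "t y \<in> ksing \<Sigma> (Q y)" if y: "y \<in> U" for y
  proof -
    have "\<phi> y \<in> sing_space \<Sigma> D H2 P y" using \<phi> y by (simp add: B_infinity_def)
    then obtain u where u: "\<phi> y = (\<lambda>z. \<theta>1 y (u z))" "u \<in> ksing \<Sigma> (Q y)" unfolding sing_space_eq[OF y] by blast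
    have "t y = u" by (simp add: fun_eq_iff t_def u(1) \<theta>1_props(2)[OF y])
    then show "\<phi> y = (\<lambda>z. \<theta>1 y (t y z))" "t y \<in> ksing \<Sigma> (Q y)" using u by auto
  qed
  have basis: "is_basis Idx (\<lambda>i. b i y) (ksing \<Sigma> (Q y))" if "y \<in> U" for y
    using Ph_basis[OF that] by (simp add: b_def)
  have ex: "\<exists>c. t y = (\<Sum>i\<in>Idx. c i *\<^sub>C b i y)" if "y \<in> U" for y
    using t\<theta>(2)[OF that] basis[OF that] unfolding is_basis_iff[OF finite_Idx] by blast
  \<comment> \<open>A pointwise choice without any regularity in \<open>y\<close>; smoothness is
    recovered from the equations that it satisfies.\<close>
  define c where "c y = (SOME c. t y = (\<Sum>i\<in>Idx. c i *\<^sub>C b i y))" for y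
  have tc: "t y \<sigma> = (\<Sum>i\<in>Idx. c y i *\<^sub>C b i y \<sigma>)" if "y \<in> U" for y \<sigma>
  proof -
    have "t y = (\<Sum>i\<in>Idx. c y i *\<^sub>C b i y)" unfolding c_def by (rule someI_ex[OF ex[OF that]])
    then show ?thesis by (simp add: fun_sum_apply scaleC_fun_def)
  qed
  have smooth: "smooth_on (\<psi> ` (U \<inter> V)) (\<lambda>x. c (inv_into V \<psi> x) i)" if V: "(V, \<psi>) \<in> A" and i: "i \<in> Idx" for V \<psi> i
  proof (rule smooth_on_local)
    define W where "W = \<psi> ` (U \<inter> V)"
    have W: "open W" "W = {x \<in> \<psi> ` V. inv_into V \<psi> x \<in> U}" unfolding W_def by (rule open_chart_image[OF manifold V U])+
    define X where "X = chart_set V \<psi> regset"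
    have X: "open X" unfolding X_def by (rule open_chart_set[OF manifold V open_regset])
    have smb: "smooth_on X (\<lambda>(x, \<sigma>). b i (inv_into V \<psi> x) \<sigma>)" if "i \<in> Idx" for i
      using smooth_Ph[OF _ _ V] that by (auto simp: b_def X_def)
    have smt: "smooth_on X (\<lambda>(x, \<sigma>). t (inv_into V \<psi> x) \<sigma>)"
    proof -
      have "U \<inter> V1 = U" using \<tau>1(2) by blast
      then have "msmooth_on (times_complex A) regset (\<lambda>(y, \<sigma>). inv_into UNIV \<iota> (\<tau>1 y (\<phi> y \<sigma>)))"
        using \<phi> \<tau>1(1) unfolding B_infinity_def by force
      from bspec[OF this[unfolded msmooth_on_times_complex[OF manifold open_regset]] V]
      show ?thesis by (simp add: X_def t_def)
    qed
    fix x0 assume x0: "x0 \<in> \<psi> ` (U \<inter> V)"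
    then have x0W: "x0 \<in> W" by (simp add: W_def)
    then have y: "inv_into V \<psi> x0 \<in> U" using W(2) by blast
    define T where "T = {(\<sigma>, v :: 'd). \<sigma> \<notin> sb (inv_into V \<psi> x0)}"
    have slice: "\<exists>N. open N \<and> x0 \<in> N \<and> smooth_on N (\<lambda>x. cinner (g (inv_into V \<psi> x) (fst q)) (snd q))"
      if g: "smooth_on X (\<lambda>(x, \<sigma>). g (inv_into V \<psi> x) \<sigma>)" and q: "q \<in> T" for g and q :: "complex \<times> 'd"
    proof -
      define N where "N = {x. (x, fst q) \<in> X}"
      have "open ((\<lambda>x. (x, fst q)) -` X)" by (intro open_vimage X continuous_intros)
      then have N: "open N" by (simp add: N_def vimage_def)
      have "x0 \<in> N" using q x0W y unfolding N_def X_def chart_regset T_def W(2) by auto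
      moreover have "smooth_on N (\<lambda>x. g (inv_into V \<psi> x) (fst q))"
        using smooth_on_slice[OF g N, of "fst q"] by (simp add: N_def)
      then have "smooth_on N (\<lambda>x. cinner (g (inv_into V \<psi> x) (fst q)) (snd q))"
        unfolding smooth_on_def by (intro allI Ck_on_bounded_linear[OF bounded_linear_cinner_left N]) blast
      ultimately show ?thesis using N by blast
    qed
    have "\<exists>N. open N \<and> x0 \<in> N \<and> (\<forall>i\<in>Idx. smooth_on N (\<lambda>x. c (inv_into V \<psi> x) i))"
    proof (rule smooth_coefficients[OF finite_Idx W(1) x0W, where T = T
        and g = "\<lambda>i x q. cinner (b i (inv_into V \<psi> x) (fst q)) (snd q)"
        and h = "\<lambda>x q. cinner (t (inv_into V \<psi> x) (fst q)) (snd q)"])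
      fix i q assume "i \<in> Idx" "q \<in> T"
      then show "\<exists>N. open N \<and> x0 \<in> N \<and> smooth_on N (\<lambda>x. cinner (b i (inv_into V \<psi> x) (fst q)) (snd q))"
        by (intro slice smb)
    next
      fix q assume "q \<in> T"
      then show "\<exists>N. open N \<and> x0 \<in> N \<and> smooth_on N (\<lambda>x. cinner (t (inv_into V \<psi> x) (fst q)) (snd q))"
        by (intro slice smt)
    next
      fix x q assume "x \<in> W" "q \<in> T"
      then show "cinner (t (inv_into V \<psi> x) (fst q)) (snd q) =
          (\<Sum>i\<in>Idx. c (inv_into V \<psi> x) i * cinner (b i (inv_into V \<psi> x) (fst q)) (snd q))"
        using tc[of "inv_into V \<psi> x" "fst q"] W(2) by (simp add: cinner_sum_left cinner_scaleC_left)
    next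
      fix d assume d: "\<And>q. q \<in> T \<Longrightarrow> (\<Sum>i\<in>Idx. d i * cinner (b i (inv_into V \<psi> x0) (fst q)) (snd q)) = 0"
      define u where "u = (\<Sum>i\<in>Idx. d i *\<^sub>C b i (inv_into V \<psi> x0))"
      have u: "u \<sigma> = (\<Sum>i\<in>Idx. d i *\<^sub>C b i (inv_into V \<psi> x0) \<sigma>)" for \<sigma> by (simp add: u_def fun_sum_apply scaleC_fun_def)
      have "u \<in> ksing \<Sigma> (Q (inv_into V \<psi> x0))"
        using basis[OF y] unfolding is_basis_iff[OF finite_Idx] u_def by blast
      then have up: "u \<in> pforms \<Sigma>" by (simp add: ksing_def)
      \<comment> \<open>If all tests vanish, \<open>u\<close> is zero off a finite set, so it is
        regular at every point and therefore the zero singular part.\<close>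
      have off: "u \<sigma> = 0" if "\<sigma> \<notin> sb (inv_into V \<psi> x0)" for \<sigma>
      proof (rule cinner_eqI)
        fix v
        show "cinner (u \<sigma>) v = cinner 0 v"
          using d[of "(\<sigma>, v)"] that by (simp add: T_def u cinner_sum_left cinner_scaleC_left)
      qed
      have "reg_at full p u" for p
      proof -
        have "\<forall>\<^sub>F z in at p. 0 = u z"
          using eventually_not_in_finite[OF finite_sing_b open_UNIV UNIV_I] by eventually_elim (use off in auto)
        then show ?thesis by (rule reg_at_cong) simp
      qed
      then have "u = (\<lambda>z. 0)" by (intro pforms_reg_zero[OF up]) (simp add: reg_on_def)
      then have "(\<Sum>i\<in>Idx. d i *\<^sub>C b i (inv_into V \<psi> x0)) = 0" by (simp add: u_def fun_eq_iff)
      then show "\<forall>i\<in>Idx. d i = 0" using basis[OF y] unfolding is_basis_iff[OF finite_Idx] by blast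
    qed
    then show "\<exists>N. open N \<and> x0 \<in> N \<and> smooth_on N (\<lambda>x. c (inv_into V \<psi> x) i)" using i by blast
  qed
  define f where "f s j l y = c y (s, j, l)" for s j l y
  have "msmooth_on A U (f s j l)" if "s \<in> {1..S}" "j \<in> {1..J s}" "l < L s j" for s j l
  proof -
    have "(s, j, l) \<in> Idx" using that by simp
    from smooth[OF _ this] show ?thesis by (auto simp: msmooth_on_def f_def o_def)
  qed
  moreover have "\<phi> y \<sigma> = (\<Sum>s=1..S. \<Sum>j=1..J s. \<Sum>l<L s j. f s j l y *\<^sub>C \<theta>1 y (Ph s j l y \<sigma>))" if y: "y \<in> U" for y \<sigma>
  proof -
    have "\<phi> y \<sigma> = \<theta>1 y (t y \<sigma>)" by (rule fun_cong[OF t\<theta>(1)[OF y]])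
    also have "\<dots> = (\<Sum>(s, j, l)\<in>Idx. f s j l y *\<^sub>C \<theta>1 y (Ph s j l y \<sigma>))"
      by (simp add: tc[OF y] clinear_mapD[OF \<theta>1_props(3)[OF y]] b_def f_def split_beta)
    also have "\<dots> = (\<Sum>s=1..S. \<Sum>j=1..J s. \<Sum>l<L s j. f s j l y *\<^sub>C \<theta>1 y (Ph s j l y \<sigma>))"
      by (simp add: sum.Sigma split_beta)
    finally show ?thesis .
  qed
  ultimately show ?thesis by (intro exI[of _ f]) blast
qed

end

theorem theorem5p1:
  fixes A :: "('y::{t2_space, second_countable_topology}, 'm::real_normed_vector) atlas"
    and H1 :: "('y, 'e1::complex_vector, 'h1::complex_hilbert) hbundle"
    and H2 :: "('y, 'e2::complex_vector, 'h2::complex_hilbert) hbundle"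
    and D :: "('y, 'e1, 'd::complex_hilbert) hbundle"
    and Dst :: "('y, 'e2, 'dst::complex_hilbert) hbundle"
    and \<iota> :: "'d \<Rightarrow> 'h1" and \<iota>st :: "'dst \<Rightarrow> 'h2"
    and \<Sigma> :: "complex set"
    and P :: "'y \<Rightarrow> complex \<Rightarrow> 'e1 \<Rightarrow> 'e2"
    and y0 :: 'y and U V1 V2 :: "'y set" and \<epsilon> :: real
    and \<tau>1 :: "'y \<Rightarrow> 'e1 \<Rightarrow> 'h1" and \<tau>2 :: "'y \<Rightarrow> 'e2 \<Rightarrow> 'h2"
    and Q :: "'y \<Rightarrow> complex \<Rightarrow> 'd \<Rightarrow> 'h2"
    and S :: nat and sg :: "nat \<Rightarrow> complex" and T0 :: "nat \<Rightarrow> 'd \<Rightarrow> 'h2"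
    and dm :: "nat \<Rightarrow> nat" and kb :: "nat \<Rightarrow> nat \<Rightarrow> 'd" and rb :: "nat \<Rightarrow> nat \<Rightarrow> 'h2"
    and J :: "nat \<Rightarrow> nat" and L :: "nat \<Rightarrow> nat \<Rightarrow> nat"
    and \<phi>0 :: "nat \<Rightarrow> nat \<Rightarrow> complex \<Rightarrow> 'd" and \<beta> :: "nat \<Rightarrow> nat \<Rightarrow> complex \<Rightarrow> 'h2"
    and \<Phi> :: "nat \<Rightarrow> nat \<Rightarrow> nat \<Rightarrow> 'y \<Rightarrow> complex \<Rightarrow> 'e1"
  \<comment> \<open>standing assumptions\<close>
  assumes manifold: "smooth_manifold A" "connected (UNIV :: 'y set)"
    and bundles: "smooth_hilbert_bundle A H1" "smooth_hilbert_bundle A H2"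
      "smooth_hilbert_bundle A D"
    and D_embedded: "embedded_bundle A \<iota> D H1"
    and D_dense: "\<And>y. hdense (fib H1 y) (car (fib D y))"
    and \<Sigma>: "open \<Sigma>" "connected \<Sigma>"
    and family: "holomorphic_fredholm_family A \<Sigma> D H1 H2 P"
    and Dst_bundle: "smooth_hilbert_bundle A Dst"
    and Dst_embedded: "embedded_bundle A \<iota>st Dst H2"
    and Dst_dom: "\<And>y \<sigma>. \<sigma> \<in> \<Sigma> \<Longrightarrow>
      car (fib Dst y) = adjoint_dom (car (fib D y)) (fib H1 y) (fib H2 y) (P y \<sigma>)"
    and adjoint_family: "holomorphic_fredholm_family A (cnj ` \<Sigma>) Dst H2 H1
      (\<lambda>y \<sigma>. adjoint_op (car (fib D y)) (fib H1 y) (fib H2 y) (P y (cnj \<sigma>)))"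
    and sing_b_finite: "\<And>y. finite (sing_b \<Sigma> D H2 P y)"
    and sing_e_closed: "closed (sing_e \<Sigma> D H2 P)"
  \<comment> \<open>the local family near \<open>y0\<close>\<close>
    and U: "open U" "connected U" "y0 \<in> U"
    and \<tau>1: "(V1, \<tau>1) \<in> trivs H1" "U \<subseteq> V1"
    and \<tau>2: "(V2, \<tau>2) \<in> trivs H2" "U \<subseteq> V2"
    and Q: "Q = local_family H1 \<tau>1 \<tau>2 \<iota> P"
    and sg: "bij_betw sg {1..S} (sing_b \<Sigma> D H2 P y0)"
    and T0: "\<And>s. T0 s = Q y0 (sg s)"
  \<comment> \<open>the conditions on \<open>\<epsilon>\<close> and \<open>U\<close>\<close>
    and \<epsilon>: "\<epsilon> > 0"
    and c1: "disjoint_family_on (\<lambda>s. ball (sg s) (2 * \<epsilon>)) {1..S}"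
      "\<And>s. s \<in> {1..S} \<Longrightarrow> ball (sg s) (2 * \<epsilon>) \<subseteq> \<Sigma>"
    and c2: "\<And>s \<sigma>. s \<in> {1..S} \<Longrightarrow> \<sigma> \<in> ball (sg s) (2 * \<epsilon>) \<Longrightarrow>
      p22_invertible \<iota> (T0 s) (Q y0 \<sigma>)"
    and c3: "\<And>s y \<sigma>. s \<in> {1..S} \<Longrightarrow> y \<in> U \<Longrightarrow> \<sigma> \<in> ball (sg s) \<epsilon> \<Longrightarrow>
      p22_invertible \<iota> (T0 s) (Q y \<sigma>)"
    and c4_bases: "\<And>s. s \<in> {1..S} \<Longrightarrow> is_basis {..<dm s} (kb s) (ker (T0 s))"
      "\<And>s. s \<in> {1..S} \<Longrightarrow> is_basis {..<dm s} (rb s) (ran_perp (T0 s))"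
    and c4_det: "\<And>s y \<sigma>. s \<in> {1..S} \<Longrightarrow> y \<in> U \<Longrightarrow>
      \<epsilon> / 2 \<le> cmod (\<sigma> - sg s) \<Longrightarrow> cmod (\<sigma> - sg s) < \<epsilon> \<Longrightarrow>
      basis_det (dm s) (kb s) (rb s) (schur \<iota> (T0 s) (Q y \<sigma>)) \<noteq> 0"
    and c4_sing: "\<And>y. y \<in> U \<Longrightarrow> sing_b \<Sigma> D H2 P y \<subseteq> (\<Union>s\<in>{1..S}. ball (sg s) (\<epsilon> / 2))"
  \<comment> \<open>the choice of the elements at \<open>y0\<close>\<close>
    and \<phi>0: "\<And>s j. s \<in> {1..S} \<Longrightarrow> j \<in> {1..J s} \<Longrightarrow>
      \<phi>0 s j \<in> local_sing_space \<iota> (T0 s) (sg s) \<epsilon> (Q y0)"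
    and \<phi>0_pole: "\<And>s j. s \<in> {1..S} \<Longrightarrow> j \<in> {1..J s} \<Longrightarrow>
      poles_in (sub_hilb (ker (T0 s))) UNIV (\<phi>0 s j) = {sg s}"
    and \<phi>0_order: "\<And>s j. s \<in> {1..S} \<Longrightarrow> j \<in> {1..J s} \<Longrightarrow>
      L s j \<ge> 1 \<and> (\<exists>v. v \<noteq> 0 \<and> ((\<lambda>\<sigma>. (\<sigma> - sg s) ^ L s j *\<^sub>C \<phi>0 s j \<sigma>) \<longlongrightarrow> v) (at (sg s)))"
    and \<phi>0_a: "\<And>s. s \<in> {1..S} \<Longrightarrow>
      is_basis (SIGMA j:{1..J s}. {..<L s j})
        (\<lambda>(j, l). sing_part (sub_hilb (ker (T0 s))) (ball (sg s) \<epsilon>)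
          (\<lambda>\<sigma>. (\<sigma> - sg s) ^ l *\<^sub>C \<phi>0 s j \<sigma>))
        (local_sing_space \<iota> (T0 s) (sg s) \<epsilon> (Q y0))"
    and \<phi>0_b: "\<And>s. s \<in> {1..S} \<Longrightarrow>
      is_basis {1..J s} (\<lambda>j. Lim (at (sg s)) (\<lambda>\<sigma>. (\<sigma> - sg s) ^ L s j *\<^sub>C \<phi>0 s j \<sigma>)) (ker (T0 s))"
    and \<beta>: "\<And>s j. s \<in> {1..S} \<Longrightarrow> j \<in> {1..J s} \<Longrightarrow>
      hol_on (sub_hilb (ran_perp (T0 s))) (ball (sg s) \<epsilon>) (\<beta> s j)"
      "\<And>s j \<sigma>. s \<in> {1..S} \<Longrightarrow> j \<in> {1..J s} \<Longrightarrow> \<sigma> \<in> ball (sg s) \<epsilon> - {sg s} \<Longrightarrow>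
      \<beta> s j \<sigma> = schur \<iota> (T0 s) (Q y0 \<sigma>) (\<phi>0 s j \<sigma>)"
    and \<phi>0_c: "\<And>s. s \<in> {1..S} \<Longrightarrow> is_basis {1..J s} (\<lambda>j. \<beta> s j (sg s)) (ran_perp (T0 s))"
  \<comment> \<open>the basis property over \<open>U\<close>\<close>
    and c5: "\<And>s y. s \<in> {1..S} \<Longrightarrow> y \<in> U \<Longrightarrow>
      is_basis (SIGMA j:{1..J s}. {..<L s j})
        (\<lambda>(j, l). phiK \<iota> (T0 s) (sg s) \<epsilon> (Q y) (\<beta> s j) l)
        (local_sing_space \<iota> (T0 s) (sg s) \<epsilon> (Q y))"
  \<comment> \<open>the elements of the claim, as functions with values in the fibers of \<open>D\<close>\<close>
    and \<Phi>: "\<And>s j l y \<sigma>. \<Phi> s j l y \<sigma> =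
      triv_inv H1 \<tau>1 y (\<iota> (phi \<iota> (T0 s) (sg s) \<epsilon> (Q y) (\<beta> s j) l \<sigma>))"
  shows "(\<forall>s\<in>{1..S}. \<forall>j\<in>{1..J s}. \<forall>l<L s j. \<Phi> s j l \<in> B_infinity A \<Sigma> \<iota> D H1 H2 P U) \<and>
    (\<forall>y\<in>U. is_basis (SIGMA s:{1..S}. SIGMA j:{1..J s}. {..<L s j})
      (\<lambda>(s, j, l). \<Phi> s j l y) (sing_space \<Sigma> D H2 P y)) \<and>
    (\<forall>\<phi>\<in>B_infinity A \<Sigma> \<iota> D H1 H2 P U.
      \<exists>f :: nat \<Rightarrow> nat \<Rightarrow> nat \<Rightarrow> 'y \<Rightarrow> complex.
        (\<forall>s\<in>{1..S}. \<forall>j\<in>{1..J s}. \<forall>l<L s j. msmooth_on A U (f s j l)) \<and>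
        (\<forall>y\<in>U. \<forall>\<sigma>. \<phi> y \<sigma> =
          (\<Sum>s=1..S. \<Sum>j=1..J s. \<Sum>l<L s j. f s j l y *\<^sub>C \<Phi> s j l y \<sigma>)))"
proof -
  interpret local_construction A H1 H2 D \<iota> \<Sigma> P U V1 V2 \<tau>1 \<tau>2 Q y0 \<epsilon> S sg T0 dm kb rb J L \<beta>
    by unfold_locales (use manifold bundles D_embedded \<Sigma> family sing_b_finite sing_e_closed U \<tau>1 \<tau>2 Q T0 \<epsilon> c1 c3
      c4_bases c4_sing \<beta>(1) c5 in \<open>simp_all\<close>)
  have \<Phi>': "\<Phi> s j l = (\<lambda>y \<sigma>. \<theta>1 y (Ph s j l y \<sigma>))" for s j l
    by (simp add: fun_eq_iff \<Phi> \<theta>1_def Ph_def)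
  show ?thesis
    unfolding \<Phi>' using Ph_B_infinity sing_space_basis smooth_coefficients_Ph by blast
qed

end
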